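(* Let $\lambda>0$, $m>0$, $q\in\mathbb{R}$, and let $A_0,A_1,A_2,A_3\colon\mathbb{R}^3\to\mathbb{R}$ be measurable (time-independent) functions such that, for some $p>3$, $(A_1,A_2,A_3)\in L^p(\mathbb{R}^3)+L^\infty(\mathbb{R}^3)$ and $|qA_0|\le m$ almost everywhere. Put $A=\sum_{\mu=0}^3A_\mu\mathfrak{e}^\mu$. Then for every $T>0$ and every $\phi_0\in H^1(\mathbb{R}^3;M_2(\mathbb{C}))$ there exists $$\phi\in C([0,T];H^1(\mathbb{R}^3;M_2(\mathbb{C})))\cap C^1([0,T];L^2(\mathbb{R}^3;M_2(\mathbb{C})))$$ with $\phi(0)=\phi_0$ that solves the regularized nonlinear Dirac equation $$\partial_0\widehat{\phi}+\sum_{k=1}^3\mathfrak{e}^k\partial_k\widehat{\phi}+i\big(qA\widehat{\phi}+mV_\lambda(\phi)\phi\big)\mathfrak{e}_3=0\qquad\text{for } t\in[0,T],$$ where $V_\lambda(\phi)=\dfrac{\det(\phi)^*}{|\det(\phi)|+\lambda\|\phi\|^2}$ for $\phi\ne0$, and $V_\lambda(\phi)\phi$ is understood as $0$ where $\phi=0$.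
   Context: $\mathfrak{e}_0$ is the $2\times2$ identity matrix and $\mathfrak{e}_1=\begin{pmatrix}0&1\\1&0\end{pmatrix}$, $\mathfrak{e}_2=\begin{pmatrix}0&-i\\i&0\end{pmatrix}$, $\mathfrak{e}_3=\begin{pmatrix}1&0\\0&-1\end{pmatrix}$ are the Pauli matrices; $\mathfrak{e}^0=\mathfrak{e}_0$, $\mathfrak{e}^k=-\mathfrak{e}_k$ for $k=1,2,3$. For $M=\begin{pmatrix}a&b\\c&d\end{pmatrix}$, $\widehat{M}=\begin{pmatrix}d^*&-c^*\\-b^*&a^*\end{pmatrix}$ (Hermitian adjoint of the adjugate), where $*$ is complex conjugation. $\|\cdot\|$ is the Frobenius norm on $M_2(\mathbb{C})$. $\partial_0$ is the derivative in time $t=x^0$ and $\partial_k=\partial/\partial x^k$ for $k=1,2,3$. $L^2$ and $H^1$ are the usual Lebesgue and Sobolev spaces of $M_2(\mathbb{C})$-valued functions on $\mathbb{R}^3$; the equation is understood as an identity in $L^2(\mathbb{R}^3;M_2(\mathbb{C}))$ for each $t$. *)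

theory Defs
  imports "HOL-Analysis.Analysis"
begin

section \<open>Lebesgue and Sobolev spaces\<close>

text \<open>
  Elements of the function spaces are represented by functions; equality in the space is equality
  almost everywhere, and the norms below are seminorms on representatives.
\<close>

definition Lp :: "real \<Rightarrow> ('a::euclidean_space \<Rightarrow> 'b::euclidean_space) set" where
  "Lp p = {f \<in> borel_measurable lebesgue. integrable lebesgue (\<lambda>x. norm (f x) powr p)}"

definition Lp_norm :: "real \<Rightarrow> ('a::euclidean_space \<Rightarrow> 'b::euclidean_space) \<Rightarrow> real" where
  "Lp_norm p f = (LINT x|lebesgue. norm (f x) powr p) powr (1 / p)"

definition Linf :: "('a::euclidean_space \<Rightarrow> 'b::euclidean_space) set" where
  "Linf = {f \<in> borel_measurable lebesgue. \<exists>C. AE x in lebesgue. norm (f x) \<le> C}"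

definition locally_integrable :: "('a::euclidean_space \<Rightarrow> 'b::euclidean_space) \<Rightarrow> bool" where
  "locally_integrable f \<longleftrightarrow> (\<forall>K. compact K \<longrightarrow> set_integrable lebesgue K f)"

primrec cont_diff :: "nat \<Rightarrow> ('a::real_normed_vector \<Rightarrow> 'b::real_normed_vector) \<Rightarrow> bool" where
  "cont_diff 0 f \<longleftrightarrow> continuous_on UNIV f"
| "cont_diff (Suc n) f \<longleftrightarrow>
     f differentiable_on UNIV \<and> (\<forall>v. cont_diff n (\<lambda>x. frechet_derivative f (at x) v))"

definition test_function :: "('a::real_normed_vector \<Rightarrow> real) \<Rightarrow> bool" where
  "test_function \<psi> \<longleftrightarrow> (\<forall>n. cont_diff n \<psi>) \<and> compact (closure {x. \<psi> x \<noteq> 0})"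

definition has_weak_partial ::
    "'n::finite \<Rightarrow> (real^'n \<Rightarrow> 'b::euclidean_space) \<Rightarrow> (real^'n \<Rightarrow> 'b) \<Rightarrow> bool" where
  "has_weak_partial k f g \<longleftrightarrow> locally_integrable f \<and> locally_integrable g \<and>
     (\<forall>\<psi>. test_function \<psi> \<longrightarrow>
        (LINT x|lebesgue. frechet_derivative \<psi> (at x) (axis k 1) *\<^sub>R f x)
        = - (LINT x|lebesgue. \<psi> x *\<^sub>R g x))"

text \<open>The choice is unique up to null sets whenever a weak derivative exists.\<close>

definition weak_partial ::
    "'n::finite \<Rightarrow> (real^'n \<Rightarrow> 'b::euclidean_space) \<Rightarrow> real^'n \<Rightarrow> 'b" where
  "weak_partial k f = (SOME g. has_weak_partial k f g)"

definition H1 :: "(real^'n::finite \<Rightarrow> 'b::euclidean_space) set" where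
  "H1 = {f \<in> Lp 2. \<forall>k. \<exists>g \<in> Lp 2. has_weak_partial k f g}"

definition H1_norm :: "(real^'n::finite \<Rightarrow> 'b::euclidean_space) \<Rightarrow> real" where
  "H1_norm f = sqrt ((Lp_norm 2 f)\<^sup>2 + (\<Sum>k\<in>UNIV. (Lp_norm 2 (weak_partial k f))\<^sup>2))"


section \<open>Curves in function spaces\<close>

text \<open>Continuity on \<open>S\<close> of a curve in the space \<open>X\<close> with norm \<open>N\<close>.\<close>

definition continuous_curve ::
    "('x \<Rightarrow> 'b::real_normed_vector) set \<Rightarrow> (('x \<Rightarrow> 'b) \<Rightarrow> real) \<Rightarrow> real set \<Rightarrow> (real \<Rightarrow> 'x \<Rightarrow> 'b) \<Rightarrow> bool"
  where
  "continuous_curve X N S u \<longleftrightarrow> (\<forall>t\<in>S. u t \<in> X) \<and>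
     (\<forall>t\<in>S. ((\<lambda>s. N (\<lambda>x. u s x - u t x)) \<longlongrightarrow> 0) (at t within S))"

text \<open>
  Membership in \<^term>\<open>Lp 2\<close> has to be required explicitly, since \<^const>\<open>Lp_norm\<close> is \<open>0\<close> on
  functions that are not \<open>p\<close>-integrable. At the end points of an interval \<open>S\<close> the derivative is
  one-sided.
\<close>

definition has_L2_derivative ::
    "real set \<Rightarrow> (real \<Rightarrow> 'a::euclidean_space \<Rightarrow> 'b::euclidean_space) \<Rightarrow> ('a \<Rightarrow> 'b) \<Rightarrow> real \<Rightarrow> bool"
  where
  "has_L2_derivative S u v t \<longleftrightarrow> (\<forall>s\<in>S. u s \<in> Lp 2) \<and> v \<in> Lp 2 \<and>
     ((\<lambda>s. Lp_norm 2 (\<lambda>x. (u s x - u t x) /\<^sub>R (s - t) - v x)) \<longlongrightarrow> 0) (at t within S)"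

definition L2_derivative ::
    "real set \<Rightarrow> (real \<Rightarrow> 'a::euclidean_space \<Rightarrow> 'b::euclidean_space) \<Rightarrow> real \<Rightarrow> 'a \<Rightarrow> 'b" where
  "L2_derivative S u t = (SOME v. has_L2_derivative S u v t)"

definition C_H1 :: "real set \<Rightarrow> (real \<Rightarrow> real^'n::finite \<Rightarrow> 'b::euclidean_space) set" where
  "C_H1 S = {u. continuous_curve H1 H1_norm S u}"

definition C1_L2 :: "real set \<Rightarrow> (real \<Rightarrow> 'a::euclidean_space \<Rightarrow> 'b::euclidean_space) set" where
  "C1_L2 S = {u. continuous_curve (Lp 2) (Lp_norm 2) S u \<and>
     (\<exists>u'. (\<forall>t\<in>S. has_L2_derivative S u (u' t) t) \<and> continuous_curve (Lp 2) (Lp_norm 2) S u')}"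


section \<open>The algebra of complex two-by-two matrices\<close>

text \<open>
  The norm of the type \<^typ>\<open>complex^2^2\<close> is the Frobenius norm, as the next lemma shows.
\<close>

lemma norm_matrix_Frobenius:
  fixes M :: "complex^'n::finite^'m::finite"
  shows "norm M = sqrt (\<Sum>i\<in>UNIV. \<Sum>j\<in>UNIV. (cmod (M $ i $ j))\<^sup>2)"
  by (simp add: norm_vec_def L2_set_def sum_nonneg)

definition cscale :: "complex \<Rightarrow> complex^'n^'m \<Rightarrow> complex^'n^'m"  (infixr "*\<^sub>C" 75) where
  "c *\<^sub>C M = (\<chi> i j. c * M $ i $ j)"

definition matrix22 :: "complex \<Rightarrow> complex \<Rightarrow> complex \<Rightarrow> complex \<Rightarrow> complex^2^2" where
  "matrix22 a b c d = vector [vector [a, b], vector [c, d]]"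

definition e_low :: "nat \<Rightarrow> complex^2^2" where
  "e_low \<mu> = (if \<mu> = 0 then mat 1
            else if \<mu> = 1 then matrix22 0 1 1 0
            else if \<mu> = 2 then matrix22 0 (- \<i>) \<i> 0
            else matrix22 1 0 0 (- 1))"

definition e_up :: "nat \<Rightarrow> complex^2^2" where
  "e_up \<mu> = (if \<mu> = 0 then e_low 0 else - e_low \<mu>)"

definition hat :: "complex^2^2 \<Rightarrow> complex^2^2" where
  "hat M = matrix22 (cnj (M $ 2 $ 2)) (- cnj (M $ 2 $ 1))
                    (- cnj (M $ 1 $ 2)) (cnj (M $ 1 $ 1))"

text \<open>At \<open>M = 0\<close> the quotient is \<open>0 / 0 = 0\<close>, so that \<^term>\<open>V l M *\<^sub>C M\<close> is \<open>0\<close> there.\<close>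

definition V :: "real \<Rightarrow> complex^2^2 \<Rightarrow> complex" where
  "V l M = cnj (det M) / complex_of_real (cmod (det M) + l * (norm M)\<^sup>2)"

definition potential :: "(nat \<Rightarrow> real^3 \<Rightarrow> real) \<Rightarrow> real^3 \<Rightarrow> complex^2^2" where
  "potential A x = (\<Sum>\<mu>=0..3. A \<mu> x *\<^sub>R e_up \<mu>)"

text \<open>
  The regularized equation, as an identity in \<open>L\<^sup>2\<close> at each time of \<open>S\<close>. In \<^typ>\<open>3\<close> the three
  indices are \<open>of_nat 1\<close>, \<open>of_nat 2\<close> and \<open>of_nat 3\<close>, the last one being \<open>0\<close>.
\<close>

definition solves_dirac ::
    "real \<Rightarrow> real \<Rightarrow> real \<Rightarrow> (nat \<Rightarrow> real^3 \<Rightarrow> real) \<Rightarrow> real set \<Rightarrow> (real \<Rightarrow> real^3 \<Rightarrow> complex^2^2) \<Rightarrow> bool"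
  where
  "solves_dirac l m q A S \<phi> \<longleftrightarrow>
     (\<forall>t\<in>S. AE x in lebesgue.
        L2_derivative S (\<lambda>s y. hat (\<phi> s y)) t x
        + (\<Sum>k=1..3. e_up k ** weak_partial (of_nat k) (\<lambda>y. hat (\<phi> t y)) x)
        + (\<i> *\<^sub>C (q *\<^sub>R (potential A x ** hat (\<phi> t x)) + (m *\<^sub>R (V l (\<phi> t x) *\<^sub>C \<phi> t x)))) ** e_low 3
        = 0)"

end

theory Submission
  imports Defs
begin

text \<open>
  In terms of \<open>\<psi> = hat \<phi>\<close> the equation reads \<open>\<psi>' = D \<psi> + K \<psi> + F \<psi>\<close> in \<open>L\<^sup>2\<close>. The Weyl operator
  \<open>D = \<Sum> \<sigma>\<^sub>k \<partial>\<^sub>k\<close> is skew-adjoint on \<open>H\<^sup>1\<close>, with \<open>|D \<psi>| = |\<nabla> \<psi>|\<close>. The potential term \<open>K\<close> is skew and, because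
  \<open>p > 3\<close>, bounded relative to \<open>D\<close> with arbitrarily small constant, so \<open>D + K\<close> is still skew-adjoint. The
  regularized nonlinearity \<open>F\<close> acts pointwise, is homogeneous of degree one and globally Lipschitz.

  Replacing the generator by its Yosida approximations gives ordinary differential equations, whose
  solutions converge uniformly to a solution in a weak sense. The norm of its derivative grows at most
  like \<open>exp (\<omega> t)\<close> in both directions of time, hence is continuous; together with weak continuity this
  makes the derivative strongly continuous, which is the required regularity.
\<close>

section \<open>Ordinary differential equations\<close>

text \<open>\<open>F\<close> is merely Lipschitz on L2, so regularity cannot come from
  differentiating an integral equation; instead the speed of a solution is estimated by comparing it
  with its own time shifts. The forward estimate alone would give continuity of the speed only from
  the right, which is why time reversal matters. All analysis of \<open>D\<close> rests on
  translations: derivatives are their generators, resolvents are found through orthogonality to a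
  translation invariant range, and smallness of the potential comes from averages over dyadic cubes.
  Cutting an L^p weight at height R leaves an L2 part of size R^(1 - p/2), averaging over a cube of
  side r costs r^(-3/2), the gradient gains r, and some R = r^(-\<theta>) makes both parts of the
  weight summable exactly when p/2 - 1 > 1/2. Since the relative bound can be made as small as
  desired, the charge q may be arbitrary. The map \<open>hat\<close> conjugates, so only real
  linearity is used and L2 is treated as a real Hilbert space.\<close>

lemma decreasing_on_interval:
  fixes z :: "real \<Rightarrow> real"
  assumes "a \<le> b"
    and "\<And>t. t \<in> {a..b} \<Longrightarrow> (z has_real_derivative z' t) (at t within {a..b})"
    and "\<And>t. t \<in> {a..b} \<Longrightarrow> z' t \<le> 0"
  shows "z b \<le> z a"
proof -
  have "\<exists>x\<in>{a..b}. z b - z a = (*) (z' x) (b - a)"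
    using assms(1,2) by (intro mvt_very_simple) (auto simp: has_field_derivative_def)
  then obtain x where "x \<in> {a..b}" "z b - z a = z' x * (b - a)" by blast
  moreover have "z' x * (b - a) \<le> 0"
    using assms(1) assms(3)[OF \<open>x \<in> {a..b}\<close>] by (simp add: mult_nonpos_nonneg)
  ultimately show ?thesis by simp
qed

text \<open>With the integrating factor, \<open>exp (- k * s) * z s - c * s\<close> is
  nonincreasing: the source \<open>c\<close> is damped by a factor of at most one. The bound is not
  sharp but explicit.\<close>

lemma gronwall:
  fixes z :: "real \<Rightarrow> real"
  assumes d: "\<And>t. t \<in> {0..T} \<Longrightarrow> (z has_real_derivative z' t) (at t within {0..T})"
    and le: "\<And>t. t \<in> {0..T} \<Longrightarrow> z' t \<le> k * z t + c"
    and "c \<ge> 0" "k \<ge> 0" and t: "t \<in> {0..T}"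
  shows "z t \<le> exp (k * t) * (z 0 + c * t)"
proof -
  let ?g = "\<lambda>s. exp (- k * s) * z s - c * s"
  have "?g t \<le> ?g 0"
  proof (rule decreasing_on_interval[where z = ?g and z' = "\<lambda>s. exp (- k * s) * (z' s - k * z s) - c"])
    fix s assume s: "s \<in> {0..t}"
    then have "s \<in> {0..T}" using t by auto
    then have "(z has_real_derivative z' s) (at s within {0..t})"
      by (rule has_field_derivative_subset[OF d]) (use t in auto)
    then show "(?g has_real_derivative exp (- k * s) * (z' s - k * z s) - c) (at s within {0..t})"
      by (auto intro!: derivative_eq_intros simp: algebra_simps)
    have "exp (- k * s) * (z' s - k * z s) \<le> exp (- k * s) * c"
      using le[OF \<open>s \<in> {0..T}\<close>] by (auto intro: mult_left_mono)
    also have "\<dots> \<le> 1 * c"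
      by (rule mult_right_mono) (use assms(3,4) s in auto)
    finally show "exp (- k * s) * (z' s - k * z s) - c \<le> 0" by simp
  qed (use t in auto)
  then have "exp (- k * t) * z t \<le> z 0 + c * t" by simp
  from mult_left_mono[OF this, of "exp (k * t)"]
  have "exp (k * t) * (exp (- k * t) * z t) \<le> exp (k * t) * (z 0 + c * t)" by simp
  then show ?thesis by (simp add: exp_minus field_simps)
qed

lemma vector_derivative_lipschitz_bound:
  fixes f :: "real \<Rightarrow> 'a::real_normed_vector"
  assumes "\<And>t. t \<in> {a..b} \<Longrightarrow> (f has_vector_derivative f' t) (at t within {a..b})"
    and "\<And>t. t \<in> {a..b} \<Longrightarrow> norm (f' t) \<le> C" and "s \<in> {a..b}" "t \<in> {a..b}"
  shows "norm (f t - f s) \<le> C * \<bar>t - s\<bar>"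
proof -
  have "C \<ge> 0" using assms(2)[OF assms(3)] norm_ge_zero order_trans by blast
  have "norm (f t - f s) \<le> C * norm (t - s)"
  proof (rule differentiable_bound[where S = "{a..b}" and f' = "\<lambda>t h. h *\<^sub>R f' t"])
    fix x assume x: "x \<in> {a..b}"
    show "(f has_derivative (\<lambda>h. h *\<^sub>R f' x)) (at x within {a..b})"
      using assms(1)[OF x] by (simp add: has_vector_derivative_def)
    show "onorm (\<lambda>h. h *\<^sub>R f' x) \<le> C"
      using assms(2)[OF x] by (intro onorm_le) (metis abs_ge_zero mult.commute mult_left_mono norm_scaleR real_norm_def)
  qed (use assms in auto)
  then show ?thesis by simp
qed

text \<open>The mean value inequality for \<open>f t - t *\<^sub>R v\<close>. It recovers a
  difference quotient from control of the derivative along an interval, and is applied to scalar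
  products, to orbits of translations and to test functions.\<close>

lemma vector_derivative_linear_bound:
  fixes f :: "real \<Rightarrow> 'a::real_normed_vector"
  assumes "\<And>t. t \<in> {a..b} \<Longrightarrow> (f has_vector_derivative f' t) (at t within {a..b})"
    and "\<And>t. t \<in> {a..b} \<Longrightarrow> norm (f' t - v) \<le> C" and "s \<in> {a..b}" "t \<in> {a..b}"
  shows "norm (f t - f s - (t - s) *\<^sub>R v) \<le> C * \<bar>t - s\<bar>"
proof -
  have "norm ((f t - t *\<^sub>R v) - (f s - s *\<^sub>R v)) \<le> C * \<bar>t - s\<bar>"
    by (rule vector_derivative_lipschitz_bound[where f' = "\<lambda>t. f' t - v"])
      (use assms in \<open>auto intro!: derivative_eq_intros\<close>)
  then show ?thesis by (simp add: algebra_simps)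
qed

lemma lipschitz_ode:
  fixes G :: "'a::banach \<Rightarrow> 'a"
  assumes lip: "\<And>x y. norm (G x - G y) \<le> K * norm (x - y)" and "T \<ge> 0"
  shows "\<exists>u. u 0 = x0 \<and> (\<forall>t\<in>{0..T}. (u has_vector_derivative G (u t)) (at t within {0..T}))"
proof -
  \<comment> \<open>The shift by one makes the constant positive even if \<open>K\<close> is
    not.\<close>
  define k where "k = \<bar>K\<bar> + 1"
  have k: "k > 0" unfolding k_def by simp
  have lipk: "norm (G x - G y) \<le> k * norm (x - y)" for x y
    by (rule order_trans[OF lip]) (auto intro!: mult_right_mono simp: k_def)
  have contG: "continuous_on S G" for S
  proof (rule continuous_on_subset[OF _ subset_UNIV])
    have "lipschitz_on k UNIV G"
      using lipk k by (auto simp: lipschitz_on_def dist_norm)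
    then show "continuous_on UNIV G" by (rule lipschitz_on_continuous_on)
  qed
  \<comment> \<open>Clamping time to \<open>{0..T}\<close> extends the iterates to the whole line,
    because the fixed point is taken among bounded continuous functions on all of \<real>.\<close>
  define c where "c = (\<lambda>t. max 0 (min T t))"
  have c: "c t \<in> {0..T}" for t using \<open>T \<ge> 0\<close> by (auto simp: c_def)
  have cid: "c t = t" if "t \<in> {0..T}" for t using that by (auto simp: c_def)
  have cc: "continuous_on UNIV c" unfolding c_def by (intro continuous_intros)
  \<comment> \<open>The weight \<open>exp (2 k t)\<close> makes the Picard operator a contraction on the whole interval.\<close>
  define I where "I = (\<lambda>v::real \<Rightarrow>\<^sub>C 'a. \<lambda>t. integral {0..t} (\<lambda>s. G (exp (2 * k * s) *\<^sub>R apply_bcontfun v s)))"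
  define P where "P = (\<lambda>v t. exp (- 2 * k * c t) *\<^sub>R (x0 + I v (c t)))"
  have cint: "continuous_on S (\<lambda>s. G (exp (2 * k * s) *\<^sub>R apply_bcontfun v s))" for S and v :: "real \<Rightarrow>\<^sub>C 'a"
    by (rule continuous_on_compose2[OF contG[of UNIV]])
      (auto intro!: continuous_intros)
  have Ic: "continuous_on {0..T} (I v)" for v
    unfolding I_def by (intro indefinite_integral_continuous_1 integrable_continuous_real cint)
  have Pc: "continuous_on UNIV (P v)" for v
  proof -
    have "continuous_on UNIV (\<lambda>t. I v (c t))"
      by (rule continuous_on_compose2[OF Ic cc]) (use c in auto)
    then show ?thesis unfolding P_def by (intro continuous_intros cc)
  qed
  have Pb: "P v \<in> bcontfun" for v
  proof -
    have "bounded (P v ` {0..T})"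
      by (intro compact_imp_bounded compact_continuous_image continuous_on_subset[OF Pc]) auto
    then obtain B where "\<forall>x\<in>{0..T}. norm (P v x) \<le> B" by (auto simp: bounded_iff)
    moreover have "P v x = P v (c x)" for x unfolding P_def by (simp only: cid[OF c])
    ultimately have "norm (P v x) \<le> B" for x using c by metis
    then show ?thesis using Pc unfolding bcontfun_def by (auto simp: bounded_iff)
  qed
  define \<Phi> where "\<Phi> v = Bcontfun (P v)" for v
  have \<Phi>: "apply_bcontfun (\<Phi> v) = P v" for v unfolding \<Phi>_def using Pb by (simp add: Bcontfun_inverse)
  have contr: "dist (\<Phi> v) (\<Phi> w) \<le> 1/2 * dist v w" for v w
  proof (rule dist_bound, unfold \<Phi>)
    fix t
    let ?s = "c t"
    have s: "0 \<le> ?s" using c[of t] by auto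
    \<comment> \<open>Integrating the weight yields \<open>exp (2 * k * s) / 2\<close>; the half
      that remains after cancelling the weight is the contraction constant.\<close>
    have ex: "((\<lambda>s. k * exp (2 * k * s) * dist v w) has_integral
        (exp (2 * k * ?s) / 2 * dist v w - exp (2 * k * 0) / 2 * dist v w)) {0..?s}"
      using k by (intro fundamental_theorem_of_calculus s)
        (auto simp: has_real_derivative_iff_has_vector_derivative[symmetric] intro!: derivative_eq_intros)
    have "norm (I v ?s - I w ?s) = norm (integral {0..?s} (\<lambda>s. G (exp (2 * k * s) *\<^sub>R apply_bcontfun v s) - G (exp (2 * k * s) *\<^sub>R apply_bcontfun w s)))"
      unfolding I_def by (subst integral_diff) (auto intro!: integrable_continuous_real cint)
    also have "\<dots> \<le> integral {0..?s} (\<lambda>s. k * exp (2 * k * s) * dist v w)"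
    proof (rule integral_norm_bound_integral)
      fix x assume "x \<in> {0..?s}"
      have "norm (G (exp (2 * k * x) *\<^sub>R apply_bcontfun v x) - G (exp (2 * k * x) *\<^sub>R apply_bcontfun w x))
        \<le> k * norm (exp (2 * k * x) *\<^sub>R (apply_bcontfun v x - apply_bcontfun w x))"
        using lipk by (metis scaleR_diff_right)
      also have "\<dots> = k * exp (2 * k * x) * dist (apply_bcontfun v x) (apply_bcontfun w x)"
        by (simp add: dist_norm)
      also have "\<dots> \<le> k * exp (2 * k * x) * dist v w"
        using k by (intro mult_left_mono dist_bounded) auto
      finally show "norm (G (exp (2 * k * x) *\<^sub>R apply_bcontfun v x) - G (exp (2 * k * x) *\<^sub>R apply_bcontfun w x))
        \<le> k * exp (2 * k * x) * dist v w" .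
    qed (auto intro!: integrable_continuous_real continuous_intros cint)
    also have "\<dots> \<le> exp (2 * k * ?s) / 2 * dist v w"
      unfolding integral_unique[OF ex] by simp
    finally have "exp (- 2 * k * ?s) * norm (I v ?s - I w ?s) \<le> exp (- 2 * k * ?s) * (exp (2 * k * ?s) / 2 * dist v w)"
      by (intro mult_left_mono) auto
    also have "\<dots> = 1/2 * dist v w" by (simp add: exp_minus)
    also have "exp (- 2 * k * ?s) * norm (I v ?s - I w ?s) = dist (P v t) (P w t)"
      unfolding P_def by (simp add: dist_norm scaleR_diff_right[symmetric])
    finally show "dist (P v t) (P w t) \<le> 1/2 * dist v w" .
  qed
  have "\<exists>!v. \<Phi> v = v" using contr by (intro banach_fix_type[where c = "1/2"]) auto
  then obtain v where v: "\<Phi> v = v" by blast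
  define u where "u t = exp (2 * k * t) *\<^sub>R apply_bcontfun v t" for t
  have ueq: "u t = x0 + integral {0..t} (\<lambda>s. G (u s))" if "t \<in> {0..T}" for t
  proof -
    have "apply_bcontfun v t = P v t" using v \<Phi> by metis
    then show ?thesis using that unfolding u_def P_def I_def
      by (simp add: cid exp_add[symmetric])
  qed
  show ?thesis
  proof (intro exI[of _ u] conjI ballI)
    show "u 0 = x0" using ueq[of 0] \<open>T \<ge> 0\<close> by simp
    fix t assume t: "t \<in> {0..T}"
    have "((\<lambda>t. x0 + integral {0..t} (\<lambda>s. G (u s))) has_vector_derivative 0 + G (u t)) (at t within {0..T})"
      by (intro has_vector_derivative_add integral_has_vector_derivative has_vector_derivative_const t)
        (simp add: u_def cint)
    then show "(u has_vector_derivative G (u t)) (at t within {0..T})"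
      by (rule has_vector_derivative_transform[rotated 2, OF has_vector_derivative_eq_rhs])
        (use t ueq in auto)
  qed
qed

section \<open>Lipschitz perturbations of skew-adjoint operators\<close>

text \<open>Approximating \<open>y\<close> itself from \<open>S\<close> turns the hypothesis into
  \<open>|y|^2 \<le> c |y|\<close>, so a one-sided bound on a dense set suffices.\<close>

lemma norm_le_inner_dense:
  fixes y :: "'a::real_inner"
  assumes "closure S = UNIV" and "\<And>w. w \<in> S \<Longrightarrow> inner y w \<le> c * norm w" and "c \<ge> 0"
  shows "norm y \<le> c"
proof -
  have "y \<in> closure S" using assms(1) by simp
  then obtain w where w: "\<And>n. w n \<in> S" "w \<longlonglongrightarrow> y" by (auto simp: closure_sequential)
  have "inner y y \<le> c * norm y"
    by (rule tendsto_le[OF _ tendsto_mult[OF tendsto_const tendsto_norm[OF w(2)]]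
          tendsto_inner[OF tendsto_const w(2)]])
      (auto simp: assms(2) w(1))
  then have "norm y * norm y \<le> c * norm y" by (simp add: dot_square_norm power2_eq_square)
  then show ?thesis using assms(3) by (cases "y = 0") (auto simp: mult_le_cancel_right)
qed

text \<open>Boundedness transfers the limit from \<open>S\<close> to nearby vectors: replacing
  \<open>w\<close> by \<open>v\<close> changes the scalar products with \<open>y n - y0\<close> by
  at most \<open>M\<close> times their distance.\<close>

lemma weak_tendsto_dense:
  fixes y :: "'b \<Rightarrow> 'a::real_inner"
  assumes "closure S = UNIV" and b: "eventually (\<lambda>n. norm (y n) \<le> C) \<F>"
    and lim: "\<And>w. w \<in> S \<Longrightarrow> ((\<lambda>n. inner (y n) w) \<longlongrightarrow> inner y0 w) \<F>"
  shows "((\<lambda>n. inner (y n) w) \<longlongrightarrow> inner y0 w) \<F>"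
proof (rule tendstoI)
  fix e :: real assume "e > 0"
  define M where "M = \<bar>C\<bar> + norm y0 + 1"
  have M: "M > 0" unfolding M_def by (simp add: add_nonneg_pos)
  have "w \<in> closure S" using assms(1) by simp
  then obtain v where v: "v \<in> S" "dist v w < e / (2 * M)"
    using M \<open>e > 0\<close> by (metis closure_approachable divide_pos_pos mult_pos_pos zero_less_numeral)
  have "eventually (\<lambda>n. dist (inner (y n) v) (inner y0 v) < e / 2) \<F>"
    using lim[OF v(1)] \<open>e > 0\<close> by (intro tendstoD) auto
  with b show "eventually (\<lambda>n. dist (inner (y n) w) (inner y0 w) < e) \<F>"
  proof eventually_elim
    case (elim n)
    have "norm (y n - y0) \<le> M" using norm_triangle_ineq4[of "y n" y0] elim(1) unfolding M_def by linarith
    have "\<bar>inner (y n - y0) (w - v)\<bar> \<le> norm (y n - y0) * norm (w - v)" by (rule Cauchy_Schwarz_ineq2)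
    also have "\<dots> \<le> M * (e / (2 * M))"
      using \<open>norm (y n - y0) \<le> M\<close> v(2) M by (intro mult_mono) (auto simp: dist_norm norm_minus_commute)
    also have "\<dots> = e / 2" using M by simp
    finally have "\<bar>inner (y n - y0) (w - v)\<bar> \<le> e / 2" .
    then show ?case using elim(2) unfolding dist_real_def inner_diff_left inner_diff_right by linarith
  qed
qed

text \<open>Weak lower semicontinuity of the norm; by Cauchy-Schwarz it is enough to test against
  the limit \<open>y0\<close> itself.\<close>

lemma weak_limit_norm_le:
  fixes y :: "'b \<Rightarrow> 'a::real_inner"
  assumes "\<F> \<noteq> bot" and b: "eventually (\<lambda>n. norm (y n) \<le> c n) \<F>" and "(c \<longlongrightarrow> c0) \<F>"
    and lim: "((\<lambda>n. inner (y n) y0) \<longlongrightarrow> inner y0 y0) \<F>"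
  shows "norm y0 \<le> c0"
proof -
  have "inner y0 y0 \<le> c0 * norm y0"
  proof (rule tendsto_le[OF assms(1) tendsto_mult[OF assms(3) tendsto_const] lim])
    show "\<forall>\<^sub>F n in \<F>. inner (y n) y0 \<le> c n * norm y0"
      using b by eventually_elim (meson mult_right_mono norm_cauchy_schwarz norm_ge_zero order_trans)
  qed
  then have *: "norm y0 * norm y0 \<le> c0 * norm y0" by (simp add: dot_square_norm power2_eq_square)
  have "0 \<le> c0"
    by (rule tendsto_lowerbound[OF assms(3) _ assms(1)])
      (use b in \<open>eventually_elim, use norm_ge_zero order_trans in blast\<close>)
  then show ?thesis using * by (cases "y0 = 0") (auto simp: mult_le_cancel_right)
qed

lemma has_vector_derivative_iff_quotient:
  fixes f :: "real \<Rightarrow> 'a::real_normed_vector"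
  shows "(f has_vector_derivative d) (at t within S) \<longleftrightarrow>
    ((\<lambda>s. (f s - f t) /\<^sub>R (s - t)) \<longlongrightarrow> d) (at t within S)"
proof -
  have "(f has_vector_derivative d) (at t within S) \<longleftrightarrow>
      ((\<lambda>s. (f s - f t - (s - t) *\<^sub>R d) /\<^sub>R norm (s - t)) \<longlongrightarrow> 0) (at t within S)"
    by (simp add: has_vector_derivative_def has_derivative_at_within bounded_linear_scaleR_left)
  also have "\<dots> \<longleftrightarrow> ((\<lambda>s. norm ((f s - f t - (s - t) *\<^sub>R d) /\<^sub>R norm (s - t))) \<longlongrightarrow> 0) (at t within S)"
    by (rule tendsto_norm_zero_iff[symmetric])
  also have "\<dots> \<longleftrightarrow> ((\<lambda>s. norm ((f s - f t) /\<^sub>R (s - t) - d)) \<longlongrightarrow> 0) (at t within S)"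
  proof (rule filterlim_cong[OF refl refl], unfold eventually_at_filter, intro always_eventually allI impI)
    fix s assume "s \<noteq> t"
    then have "(f s - f t) /\<^sub>R (s - t) - d = (f s - f t - (s - t) *\<^sub>R d) /\<^sub>R (s - t)"
      by (simp add: scaleR_diff_right)
    then show "norm ((f s - f t - (s - t) *\<^sub>R d) /\<^sub>R norm (s - t)) = norm ((f s - f t) /\<^sub>R (s - t) - d)"
      by simp
  qed
  also have "\<dots> \<longleftrightarrow> ((\<lambda>s. (f s - f t) /\<^sub>R (s - t)) \<longlongrightarrow> d) (at t within S)"
    by (subst tendsto_norm_zero_iff) (rule LIM_zero_iff)
  finally show ?thesis .
qed

lemma has_real_derivative_norm_square:
  fixes u :: "real \<Rightarrow> 'a::real_inner"
  assumes "(u has_vector_derivative d) (at t within S)"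
  shows "((\<lambda>s. (norm (u s))\<^sup>2) has_real_derivative 2 * inner d (u t)) (at t within S)"
proof -
  have "((\<lambda>s. inner (u s) (u s)) has_derivative (\<lambda>h. inner (u t) (h *\<^sub>R d) + inner (h *\<^sub>R d) (u t))) (at t within S)"
    using assms unfolding has_vector_derivative_def by (intro has_derivative_inner)
  then have "((\<lambda>s. inner (u s) (u s)) has_derivative (*) (2 * inner d (u t))) (at t within S)"
    by (rule has_derivative_eq_rhs) (auto simp: inner_commute algebra_simps)
  then show ?thesis by (simp add: has_field_derivative_def dot_square_norm)
qed

text \<open>The derivative is estimated through the difference of the solution and its time shifts.\<close>

lemma dissipative_ode_derivative_bound:
  fixes G :: "'a::real_inner \<Rightarrow> 'a"
  assumes G: "\<And>x y. inner (G x - G y) (x - y) \<le> \<omega> * (norm (x - y))\<^sup>2" and "\<omega> \<ge> 0"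
    and u: "\<And>t. t \<in> {0..T} \<Longrightarrow> (u has_vector_derivative G (u t)) (at t within {0..T})"
    and t: "0 \<le> t" "t < T"
  shows "norm (G (u t)) \<le> exp (\<omega> * t) * norm (G (u 0))"
proof -
  have shift: "norm (u (t + h) - u t) \<le> exp (\<omega> * t) * norm (u h - u 0)" if h: "0 < h" "h \<le> T - t" for h
  proof -
    \<comment> \<open>Two solutions of the same autonomous equation separate at most at rate
      \<omega>; the second one here is the first, shifted by \<open>h\<close>.\<close>
    let ?z = "\<lambda>s. (norm (u (h + s) - u s))\<^sup>2"
    have "?z t \<le> exp (2 * \<omega> * t) * (?z 0 + 0 * t)"
    proof (rule gronwall[where z = ?z and T = t and z' = "\<lambda>s. 2 * inner (G (u (h + s)) - G (u s)) (u (h + s) - u s)"])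
      fix s assume s: "s \<in> {0..t}"
      have "(u has_vector_derivative G (u s)) (at s within {0..t})"
        by (rule has_vector_derivative_within_subset[OF u]) (use s t in auto)
      moreover have "((u \<circ> (\<lambda>s. h + s)) has_vector_derivative (1 *\<^sub>R G (u (h + s)))) (at s within {0..t})"
      proof (rule vector_diff_chain_within)
        show "((+) h has_vector_derivative 1) (at s within {0..t})"
          by (auto intro!: derivative_eq_intros)
        show "(u has_vector_derivative G (u (h + s))) (at (h + s) within (+) h ` {0..t})"
          by (rule has_vector_derivative_within_subset[OF u]) (use s t h in auto)
      qed
      ultimately show "(?z has_real_derivative 2 * inner (G (u (h + s)) - G (u s)) (u (h + s) - u s)) (at s within {0..t})"
        by (intro has_real_derivative_norm_square has_vector_derivative_diff) (auto simp: o_def)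
      show "2 * inner (G (u (h + s)) - G (u s)) (u (h + s) - u s) \<le> 2 * \<omega> * ?z s + 0"
        using G[of "u (h + s)" "u s"] by simp
    qed (use t assms(2) in auto)
    also have "\<dots> = (exp (\<omega> * t) * norm (u h - u 0))\<^sup>2"
      by (simp add: power_mult_distrib exp_double[symmetric] mult.assoc)
    finally show ?thesis by (simp add: add.commute power2_le_iff_abs_le)
  qed
  \<comment> \<open>Shifts of length at most \<open>T - t\<close> keep both curves inside the
    interval. Dividing by them turns the shift estimate into one for the derivatives at
    \<open>t\<close> and at 0.\<close>
  define h where "h n = (T - t) / real (Suc n)" for n
  have h: "0 < h n" "h n \<le> T - t" for n
    using t unfolding h_def by (auto simp: divide_le_eq mult_le_cancel_left1)
  have h0: "h \<longlonglongrightarrow> 0" unfolding h_def divide_inverse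
    using tendsto_mult[OF tendsto_const LIMSEQ_inverse_real_of_nat, of "T - t"] by simp
  have lim: "(\<lambda>n. (u (s + h n) - u s) /\<^sub>R h n) \<longlonglongrightarrow> G (u s)" if s: "0 \<le> s" "s \<le> t" for s
  proof -
    have "((\<lambda>r. (u r - u s) /\<^sub>R (r - s)) \<longlongrightarrow> G (u s)) (at s within {0..T})"
      using u[of s] s t by (simp add: has_vector_derivative_iff_quotient)
    moreover have "filterlim (\<lambda>n. s + h n) (at s within {0..T}) sequentially"
      unfolding filterlim_at
    proof
      show "\<forall>\<^sub>F n in sequentially. s + h n \<in> {0..T} \<and> s + h n \<noteq> s"
      proof (intro always_eventually allI)
        show "s + h n \<in> {0..T} \<and> s + h n \<noteq> s" for n using h[of n] s t by auto
      qed
      show "(\<lambda>n. s + h n) \<longlonglongrightarrow> s" using tendsto_add[OF tendsto_const h0, of s] by simp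
    qed
    ultimately have "(\<lambda>n. (u (s + h n) - u s) /\<^sub>R (s + h n - s)) \<longlonglongrightarrow> G (u s)"
      by (rule filterlim_compose)
    then show ?thesis by simp
  qed
  show ?thesis
  proof (rule tendsto_le[OF _ tendsto_mult[OF tendsto_const tendsto_norm[OF lim[of 0]]] tendsto_norm[OF lim[of t]]])
    show "\<forall>\<^sub>F n in sequentially. norm ((u (t + h n) - u t) /\<^sub>R h n) \<le> exp (\<omega> * t) * norm ((u (0 + h n) - u 0) /\<^sub>R h n)"
    proof (intro always_eventually allI)
      fix n
      have "inverse (h n) * norm (u (t + h n) - u t) \<le> inverse (h n) * (exp (\<omega> * t) * norm (u (h n) - u 0))"
        using h[of n] by (intro mult_left_mono shift) auto
      then show "norm ((u (t + h n) - u t) /\<^sub>R h n) \<le> exp (\<omega> * t) * norm ((u (0 + h n) - u 0) /\<^sub>R h n)"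
        using h[of n] by (simp add: mult.left_commute)
    qed
  qed (use t in auto)
qed

text \<open>Skew-adjointness in a form that can be verified directly: skew symmetry on a dense
  domain and surjectivity of \<open>1 - a L\<close> and \<open>1 + a L\<close> for small
  \<open>a\<close>. The threshold \<open>a0\<close> is a parameter because the perturbed operator is
  shown to have this surjectivity for a smaller range of \<open>a\<close>.\<close>

locale skew_generator =
  fixes Dm :: "'a::{real_inner,banach} set" and L :: "'a \<Rightarrow> 'a" and a0 :: real
  assumes sub: "subspace Dm"
    and L_add: "\<And>x y. x \<in> Dm \<Longrightarrow> y \<in> Dm \<Longrightarrow> L (x + y) = L x + L y"
    and L_scale: "\<And>c x. x \<in> Dm \<Longrightarrow> L (c *\<^sub>R x) = c *\<^sub>R L x"
    and skew: "\<And>x. x \<in> Dm \<Longrightarrow> inner (L x) x = 0"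
    and dense: "closure Dm = UNIV"
    and a0: "a0 > 0"
    and range_pos: "\<And>a f. 0 < a \<Longrightarrow> a < a0 \<Longrightarrow> \<exists>u\<in>Dm. u - a *\<^sub>R L u = f"
    and range_neg: "\<And>a f. 0 < a \<Longrightarrow> a < a0 \<Longrightarrow> \<exists>u\<in>Dm. u + a *\<^sub>R L u = f"
begin

text \<open>The axioms are symmetric in the sign of \<open>L\<close>; this is what permits time
  reversal.\<close>

lemma neg: "skew_generator Dm (\<lambda>x. - L x) a0"
proof
qed (use sub L_add L_scale skew dense a0 range_pos range_neg in auto)

lemma mem_diff: "x \<in> Dm \<Longrightarrow> y \<in> Dm \<Longrightarrow> x - y \<in> Dm" using sub by (rule subspace_diff)
lemma mem_scale: "x \<in> Dm \<Longrightarrow> c *\<^sub>R x \<in> Dm" using sub by (rule subspace_scale)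

lemma L_diff: "x \<in> Dm \<Longrightarrow> y \<in> Dm \<Longrightarrow> L (x - y) = L x - L y"
  using L_add[of x "(-1) *\<^sub>R y"] L_scale[of y "-1"] mem_scale[of y "-1"] by simp

lemma skew_swap:
  assumes "x \<in> Dm" "y \<in> Dm"
  shows "inner (L x) y = - inner x (L y)"
proof -
  have "inner (L (x + y)) (x + y) = 0" using assms sub by (intro skew subspace_add)
  then show ?thesis using assms skew[of x] skew[of y]
    by (simp add: L_add inner_add_left inner_add_right inner_commute)
qed

text \<open>Pythagoras: the mixed terms vanish by skewness. Uniqueness in the resolvent equation and
  the bounds \<open>|J a f| \<le> |f|\<close> and \<open>a |Y a f| \<le> |f|\<close> all come from
  this identity.\<close>

lemma norm_resolvent:
  assumes "x \<in> Dm"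
  shows "(norm (x - a *\<^sub>R L x))\<^sup>2 = (norm x)\<^sup>2 + a\<^sup>2 * (norm (L x))\<^sup>2"
proof -
  have "inner x (L x) = 0" using skew[OF assms] by (simp add: inner_commute)
  then show ?thesis using skew[OF assms] unfolding power2_norm_eq_inner
    by (simp only: inner_diff_left inner_diff_right inner_scaleR_left inner_scaleR_right)
      (simp add: power2_eq_square)
qed

text \<open>The resolvent \<open>(1 - a L)^(-1)\<close> and, after it, the Yosida approximation
  \<open>L (1 - a L)^(-1)\<close>, which is bounded and defined everywhere.\<close>

definition J :: "real \<Rightarrow> 'a \<Rightarrow> 'a" where "J a f = (SOME u. u \<in> Dm \<and> u - a *\<^sub>R L u = f)"
definition Y :: "real \<Rightarrow> 'a \<Rightarrow> 'a" where "Y a f = L (J a f)"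

section \<open>Estimates for the resolvent and the Yosida approximation\<close>

context
  fixes a assumes a: "0 < a" "a < a0"
begin

lemma J: "J a f \<in> Dm" "J a f - a *\<^sub>R Y a f = f"
proof -
  have "\<exists>u. u \<in> Dm \<and> u - a *\<^sub>R L u = f" using range_pos[OF a] by blast
  then have "J a f \<in> Dm \<and> J a f - a *\<^sub>R L (J a f) = f" unfolding J_def by (rule someI_ex)
  then show "J a f \<in> Dm" "J a f - a *\<^sub>R Y a f = f" unfolding Y_def by auto
qed

lemma J_unique:
  assumes "u \<in> Dm" "u - a *\<^sub>R L u = f"
  shows "J a f = u"
proof -
  have d: "J a f - u \<in> Dm" using J(1) assms(1) by (rule mem_diff)
  have "(J a f - u) - a *\<^sub>R L (J a f - u) = (J a f - a *\<^sub>R Y a f) - (u - a *\<^sub>R L u)"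
    using J(1) assms(1) unfolding Y_def by (simp add: L_diff algebra_simps)
  also have "\<dots> = 0" using J(2) assms(2) by simp
  finally have "(norm (J a f - u))\<^sup>2 + a\<^sup>2 * (norm (L (J a f - u)))\<^sup>2 = 0"
    using norm_resolvent[OF d, of a] by simp
  moreover have "0 \<le> a\<^sup>2 * (norm (L (J a f - u)))\<^sup>2" "0 \<le> (norm (J a f - u))\<^sup>2" by simp_all
  ultimately have "(norm (J a f - u))\<^sup>2 = 0" by linarith
  then show ?thesis by simp
qed

lemma J_diff: "J a f - J a g = J a (f - g)"
proof (rule J_unique[symmetric])
  have "J a f - J a g - a *\<^sub>R L (J a f - J a g) = (J a f - a *\<^sub>R Y a f) - (J a g - a *\<^sub>R Y a g)"
    using J(1) unfolding Y_def by (simp add: L_diff algebra_simps)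
  then show "J a f - J a g - a *\<^sub>R L (J a f - J a g) = f - g" using J(2) by simp
qed (intro mem_diff J)

lemma Y_diff: "Y a f - Y a g = Y a (f - g)"
  unfolding Y_def J_diff[symmetric] using J(1) by (simp add: L_diff)

lemma norm_J_Y: "(norm (J a f))\<^sup>2 + a\<^sup>2 * (norm (Y a f))\<^sup>2 = (norm f)\<^sup>2"
  using norm_resolvent[OF J(1), of f a] J(2)[of f] unfolding Y_def by simp

lemma norm_J: "norm (J a f) \<le> norm f"
proof (rule power2_le_imp_le)
  have "0 \<le> a\<^sup>2 * (norm (Y a f))\<^sup>2" by simp
  then show "(norm (J a f))\<^sup>2 \<le> (norm f)\<^sup>2" using norm_J_Y[of f] by linarith
qed simp

lemma norm_Y: "norm (Y a f) \<le> inverse a * norm f"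
proof -
  have "(a * norm (Y a f))\<^sup>2 \<le> (norm f)\<^sup>2"
    using norm_J_Y[of f] zero_le_power2[of "norm (J a f)"] unfolding power_mult_distrib by linarith
  then have "a * norm (Y a f) \<le> norm f" by (rule power2_le_imp_le) simp
  then show ?thesis using a by (simp add: field_simps)
qed

text \<open>\<open>Y a x\<close> is a multiple of \<open>J a x - x\<close> and hence in the domain;
  applying \<open>L\<close> to the resolvent equation shows that \<open>L\<close> commutes with the
  resolvent.\<close>

lemma Y_on_domain:
  assumes "x \<in> Dm" shows "Y a x = J a (L x)"
proof (rule J_unique[symmetric])
  have "Y a x = inverse a *\<^sub>R (J a x - x)" using J(2)[of x] a by (simp add: field_simps)
  then show m: "Y a x \<in> Dm" using J(1) assms by (simp add: mem_scale mem_diff)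
  have "J a x - a *\<^sub>R Y a x = x" by (rule J)
  then have "L x = L (J a x - a *\<^sub>R Y a x)" by simp
  also have "\<dots> = Y a x - a *\<^sub>R L (Y a x)"
    using m J(1) by (subst L_diff) (auto simp: mem_scale L_scale Y_def)
  finally show "Y a x - a *\<^sub>R L (Y a x) = L x" by simp
qed

lemma norm_Y_on_domain: "x \<in> Dm \<Longrightarrow> norm (Y a x) \<le> norm (L x)"
  by (simp add: Y_on_domain norm_J)

lemma norm_J_minus: "norm (J a x - x) = a * norm (Y a x)"
proof -
  have "J a x - x = a *\<^sub>R Y a x" using J(2)[of x] by (simp add: algebra_simps)
  then show ?thesis using a by simp
qed

text \<open>By skewness on \<open>J a f\<close> the scalar product equals
  \<open>- a |Y a f|^2\<close>: the approximations are dissipative although \<open>L\<close> is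
  skew.\<close>

lemma inner_Y: "inner (Y a f) f \<le> 0"
proof -
  have "inner (Y a f) f = inner (Y a f) (J a f) - a * inner (Y a f) (Y a f)"
    using J(2)[of f] by (metis inner_diff_right inner_scaleR_right)
  moreover have "inner (Y a f) (J a f) = 0" unfolding Y_def by (rule skew[OF J(1)])
  ultimately show ?thesis using a by simp
qed

lemma tendsto_Y:
  assumes "(x \<longlongrightarrow> x0) \<F>" shows "((\<lambda>n. Y a (x n)) \<longlongrightarrow> Y a x0) \<F>"
proof -
  have "((\<lambda>n. Y a (x n) - Y a x0) \<longlongrightarrow> 0) \<F>"
  proof (rule Lim_null_comparison)
    show "\<forall>\<^sub>F n in \<F>. norm (Y a (x n) - Y a x0) \<le> inverse a * norm (x n - x0)"
      by (simp add: Y_diff norm_Y)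
    show "((\<lambda>n. inverse a * norm (x n - x0)) \<longlongrightarrow> 0) \<F>"
      using tendsto_mult[OF tendsto_const tendsto_norm_zero[OF LIM_zero[OF assms]], of "inverse a"] by simp
  qed
  then show ?thesis by (rule LIM_zero_cancel)
qed

end

text \<open>Split \<open>f - g\<close> into the difference of the resolvents and that of their
  errors; the first part is annihilated because \<open>L\<close> is skew on
  \<open>J a f - J b g\<close>.\<close>

lemma resolvent_identity:
  assumes a: "0 < a" "a < a0" and b: "0 < b" "b < a0"
  shows "inner (Y a f - Y b g) (f - g) = - inner (Y a f - Y b g) (a *\<^sub>R Y a f - b *\<^sub>R Y b g)"
proof -
  have "f - g = (J a f - J b g) - (a *\<^sub>R Y a f - b *\<^sub>R Y b g)"
    using J(2)[OF a, of f] J(2)[OF b, of g] by (simp add: algebra_simps)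
  moreover have "inner (Y a f - Y b g) (J a f - J b g) = 0"
    unfolding Y_def using J(1)[OF a, of f] J(1)[OF b, of g]
    by (simp add: L_diff[symmetric] skew mem_diff)
  ultimately show ?thesis by (simp add: inner_diff_right)
qed

text \<open>What the resolvent identity leaves is of first order in the parameters once both Yosida
  terms are bounded. This makes the approximate solutions a Cauchy sequence.\<close>

lemma Y_difference_bound:
  assumes a: "0 < a" "a < a0" and b: "0 < b" "b < a0"
    and C: "norm (Y a f) \<le> C" "norm (Y b g) \<le> C"
  shows "inner (Y a f - Y b g) (f - g) \<le> 2 * C\<^sup>2 * (a + b)"
proof -
  have "0 \<le> C" using C(1) norm_ge_zero order_trans by blast
  have "inner (Y a f - Y b g) (f - g) \<le> norm (Y a f - Y b g) * norm (a *\<^sub>R Y a f - b *\<^sub>R Y b g)"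
    unfolding resolvent_identity[OF a b] using Cauchy_Schwarz_ineq2 by (metis abs_le_D2)
  also have "\<dots> \<le> (2 * C) * (a * C + b * C)"
  proof (intro mult_mono)
    show "norm (Y a f - Y b g) \<le> 2 * C" using norm_triangle_ineq4[of "Y a f" "Y b g"] C by linarith
    have "norm (a *\<^sub>R Y a f - b *\<^sub>R Y b g) \<le> norm (a *\<^sub>R Y a f) + norm (b *\<^sub>R Y b g)" by (rule norm_triangle_ineq4)
    also have "\<dots> \<le> a * C + b * C" using a b C by (auto intro!: add_mono mult_left_mono)
    finally show "norm (a *\<^sub>R Y a f - b *\<^sub>R Y b g) \<le> a * C + b * C" .
  qed (use \<open>0 \<le> C\<close> in auto)
  finally show ?thesis by (simp add: algebra_simps power2_eq_square)
qed

text \<open>The \<open>+ 2\<close> keeps even the zeroth parameter strictly below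
  \<open>a0\<close>.\<close>

definition an :: "nat \<Rightarrow> real" where "an n = a0 / (real n + 2)"

lemma an: "0 < an n" "an n < a0"
  unfolding an_def using a0 by (auto simp: divide_less_eq)

lemma an_tendsto: "an \<longlonglongrightarrow> 0"
proof -
  have "(\<lambda>n. a0 * inverse (real (Suc (Suc n)))) \<longlonglongrightarrow> a0 * 0"
    by (intro tendsto_mult tendsto_const LIMSEQ_Suc[OF LIMSEQ_inverse_real_of_nat])
  then show ?thesis unfolding an_def divide_inverse by (simp add: add.commute)
qed

lemma an_decseq: "m \<le> n \<Longrightarrow> an n \<le> an m"
  unfolding an_def using a0 by (intro divide_left_mono) auto

text \<open>On the domain the error is \<open>a |Y a v| \<le> a |L v|\<close>; contractivity of the
  resolvents carries the limit over to the closure.\<close>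

lemma J_tendsto: "(\<lambda>n. J (an n) x) \<longlonglongrightarrow> x"
proof (rule tendstoI)
  fix e :: real assume "e > 0"
  have "x \<in> closure Dm" using dense by simp
  then obtain v where v: "v \<in> Dm" "dist v x < e / 3"
    using \<open>e > 0\<close> by (metis closure_approachable divide_pos_pos zero_less_numeral)
  have "(\<lambda>n. an n * norm (L v)) \<longlonglongrightarrow> 0 * norm (L v)" by (intro tendsto_intros an_tendsto)
  then have "\<forall>\<^sub>F n in sequentially. an n * norm (L v) < e / 3"
    using \<open>e > 0\<close> by (intro order_tendstoD(2)) auto
  then show "\<forall>\<^sub>F n in sequentially. dist (J (an n) x) x < e"
  proof eventually_elim
    case (elim n)
    have "norm (J (an n) v - v) \<le> an n * norm (L v)"
      using an[of n] v(1) by (simp add: norm_J_minus norm_Y_on_domain)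
    moreover have "norm (J (an n) x - J (an n) v) \<le> norm (x - v)"
      using an[of n] by (simp add: J_diff norm_J)
    moreover have "norm (J (an n) x - x) \<le> norm (J (an n) x - J (an n) v) + norm (J (an n) v - v) + norm (v - x)"
      using norm_triangle_ineq[of "J (an n) x - J (an n) v" "J (an n) v - x"]
        norm_triangle_ineq[of "J (an n) v - v" "v - x"] by simp
    ultimately show ?case using v(2) elim by (simp add: dist_norm norm_minus_commute)
  qed
qed

text \<open>A domain vector is the resolvent of \<open>x - a L x\<close>. The resolvent is
  continuous and maps into the domain, so the limit \<open>x0\<close> is again a resolvent.\<close>

lemma closed_operator:
  assumes F: "\<F> \<noteq> bot" and x: "(x \<longlongrightarrow> x0) \<F>" "((\<lambda>n. L (x n)) \<longlongrightarrow> y) \<F>"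
    and m: "eventually (\<lambda>n. x n \<in> Dm) \<F>"
  shows "x0 \<in> Dm"
proof -
  note a = an[of 0]
  have "((\<lambda>n. J (an 0) (x n - an 0 *\<^sub>R L (x n)) - J (an 0) (x0 - an 0 *\<^sub>R y)) \<longlongrightarrow> 0) \<F>"
  proof (rule Lim_null_comparison)
    show "\<forall>\<^sub>F n in \<F>. norm (J (an 0) (x n - an 0 *\<^sub>R L (x n)) - J (an 0) (x0 - an 0 *\<^sub>R y))
        \<le> norm ((x n - an 0 *\<^sub>R L (x n)) - (x0 - an 0 *\<^sub>R y))"
      using a by (simp add: J_diff norm_J)
    show "((\<lambda>n. norm ((x n - an 0 *\<^sub>R L (x n)) - (x0 - an 0 *\<^sub>R y))) \<longlongrightarrow> 0) \<F>"
      by (intro tendsto_norm_zero LIM_zero tendsto_intros x)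
  qed
  then have "((\<lambda>n. J (an 0) (x n - an 0 *\<^sub>R L (x n))) \<longlongrightarrow> J (an 0) (x0 - an 0 *\<^sub>R y)) \<F>"
    by (rule LIM_zero_cancel)
  moreover have "\<forall>\<^sub>F n in \<F>. J (an 0) (x n - an 0 *\<^sub>R L (x n)) = x n"
    using m by eventually_elim (intro J_unique a refl)
  ultimately have "(x \<longlongrightarrow> J (an 0) (x0 - an 0 *\<^sub>R y)) \<F>"
    using Lim_transform_eventually by blast
  then have "x0 = J (an 0) (x0 - an 0 *\<^sub>R y)" using F x(1) tendsto_unique by blast
  then show ?thesis using J(1)[OF a] by metis
qed

text \<open>Skewness moves \<open>L\<close> onto test vectors from the domain, where convergence of
  \<open>x n\<close> suffices; boundedness of \<open>L (x n)\<close> extends the limit to all test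
  vectors.\<close>

lemma weak_L_tendsto:
  assumes "(x \<longlongrightarrow> x0) \<F>" "x0 \<in> Dm" and "eventually (\<lambda>n. x n \<in> Dm \<and> norm (L (x n)) \<le> C) \<F>"
  shows "((\<lambda>n. inner (L (x n)) w) \<longlongrightarrow> inner (L x0) w) \<F>"
proof (rule weak_tendsto_dense[OF dense])
  show "eventually (\<lambda>n. norm (L (x n)) \<le> C) \<F>" using assms(3) by eventually_elim simp
  fix w assume w: "w \<in> Dm"
  have "((\<lambda>n. - inner (x n) (L w)) \<longlongrightarrow> - inner x0 (L w)) \<F>" by (intro tendsto_intros assms)
  then have "((\<lambda>n. - inner (x n) (L w)) \<longlongrightarrow> inner (L x0) w) \<F>" using assms(2) w by (simp add: skew_swap)
  moreover have "\<forall>\<^sub>F n in \<F>. - inner (x n) (L w) = inner (L (x n)) w"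
    using assms(3) by eventually_elim (simp add: skew_swap w)
  ultimately show "((\<lambda>n. inner (L (x n)) w) \<longlongrightarrow> inner (L x0) w) \<F>"
    by (rule Lim_transform_eventually)
qed

text \<open>
  Weak closedness without weak compactness: boundedness of \<open>Y a x\<close> as \<open>a\<close> tends to \<open>0\<close> makes the family
  Cauchy, because \<open>a |Y a x|\<^sup>2 + b |Y b x|\<^sup>2 = (a + b) \<langle>Y a x, Y b x\<rangle>\<close>.
\<close>

lemma demiclosed:
  assumes F: "\<F> \<noteq> bot" and x: "(x \<longlongrightarrow> x0) \<F>"
    and b: "eventually (\<lambda>n. x n \<in> Dm \<and> norm (L (x n)) \<le> C) \<F>"
  shows "x0 \<in> Dm"
proof -
  define y where "y n = Y (an n) x0" for n
  have yC: "norm (y n) \<le> C" for n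
  proof (rule tendsto_upperbound[OF tendsto_norm[OF tendsto_Y[OF an x]] _ F, of n, folded y_def])
    show "\<forall>\<^sub>F i in \<F>. norm (Y (an n) (x i)) \<le> C"
      using b by eventually_elim (meson an norm_Y_on_domain order_trans)
  qed
  have step: "(norm (y m - y n))\<^sup>2 * (an m + an n) = (an m - an n) * ((norm (y n))\<^sup>2 - (norm (y m))\<^sup>2)" for m n
  proof -
    have "0 = inner (y m - y n) (an m *\<^sub>R y m - an n *\<^sub>R y n)"
      using resolvent_identity[OF an an, of m x0 n x0] unfolding y_def[symmetric] by simp
    then have "an m * inner (y m) (y m) + an n * inner (y n) (y n) = (an m + an n) * inner (y m) (y n)"
      by (simp only: inner_diff_left inner_diff_right inner_scaleR_right inner_commute[of "y n" "y m"]) (simp add: algebra_simps)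
    then show ?thesis unfolding power2_norm_eq_inner
      by (simp only: inner_diff_left inner_diff_right inner_commute[of "y n" "y m"]) (simp add: algebra_simps)
  qed
  have le: "(norm (y m - y n))\<^sup>2 \<le> (norm (y n))\<^sup>2 - (norm (y m))\<^sup>2" if "m \<le> n" for m n
  proof -
    have pos: "0 < an m + an n" using an[of m] an[of n] by linarith
    have q: "0 \<le> an m - an n" "an m - an n \<le> an m + an n" using an_decseq[OF that] an[of n] by linarith+
    show ?thesis
    \<comment> \<open>For distinct parameters the identity first shows that the norms grow as the
      parameter decreases; then the factor \<open>an m - an n\<close> may be enlarged to
      \<open>an m + an n\<close> and cancelled.\<close>
    proof (cases "an m = an n")
      case True
      then have "norm (y m - y n) = 0" unfolding y_def by simp
      then show ?thesis by simp
    next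
      case False
      then have "0 < an m - an n" using q by simp
      moreover have "0 \<le> (an m - an n) * ((norm (y n))\<^sup>2 - (norm (y m))\<^sup>2)"
        unfolding step[symmetric] using pos by (intro mult_nonneg_nonneg) auto
      ultimately have "0 \<le> (norm (y n))\<^sup>2 - (norm (y m))\<^sup>2" by (simp add: zero_le_mult_iff)
      then have "(norm (y m - y n))\<^sup>2 * (an m + an n) \<le> (an m + an n) * ((norm (y n))\<^sup>2 - (norm (y m))\<^sup>2)"
        unfolding step using q by (intro mult_right_mono) auto
      then show ?thesis using pos by (simp add: mult.commute)
    qed
  qed
  have "Bseq (\<lambda>n. (norm (y n))\<^sup>2)"
    using yC by (intro BseqI'[where K = "C\<^sup>2"]) (simp add: power_mono)
  moreover have "incseq (\<lambda>n. (norm (y n))\<^sup>2)"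
    unfolding incseq_def
  proof (intro allI impI)
    show "(norm (y m))\<^sup>2 \<le> (norm (y n))\<^sup>2" if "m \<le> n" for m n
      using le[OF that] zero_le_power2[of "norm (y m - y n)"] by linarith
  qed
  ultimately have "convergent (\<lambda>n. (norm (y n))\<^sup>2)"
    by (intro Bseq_monoseq_convergent) (auto simp: monoseq_def incseq_def)
  then have c: "Cauchy (\<lambda>n. (norm (y n))\<^sup>2)" by (rule convergent_Cauchy)
  have "Cauchy y"
  proof (rule metric_CauchyI)
    fix e :: real assume "e > 0"
    then obtain M where M: "\<And>m n. m \<ge> M \<Longrightarrow> n \<ge> M \<Longrightarrow> dist ((norm (y m))\<^sup>2) ((norm (y n))\<^sup>2) < e\<^sup>2"
      using metric_CauchyD[OF c, of "e\<^sup>2"] by auto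
    have "norm (y m - y n) < e" if "m \<ge> M" "n \<ge> M" for m n
    proof (rule power2_less_imp_less)
      show "(norm (y m - y n))\<^sup>2 < e\<^sup>2"
        using le[of m n] le[of n m] M[OF that] by (cases "m \<le> n") (auto simp: dist_real_def norm_minus_commute)
    qed (use \<open>e > 0\<close> in simp)
    then show "\<exists>M. \<forall>m\<ge>M. \<forall>n\<ge>M. dist (y m) (y n) < e" by (auto simp: dist_norm)
  qed
  then obtain y0 where y0: "y \<longlonglongrightarrow> y0" using convergent_eq_Cauchy by blast
  show ?thesis
  proof (rule closed_operator[OF sequentially_bot])
    show "(\<lambda>n. J (an n) x0) \<longlonglongrightarrow> x0" by (rule J_tendsto)
    show "(\<lambda>n. L (J (an n) x0)) \<longlonglongrightarrow> y0" using y0 unfolding y_def Y_def .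
  qed (simp add: J an)
qed

end

text \<open>
  Differentiability is only tested against the domain: this notion is invariant under time reversal
  and under uniform limits of the Yosida approximations, and still strong enough for uniqueness.
\<close>

definition weak_solution ::
    "'a::real_inner set \<Rightarrow> ('a \<Rightarrow> 'a) \<Rightarrow> ('a \<Rightarrow> 'a) \<Rightarrow> real \<Rightarrow> (real \<Rightarrow> 'a) \<Rightarrow> bool" where
  "weak_solution Dm L F T u \<longleftrightarrow> (\<forall>t\<in>{0..T}. u t \<in> Dm) \<and>
     (\<exists>C. \<forall>s\<in>{0..T}. \<forall>t\<in>{0..T}. norm (u t - u s) \<le> C * \<bar>t - s\<bar>) \<and>
     (\<exists>C. \<forall>t\<in>{0..T}. norm (L (u t)) \<le> C) \<and>
     (\<forall>w\<in>Dm. \<forall>t\<in>{0..T}. ((\<lambda>s. inner (u s) w) has_real_derivative inner (L (u t) + F (u t)) w) (at t within {0..T}))"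

text \<open>One statement for two uses: \<sigma> = 1 restarts a solution at time \<open>c\<close>,
  and \<sigma> = -1 reverses time, which replaces \<open>L\<close> and \<open>F\<close> by their
  negatives.\<close>

lemma weak_solution_reparametrize:
  assumes w: "weak_solution Dm L F T u" and \<sigma>: "\<bar>\<sigma>\<bar> = 1"
    and range: "\<And>r. r \<in> {0..S} \<Longrightarrow> c + \<sigma> * r \<in> {0..T}"
  shows "weak_solution Dm (\<lambda>x. \<sigma> *\<^sub>R L x) (\<lambda>x. \<sigma> *\<^sub>R F x) S (\<lambda>r. u (c + \<sigma> * r))"
  unfolding weak_solution_def
proof (intro conjI ballI)
  show "u (c + \<sigma> * r) \<in> Dm" if "r \<in> {0..S}" for r
    using w range[OF that] unfolding weak_solution_def by blast
  obtain C where C: "\<forall>s\<in>{0..T}. \<forall>t\<in>{0..T}. norm (u t - u s) \<le> C * \<bar>t - s\<bar>"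
    using w unfolding weak_solution_def by blast
  show "\<exists>C. \<forall>s\<in>{0..S}. \<forall>t\<in>{0..S}. norm (u (c + \<sigma> * t) - u (c + \<sigma> * s)) \<le> C * \<bar>t - s\<bar>"
  proof (intro exI[of _ C] ballI)
    fix s t assume st: "s \<in> {0..S}" "t \<in> {0..S}"
    have "norm (u (c + \<sigma> * t) - u (c + \<sigma> * s)) \<le> C * \<bar>(c + \<sigma> * t) - (c + \<sigma> * s)\<bar>"
      using C range st by blast
    also have "(c + \<sigma> * t) - (c + \<sigma> * s) = \<sigma> * (t - s)" by (simp add: algebra_simps)
    finally show "norm (u (c + \<sigma> * t) - u (c + \<sigma> * s)) \<le> C * \<bar>t - s\<bar>" using \<sigma> by (simp add: abs_mult)
  qed
  obtain B where B: "\<forall>t\<in>{0..T}. norm (L (u t)) \<le> B"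
    using w unfolding weak_solution_def by blast
  show "\<exists>C. \<forall>t\<in>{0..S}. norm (\<sigma> *\<^sub>R L (u (c + \<sigma> * t))) \<le> C"
    using B range \<sigma> by (intro exI[of _ B]) auto
  fix v t assume v: "v \<in> Dm" and t: "t \<in> {0..S}"
  have "((\<lambda>s. inner (u s) v) has_real_derivative inner (L (u (c + \<sigma> * t)) + F (u (c + \<sigma> * t))) v)
      (at (c + \<sigma> * t) within {0..T})"
    using w v range[OF t] unfolding weak_solution_def by blast
  then have "((\<lambda>s. inner (u s) v) has_real_derivative inner (L (u (c + \<sigma> * t)) + F (u (c + \<sigma> * t))) v)
      (at (c + \<sigma> * t) within (\<lambda>r. c + \<sigma> * r) ` {0..S})"
    by (rule has_field_derivative_subset) (use range in auto)
  then have "((\<lambda>s. inner (u s) v) \<circ> (\<lambda>r. c + \<sigma> * r) has_real_derivative inner (L (u (c + \<sigma> * t)) + F (u (c + \<sigma> * t))) v * \<sigma>)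
      (at t within {0..S})"
    by (rule DERIV_image_chain) (auto intro!: derivative_eq_intros)
  then show "((\<lambda>s. inner (u (c + \<sigma> * s)) v) has_real_derivative
      inner (\<sigma> *\<^sub>R L (u (c + \<sigma> * t)) + \<sigma> *\<^sub>R F (u (c + \<sigma> * t))) v) (at t within {0..S})"
    by (simp add: o_def inner_add_left algebra_simps)
qed

section \<open>Uniqueness, existence and regularity of weak solutions\<close>

context skew_generator
begin

text \<open>The difference \<open>z s\<close> lies in the domain and may itself serve as test
  vector. This differentiates \<open>|z r|^2\<close> at \<open>r = s\<close>, because \<open>|z r|^2
  = 2 \<langle>z r, z s\<rangle> - |z s|^2 + |z r - z s|^2\<close> and the Lipschitz bound makes the
  last term quadratic in \<open>r - s\<close>.\<close>

lemma weak_solution_contraction: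
  assumes F: "\<And>x y. norm (F x - F y) \<le> \<omega> * norm (x - y)" and "\<omega> \<ge> 0"
    and u: "weak_solution Dm L F T u" and v: "weak_solution Dm L F T v" and t: "t \<in> {0..T}"
  shows "norm (u t - v t) \<le> exp (\<omega> * t) * norm (u 0 - v 0)"
proof -
  define z where "z s = u s - v s" for s
  obtain C1 where C1: "\<forall>s\<in>{0..T}. \<forall>t\<in>{0..T}. norm (u t - u s) \<le> C1 * \<bar>t - s\<bar>"
    using u unfolding weak_solution_def by blast
  obtain C2 where C2: "\<forall>s\<in>{0..T}. \<forall>t\<in>{0..T}. norm (v t - v s) \<le> C2 * \<bar>t - s\<bar>"
    using v unfolding weak_solution_def by blast
  define C where "C = C1 + C2"
  have C: "norm (z s - z r) \<le> C * \<bar>s - r\<bar>" if "s \<in> {0..T}" "r \<in> {0..T}" for s r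
  proof -
    have "norm (z s - z r) \<le> norm (u s - u r) + norm (v s - v r)"
      unfolding z_def using norm_triangle_ineq4[of "u s - u r" "v s - v r"] by (simp add: algebra_simps)
    also have "\<dots> \<le> C1 * \<bar>s - r\<bar> + C2 * \<bar>s - r\<bar>" using C1 C2 that by (intro add_mono) auto
    finally show ?thesis unfolding C_def by (simp add: distrib_right)
  qed
  have zm: "z s \<in> Dm" if "s \<in> {0..T}" for s
    using that u v mem_diff unfolding weak_solution_def z_def by blast
  define z' where "z' s = (L (u s) + F (u s)) - (L (v s) + F (v s))" for s
  have der: "((\<lambda>r. (norm (z r))\<^sup>2) has_real_derivative 2 * inner (z' s) (z s)) (at s within {0..T})"
    if s: "s \<in> {0..T}" for s
  proof -
    have "((\<lambda>r. inner (u r) (z s)) has_real_derivative inner (L (u s) + F (u s)) (z s)) (at s within {0..T})"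
      and "((\<lambda>r. inner (v r) (z s)) has_real_derivative inner (L (v s) + F (v s)) (z s)) (at s within {0..T})"
      using u v zm[OF s] s unfolding weak_solution_def by blast+
    then have 1: "((\<lambda>r. inner (z r) (z s)) has_real_derivative inner (z' s) (z s)) (at s within {0..T})"
      unfolding z_def[of r for r] z'_def inner_diff_left[of "u r" for r] inner_diff_left[of "L (u s) + F (u s)"]
      by (rule DERIV_diff)
    have 2: "((\<lambda>r. (norm (z r - z s))\<^sup>2) has_real_derivative 0) (at s within {0..T})"
      unfolding has_field_derivative_iff
    proof (rule Lim_null_comparison)
      show "\<forall>\<^sub>F r in at s within {0..T}. norm (((norm (z r - z s))\<^sup>2 - (norm (z s - z s))\<^sup>2) / (r - s)) \<le> C\<^sup>2 * \<bar>r - s\<bar>"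
        unfolding eventually_at_filter
      proof (intro always_eventually allI impI)
        fix r assume r: "r \<noteq> s" "r \<in> {0..T}"
        have "(norm (z r - z s))\<^sup>2 \<le> (C * \<bar>r - s\<bar>)\<^sup>2" using C[OF r(2) s] by (intro power_mono) auto
        then show "norm (((norm (z r - z s))\<^sup>2 - (norm (z s - z s))\<^sup>2) / (r - s)) \<le> C\<^sup>2 * \<bar>r - s\<bar>"
          using r(1) by (simp add: divide_le_eq power_mult_distrib power2_eq_square algebra_simps)
      qed
      show "((\<lambda>r. C\<^sup>2 * \<bar>r - s\<bar>) \<longlongrightarrow> 0) (at s within {0..T})"
        by (auto intro!: tendsto_eq_intros)
    qed
    have "(\<lambda>r. (norm (z r))\<^sup>2) = (\<lambda>r. 2 * inner (z r) (z s) - (norm (z s))\<^sup>2 + (norm (z r - z s))\<^sup>2)"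
      unfolding power2_norm_eq_inner by (rule ext) (simp add: inner_diff_left inner_diff_right inner_commute)
    then show ?thesis
      using DERIV_add[OF DERIV_diff[OF DERIV_cmult[OF 1, of 2] DERIV_const[of "(norm (z s))\<^sup>2"]] 2] by simp
  qed
  have "(norm (z t))\<^sup>2 \<le> exp (2 * \<omega> * t) * ((norm (z 0))\<^sup>2 + 0 * t)"
  proof (rule gronwall[where z = "\<lambda>s. (norm (z s))\<^sup>2" and T = T and z' = "\<lambda>s. 2 * inner (z' s) (z s)"])
    fix s assume s: "s \<in> {0..T}"
    show "((\<lambda>r. (norm (z r))\<^sup>2) has_real_derivative 2 * inner (z' s) (z s)) (at s within {0..T})" by (rule der[OF s])
    have us: "u s \<in> Dm" "v s \<in> Dm" using u v s unfolding weak_solution_def by blast+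
    have "z' s = L (z s) + (F (u s) - F (v s))"
      unfolding z'_def z_def L_diff[OF us] by simp
    then have "inner (z' s) (z s) = inner (F (u s) - F (v s)) (z s)"
      using skew[OF zm[OF s]] by (simp add: inner_add_left)
    also have "\<dots> \<le> norm (F (u s) - F (v s)) * norm (z s)" by (rule norm_cauchy_schwarz)
    also have "\<dots> \<le> (\<omega> * norm (z s)) * norm (z s)" unfolding z_def by (intro mult_right_mono F) auto
    finally show "2 * inner (z' s) (z s) \<le> 2 * \<omega> * (norm (z s))\<^sup>2 + 0" by (simp add: power2_eq_square)
  qed (use assms in auto)
  also have "\<dots> = (exp (\<omega> * t) * norm (z 0))\<^sup>2"
    by (simp add: power_mult_distrib exp_double[symmetric] mult.assoc)
  finally show ?thesis unfolding z_def by (rule power2_le_imp_le) simp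
qed

lemma weak_solution_exists:
  assumes F: "\<And>x y. norm (F x - F y) \<le> \<omega> * norm (x - y)" and \<omega>: "\<omega> \<ge> 0"
    and u0: "u0 \<in> Dm" and T: "T \<ge> 0"
  shows "\<exists>u. weak_solution Dm L F T u \<and> u 0 = u0 \<and>
    (\<forall>t\<in>{0..T}. norm (L (u t) + F (u t)) \<le> exp (\<omega> * t) * norm (L u0 + F u0))"
proof -
  define G where "G n x = Y (an n) x + F x" for n x
  have G_lip: "norm (G n x - G n y) \<le> (inverse (an n) + \<omega>) * norm (x - y)" for n x y
  proof -
    have "norm (G n x - G n y) \<le> norm (Y (an n) x - Y (an n) y) + norm (F x - F y)"
      unfolding G_def using norm_triangle_ineq[of "Y (an n) x - Y (an n) y" "F x - F y"] by (simp add: algebra_simps)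
    also have "\<dots> \<le> inverse (an n) * norm (x - y) + \<omega> * norm (x - y)"
      using an[of n] by (intro add_mono F) (simp add: Y_diff norm_Y)
    finally show ?thesis by (simp add: algebra_simps)
  qed
  have F_inner: "inner (F x - F y) (x - y) \<le> \<omega> * (norm (x - y))\<^sup>2" for x y
  proof -
    have "inner (F x - F y) (x - y) \<le> norm (F x - F y) * norm (x - y)" by (rule norm_cauchy_schwarz)
    also have "\<dots> \<le> (\<omega> * norm (x - y)) * norm (x - y)" by (intro mult_right_mono F) auto
    finally show ?thesis by (simp add: power2_eq_square)
  qed
  have G_inner: "inner (G n x - G n y) (x - y) \<le> \<omega> * (norm (x - y))\<^sup>2" for n x y
  proof -
    have "inner (G n x - G n y) (x - y) = inner (Y (an n) (x - y)) (x - y) + inner (F x - F y) (x - y)"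
      unfolding G_def using Y_diff[OF an, of n x y]
      by (simp add: add_diff_add inner_add_left)
    then show ?thesis using inner_Y[OF an, of n "x - y"] F_inner[of x y] by linarith
  qed
  \<comment> \<open>The extra unit of time leaves room for the shifts in
    \<open>dissipative_ode_derivative_bound\<close>, which bounds the speed only strictly before the
    end of the interval.\<close>
  have "\<exists>U. U 0 = u0 \<and> (\<forall>t\<in>{0..T + 1}. (U has_vector_derivative G n (U t)) (at t within {0..T + 1}))" for n
    using T by (intro lipschitz_ode[OF G_lip]) auto
  then obtain U where U0: "\<And>n. U n 0 = u0"
    and U1: "\<And>n t. t \<in> {0..T + 1} \<Longrightarrow> (U n has_vector_derivative G n (U n t)) (at t within {0..T + 1})"
    by metis
  have U: "(U n has_vector_derivative G n (U n t)) (at t within {0..T})" if "t \<in> {0..T}" for n t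
    by (rule has_vector_derivative_within_subset[OF U1]) (use that in auto)
  have Uc: "continuous_on {0..T} (U n)" for n
    using U by (rule continuous_on_vector_derivative)
  have GU: "norm (G n (U n t)) \<le> exp (\<omega> * t) * norm (G n u0)" if "t \<in> {0..T}" for n t
    using dissipative_ode_derivative_bound[OF G_inner[where n = n] \<omega> U1[where n = n], where t = t] that by (simp add: U0)
  \<comment> \<open>Independent of \<open>n\<close>, because the Yosida approximation of
    \<open>u0\<close> is dominated by \<open>L u0\<close>; here the initial value has to lie in the
    domain.\<close>
  define C1 where "C1 = exp (\<omega> * T) * (norm (L u0) + norm (F u0))"
  have C1: "C1 \<ge> 0" unfolding C1_def by simp
  have GU1: "norm (G n (U n t)) \<le> C1" if t: "t \<in> {0..T}" for n t
  proof -
    have "norm (G n u0) \<le> norm (L u0) + norm (F u0)"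
      unfolding G_def using norm_Y_on_domain[OF an u0, of n] norm_triangle_ineq[of "Y (an n) u0" "F u0"] by linarith
    moreover have "exp (\<omega> * t) \<le> exp (\<omega> * T)" using t \<omega> by (simp add: mult_left_mono)
    ultimately have "exp (\<omega> * t) * norm (G n u0) \<le> C1" unfolding C1_def by (intro mult_mono) auto
    then show ?thesis using GU[OF t, of n] by linarith
  qed
  have U_lip: "norm (U n t - U n s) \<le> C1 * \<bar>t - s\<bar>" if "s \<in> {0..T}" "t \<in> {0..T}" for n s t
    by (rule vector_derivative_lipschitz_bound[OF U GU1]) (use that in auto)
  \<comment> \<open>Bounds the Yosida term as the difference of the speed and
    \<open>F (U n t)\<close>, the latter growing at most linearly with the distance from
    \<open>u0\<close>.\<close>
  define C2 where "C2 = C1 + (\<omega> * (C1 * T) + norm (F u0))"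
  have C2: "C2 \<ge> 0" unfolding C2_def using C1 \<omega> T by simp
  have YU: "norm (Y (an n) (U n t)) \<le> C2" if t: "t \<in> {0..T}" for n t
  proof -
    have "norm (U n t - u0) \<le> C1 * T"
      using U_lip[of 0 t n] t C1 T by (auto simp: U0 intro: order_trans mult_left_mono)
    then have "norm (F (U n t) - F u0) \<le> \<omega> * (C1 * T)"
      by (intro order_trans[OF F] mult_left_mono \<omega>)
    then have "norm (F (U n t)) \<le> \<omega> * (C1 * T) + norm (F u0)"
      using norm_triangle_ineq2[of "F (U n t)" "F u0"] by linarith
    moreover have "norm (Y (an n) (U n t)) \<le> norm (G n (U n t)) + norm (F (U n t))"
      using norm_triangle_ineq4[of "G n (U n t)" "F (U n t)"] unfolding G_def by simp
    ultimately show ?thesis using GU1[OF t, of n] unfolding C2_def by linarith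
  qed
  \<comment> \<open>The Gronwall constant of the next estimate: \<open>Y_difference_bound\<close>
    contributes \<open>2 * C2\<^sup>2\<close>, and differentiating a squared norm doubles
    it.\<close>
  define K where "K = exp (2 * \<omega> * T) * (4 * C2\<^sup>2 * T)"
  have K: "K \<ge> 0" unfolding K_def using T by simp
  have close: "(norm (U n t - U m t))\<^sup>2 \<le> K * (an n + an m)" if t: "t \<in> {0..T}" for n m t
  proof -
    let ?z = "\<lambda>s. (norm (U n s - U m s))\<^sup>2"
    define e where "e = an n + an m"
    have e: "e > 0" unfolding e_def using an[of n] an[of m] by simp
    have "?z t \<le> exp (2 * \<omega> * t) * (?z 0 + 4 * C2\<^sup>2 * e * t)"
    proof (rule gronwall[where z = ?z and T = T and z' = "\<lambda>s. 2 * inner (G n (U n s) - G m (U m s)) (U n s - U m s)"])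
      fix s assume s: "s \<in> {0..T}"
      show "(?z has_real_derivative 2 * inner (G n (U n s) - G m (U m s)) (U n s - U m s)) (at s within {0..T})"
        by (intro has_real_derivative_norm_square has_vector_derivative_diff U s)
      have "inner (G n (U n s) - G m (U m s)) (U n s - U m s)
          = inner (Y (an n) (U n s) - Y (an m) (U m s)) (U n s - U m s) + inner (F (U n s) - F (U m s)) (U n s - U m s)"
        unfolding G_def by (simp add: add_diff_add inner_add_left)
      also have "\<dots> \<le> 2 * C2\<^sup>2 * e + \<omega> * ?z s"
        unfolding e_def by (intro add_mono Y_difference_bound an YU s F_inner)
      finally show "2 * inner (G n (U n s) - G m (U m s)) (U n s - U m s) \<le> 2 * \<omega> * ?z s + 4 * C2\<^sup>2 * e"
        by simp
    qed (use \<omega> e t in auto)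
    also have "\<dots> \<le> exp (2 * \<omega> * T) * (4 * C2\<^sup>2 * e * T)"
      using t \<omega> e by (intro mult_mono) (auto simp: U0 intro!: mult_left_mono)
    finally show ?thesis unfolding K_def e_def by (simp add: algebra_simps)
  qed
  have "uniformly_Cauchy_on {0..T} U"
    unfolding uniformly_Cauchy_on_def
  proof (intro allI impI)
    fix e :: real assume e: "e > 0"
    have "(\<lambda>n. K * (an n + an n)) \<longlonglongrightarrow> K * (0 + 0)" by (intro tendsto_intros an_tendsto)
    then have "\<forall>\<^sub>F n in sequentially. K * (an n + an n) < e\<^sup>2" using e by (intro order_tendstoD(2)) auto
    then obtain M where M: "K * (an M + an M) < e\<^sup>2" by (auto simp: eventually_sequentially)
    have "dist (U m t) (U n t) < e" if "t \<in> {0..T}" "m \<ge> M" "n \<ge> M" for t m n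
    proof -
      have "(norm (U m t - U n t))\<^sup>2 \<le> K * (an m + an n)" by (rule close[OF that(1)])
      also have "\<dots> \<le> K * (an M + an M)" using K that by (intro mult_left_mono add_mono an_decseq)
      also note M
      finally show ?thesis using e by (simp add: dist_norm power_less_imp_less_base)
    qed
    then show "\<exists>M. \<forall>x\<in>{0..T}. \<forall>m\<ge>M. \<forall>n\<ge>M. dist (U m x) (U n x) < e" by blast
  qed
  then obtain u where u: "uniform_limit {0..T} U u sequentially"
    using Cauchy_uniformly_convergent unfolding uniformly_convergent_on_def by blast
  have ulim: "(\<lambda>n. U n t) \<longlonglongrightarrow> u t" if "t \<in> {0..T}" for t
    using u that by (rule tendsto_uniform_limitI)
  \<comment> \<open>\<open>U n t\<close> need not lie in the domain; its resolvent does, and differs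
    from it by \<open>an n\<close> times a bounded quantity.\<close>
  have JU: "uniform_limit {0..T} (\<lambda>n t. J (an n) (U n t)) u sequentially"
  proof -
    have "uniform_limit {0..T} (\<lambda>n t. J (an n) (U n t) - U n t) (\<lambda>t. 0) sequentially"
    proof (rule uniform_limitI)
      fix e :: real assume "e > 0"
      have "(\<lambda>n. an n * C2) \<longlonglongrightarrow> 0 * C2" by (intro tendsto_intros an_tendsto)
      then have "\<forall>\<^sub>F n in sequentially. an n * C2 < e" using \<open>e > 0\<close> by (intro order_tendstoD(2)) auto
      then show "\<forall>\<^sub>F n in sequentially. \<forall>t\<in>{0..T}. dist (J (an n) (U n t) - U n t) 0 < e"
      proof eventually_elim
        case (elim n)
        show ?case
        proof
          fix t assume "t \<in> {0..T}"
          then have "an n * norm (Y (an n) (U n t)) \<le> an n * C2"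
            using an[of n] by (intro mult_left_mono YU) auto
          then have "an n * norm (Y (an n) (U n t)) < e" using elim by linarith
          then show "dist (J (an n) (U n t) - U n t) 0 < e" by (simp add: norm_J_minus an)
        qed
      qed
    qed
    from uniform_limit_add[OF this u] show ?thesis by simp
  qed
  have JUlim: "(\<lambda>n. J (an n) (U n t)) \<longlonglongrightarrow> u t" if "t \<in> {0..T}" for t
    using JU that by (rule tendsto_uniform_limitI)
  have ev: "\<forall>\<^sub>F n in sequentially. J (an n) (U n t) \<in> Dm \<and> norm (L (J (an n) (U n t))) \<le> C2" if "t \<in> {0..T}" for t
    using YU[OF that] by (auto simp: J an Y_def)
  have um: "u t \<in> Dm" if "t \<in> {0..T}" for t
    by (rule demiclosed[OF sequentially_bot JUlim[OF that] ev[OF that]])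
  have Lweak: "(\<lambda>n. inner (Y (an n) (U n t)) w) \<longlonglongrightarrow> inner (L (u t)) w" if "t \<in> {0..T}" for t w
    unfolding Y_def by (rule weak_L_tendsto[OF JUlim[OF that] um[OF that] ev[OF that]])
  have Fu: "uniform_limit {0..T} (\<lambda>n t. F (U n t)) (\<lambda>t. F (u t)) sequentially"
  proof (rule uniform_limitI)
    fix e :: real assume "e > 0"
    then have "\<forall>\<^sub>F n in sequentially. \<forall>t\<in>{0..T}. dist (U n t) (u t) < e / (\<omega> + 1)"
      using u \<omega> by (intro uniform_limitD) auto
    then show "\<forall>\<^sub>F n in sequentially. \<forall>t\<in>{0..T}. dist (F (U n t)) (F (u t)) < e"
    proof eventually_elim
      case (elim n)
      show ?case
      proof
        fix t assume "t \<in> {0..T}"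
        have "norm (F (U n t) - F (u t)) \<le> (\<omega> + 1) * norm (U n t - u t)"
          by (rule order_trans[OF F]) (simp add: mult_right_mono)
        also have "\<dots> < (\<omega> + 1) * (e / (\<omega> + 1))"
          using elim \<open>t \<in> {0..T}\<close> \<omega> by (intro mult_strict_left_mono) (auto simp: dist_norm)
        finally show "dist (F (U n t)) (F (u t)) < e" using \<omega> by (simp add: dist_norm)
      qed
    qed
  qed
  have Fulim: "(\<lambda>n. F (U n t)) \<longlonglongrightarrow> F (u t)" if "t \<in> {0..T}" for t
    using Fu that by (rule tendsto_uniform_limitI)
  \<comment> \<open>As the Yosida approximation of \<open>u0\<close> is the resolvent of
    \<open>L u0\<close>, the initial speeds converge strongly, and the growth bound keeps the exact
    constant \<open>|L u0 + F u0|\<close> in the limit. Continuity of the speed depends on this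
    sharpness.\<close>
  have Gu0: "(\<lambda>n. G n u0) \<longlonglongrightarrow> L u0 + F u0"
    unfolding G_def using J_tendsto[of "L u0"] Y_on_domain[OF an u0] by (intro tendsto_add tendsto_const) simp
  have bound: "norm (L (u t) + F (u t)) \<le> exp (\<omega> * t) * norm (L u0 + F u0)" if t: "t \<in> {0..T}" for t
  proof (rule weak_limit_norm_le[OF sequentially_bot])
    show "\<forall>\<^sub>F n in sequentially. norm (G n (U n t)) \<le> exp (\<omega> * t) * norm (G n u0)"
      using GU[OF t] by simp
    show "(\<lambda>n. exp (\<omega> * t) * norm (G n u0)) \<longlonglongrightarrow> exp (\<omega> * t) * norm (L u0 + F u0)"
      by (intro tendsto_intros Gu0)
    show "(\<lambda>n. inner (G n (U n t)) (L (u t) + F (u t))) \<longlonglongrightarrow> inner (L (u t) + F (u t)) (L (u t) + F (u t))"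
      unfolding G_def inner_add_left[of "Y (an n) (U n t)" for n] inner_add_left[of "L (u t)" "F (u t)"]
      by (intro tendsto_add Lweak t tendsto_inner Fulim tendsto_const)
  qed
  have Lu: "norm (L (u t)) \<le> C2" if t: "t \<in> {0..T}" for t
    by (rule weak_limit_norm_le[OF sequentially_bot _ tendsto_const Lweak[OF t]])
      (use YU[OF t] in simp)
  have uc: "continuous_on {0..T} u"
  proof (rule uniform_limit_theorem[OF _ u])
    show "\<forall>\<^sub>F n in sequentially. continuous_on {0..T} (U n)"
      by (intro always_eventually allI Uc)
  qed simp
  have Fc: "continuous_on {0..T} (\<lambda>t. F (u t))"
  proof (rule uniform_limit_theorem[OF _ Fu])
    have "continuous_on UNIV F"
      by (rule lipschitz_on_continuous_on[of \<omega>]) (use F \<omega> in \<open>auto simp: lipschitz_on_def dist_norm\<close>)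
    then show "\<forall>\<^sub>F n in sequentially. continuous_on {0..T} (\<lambda>t. F (U n t))"
      by (intro always_eventually allI continuous_on_compose2[OF _ Uc]) auto
  qed simp
  have wd: "((\<lambda>s. inner (u s) w) has_real_derivative inner (L (u t) + F (u t)) w) (at t within {0..T})"
    if w: "w \<in> Dm" and t: "t \<in> {0..T}" for w t
  proof -
    \<comment> \<open>With \<open>L\<close> moved onto \<open>w\<close>, the integrand involves only
      \<open>u\<close> and \<open>F u\<close>, along which convergence is uniform; so the integrated
      equation passes to the limit.\<close>
    define g where "g s = - inner (u s) (L w) + inner (F (u s)) w" for s
    have gc: "continuous_on {0..T} g" unfolding g_def by (intro continuous_intros uc Fc)
    define gn where "gn n s = inner (G n (U n s)) w" for n s
    have gneq: "gn n s = - inner (J (an n) (U n s)) (L w) + inner (F (U n s)) w" for n s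
      unfolding gn_def G_def Y_def inner_add_left by (simp add: skew_swap J an w)
    have gul: "uniform_limit {0..T} gn g sequentially"
      unfolding gneq g_def
      by (intro uniform_limit_add uniform_limit_uminus bounded_linear.uniform_limit[OF bounded_linear_inner_left JU]
          bounded_linear.uniform_limit[OF bounded_linear_inner_left Fu])
    have Uw: "((gn n) has_integral (inner (U n s) w - inner u0 w)) {0..s}" if s: "s \<in> {0..T}" for n s
    proof -
      have "(gn n has_integral (inner (U n s) w - inner (U n 0) w)) {0..s}"
      proof (rule fundamental_theorem_of_calculus)
        fix x assume x: "x \<in> {0..s}"
        have "(U n has_vector_derivative G n (U n x)) (at x within {0..s})"
          by (rule has_vector_derivative_within_subset[OF U]) (use x s in auto)
        then show "((\<lambda>s. inner (U n s) w) has_vector_derivative gn n x) (at x within {0..s})"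
          unfolding gn_def by (rule bounded_linear.has_vector_derivative[OF bounded_linear_inner_left])
      qed (use s in auto)
      then show ?thesis by (simp add: U0)
    qed
    have eq: "inner (u s) w = inner u0 w + integral {0..s} g" if s: "s \<in> {0..T}" for s
    proof -
      have "uniform_limit {0..s} gn g sequentially"
        by (rule uniform_limit_on_subset[OF gul]) (use s in auto)
      moreover have "continuous_on {0..s} (gn n)" for n
      proof -
        have "continuous_on UNIV (G n)"
          by (rule lipschitz_on_continuous_on[of "inverse (an n) + \<omega>"])
            (use G_lip \<omega> an[of n] in \<open>auto simp: lipschitz_on_def dist_norm\<close>)
        then have "continuous_on {0..T} (\<lambda>s. G n (U n s))"
          by (rule continuous_on_compose2[OF _ Uc]) auto
        then have "continuous_on {0..s} (\<lambda>s. G n (U n s))"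
          by (rule continuous_on_subset) (use s in auto)
        then show ?thesis unfolding gn_def by (intro continuous_intros)
      qed
      ultimately obtain I K where I: "\<And>n. (gn n has_integral I n) {0..s}" "(g has_integral K) {0..s}" "I \<longlonglongrightarrow> K"
        using uniform_limit_integral[OF _ _ sequentially_bot] by metis
      then have "(\<lambda>n. inner (U n s) w - inner u0 w) \<longlonglongrightarrow> integral {0..s} g"
        using has_integral_unique[OF Uw[OF s] I(1)] integral_unique[OF I(2)] by simp
      moreover have "(\<lambda>n. inner (U n s) w - inner u0 w) \<longlonglongrightarrow> inner (u s) w - inner u0 w"
        by (intro tendsto_intros ulim s)
      ultimately have "inner (u s) w - inner u0 w = integral {0..s} g" by (rule LIMSEQ_unique[rotated])
      then show ?thesis by simp
    qed
    have "((\<lambda>s. inner u0 w + integral {0..s} g) has_vector_derivative 0 + g t) (at t within {0..T})"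
      by (intro has_vector_derivative_add has_vector_derivative_const integral_has_vector_derivative gc t)
    then have "((\<lambda>s. inner (u s) w) has_vector_derivative 0 + g t) (at t within {0..T})"
      by (rule has_vector_derivative_transform[rotated 2]) (use t eq in auto)
    moreover have "0 + g t = inner (L (u t) + F (u t)) w"
      unfolding g_def using skew_swap[OF um[OF t] w] by (simp add: inner_add_left)
    ultimately show ?thesis by (simp add: has_real_derivative_iff_has_vector_derivative)
  qed
  have ulip: "norm (u t - u s) \<le> C1 * \<bar>t - s\<bar>" if "s \<in> {0..T}" "t \<in> {0..T}" for s t
    by (rule tendsto_upperbound[OF tendsto_norm[OF tendsto_diff[OF ulim ulim]]])
      (use that U_lip in auto)
  have "weak_solution Dm L F T u"
    unfolding weak_solution_def using um ulip Lu wd by blast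
  moreover have "u 0 = u0"
    using ulim[of 0] T by (simp add: U0 LIMSEQ_const_iff)
  ultimately show ?thesis using bound by blast
qed

text \<open>Restart at time \<open>s\<close>: by uniqueness the restarted curve is the solution that
  \<open>weak_solution_exists\<close> constructs from \<open>u s\<close>, and that one carries the
  sharp bound.\<close>

lemma weak_solution_norm_forward:
  assumes F: "\<And>x y. norm (F x - F y) \<le> \<omega> * norm (x - y)" and \<omega>: "\<omega> \<ge> 0"
    and u: "weak_solution Dm L F T u" and st: "0 \<le> s" "s \<le> t" "t \<le> T"
  shows "norm (L (u t) + F (u t)) \<le> exp (\<omega> * (t - s)) * norm (L (u s) + F (u s))"
proof -
  define v where "v r = u (s + 1 * r)" for r
  have v: "weak_solution Dm L F (T - s) v"
    using weak_solution_reparametrize[OF u, of 1 "T - s" s] st unfolding v_def by simp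
  have "u s \<in> Dm" using u st unfolding weak_solution_def by auto
  then obtain w where w: "weak_solution Dm L F (T - s) w" "w 0 = u s"
      "\<forall>r\<in>{0..T - s}. norm (L (w r) + F (w r)) \<le> exp (\<omega> * r) * norm (L (u s) + F (u s))"
    using weak_solution_exists[OF F \<omega>, of "u s" "T - s"] st by auto
  have "norm (v (t - s) - w (t - s)) \<le> exp (\<omega> * (t - s)) * norm (v 0 - w 0)"
    by (rule weak_solution_contraction[OF F \<omega> v w(1)]) (use st in auto)
  then have "w (t - s) = u t" using w(2) by (simp add: v_def)
  moreover have "t - s \<in> {0..T - s}" using st by simp
  ultimately show ?thesis using w(3) by metis
qed

text \<open>For \<open>t < s\<close> the forward estimate applies to the reversed curve, a solution
  for \<open>- L\<close> and \<open>- F\<close> whose speed has the same norm.\<close>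

lemma weak_solution_norm_symmetric:
  assumes F: "\<And>x y. norm (F x - F y) \<le> \<omega> * norm (x - y)" and \<omega>: "\<omega> \<ge> 0"
    and u: "weak_solution Dm L F T u" and st: "s \<in> {0..T}" "t \<in> {0..T}"
  shows "norm (L (u t) + F (u t)) \<le> exp (\<omega> * \<bar>t - s\<bar>) * norm (L (u s) + F (u s))"
proof (cases "s \<le> t")
  case True
  then show ?thesis using weak_solution_norm_forward[OF F \<omega> u, of s t] st by simp
next
  case False
  interpret n: skew_generator Dm "\<lambda>x. - L x" a0 by (rule neg)
  have v: "weak_solution Dm (\<lambda>x. - L x) (\<lambda>x. - F x) T (\<lambda>r. u (T - r))"
    using weak_solution_reparametrize[OF u, of "-1" T T] by simp
  have F': "norm (- F x - - F y) \<le> \<omega> * norm (x - y)" for x y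
    using F[of x y] by (simp add: norm_minus_commute)
  have "norm (- L (u (T - (T - t))) + - F (u (T - (T - t)))) \<le> exp (\<omega> * ((T - t) - (T - s))) * norm (- L (u (T - (T - s))) + - F (u (T - (T - s))))"
    using n.weak_solution_norm_forward[OF F' \<omega> v, of "T - s" "T - t"] False st by simp
  then show ?thesis using False
    by (simp only: diff_diff_eq2 add_diff_cancel_left' minus_add_distrib[symmetric] norm_minus_cancel) (simp add: algebra_simps)
qed

theorem semilinear_evolution:
  assumes F: "\<And>x y. norm (F x - F y) \<le> \<omega> * norm (x - y)" and \<omega>: "\<omega> \<ge> 0"
    and u0: "u0 \<in> Dm" and T: "T \<ge> 0"
  shows "\<exists>u. u 0 = u0 \<and> continuous_on {0..T} (\<lambda>t. L (u t)) \<and>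
    (\<forall>t\<in>{0..T}. u t \<in> Dm \<and> (u has_vector_derivative L (u t) + F (u t)) (at t within {0..T}))"
proof -
  obtain u where u: "weak_solution Dm L F T u" and u00: "u 0 = u0"
    using weak_solution_exists[OF F \<omega> u0 T] by blast
  define B where "B t = L (u t) + F (u t)" for t
  have um: "u t \<in> Dm" if "t \<in> {0..T}" for t using u that unfolding weak_solution_def by blast
  obtain C1 where C1: "\<forall>s\<in>{0..T}. \<forall>t\<in>{0..T}. norm (u t - u s) \<le> C1 * \<bar>t - s\<bar>"
    using u unfolding weak_solution_def by blast
  obtain C2 where C2: "\<forall>t\<in>{0..T}. norm (L (u t)) \<le> C2"
    using u unfolding weak_solution_def by blast
  have "lipschitz_on \<bar>C1\<bar> {0..T} u"
    unfolding lipschitz_on_def dist_norm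
  proof (intro conjI ballI)
    fix s t assume "s \<in> {0..T}" "t \<in> {0..T}"
    then have "norm (u s - u t) \<le> C1 * \<bar>s - t\<bar>" using C1 by blast
    also have "\<dots> \<le> \<bar>C1\<bar> * \<bar>s - t\<bar>" by (simp add: mult_right_mono)
    finally show "norm (u s - u t) \<le> \<bar>C1\<bar> * norm (s - t)" by simp
  qed simp
  then have uc: "continuous_on {0..T} u" by (rule lipschitz_on_continuous_on)
  have "continuous_on UNIV F"
    by (rule lipschitz_on_continuous_on[of \<omega>]) (use F \<omega> in \<open>auto simp: lipschitz_on_def dist_norm\<close>)
  then have Fc: "continuous_on {0..T} (\<lambda>t. F (u t))"
    by (rule continuous_on_compose2[OF _ uc]) auto
  have "(B \<longlongrightarrow> B t) (at t within {0..T})" if t: "t \<in> {0..T}" for t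
  proof -
    have ut: "(u \<longlongrightarrow> u t) (at t within {0..T})" "((\<lambda>s. F (u s)) \<longlongrightarrow> F (u t)) (at t within {0..T})"
      using uc Fc t by (auto simp: continuous_on_def)
    have ev: "\<forall>\<^sub>F s in at t within {0..T}. u s \<in> Dm \<and> norm (L (u s)) \<le> C2"
      using um C2 by (auto simp: eventually_at_filter)
    have w: "((\<lambda>s. inner (B s) (B t)) \<longlongrightarrow> inner (B t) (B t)) (at t within {0..T})"
      unfolding B_def[of s for s] inner_add_left
      by (intro tendsto_add weak_L_tendsto[OF ut(1) um[OF t] ev] tendsto_inner ut(2) tendsto_const)
    \<comment> \<open>Squeezed between the growth estimate from \<open>s\<close> to \<open>t\<close>
      and the one from \<open>t\<close> to \<open>s\<close>.\<close>
    have n: "((\<lambda>s. norm (B s)) \<longlongrightarrow> norm (B t)) (at t within {0..T})"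
    proof (rule tendsto_sandwich)
      show "\<forall>\<^sub>F s in at t within {0..T}. exp (- \<omega> * \<bar>t - s\<bar>) * norm (B t) \<le> norm (B s)"
        unfolding eventually_at_filter
      proof (intro always_eventually allI impI)
        fix s assume "s \<in> {0..T}"
        then have "exp (- \<omega> * \<bar>t - s\<bar>) * norm (B t) \<le> exp (- \<omega> * \<bar>t - s\<bar>) * (exp (\<omega> * \<bar>t - s\<bar>) * norm (B s))"
          unfolding B_def by (intro mult_left_mono weak_solution_norm_symmetric[OF F \<omega> u] t) auto
        then show "exp (- \<omega> * \<bar>t - s\<bar>) * norm (B t) \<le> norm (B s)"
          by (simp add: mult.assoc[symmetric] exp_add[symmetric])
      qed
      show "\<forall>\<^sub>F s in at t within {0..T}. norm (B s) \<le> exp (\<omega> * \<bar>s - t\<bar>) * norm (B t)"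
        unfolding eventually_at_filter B_def
        by (intro always_eventually allI impI weak_solution_norm_symmetric[OF F \<omega> u] t)
      have "((\<lambda>s. exp (- \<omega> * \<bar>t - s\<bar>) * norm (B t)) \<longlongrightarrow> exp (- \<omega> * \<bar>t - t\<bar>) * norm (B t)) (at t within {0..T})"
        by (intro tendsto_intros)
      then show "((\<lambda>s. exp (- \<omega> * \<bar>t - s\<bar>) * norm (B t)) \<longlongrightarrow> norm (B t)) (at t within {0..T})" by simp
      have "((\<lambda>s. exp (\<omega> * \<bar>s - t\<bar>) * norm (B t)) \<longlongrightarrow> exp (\<omega> * \<bar>t - t\<bar>) * norm (B t)) (at t within {0..T})"
        by (intro tendsto_intros)
      then show "((\<lambda>s. exp (\<omega> * \<bar>s - t\<bar>) * norm (B t)) \<longlongrightarrow> norm (B t)) (at t within {0..T})" by simp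
    qed
    \<comment> \<open>Weak convergence together with convergence of the norms is strong convergence,
      by expanding the square.\<close>
    have "((\<lambda>s. (norm (B s))\<^sup>2 - 2 * inner (B s) (B t) + (norm (B t))\<^sup>2) \<longlongrightarrow> (norm (B t))\<^sup>2 - 2 * inner (B t) (B t) + (norm (B t))\<^sup>2) (at t within {0..T})"
      by (intro tendsto_intros n w)
    moreover have "(norm (B s))\<^sup>2 - 2 * inner (B s) (B t) + (norm (B t))\<^sup>2 = (norm (B s - B t))\<^sup>2" for s
      unfolding power2_norm_eq_inner by (simp add: inner_diff_left inner_diff_right inner_commute)
    ultimately have "((\<lambda>s. (norm (B s - B t))\<^sup>2) \<longlongrightarrow> 0) (at t within {0..T})"
      by (simp add: power2_norm_eq_inner)
    then have "((\<lambda>s. norm (B s - B t)) \<longlongrightarrow> 0) (at t within {0..T})"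
      using tendsto_real_sqrt[of "\<lambda>s. (norm (B s - B t))\<^sup>2" 0] by simp
    then show ?thesis by (simp add: tendsto_norm_zero_iff LIM_zero_iff)
  qed
  then have Bc: "continuous_on {0..T} B" by (auto simp: continuous_on_def)
  have "continuous_on {0..T} (\<lambda>t. B t - F (u t))" by (intro continuous_intros Bc Fc)
  then have Lc: "continuous_on {0..T} (\<lambda>t. L (u t))" unfolding B_def by simp
  \<comment> \<open>Now that \<open>B\<close> is continuous, the weak derivative is strong: the
    linear bound holds against every domain vector with a constant proportional to its norm, and
    these vectors are dense.\<close>
  have der: "(u has_vector_derivative B t) (at t within {0..T})" if t: "t \<in> {0..T}" for t
    unfolding has_vector_derivative_def has_derivative_within_alt
  proof (intro conjI allI impI bounded_linear_scaleR_left)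
    fix e :: real assume e: "e > 0"
    obtain d where d: "d > 0" "\<And>s. s \<in> {0..T} \<Longrightarrow> dist s t < d \<Longrightarrow> dist (B s) (B t) < e"
      using Bc t e unfolding continuous_on_iff by blast
    have "norm (u s - u t - (s - t) *\<^sub>R B t) \<le> e * norm (s - t)" if s: "s \<in> {0..T}" "norm (s - t) < d" for s
    proof (rule norm_le_inner_dense[OF dense])
      fix w assume w: "w \<in> Dm"
      have "norm (inner (u s) w - inner (u t) w - (s - t) *\<^sub>R inner (B t) w) \<le> (e * norm w) * \<bar>s - t\<bar>"
      proof (rule vector_derivative_linear_bound[where a = "min s t" and b = "max s t" and f' = "\<lambda>r. inner (B r) w"])
        fix r assume r: "r \<in> {min s t..max s t}"
        then have r': "r \<in> {0..T}" using s t by auto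
        have "((\<lambda>s. inner (u s) w) has_vector_derivative inner (B r) w) (at r within {0..T})"
          using u w r' unfolding weak_solution_def B_def
          by (auto simp: has_real_derivative_iff_has_vector_derivative)
        then show "((\<lambda>s. inner (u s) w) has_vector_derivative inner (B r) w) (at r within {min s t..max s t})"
          by (rule has_vector_derivative_within_subset) (use s t in auto)
        have "dist r t < d" using r s(2) by (auto simp: dist_real_def)
        then have "norm (B r - B t) \<le> e" using d(2)[OF r'] by (simp add: dist_norm)
        have "norm (inner (B r) w - inner (B t) w) = \<bar>inner (B r - B t) w\<bar>" by (simp add: inner_diff_left)
        also have "\<dots> \<le> norm (B r - B t) * norm w" by (rule Cauchy_Schwarz_ineq2)
        also have "\<dots> \<le> e * norm w" using \<open>norm (B r - B t) \<le> e\<close> by (intro mult_right_mono) auto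
        finally show "norm (inner (B r) w - inner (B t) w) \<le> e * norm w" .
      qed auto
      then have "\<bar>inner (u s - u t - (s - t) *\<^sub>R B t) w\<bar> \<le> e * norm w * \<bar>s - t\<bar>"
        by (simp add: inner_diff_left)
      then show "inner (u s - u t - (s - t) *\<^sub>R B t) w \<le> e * norm (s - t) * norm w"
        by (simp add: mult.commute mult.left_commute)
    qed (use e in simp)
    then show "\<exists>d>0. \<forall>s\<in>{0..T}. norm (s - t) < d \<longrightarrow> norm (u s - u t - (s - t) *\<^sub>R B t) \<le> e * norm (s - t)"
      using d(1) by blast
  qed
  show ?thesis using u00 Lc um der unfolding B_def by blast
qed

end

section \<open>Orthogonal complements and relatively bounded perturbations\<close>

text \<open>The projection theorem: a minimizing sequence is Cauchy by the parallelogram identity,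
  and the first variation at its limit \<open>p\<close> makes \<open>x - p\<close> orthogonal to
  \<open>S\<close>, hence zero.\<close>

lemma closed_subspace_dense_eq_UNIV:
  fixes S :: "'a::{real_inner,banach} set"
  assumes S: "subspace S" "closed S" and orth: "\<And>f. (\<And>w. w \<in> S \<Longrightarrow> inner f w = 0) \<Longrightarrow> f = 0"
  shows "S = UNIV"
proof -
  have "x \<in> S" for x
  proof -
    define d where "d = infdist x S"
    have ne: "S \<noteq> {}" using subspace_0[OF S(1)] by auto
    have d: "d \<ge> 0" "\<And>w. w \<in> S \<Longrightarrow> d \<le> norm (x - w)"
      unfolding d_def using infdist_le[of _ S x] by (auto simp: infdist_nonneg dist_norm)
    have "\<exists>w\<in>S. norm (x - w) < d + inverse (real (Suc n))" for n
    proof -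
      have "(INF w\<in>S. dist x w) < d + inverse (real (Suc n))"
        unfolding d_def infdist_notempty[OF ne] by simp
      moreover have "bdd_below (dist x ` S)" by (rule bdd_belowI[of _ 0]) auto
      ultimately show ?thesis using ne by (simp add: cINF_less_iff dist_norm)
    qed
    then obtain w where w: "\<And>n. w n \<in> S" "\<And>n. norm (x - w n) < d + inverse (real (Suc n))" by metis
    have par: "(norm (w m - w n))\<^sup>2 \<le> 2 * (norm (x - w m))\<^sup>2 + 2 * (norm (x - w n))\<^sup>2 - 4 * d\<^sup>2" for m n
    proof -
      have "(1/2) *\<^sub>R (w m + w n) \<in> S" using S w by (intro subspace_scale subspace_add) auto
      then have "d\<^sup>2 \<le> (norm (x - (1/2) *\<^sub>R (w m + w n)))\<^sup>2" using d by (intro power_mono) auto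
      moreover have "(norm (b - a))\<^sup>2 = 2 * (norm a)\<^sup>2 + 2 * (norm b)\<^sup>2 - 4 * (norm ((1/2) *\<^sub>R (a + b)))\<^sup>2" for a b :: 'a
        by (simp add: power_mult_distrib power_divide) (simp only: power2_norm_eq_inner inner_diff_left inner_diff_right
            inner_add_left inner_add_right inner_commute[of b a])
      from this[of "x - w n" "x - w m"]
      have "(norm (w m - w n))\<^sup>2 = 2 * (norm (x - w m))\<^sup>2 + 2 * (norm (x - w n))\<^sup>2 - 4 * (norm (x - (1/2) *\<^sub>R (w m + w n)))\<^sup>2"
      proof -
        have "(1/2) *\<^sub>R ((x - w n) + (x - w m)) = x - (1/2) *\<^sub>R (w m + w n)"
          by (simp add: scaleR_add_right scaleR_diff_right field_simps flip: scaleR_add_left)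
        then show ?thesis using \<open>(norm ((x - w m) - (x - w n)))\<^sup>2 = _\<close> by (simp add: norm_minus_commute)
      qed
      ultimately show ?thesis by simp
    qed
    have lim: "(\<lambda>n. (norm (x - w n))\<^sup>2) \<longlonglongrightarrow> d\<^sup>2"
    proof (rule tendsto_power, rule tendsto_sandwich[OF _ _ tendsto_const])
      show "(\<lambda>n. d + inverse (real (Suc n))) \<longlonglongrightarrow> d"
        using tendsto_add[OF tendsto_const LIMSEQ_inverse_real_of_nat, of d] by simp
      show "\<forall>\<^sub>F n in sequentially. norm (x - w n) \<le> d + inverse (real (Suc n))"
        by (intro always_eventually allI less_imp_le w)
    qed (use d w in auto)
    have "Cauchy w"
    proof (rule metric_CauchyI)
      fix e :: real assume e: "e > 0"
      have "\<forall>\<^sub>F n in sequentially. (norm (x - w n))\<^sup>2 < d\<^sup>2 + e\<^sup>2 / 4"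
        using lim e by (intro order_tendstoD(2)) auto
      then obtain M where M: "\<And>n. n \<ge> M \<Longrightarrow> (norm (x - w n))\<^sup>2 < d\<^sup>2 + e\<^sup>2 / 4"
        by (auto simp: eventually_sequentially)
      have "dist (w m) (w n) < e" if "m \<ge> M" "n \<ge> M" for m n
      proof -
        have "(norm (w m - w n))\<^sup>2 < e\<^sup>2" using par[of m n] M[OF that(1)] M[OF that(2)] by linarith
        then show ?thesis using e by (simp add: dist_norm power_less_imp_less_base)
      qed
      then show "\<exists>M. \<forall>m\<ge>M. \<forall>n\<ge>M. dist (w m) (w n) < e" by blast
    qed
    then obtain p where p: "w \<longlonglongrightarrow> p" using convergent_eq_Cauchy by blast
    have pS: "p \<in> S" using closed_sequentially[OF S(2)] w(1) p by blast
    have dp: "(norm (x - p))\<^sup>2 = d\<^sup>2"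
      by (rule LIMSEQ_unique[OF _ lim]) (intro tendsto_intros p)
    have "inner (x - p) v = 0" if v: "v \<in> S" for v
    proof -
      define c where "c = inner (x - p) v"
      \<comment> \<open>The optimal step would be \<open>c / |v|^2\<close>; the added one avoids
        division by zero and still decreases the distance unless \<open>c = 0\<close>.\<close>
      define s where "s = c / ((norm v)\<^sup>2 + 1)"
      have pos: "0 < (norm v)\<^sup>2 + 1" by (simp add: add_nonneg_pos)
      have "p + s *\<^sub>R v \<in> S" using S pS v by (intro subspace_add subspace_scale)
      then have "d\<^sup>2 \<le> (norm (x - (p + s *\<^sub>R v)))\<^sup>2" using d by (intro power_mono) auto
      also have "x - (p + s *\<^sub>R v) = (x - p) - s *\<^sub>R v" by simp
      also have "(norm ((x - p) - s *\<^sub>R v))\<^sup>2 = (norm (x - p))\<^sup>2 - 2 * s * c + s\<^sup>2 * (norm v)\<^sup>2"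
        unfolding power2_norm_eq_inner c_def inner_diff_left[of "x - p"] inner_diff_right[of _ "x - p"]
        by (simp add: inner_commute[of v "x - p"] power2_eq_square)
      finally have "2 * s * c \<le> s\<^sup>2 * (norm v)\<^sup>2" using dp by simp
      also have "\<dots> \<le> s\<^sup>2 * ((norm v)\<^sup>2 + 1)" by (intro mult_left_mono) auto
      also have "\<dots> = s * c" unfolding s_def using pos by (simp add: power2_eq_square)
      finally have "s * c \<le> 0" by linarith
      then have "c\<^sup>2 / ((norm v)\<^sup>2 + 1) \<le> 0" unfolding s_def by (simp add: power2_eq_square)
      then have "c\<^sup>2 \<le> 0" using pos by (simp add: divide_le_0_iff)
      then show ?thesis unfolding c_def by simp
    qed
    then have "x - p = 0" by (rule orth)
    then show ?thesis using pS by simp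
  qed
  then show ?thesis by blast
qed

section \<open>Relatively bounded skew perturbations\<close>

context skew_generator
begin

text \<open>Seek \<open>u = J a g\<close>; then \<open>g = f + a K (J a g)\<close> is required. The
  factor 1/4 acts on \<open>a |Y a g| \<le> |g|\<close> and \<open>a * C \<le> 1/4\<close> on
  \<open>|J a g| \<le> |g|\<close>, so the right-hand side contracts by 1/2.\<close>

lemma relatively_bounded_range:
  assumes K_diff: "\<And>x y. x \<in> Dm \<Longrightarrow> y \<in> Dm \<Longrightarrow> K (x - y) = K x - K y"
    and K: "\<And>x. x \<in> Dm \<Longrightarrow> norm (K x) \<le> 1/4 * norm (L x) + C * norm x"
    and a: "0 < a" "a < a0" "a * C \<le> 1/4" and C: "C \<ge> 0"
  shows "\<exists>u\<in>Dm. u - a *\<^sub>R (L u + K u) = f"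
proof -
  define \<Phi> where "\<Phi> g = f + a *\<^sub>R K (J a g)" for g
  have "\<exists>!g. \<Phi> g = g"
  proof (rule banach_fix_type[where c = "1/2"], simp_all, intro allI)
    fix g h
    have "\<Phi> g - \<Phi> h = a *\<^sub>R K (J a (g - h))"
      unfolding \<Phi>_def using J(1)[OF a(1,2)] by (simp add: K_diff J_diff[OF a(1,2), symmetric] scaleR_diff_right)
    then have "norm (\<Phi> g - \<Phi> h) = a * norm (K (J a (g - h)))" using a by simp
    also have "\<dots> \<le> a * (1/4 * norm (Y a (g - h)) + C * norm (J a (g - h)))"
      unfolding Y_def using a by (intro mult_left_mono K J) auto
    also have "\<dots> = 1/4 * (a * norm (Y a (g - h))) + (a * C) * norm (J a (g - h))" by (simp add: algebra_simps)
    also have "\<dots> \<le> 1/4 * norm (g - h) + 1/4 * norm (g - h)"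
    proof (intro add_mono mult_left_mono mult_mono norm_J a)
      show "a * norm (Y a (g - h)) \<le> norm (g - h)"
        using norm_Y[OF a(1,2), of "g - h"] a(1) by (simp add: field_simps)
    qed (use a C in auto)
    finally show "dist (\<Phi> g) (\<Phi> h) * 2 \<le> dist g h" by (simp add: dist_norm)
  qed
  then obtain g where g: "\<Phi> g = g" by blast
  show ?thesis
  proof (intro bexI[of _ "J a g"])
    show "J a g - a *\<^sub>R (L (J a g) + K (J a g)) = f"
    proof -
      have "J a g - a *\<^sub>R (L (J a g) + K (J a g)) = (J a g - a *\<^sub>R Y a g) - a *\<^sub>R K (J a g)"
        unfolding Y_def by (simp add: scaleR_add_right)
      also have "\<dots> = g - a *\<^sub>R K (J a g)" using J(2)[OF a(1,2)] by simp
      also have "\<dots> = f" using g unfolding \<Phi>_def by (simp add: diff_eq_eq)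
      finally show ?thesis .
    qed
  qed (rule J[OF a(1,2)])
qed

text \<open>The Kato-Rellich argument. The threshold \<open>1 / (4 * (C + 1))\<close> guarantees
  \<open>a * C \<le> 1/4\<close>; the other sign comes from the same range lemma for
  \<open>- L\<close> and \<open>- K\<close>.\<close>

lemma relatively_bounded_perturbation:
  assumes K_add: "\<And>x y. x \<in> Dm \<Longrightarrow> y \<in> Dm \<Longrightarrow> K (x + y) = K x + K y"
    and K_scale: "\<And>c x. x \<in> Dm \<Longrightarrow> K (c *\<^sub>R x) = c *\<^sub>R K x"
    and K_skew: "\<And>x. x \<in> Dm \<Longrightarrow> inner (K x) x = 0"
    and K: "\<And>x. x \<in> Dm \<Longrightarrow> norm (K x) \<le> 1/4 * norm (L x) + C * norm x"
    and C: "C \<ge> 0"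
  shows "skew_generator Dm (\<lambda>x. L x + K x) (min a0 (1 / (4 * (C + 1))))"
proof
  show "subspace Dm" "closure Dm = UNIV" by (rule sub, rule dense)
  show "0 < min a0 (1 / (4 * (C + 1)))" using a0 C by simp
  fix x y c
  show "L (x + y) + K (x + y) = (L x + K x) + (L y + K y)" if "x \<in> Dm" "y \<in> Dm"
    using that by (simp add: L_add K_add)
  show "L (c *\<^sub>R x) + K (c *\<^sub>R x) = c *\<^sub>R (L x + K x)" if "x \<in> Dm"
    using that by (simp add: L_scale K_scale scaleR_add_right)
  show "inner (L x + K x) x = 0" if "x \<in> Dm"
    using that by (simp add: skew K_skew inner_add_left)
next
  interpret n: skew_generator Dm "\<lambda>x. - L x" a0 by (rule neg)
  have K_diff: "K (x - y) = K x - K y" if "x \<in> Dm" "y \<in> Dm" for x y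
    using K_add[of x "(-1) *\<^sub>R y"] K_scale[of y "-1"] mem_scale[of y "-1"] that by simp
  fix a f assume a: "0 < a" "a < min a0 (1 / (4 * (C + 1)))"
  have aC: "a * C \<le> 1/4"
  proof -
    have "a * C \<le> 1 / (4 * (C + 1)) * (C + 1)" using a C by (intro mult_mono) auto
    also have "\<dots> = 1/4" using C by (simp add: field_simps)
    finally show ?thesis .
  qed
  show "\<exists>u\<in>Dm. u - a *\<^sub>R (L u + K u) = f"
    by (rule relatively_bounded_range[OF K_diff K _ _ aC C]) (use a in auto)
  have "\<exists>u\<in>Dm. u - a *\<^sub>R (- L u + - K u) = f"
    by (rule n.relatively_bounded_range[OF _ _ _ _ aC C]) (use a K K_diff in auto)
  then show "\<exists>u\<in>Dm. u + a *\<^sub>R (L u + K u) = f" by (simp add: algebra_simps)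
qed

end


section \<open>Groups of translations\<close>

text \<open>Derivatives, averages and the Weyl operator use only a strongly continuous isometric
  action of \<real>^n on a Hilbert space; this generality keeps measure theory out of them.\<close>

locale translation_group =
  fixes \<tau> :: "real^'n::finite \<Rightarrow> 'a::{real_inner,banach} \<Rightarrow> 'a"
  assumes tau_linear: "linear (\<tau> y)"
    and norm_tau [simp]: "norm (\<tau> y u) = norm u"
    and tau_add: "\<tau> (x + y) u = \<tau> x (\<tau> y u)"
    and tau_0 [simp]: "\<tau> 0 u = u"
    and tau_cont: "continuous_on UNIV (\<lambda>y. \<tau> y u)"
begin

lemma tau_diff: "\<tau> y (u - v) = \<tau> y u - \<tau> y v" by (rule linear_diff[OF tau_linear])
lemma tau_plus: "\<tau> y (u + v) = \<tau> y u + \<tau> y v" by (rule linear_add[OF tau_linear])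
lemma tau_scale: "\<tau> y (c *\<^sub>R u) = c *\<^sub>R \<tau> y u" by (rule linear_scale[OF tau_linear])
lemma tau_commute: "\<tau> x (\<tau> y u) = \<tau> y (\<tau> x u)" by (metis add.commute tau_add)
lemma tau_inverse [simp]: "\<tau> (- y) (\<tau> y u) = u" "\<tau> y (\<tau> (- y) u) = u" by (simp_all add: tau_add[symmetric])

lemma tau_bounded_linear: "bounded_linear (\<tau> y)"
  using linear_add[OF tau_linear] linear_scale[OF tau_linear] by (intro bounded_linear_intro[where K = 1]) auto

lemma inner_tau: "inner (\<tau> y u) (\<tau> y v) = inner u v"
proof -
  have "(norm (\<tau> y (u + v)))\<^sup>2 = (norm (u + v))\<^sup>2" by simp
  then have "inner (\<tau> y u + \<tau> y v) (\<tau> y u + \<tau> y v) = inner (u + v) (u + v)"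
    unfolding tau_plus power2_norm_eq_inner .
  moreover have "inner (\<tau> y u) (\<tau> y u) = inner u u" "inner (\<tau> y v) (\<tau> y v) = inner v v"
    unfolding power2_norm_eq_inner[symmetric] by simp_all
  ultimately show ?thesis by (simp add: inner_add_left inner_add_right inner_commute)
qed

lemma inner_tau_swap: "inner (\<tau> y u) v = inner u (\<tau> (- y) v)"
  by (metis inner_tau tau_inverse(2))

abbreviation sh :: "'n \<Rightarrow> real \<Rightarrow> 'a \<Rightarrow> 'a" where "sh k s \<equiv> \<tau> (axis k s)"

lemma sh_add: "sh k (s + t) u = sh k s (sh k t u)"
proof -
  have "axis k (s + t) = axis k s + axis k t" by (simp add: axis_def vec_eq_iff)
  then show ?thesis by (simp add: tau_add)
qed

lemma axis_zero_real: "axis k (0::real) = 0" by (simp add: axis_def vec_eq_iff)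
lemma axis_minus_real: "axis k (- s) = - axis k (s::real)" by (simp add: axis_def vec_eq_iff)

lemma sh_0 [simp]: "sh k 0 u = u" by (simp add: axis_zero_real)

lemma sh_cont: "continuous_on S (\<lambda>s. sh k s u)"
proof -
  have e: "axis k = (\<lambda>s. s *\<^sub>R axis k (1::real))" by (auto simp: axis_def vec_eq_iff)
  have "continuous_on S (axis k :: real \<Rightarrow> _)"
    by (subst e) (intro continuous_on_scaleR continuous_on_id continuous_on_const)
  then show ?thesis using continuous_on_compose2[OF tau_cont, of S "axis k" u] by simp
qed

text \<open>The generator of the translations in direction \<open>k\<close>, as a relation because
  it is unbounded. In L2 it turns out to be the weak partial derivative.\<close>

definition pd :: "'n \<Rightarrow> 'a \<Rightarrow> 'a \<Rightarrow> bool" where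
  "pd k u g \<longleftrightarrow> ((\<lambda>s. sh k s u) has_vector_derivative g) (at 0)"

lemma pd_unique: "pd k u g \<Longrightarrow> pd k u h \<Longrightarrow> g = h"
  unfolding pd_def by (rule vector_derivative_unique_at)

lemma pd_commuting:
  assumes "pd k u g" "bounded_linear A" "\<And>s v. A (sh k s v) = sh k s (A v)"
  shows "pd k (A u) (A g)"
  using bounded_linear.has_vector_derivative[OF assms(2) assms(1)[unfolded pd_def]] unfolding pd_def assms(3) .

lemma pd_add: "pd k u g \<Longrightarrow> pd k v h \<Longrightarrow> pd k (u + v) (g + h)"
  unfolding pd_def tau_plus by (rule has_vector_derivative_add)

lemma pd_scale: "pd k u g \<Longrightarrow> pd k (c *\<^sub>R u) (c *\<^sub>R g)"
  by (rule pd_commuting) (auto simp: bounded_linear_scaleR_right tau_scale)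

lemma pd_curve:
  assumes "pd k u g"
  shows "((\<lambda>s. sh k s u) has_vector_derivative sh k s g) (at s within S)"
proof (rule has_vector_derivative_at_within)
  have "((\<lambda>r. sh k r u) \<circ> (\<lambda>r. r - s) has_vector_derivative (1 *\<^sub>R g)) (at s)"
    using assms unfolding pd_def
    by (intro vector_diff_chain_at) (auto intro!: derivative_eq_intros)
  then have "((\<lambda>r. sh k s (sh k (r - s) u)) has_vector_derivative sh k s g) (at s)"
    by (intro bounded_linear.has_vector_derivative[OF tau_bounded_linear]) (simp add: o_def)
  then show "((\<lambda>r. sh k r u) has_vector_derivative sh k s g) (at s)"
    by (simp add: sh_add[symmetric])
qed

text \<open>A difference quotient characterization without limits, stable under limits of \<open>u\<close> and \<open>g\<close>.\<close>

lemma pd_iff_bound: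
  "pd k u g \<longleftrightarrow> (\<forall>h C. (\<forall>s. \<bar>s\<bar> \<le> \<bar>h\<bar> \<longrightarrow> norm (sh k s g - g) \<le> C) \<longrightarrow> norm (sh k h u - u - h *\<^sub>R g) \<le> C * \<bar>h\<bar>)"
proof (intro iffI allI impI)
  fix h C assume pd: "pd k u g" and C: "\<forall>s. \<bar>s\<bar> \<le> \<bar>h\<bar> \<longrightarrow> norm (sh k s g - g) \<le> C"
  have "norm (sh k h u - sh k 0 u - (h - 0) *\<^sub>R g) \<le> C * \<bar>h - 0\<bar>"
    by (rule vector_derivative_linear_bound[where a = "min 0 h" and b = "max 0 h" and f' = "\<lambda>s. sh k s g"])
      (use C in \<open>auto intro: pd_curve[OF pd]\<close>)
  then show "norm (sh k h u - u - h *\<^sub>R g) \<le> C * \<bar>h\<bar>" by simp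
next
  assume *: "\<forall>h C. (\<forall>s. \<bar>s\<bar> \<le> \<bar>h\<bar> \<longrightarrow> norm (sh k s g - g) \<le> C) \<longrightarrow> norm (sh k h u - u - h *\<^sub>R g) \<le> C * \<bar>h\<bar>"
  show "pd k u g"
    unfolding pd_def has_vector_derivative_def has_derivative_within_alt
  proof (intro conjI allI impI bounded_linear_scaleR_left)
    fix e :: real assume "e > 0"
    have "continuous_on UNIV (\<lambda>s. sh k s g)" by (rule sh_cont)
    then obtain d where d: "d > 0" "\<And>s. dist s 0 < d \<Longrightarrow> dist (sh k s g) (sh k 0 g) < e"
      using \<open>e > 0\<close> unfolding continuous_on_iff by (metis UNIV_I)
    show "\<exists>d>0. \<forall>y\<in>UNIV. norm (y - 0) < d \<longrightarrow> norm (sh k y u - sh k 0 u - (y - 0) *\<^sub>R g) \<le> e * norm (y - 0)"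
    proof (intro exI[of _ d] conjI ballI impI d(1))
      fix h :: real assume h: "norm (h - 0) < d"
      have "\<forall>s. \<bar>s\<bar> \<le> \<bar>h\<bar> \<longrightarrow> norm (sh k s g - g) \<le> e"
        using d(2) h by (auto simp: dist_norm intro!: less_imp_le)
      then show "norm (sh k h u - sh k 0 u - (h - 0) *\<^sub>R g) \<le> e * norm (h - 0)" using * by simp
    qed
  qed
qed

text \<open>The bound in \<open>pd_iff_bound\<close> survives limits: replacing \<open>g0\<close> by
  \<open>g n\<close> worsens the constant by \<open>2 |g n - g0|\<close> for every shift, since
  translations are isometric.\<close>

lemma pd_closed:
  assumes "\<And>n. pd k (u n) (g n)" "u \<longlonglongrightarrow> u0" "g \<longlonglongrightarrow> g0"
  shows "pd k u0 g0"
  unfolding pd_iff_bound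
proof (intro allI impI)
  fix h C assume C: "\<forall>s. \<bar>s\<bar> \<le> \<bar>h\<bar> \<longrightarrow> norm (sh k s g0 - g0) \<le> C"
  have b: "norm (sh k h (u n) - u n - h *\<^sub>R g n) \<le> (C + 2 * norm (g n - g0)) * \<bar>h\<bar>" for n
  proof -
    have "norm (sh k s (g n) - g n) \<le> C + 2 * norm (g n - g0)" if "\<bar>s\<bar> \<le> \<bar>h\<bar>" for s
    proof -
      have "sh k s (g n) - g n = (sh k s g0 - g0) + (sh k s (g n - g0) - (g n - g0))" by (simp add: tau_diff)
      also have "norm \<dots> \<le> norm (sh k s g0 - g0) + (norm (sh k s (g n - g0)) + norm (g n - g0))"
        by (intro order_trans[OF norm_triangle_ineq] add_mono norm_triangle_ineq4 order_refl)
      finally show ?thesis using C that by fastforce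
    qed
    then show ?thesis using assms(1)[of n] unfolding pd_iff_bound by blast
  qed
  show "norm (sh k h u0 - u0 - h *\<^sub>R g0) \<le> C * \<bar>h\<bar>"
  proof (rule tendsto_le[OF sequentially_bot])
    show "(\<lambda>n. norm (sh k h (u n) - u n - h *\<^sub>R g n)) \<longlonglongrightarrow> norm (sh k h u0 - u0 - h *\<^sub>R g0)"
      by (intro tendsto_intros bounded_linear.tendsto[OF tau_bounded_linear] assms)
    have "(\<lambda>n. (C + 2 * norm (g n - g0)) * \<bar>h\<bar>) \<longlonglongrightarrow> (C + 2 * norm (g0 - g0)) * \<bar>h\<bar>"
      by (intro tendsto_intros assms)
    then show "(\<lambda>n. (C + 2 * norm (g n - g0)) * \<bar>h\<bar>) \<longlonglongrightarrow> C * \<bar>h\<bar>" by simp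
  qed (simp add: b)
qed

text \<open>Integration by parts: both sides are the derivative at \<open>s = 0\<close> of the
  scalar product of \<open>sh k s u\<close> with \<open>v\<close>, which is that of \<open>u\<close>
  with \<open>sh k (- s) v\<close>.\<close>

lemma pd_skew:
  assumes "pd k u g" "pd k v h"
  shows "inner g v = - inner u h"
proof -
  have 1: "((\<lambda>s. inner (sh k s u) v) has_vector_derivative inner g v) (at 0)"
    by (rule bounded_linear.has_vector_derivative[OF bounded_linear_inner_left assms(1)[unfolded pd_def]])
  have "((\<lambda>s. sh k s v) \<circ> uminus has_vector_derivative ((-1) *\<^sub>R h)) (at 0)"
    using assms(2) unfolding pd_def by (intro vector_diff_chain_at) (auto intro!: derivative_eq_intros)
  then have "((\<lambda>s. inner u (sh k (- s) v)) has_vector_derivative inner u ((-1) *\<^sub>R h)) (at 0)"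
    by (intro bounded_linear.has_vector_derivative[OF bounded_linear_inner_right]) (simp add: o_def)
  then have 2: "((\<lambda>s. inner (sh k s u) v) has_vector_derivative inner u ((-1) *\<^sub>R h)) (at 0)"
    by (simp add: inner_tau_swap axis_minus_real)
  show ?thesis using vector_derivative_unique_at[OF 1 2] by simp
qed

lemma sh_lipschitz:
  assumes "pd k u g" shows "norm (sh k h u - u) \<le> norm g * \<bar>h\<bar>"
proof -
  have "norm (sh k h u - sh k 0 u) \<le> norm g * \<bar>h - 0\<bar>"
    by (rule vector_derivative_lipschitz_bound[where a = "min 0 h" and b = "max 0 h" and f' = "\<lambda>s. sh k s g"])
      (auto intro: pd_curve[OF assms])
  then show ?thesis by simp
qed

definition H :: "'a set" where "H = {u. \<forall>k. \<exists>g. pd k u g}"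
definition dd :: "'n \<Rightarrow> 'a \<Rightarrow> 'a" where "dd k u = (SOME g. pd k u g)"

lemma pd_dd: "u \<in> H \<Longrightarrow> pd k u (dd k u)"
  unfolding H_def dd_def by (auto intro: someI_ex)

lemma dd_eq: "pd k u g \<Longrightarrow> dd k u = g"
  unfolding dd_def by (meson pd_unique someI)

lemma H_I: "(\<And>k. pd k u (g k)) \<Longrightarrow> u \<in> H" unfolding H_def by blast

lemma subspace_H: "subspace H"
proof (rule subspaceI)
  have "pd k (0 *\<^sub>R 0) (0 *\<^sub>R 0)" for k unfolding pd_def by (simp add: linear_0[OF tau_linear])
  then show "0 \<in> H" by (intro H_I[of 0 "\<lambda>k. 0"]) simp
  show "x + y \<in> H" if "x \<in> H" "y \<in> H" for x y by (rule H_I) (rule pd_add[OF pd_dd pd_dd, OF that])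
  show "c *\<^sub>R x \<in> H" if "x \<in> H" for c x by (rule H_I) (rule pd_scale[OF pd_dd, OF that])
qed

lemma dd_add: "x \<in> H \<Longrightarrow> y \<in> H \<Longrightarrow> dd k (x + y) = dd k x + dd k y"
  by (intro dd_eq pd_add pd_dd)
lemma dd_scale: "x \<in> H \<Longrightarrow> dd k (c *\<^sub>R x) = c *\<^sub>R dd k x"
  by (intro dd_eq pd_scale pd_dd)
lemma dd_diff: "x \<in> H \<Longrightarrow> y \<in> H \<Longrightarrow> dd k (x - y) = dd k x - dd k y"
  using dd_add[of x "(-1) *\<^sub>R y" k] dd_scale[of y k "-1"] subspace_scale[OF subspace_H, of y "-1"] by simp

text \<open>The path from 0 to \<open>y\<close> runs along the coordinate axes one after another;
  isometry lets the increments add up.\<close>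

lemma tau_lipschitz:
  assumes "u \<in> H"
  shows "norm (\<tau> y u - u) \<le> (\<Sum>k\<in>UNIV. \<bar>y $ k\<bar> * norm (dd k u))"
proof -
  have *: "norm (\<tau> (\<Sum>k\<in>S. axis k (y $ k)) u - u) \<le> (\<Sum>k\<in>S. \<bar>y $ k\<bar> * norm (dd k u))" if "finite S" for S
    using that
  proof (induction S rule: finite_induct)
    case (insert j S)
    let ?v = "\<tau> (\<Sum>k\<in>S. axis k (y $ k)) u"
    have "norm (sh j (y $ j) ?v - u) \<le> norm (sh j (y $ j) (?v - u)) + norm (sh j (y $ j) u - u)"
      using norm_triangle_ineq[of "sh j (y $ j) (?v - u)" "sh j (y $ j) u - u"] by (simp add: tau_diff)
    also have "\<dots> \<le> (\<Sum>k\<in>S. \<bar>y $ k\<bar> * norm (dd k u)) + \<bar>y $ j\<bar> * norm (dd j u)"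
      using insert.IH sh_lipschitz[OF pd_dd[OF assms], of j "y $ j"] by (simp add: mult.commute)
    finally show ?case using insert.hyps by (simp add: tau_add)
  qed simp
  have "(\<Sum>k\<in>UNIV. axis k (y $ k)) = y"
    by (simp add: vec_eq_iff axis_def if_distrib[where f = "\<lambda>f. f _"] cong: if_cong)
  then show ?thesis using *[of UNIV] by simp
qed

subsection \<open>Averages\<close>

text \<open>The Steklov mean in one coordinate direction.\<close>

definition N :: "'n \<Rightarrow> real \<Rightarrow> 'a \<Rightarrow> 'a" where
  "N k r u = inverse r *\<^sub>R integral {0..r} (\<lambda>s. sh k s u)"

lemma sh_integrable: "(\<lambda>s. sh k s u) integrable_on {a..b}"
  by (intro integrable_continuous_real sh_cont)

lemma N_commuting:
  assumes A: "bounded_linear A" "\<And>s. A (sh k s u) = sh k s (A u)"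
  shows "A (N k r u) = N k r (A u)"
proof -
  have "A (N k r u) = inverse r *\<^sub>R A (integral {0..r} (\<lambda>s. sh k s u))"
    unfolding N_def by (rule linear_scale[OF bounded_linear.linear[OF A(1)]])
  also have "A (integral {0..r} (\<lambda>s. sh k s u)) = integral {0..r} (A \<circ> (\<lambda>s. sh k s u))"
    by (rule integral_linear[OF sh_integrable A(1), symmetric])
  finally show ?thesis by (simp add: N_def o_def A(2))
qed

lemma N_diff: "N k r (u - v) = N k r u - N k r v"
  unfolding N_def tau_diff by (simp add: integral_diff sh_integrable scaleR_diff_right)

lemma N_approx:
  assumes "r > 0" "\<And>s. 0 \<le> s \<Longrightarrow> s \<le> r \<Longrightarrow> norm (sh k s u - v) \<le> C"
  shows "norm (N k r u - v) \<le> C"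
proof -
  have "N k r u - v = inverse r *\<^sub>R integral {0..r} (\<lambda>s. sh k s u - v)"
    using assms(1) by (simp add: N_def integral_diff[OF sh_integrable integrable_const_ivl] scaleR_diff_right)
  moreover have "norm (integral {0..r} (\<lambda>s. sh k s u - v)) \<le> C * (r - 0)"
    by (rule integral_bound) (use assms in \<open>auto intro!: continuous_intros sh_cont\<close>)
  ultimately show ?thesis using assms(1) by (simp add: field_simps)
qed

lemma norm_N: "r > 0 \<Longrightarrow> norm (N k r u) \<le> norm u"
  using N_approx[of r k u 0 "norm u"] by simp

lemma N_tendsto: "((\<lambda>r. N k r u) \<longlongrightarrow> u) (at_right 0)"
proof (rule tendstoI)
  fix e :: real assume "e > 0"
  have "continuous_on UNIV (\<lambda>s. sh k s u)" by (rule sh_cont)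
  then obtain d where d: "d > 0" "\<And>s. dist s 0 < d \<Longrightarrow> dist (sh k s u) (sh k 0 u) < e / 2"
    using \<open>e > 0\<close> unfolding continuous_on_iff by (metis UNIV_I half_gt_zero)
  have "dist (N k r u) u < e" if "0 < r" "r < d" for r
  proof -
    have "norm (N k r u - u) \<le> e / 2"
      by (rule N_approx) (use d(2) that in \<open>auto simp: dist_norm intro!: less_imp_le\<close>)
    then show ?thesis using \<open>e > 0\<close> by (simp add: dist_norm)
  qed
  then show "\<forall>\<^sub>F r in at_right 0. dist (N k r u) u < e"
    unfolding eventually_at_right_field using d(1) by blast
qed

lemma pd_N:
  assumes "r > 0" shows "pd k (N k r u) (inverse r *\<^sub>R (sh k r u - u))"
proof -
  define c where "c s = sh k s u" for s
  \<comment> \<open>Starting the primitive at -1 makes it differentiable on both sides of 0.\<close>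
  define \<Phi> where "\<Phi> t = integral {-1..t} c" for t
  have ci: "c integrable_on {a..b}" for a b unfolding c_def by (rule sh_integrable)
  have \<Phi>: "(\<Phi> has_vector_derivative c t) (at t)" if "t > -1" for t
  proof -
    have "(\<Phi> has_vector_derivative c t) (at t within {-1..t + 1})"
      unfolding \<Phi>_def by (rule integral_has_vector_derivative) (use that in \<open>auto simp: c_def sh_cont\<close>)
    moreover have "at t within {-1..t + 1} = at t" by (rule at_within_interior) (use that in auto)
    ultimately show ?thesis by simp
  qed
  have eq: "sh k h (N k r u) = inverse r *\<^sub>R (\<Phi> (r + h) - \<Phi> h)" if "h > -1" for h
  proof -
    have "sh k h (N k r u) = N k r (sh k h u)"
      by (rule N_commuting[OF tau_bounded_linear tau_commute])
    also have "\<dots> = inverse r *\<^sub>R integral {0..r} (c \<circ> ((+) h))"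
      unfolding N_def c_def o_def by (simp only: sh_add[symmetric] add.commute)
    also have "integral {0..r} (c \<circ> ((+) h)) = integral {0 + h..r + h} c"
      by (rule integral_shift_Icc_real)
    also have "\<dots> = \<Phi> (r + h) - \<Phi> h"
      unfolding \<Phi>_def using Henstock_Kurzweil_Integration.integral_combine[where a = "-1" and c = h and b = "r + h" and f = c] ci that assms by (simp add: algebra_simps)
    finally show ?thesis .
  qed
  have "((\<lambda>h. \<Phi> h) \<circ> (\<lambda>h. r + h) has_vector_derivative (1 *\<^sub>R c (r + 0))) (at 0)"
    using assms by (intro vector_diff_chain_at) (auto intro!: derivative_eq_intros \<Phi>)
  then have "((\<lambda>h. \<Phi> (r + h) - \<Phi> h) has_vector_derivative (c r - c 0)) (at 0)"
    using \<Phi>[of 0] by (intro has_vector_derivative_diff) (auto simp: o_def)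
  then have "((\<lambda>h. inverse r *\<^sub>R (\<Phi> (r + h) - \<Phi> h)) has_vector_derivative inverse r *\<^sub>R (c r - c 0)) (at 0)"
    by (rule bounded_linear.has_vector_derivative[OF bounded_linear_scaleR_right])
  then have "((\<lambda>h. sh k h (N k r u)) has_vector_derivative inverse r *\<^sub>R (c r - c 0)) (at 0)"
    by (rule has_vector_derivative_transform_within_open[where S = "{-1<..}"]) (auto simp: eq)
  then show ?thesis unfolding pd_def by (simp add: c_def)
qed

primrec mol :: "'n list \<Rightarrow> real \<Rightarrow> 'a \<Rightarrow> 'a" where
  "mol [] r u = u"
| "mol (k # ks) r u = N k r (mol ks r u)"

lemma N_bounded_linear: "r > 0 \<Longrightarrow> bounded_linear (N k r)"
proof (rule bounded_linear_intro[where K = 1])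
  show "N k r (x + y) = N k r x + N k r y" for x y
    unfolding N_def tau_plus by (simp add: integral_add sh_integrable scaleR_add_right)
  show "N k r (c *\<^sub>R x) = c *\<^sub>R N k r x" for c x
    unfolding N_def tau_scale by simp
qed (simp add: norm_N)

text \<open>Each average creates the derivative in its own direction and preserves the others,
  because averages commute with translations. One average per direction thus leads into
  \<open>H\<close>.\<close>

lemma mol_pd: "r > 0 \<Longrightarrow> k \<in> set ks \<Longrightarrow> \<exists>g. pd k (mol ks r u) g"
proof (induction ks)
  case (Cons j ks)
  show ?case
  proof (cases "j = k")
    case True then show ?thesis using pd_N[OF Cons.prems(1)] by auto
  next
    case False
    then obtain g where g: "pd k (mol ks r u) g" using Cons by auto
    have "pd k (N j r (mol ks r u)) (N j r g)"
      by (rule pd_commuting[OF g N_bounded_linear[OF Cons.prems(1)]])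
        (rule N_commuting[OF tau_bounded_linear tau_commute, symmetric])
    then show ?thesis by auto
  qed
qed simp

lemma mol_tendsto: "((\<lambda>r. mol ks r u) \<longlongrightarrow> u) (at_right 0)"
proof (induction ks)
  case (Cons k ks)
  have "((\<lambda>r. norm (mol ks r u - u) + norm (N k r u - u)) \<longlongrightarrow> norm (u - u) + norm (u - u)) (at_right 0)"
    by (intro tendsto_intros Cons N_tendsto)
  then have l: "((\<lambda>r. norm (mol ks r u - u) + norm (N k r u - u)) \<longlongrightarrow> 0) (at_right 0)" by simp
  have "((\<lambda>r. N k r (mol ks r u) - u) \<longlongrightarrow> 0) (at_right 0)"
  proof (rule Lim_null_comparison[OF _ l])
    have "norm (N k r (mol ks r u) - u) \<le> norm (mol ks r u - u) + norm (N k r u - u)" if "r > 0" for r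
    proof -
      have "norm (N k r (mol ks r u) - u) \<le> norm (N k r (mol ks r u - u)) + norm (N k r u - u)"
        using norm_triangle_ineq[of "N k r (mol ks r u - u)" "N k r u - u"] by (simp add: N_diff)
      then show ?thesis using norm_N[OF that, of k "mol ks r u - u"] by linarith
    qed
    then show "\<forall>\<^sub>F r in at_right 0. norm (N k r (mol ks r u) - u) \<le> norm (mol ks r u - u) + norm (N k r u - u)"
      unfolding eventually_at_right_field by (intro exI[of _ 1]) auto
  qed
  then show ?case by (simp add: LIM_zero_iff)
qed simp

lemma all_directions: "\<exists>ks. set ks = (UNIV :: 'n set)" by (rule finite_list) simp

lemma dense_H: "closure H = UNIV"
proof -
  obtain ks where ks: "set ks = (UNIV :: 'n set)" using all_directions by blast
  have "u \<in> closure H" for u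
  proof (rule Lim_in_closed_set[OF closed_closure _ _ mol_tendsto])
    have "mol ks r u \<in> H" if "r > 0" for r using mol_pd[OF that] ks unfolding H_def by auto
    then show "\<forall>\<^sub>F r in at_right 0. mol ks r u \<in> closure H"
      unfolding eventually_at_right_field using closure_subset by (intro exI[of _ 1]) auto
  qed simp
  then show ?thesis by auto
qed

text \<open>The translations inside the averages can be moved onto \<open>w\<close>, where the
  invariance of \<open>R\<close> absorbs them.\<close>

lemma mol_orthogonal:
  assumes r: "r > 0" and R: "\<And>y w. w \<in> R \<Longrightarrow> \<tau> y w \<in> R" and f: "\<And>w. w \<in> R \<Longrightarrow> inner f w = 0"
  shows "w \<in> R \<Longrightarrow> inner (mol ks r f) w = 0"
proof (induction ks arbitrary: w)
  case (Cons k ks)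
  have "inner (integral {0..r} (\<lambda>s. sh k s (mol ks r f))) w = integral {0..r} (\<lambda>s. inner (sh k s (mol ks r f)) w)"
    using integral_linear[OF sh_integrable bounded_linear_inner_left[of w]] by (simp add: o_def)
  also have "\<dots> = 0" using Cons.IH R[OF Cons.prems] by (simp add: inner_tau_swap)
  finally show ?case by (simp add: N_def)
qed (use f in simp)

end

section \<open>Averages over cubes and the dyadic multiplier estimate\<close>

context translation_group
begin

abbreviation cube :: "real \<Rightarrow> (real^'n) set" where "cube r \<equiv> cbox 0 (\<chi> i. r)"

lemma content_cube: "r \<ge> 0 \<Longrightarrow> measure lborel (cube r) = r ^ CARD('n)"
  by (subst content_cbox_cart) (auto simp: interval_ne_empty_cart)

text \<open>A single integral over the cube, unlike the iterated means above, so that translates can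
  be averaged against a weight by Tonelli's theorem.\<close>

definition M :: "real \<Rightarrow> 'a \<Rightarrow> 'a" where
  "M r u = inverse (r ^ CARD('n)) *\<^sub>R integral (cube r) (\<lambda>y. \<tau> y u)"

lemma tau_integrable: "(\<lambda>y. \<tau> y u) integrable_on cbox a b"
  by (intro integrable_continuous continuous_on_subset[OF tau_cont]) simp

lemma M_commuting:
  assumes A: "bounded_linear A" "\<And>y. A (\<tau> y u) = \<tau> y (A u)"
  shows "A (M r u) = M r (A u)"
proof -
  have "A (M r u) = inverse (r ^ CARD('n)) *\<^sub>R A (integral (cube r) (\<lambda>y. \<tau> y u))"
    unfolding M_def by (rule linear_scale[OF bounded_linear.linear[OF A(1)]])
  also have "A (integral (cube r) (\<lambda>y. \<tau> y u)) = integral (cube r) (A \<circ> (\<lambda>y. \<tau> y u))"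
    by (rule integral_linear[OF tau_integrable A(1), symmetric])
  finally show ?thesis by (simp add: M_def o_def A(2))
qed

lemma M_diff: "M r (u - v) = M r u - M r v"
  unfolding M_def tau_diff by (simp add: integral_diff tau_integrable scaleR_diff_right)

lemma M_approx:
  assumes r: "r > 0" and C: "\<And>y. y \<in> cube r \<Longrightarrow> norm (\<tau> y u - v) \<le> C"
  shows "norm (M r u - v) \<le> C"
proof -
  have "(0::real^'n) \<in> cube r" using r by (simp add: mem_box_cart)
  then have "C \<ge> 0" using C norm_ge_zero order_trans by blast
  have p: "r ^ CARD('n) > 0" using r by simp
  have "((\<lambda>y. \<tau> y u - v) has_integral (integral (cube r) (\<lambda>y. \<tau> y u) - measure lborel (cube r) *\<^sub>R v)) (cube r)"
    by (intro has_integral_diff integrable_integral tau_integrable has_integral_const)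
  from has_integral_bound[OF \<open>C \<ge> 0\<close> this C]
  have "norm (integral (cube r) (\<lambda>y. \<tau> y u) - r ^ CARD('n) *\<^sub>R v) \<le> C * r ^ CARD('n)"
    using r by (simp add: content_cube)
  then have b: "inverse (r ^ CARD('n)) * norm (integral (cube r) (\<lambda>y. \<tau> y u) - r ^ CARD('n) *\<^sub>R v)
      \<le> inverse (r ^ CARD('n)) * (C * r ^ CARD('n))" using p by (intro mult_left_mono) auto
  have "M r u - v = inverse (r ^ CARD('n)) *\<^sub>R (integral (cube r) (\<lambda>y. \<tau> y u) - r ^ CARD('n) *\<^sub>R v)"
    unfolding M_def using r by (simp add: scaleR_diff_right)
  then have "norm (M r u - v) = inverse (r ^ CARD('n)) * norm (integral (cube r) (\<lambda>y. \<tau> y u) - r ^ CARD('n) *\<^sub>R v)"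
    using r by simp
  also note b
  also have "inverse (r ^ CARD('n)) * (C * r ^ CARD('n)) = C" using r by simp
  finally show ?thesis .
qed

lemma norm_M: "r > 0 \<Longrightarrow> norm (M r u) \<le> norm u"
  using M_approx[of r u 0 "norm u"] by simp

lemma M_bounded_linear: "r > 0 \<Longrightarrow> bounded_linear (M r)"
proof (rule bounded_linear_intro[where K = 1])
  show "M r (x + y) = M r x + M r y" for x y
    unfolding M_def tau_plus by (simp add: integral_add tau_integrable scaleR_add_right)
  show "M r (c *\<^sub>R x) = c *\<^sub>R M r x" for c x
    unfolding M_def tau_scale by simp
qed (simp add: norm_M)

lemma M_M_commute:
  assumes "r > 0" shows "M r (M s u) = M s (M r u)"
  by (rule M_commuting[OF M_bounded_linear[OF assms]])
    (rule M_commuting[OF tau_bounded_linear tau_commute, symmetric])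

definition grad_norm :: "'a \<Rightarrow> real" where "grad_norm u = (\<Sum>k\<in>UNIV. norm (dd k u))"

lemma M_lipschitz:
  assumes "r > 0" "u \<in> H" shows "norm (M r u - u) \<le> r * grad_norm u"
proof (rule M_approx[OF assms(1)])
  fix y :: "real^'n" assume y: "y \<in> cube r"
  have "norm (\<tau> y u - u) \<le> (\<Sum>k\<in>UNIV. \<bar>y $ k\<bar> * norm (dd k u))" by (rule tau_lipschitz[OF assms(2)])
  also have "\<dots> \<le> (\<Sum>k\<in>UNIV. r * norm (dd k u))"
    using y by (intro sum_mono mult_right_mono) (auto simp: mem_box_cart)
  finally show "norm (\<tau> y u - u) \<le> r * grad_norm u" by (simp add: grad_norm_def sum_distrib_left)
qed

text \<open>
  Sobolev-type multiplier estimate: the dyadic telescope \<open>u = M\<^sub>J u - \<Sum>\<^sub>j (M\<^sub>j - M\<^sub>j\<^sub>+\<^sub>1) u\<close> is summed with a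
  truncation level that depends on the scale. The identity
  \<open>M\<^sub>r - M\<^sub>s = M\<^sub>r (1 - M\<^sub>s) + M\<^sub>s (M\<^sub>r - 1)\<close> lets each increment profit from both the smoothing and the gradient.
\<close>

lemma dyadic_multiplier_bound:
  assumes \<gamma>: "\<gamma> > 1/2" and \<beta>: "\<beta> \<ge> 0" and \<epsilon>: "\<epsilon> > 0"
  shows "\<exists>C\<ge>0. \<forall>T :: 'a \<Rightarrow> 'a. bounded_linear T \<longrightarrow>
      (\<forall>R\<ge>1. \<exists>T' :: 'a \<Rightarrow> 'a. bounded_linear T' \<and> (\<forall>v. norm (T v) \<le> R * norm v + norm (T' v)) \<and>
         (\<forall>r>0. \<forall>v. norm (T' (M r v)) \<le> \<beta> * R powr - \<gamma> * r powr - (3/2) * norm v)) \<longrightarrow>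
      (\<forall>u\<in>H. norm (T u) \<le> \<epsilon> * grad_norm u + C * norm u)"
proof -
  \<comment> \<open>At scale \<open>2^(-j)\<close> the weight is cut at height
    \<open>2^(j \<theta>)\<close>. The bounded part of an increment then decays like
    \<open>2^(-j (1 - \<theta>))\<close>, the singular part like
    \<open>2^(-j (\<theta> \<gamma> - 1/2))\<close>; the midpoint of \<open>1 / (2 \<gamma>)\<close>
    and 1 makes both exponents positive.\<close>
  define \<theta> where "\<theta> = (1 + 1 / (2 * \<gamma>)) / 2"
  have \<gamma>0: "\<gamma> > 0" using \<gamma> by simp
  have i: "1 / (2 * \<gamma>) < 1" using \<gamma> by simp
  have \<theta>: "0 < \<theta>" "\<theta> < 1" unfolding \<theta>_def using i \<gamma>0 by (auto simp: add_pos_pos)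
  have \<theta>\<gamma>: "\<theta> * \<gamma> > 1/2"
  proof -
    have "\<theta> > 1 / (2 * \<gamma>)" unfolding \<theta>_def using i by simp
    then show ?thesis using \<gamma>0 by (simp add: field_simps)
  qed
  define \<delta> where "\<delta> = min (1 - \<theta>) (\<theta> * \<gamma> - 1/2)"
  have \<delta>: "\<delta> > 0" "\<delta> \<le> 1 - \<theta>" "\<delta> \<le> \<theta> * \<gamma> - 1/2" unfolding \<delta>_def using \<theta> \<theta>\<gamma> by auto
  define \<rho> where "\<rho> = 2 powr (- \<delta>)"
  have \<rho>: "0 < \<rho>" "\<rho> < 1" unfolding \<rho>_def using \<delta> by (auto simp: powr_less_one)
  have \<rho>j: "2 powr (- real j * c) \<le> \<rho> ^ j" if "\<delta> \<le> c" for j c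
  proof -
    have "2 powr (- real j * c) \<le> 2 powr (- \<delta> * real j)"
      using that by (intro powr_mono) (auto simp: mult.commute intro!: mult_right_mono)
    also have "\<dots> = \<rho> ^ j" unfolding \<rho>_def
      by (subst powr_realpow[symmetric]) (simp_all add: powr_powr)
    finally show ?thesis .
  qed
  define K where "K = 2 + 4 * \<beta>"
  have K: "K > 0" unfolding K_def using \<beta> by simp
  have "(\<lambda>j. K / (1 - \<rho>) * \<rho> ^ j) \<longlonglongrightarrow> K / (1 - \<rho>) * 0"
    using \<rho> by (intro tendsto_intros LIMSEQ_realpow_zero) auto
  then have "\<forall>\<^sub>F j in sequentially. K / (1 - \<rho>) * \<rho> ^ j < \<epsilon>" using \<epsilon> by (intro order_tendstoD(2)) auto
  then obtain j0 where j0: "K / (1 - \<rho>) * \<rho> ^ j0 < \<epsilon>" by (auto simp: eventually_sequentially)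
  define r where "r j = 2 powr - real j" for j
  have r: "r j > 0" for j unfolding r_def by simp
  have r0: "r \<longlonglongrightarrow> 0"
  proof -
    have "r = (\<lambda>j. (1/2) ^ j)" unfolding r_def powr_minus
      by (simp add: powr_realpow power_one_over inverse_eq_divide)
    then show ?thesis by (simp add: LIMSEQ_realpow_zero)
  qed
  \<comment> \<open>The average at the fixed scale \<open>r j0\<close> is estimated with truncation
    level 1; all finer increments together cost at most \<epsilon> times the gradient, by the choice
    of \<open>j0\<close>.\<close>
  define C where "C = 1 + \<beta> * r j0 powr - (3/2)"
  show ?thesis
  proof (intro exI[of _ C] conjI allI impI ballI)
    show "C \<ge> 0" unfolding C_def using \<beta> by simp
    fix T :: "'a \<Rightarrow> 'a" and u
    assume T: "bounded_linear T" and u: "u \<in> H"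
      and spl: "\<forall>R\<ge>1. \<exists>T' :: 'a \<Rightarrow> 'a. bounded_linear T' \<and> (\<forall>v. norm (T v) \<le> R * norm v + norm (T' v)) \<and>
         (\<forall>r>0. \<forall>v. norm (T' (M r v)) \<le> \<beta> * R powr - \<gamma> * r powr - (3/2) * norm v)"
    define G where "G = grad_norm u"
    have G: "G \<ge> 0" unfolding G_def grad_norm_def by (simp add: sum_nonneg)
    have step: "norm (T (M (r j) u - M (r (Suc j)) u)) \<le> K * G * \<rho> ^ j" for j
    proof -
      define R where "R = 2 powr (real j * \<theta>)"
      have "R \<ge> 1" unfolding R_def using \<theta> by (simp add: ge_one_powr_ge_zero)
      then obtain T' :: "'a \<Rightarrow> 'a" where T': "bounded_linear T'" "\<And>v. norm (T v) \<le> R * norm v + norm (T' v)"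
         "\<And>r v. r > 0 \<Longrightarrow> norm (T' (M r v)) \<le> \<beta> * R powr - \<gamma> * r powr - (3/2) * norm v"
        using spl[rule_format, OF \<open>R \<ge> 1\<close>] by blast
      let ?a = "r j" and ?b = "r (Suc j)"
      have b: "?b = ?a / 2" unfolding r_def by (simp add: powr_diff powr_minus_divide)
      have e: "M ?a u - M ?b u = M ?a (u - M ?b u) + M ?b (M ?a u - u)"
        using M_M_commute[OF r, of j "r (Suc j)" u] by (simp add: M_diff)
      have 1: "norm (M ?a u - M ?b u) \<le> 2 * ?a * G"
      proof -
        have "M ?a u - M ?b u = (M ?a u - u) - (M ?b u - u)" by simp
        then have "norm (M ?a u - M ?b u) \<le> norm (M ?a u - u) + norm (M ?b u - u)" by (metis norm_triangle_ineq4)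
        also have "\<dots> \<le> ?a * G + ?b * G" unfolding G_def by (intro add_mono M_lipschitz r u)
        also have "\<dots> \<le> 2 * ?a * G" unfolding b using r[of j] G by (simp add: field_simps)
        finally show ?thesis .
      qed
      have bp: "?b powr - (3/2) = ?a powr - (3/2) * 2 powr (3/2)"
        unfolding b using r[of j] by (simp add: powr_divide powr_minus_divide)
      have 2: "norm (T' (M ?a u - M ?b u)) \<le> 4 * \<beta> * G * R powr - \<gamma> * ?a powr (- (1/2))"
      proof -
        have "norm (T' (M ?a u - M ?b u)) \<le> norm (T' (M ?a (u - M ?b u))) + norm (T' (M ?b (M ?a u - u)))"
          unfolding e linear_add[OF bounded_linear.linear[OF T'(1)]] by (rule norm_triangle_ineq)
        also have "\<dots> \<le> \<beta> * R powr - \<gamma> * ?a powr - (3/2) * (?b * G) + \<beta> * R powr - \<gamma> * ?b powr - (3/2) * (?a * G)"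
          unfolding G_def using \<beta>
          by (intro add_mono order_trans[OF T'(3)[OF r]] mult_left_mono)
            (auto simp: norm_minus_commute[of u] intro!: M_lipschitz r u)
        also have "\<dots> = \<beta> * G * R powr - \<gamma> * (?a powr - (3/2) * ?a) * (1 / 2 + 2 powr (3/2))"
          by (simp only: bp) (simp add: b algebra_simps)
        also have "?a powr - (3/2) * ?a = ?a powr - (1/2)"
        proof -
          have "?a powr - (1/2) = ?a powr (- (3/2) + 1)" by simp
          also have "\<dots> = ?a powr - (3/2) * ?a powr 1" by (rule powr_add)
          also have "?a powr 1 = ?a" using r[of j] by (simp only: powr_one_gt_zero_iff)
          finally show ?thesis by simp
        qed
        \<comment> \<open>The summands \<open>1 / 2\<close> and \<open>2 powr (3/2)\<close> arise
          from halving the scale; rounding their sum up gives the 4 in \<open>K\<close>.\<close>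
        also have "\<beta> * G * R powr - \<gamma> * ?a powr - (1/2) * (1 / 2 + 2 powr (3/2)) \<le> \<beta> * G * R powr - \<gamma> * ?a powr - (1/2) * 4"
        proof (rule mult_left_mono)
          have "(2 powr (3/2))\<^sup>2 = (2::real) powr (3/2 + 3/2)" unfolding power2_eq_square by (rule powr_add[symmetric])
          also have "\<dots> = 8" by (simp add: powr_numeral)
          also have "\<dots> \<le> (7/2::real)\<^sup>2" by (simp add: power2_eq_square)
          finally have "2 powr (3/2) \<le> (7/2::real)" by (rule power2_le_imp_le) simp
          then show "1 / 2 + 2 powr (3/2) \<le> (4::real)" by simp
        qed (use \<beta> G in simp)
        finally show ?thesis by (simp add: algebra_simps)
      qed
      have "norm (T (M ?a u - M ?b u)) \<le> R * (2 * ?a * G) + 4 * \<beta> * G * R powr - \<gamma> * ?a powr (- (1/2))"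
        using 2 \<open>R \<ge> 1\<close> by (intro order_trans[OF T'(2)] add_mono mult_left_mono 1) auto
      also have "R * (2 * ?a * G) = 2 * G * 2 powr (- real j * (1 - \<theta>))"
        unfolding R_def r_def by (simp add: powr_add[symmetric] algebra_simps)
      also have "4 * \<beta> * G * R powr - \<gamma> * ?a powr (- (1/2)) = 4 * \<beta> * G * 2 powr (- real j * (\<theta> * \<gamma> - 1/2))"
        unfolding R_def r_def powr_powr mult.assoc powr_add[symmetric] by (simp add: algebra_simps)
      also have "2 * G * 2 powr (- real j * (1 - \<theta>)) + 4 * \<beta> * G * 2 powr (- real j * (\<theta> * \<gamma> - 1/2))
          \<le> 2 * G * \<rho> ^ j + 4 * \<beta> * G * \<rho> ^ j"
        using G \<beta> by (intro add_mono mult_left_mono \<rho>j \<delta>) auto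
      finally show ?thesis unfolding K_def by (simp add: algebra_simps)
    qed
    have head: "norm (T (M (r j0) u)) \<le> C * norm u"
    proof -
      obtain T' :: "'a \<Rightarrow> 'a" where T': "\<And>v. norm (T v) \<le> 1 * norm v + norm (T' v)"
         "\<And>r v. r > 0 \<Longrightarrow> norm (T' (M r v)) \<le> \<beta> * 1 powr - \<gamma> * r powr - (3/2) * norm v"
        using spl[rule_format, of 1] by auto
      have "norm (T (M (r j0) u)) \<le> norm (M (r j0) u) + norm (T' (M (r j0) u))" using T'(1)[of "M (r j0) u"] by simp
      also have "\<dots> \<le> norm u + \<beta> * r j0 powr - (3/2) * norm u"
        using T'(2)[OF r, of j0 u] by (intro add_mono norm_M r) simp
      finally show ?thesis unfolding C_def by (simp add: algebra_simps)
    qed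
    have tail: "norm (T (M (r (j0 + n)) u)) \<le> C * norm u + K * G * \<rho> ^ j0 * (\<Sum>i<n. \<rho> ^ i)" for n
    proof (induction n)
      case 0 show ?case using head by simp
    next
      case (Suc n)
      have "T (M (r (j0 + Suc n)) u) = T (M (r (j0 + n)) u) - T (M (r (j0 + n)) u - M (r (Suc (j0 + n))) u)"
        by (simp add: linear_diff[OF bounded_linear.linear[OF T]])
      then have "norm (T (M (r (j0 + Suc n)) u)) \<le> norm (T (M (r (j0 + n)) u)) + norm (T (M (r (j0 + n)) u - M (r (Suc (j0 + n))) u))"
        by (metis norm_triangle_ineq4)
      also have "\<dots> \<le> (C * norm u + K * G * \<rho> ^ j0 * (\<Sum>i<n. \<rho> ^ i)) + K * G * \<rho> ^ (j0 + n)"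
        by (intro add_mono Suc.IH step)
      finally show ?case by (simp add: algebra_simps power_add)
    qed
    have geo: "(\<Sum>i<n. \<rho> ^ i) \<le> 1 / (1 - \<rho>)" for n
    proof -
      have "(\<Sum>i<n. \<rho> ^ i) = (1 - \<rho> ^ n) / (1 - \<rho>)" using \<rho> by (simp add: sum_gp_strict)
      also have "\<dots> \<le> 1 / (1 - \<rho>)" using \<rho> by (intro divide_right_mono) auto
      finally show ?thesis .
    qed
    have bnd: "norm (T (M (r (j0 + n)) u)) \<le> \<epsilon> * G + C * norm u" for n
    proof -
      have "K * G * \<rho> ^ j0 * (\<Sum>i<n. \<rho> ^ i) \<le> K * G * \<rho> ^ j0 * (1 / (1 - \<rho>))"
        using K G \<rho> by (intro mult_left_mono geo) auto
      also have "\<dots> = (K / (1 - \<rho>) * \<rho> ^ j0) * G" by simp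
      also have "\<dots> \<le> \<epsilon> * G" using j0 G by (intro mult_right_mono) auto
      finally show ?thesis using tail[of n] by linarith
    qed
    have "(\<lambda>n. M (r n) u - u) \<longlonglongrightarrow> 0"
    proof (rule Lim_null_comparison)
      show "\<forall>\<^sub>F n in sequentially. norm (M (r n) u - u) \<le> r n * grad_norm u"
        by (intro always_eventually allI M_lipschitz r u)
      show "(\<lambda>n. r n * grad_norm u) \<longlonglongrightarrow> 0"
        using tendsto_mult[OF r0 tendsto_const[of "grad_norm u"]] by simp
    qed
    then have "(\<lambda>n. M (r n) u) \<longlonglongrightarrow> u" by (rule LIM_zero_cancel)
    \<comment> \<open>Boundedness of \<open>T\<close> enters the limit without its norm: the
      constants come from the splitting alone and are therefore the same for all truncations of a
      weight.\<close>
    then have "(\<lambda>n. T (M (r (n + j0)) u)) \<longlonglongrightarrow> T u"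
      by (intro bounded_linear.tendsto[OF T] LIMSEQ_ignore_initial_segment)
    then show "norm (T u) \<le> \<epsilon> * grad_norm u + C * norm u"
      by (rule tendsto_upperbound[OF tendsto_norm])
        (use bnd in \<open>auto simp: G_def add.commute\<close>)
  qed
qed

end


section \<open>The Weyl operator\<close>

text \<open>An abstract Clifford structure; its model is left multiplication by the Pauli
  matrices.\<close>

locale weyl_operator = translation_group \<tau> for \<tau> :: "real^'n::finite \<Rightarrow> 'a::{real_inner,banach} \<Rightarrow> 'a" +
  fixes \<sigma> :: "'n \<Rightarrow> 'a \<Rightarrow> 'a"
  assumes sigma_bounded_linear: "bounded_linear (\<sigma> k)"
    and sigma_sym: "inner (\<sigma> k u) v = inner u (\<sigma> k v)"
    and sigma_sq: "\<sigma> k (\<sigma> k u) = u"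
    and sigma_anti: "j \<noteq> k \<Longrightarrow> \<sigma> j (\<sigma> k u) = - \<sigma> k (\<sigma> j u)"
    and sigma_tau: "\<sigma> k (\<tau> y u) = \<tau> y (\<sigma> k u)"
begin

definition D :: "'a \<Rightarrow> 'a" where "D u = (\<Sum>k\<in>UNIV. \<sigma> k (dd k u))"

lemma sigma_add: "\<sigma> k (u + v) = \<sigma> k u + \<sigma> k v"
  by (rule linear_add[OF bounded_linear.linear[OF sigma_bounded_linear]])
lemma sigma_scale: "\<sigma> k (c *\<^sub>R u) = c *\<^sub>R \<sigma> k u"
  by (rule linear_scale[OF bounded_linear.linear[OF sigma_bounded_linear]])
lemma sigma_diff: "\<sigma> k (u - v) = \<sigma> k u - \<sigma> k v"
  by (rule linear_diff[OF bounded_linear.linear[OF sigma_bounded_linear]])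

lemma norm_sigma [simp]: "norm (\<sigma> k u) = norm u"
  by (simp add: norm_eq_sqrt_inner sigma_sym sigma_sq)

lemma D_add: "x \<in> H \<Longrightarrow> y \<in> H \<Longrightarrow> D (x + y) = D x + D y"
  unfolding D_def by (simp add: dd_add sigma_add sum.distrib)
lemma D_scale: "x \<in> H \<Longrightarrow> D (c *\<^sub>R x) = c *\<^sub>R D x"
  unfolding D_def by (simp add: dd_scale sigma_scale scaleR_sum_right)
lemma D_diff: "x \<in> H \<Longrightarrow> y \<in> H \<Longrightarrow> D (x - y) = D x - D y"
  unfolding D_def by (simp add: dd_diff sigma_diff sum_subtractf)

lemma dd_tau:
  assumes "u \<in> H" shows "\<tau> y u \<in> H" "dd k (\<tau> y u) = \<tau> y (dd k u)"
proof -
  have "pd k (\<tau> y u) (\<tau> y (dd k u))" for k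
    by (rule pd_commuting[OF pd_dd[OF assms] tau_bounded_linear tau_commute])
  then show "\<tau> y u \<in> H" "dd k (\<tau> y u) = \<tau> y (dd k u)" by (rule H_I, rule dd_eq)
qed

lemma D_tau: "u \<in> H \<Longrightarrow> D (\<tau> y u) = \<tau> y (D u)"
  unfolding D_def by (simp add: dd_tau sigma_tau linear_sum[OF tau_linear])

lemma D_skew:
  assumes "u \<in> H" shows "inner (D u) u = 0"
proof -
  have "inner (\<sigma> k (dd k u)) u = 0" for k
  proof -
    have "pd k (\<sigma> k u) (\<sigma> k (dd k u))"
      by (rule pd_commuting[OF pd_dd[OF assms] sigma_bounded_linear sigma_tau])
    from pd_skew[OF pd_dd[OF assms] this] show ?thesis by (simp add: sigma_sym inner_commute)
  qed
  then show ?thesis unfolding D_def by (simp add: inner_sum_left)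
qed

text \<open>Central differences are exactly skew, which one-sided quotients are not; they also
  commute and are bounded, and so can replace second derivatives.\<close>

definition cd :: "'n \<Rightarrow> real \<Rightarrow> 'a \<Rightarrow> 'a" where "cd k h u = (sh k h u - sh k (- h) u) /\<^sub>R (2 * h)"

lemma cd_tendsto:
  assumes "u \<in> H" shows "((\<lambda>h. cd k h u) \<longlongrightarrow> dd k u) (at 0)"
proof -
  let ?c = "\<lambda>s. sh k s u"
  have d: "(?c has_vector_derivative dd k u) (at 0)" using pd_dd[OF assms] unfolding pd_def .
  have "(?c \<circ> uminus has_vector_derivative ((-1) *\<^sub>R dd k u)) (at 0)"
    using d by (intro vector_diff_chain_at) (auto intro!: derivative_eq_intros)
  then have "((\<lambda>h. ?c h - ?c (- h)) has_vector_derivative (dd k u - (-1) *\<^sub>R dd k u)) (at 0)"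
    using d by (intro has_vector_derivative_diff) (auto simp: o_def)
  then have "((\<lambda>h. (1/2) *\<^sub>R ((?c h - ?c (- h)) /\<^sub>R h)) \<longlongrightarrow> (1/2) *\<^sub>R (dd k u - (-1) *\<^sub>R dd k u)) (at 0)"
    unfolding has_vector_derivative_iff_quotient by (intro tendsto_scaleR tendsto_const) simp
  moreover have "(1/2) *\<^sub>R (dd k u - (-1) *\<^sub>R dd k u) = dd k u" by (simp flip: scaleR_2)
  ultimately show ?thesis unfolding cd_def by (simp add: mult.commute)
qed

lemma cd_skew: "inner (cd k h u) v = - inner u (cd k h v)"
  unfolding cd_def by (simp add: inner_diff_left inner_diff_right inner_tau_swap axis_minus_real algebra_simps)

lemma cd_commute: "cd j h (cd k h u) = cd k h (cd j h u)"
  unfolding cd_def tau_scale tau_diff tau_commute[of "axis j h" "axis k h"] tau_commute[of "axis j h" "axis k (- h)"]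
    tau_commute[of "axis j (- h)" "axis k h"] tau_commute[of "axis j (- h)" "axis k (- h)"]
  by (simp add: scaleR_diff_right)

lemma cd_sigma: "cd j h (\<sigma> k u) = \<sigma> k (cd j h u)"
  unfolding cd_def by (simp add: sigma_tau sigma_scale sigma_diff)

text \<open>Formally one integrates by parts twice and uses anticommutation. Since \<open>u\<close>
  has only first derivatives, this is carried out for central differences, whose step then tends to
  zero.\<close>

lemma cross_terms:
  assumes "u \<in> H" "j \<noteq> k"
  shows "inner (\<sigma> j (dd j u)) (\<sigma> k (dd k u)) = - inner (\<sigma> k (dd k u)) (\<sigma> j (dd j u))"
proof -
  have eq: "inner (\<sigma> j (cd j h u)) (\<sigma> k (cd k h u)) = - inner (\<sigma> k (cd k h u)) (\<sigma> j (cd j h u))" for h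
  proof -
    have "inner (\<sigma> j (cd j h u)) (\<sigma> k (cd k h u)) = inner (cd j h (\<sigma> j u)) (cd k h (\<sigma> k u))" by (simp add: cd_sigma)
    also have "\<dots> = - inner (\<sigma> j u) (cd k h (cd j h (\<sigma> k u)))" by (simp add: cd_skew cd_commute)
    also have "\<dots> = inner (cd k h (\<sigma> j u)) (cd j h (\<sigma> k u))" by (simp add: cd_skew[of k])
    also have "\<dots> = inner (cd k h u) (\<sigma> j (\<sigma> k (cd j h u)))" by (simp add: cd_sigma sigma_sym)
    also have "\<dots> = - inner (\<sigma> k (cd k h u)) (\<sigma> j (cd j h u))" unfolding sigma_anti[OF assms(2)] by (simp add: sigma_sym)
    finally show ?thesis .
  qed
  have "((\<lambda>h. inner (\<sigma> j (cd j h u)) (\<sigma> k (cd k h u))) \<longlongrightarrow> inner (\<sigma> j (dd j u)) (\<sigma> k (dd k u))) (at 0)"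
    by (intro tendsto_inner bounded_linear.tendsto[OF sigma_bounded_linear] cd_tendsto assms)
  moreover have "((\<lambda>h. - inner (\<sigma> k (cd k h u)) (\<sigma> j (cd j h u))) \<longlongrightarrow> - inner (\<sigma> k (dd k u)) (\<sigma> j (dd j u))) (at 0)"
    by (intro tendsto_inner tendsto_minus bounded_linear.tendsto[OF sigma_bounded_linear] cd_tendsto assms)
  ultimately show ?thesis unfolding eq using tendsto_unique[OF at_neq_bot] by blast
qed

text \<open>Anticommutation removes the cross terms, so \<open>D\<close> controls every first
  derivative and its graph norm is the H1 norm.\<close>

lemma norm_D:
  assumes "u \<in> H" shows "(norm (D u))\<^sup>2 = (\<Sum>k\<in>UNIV. (norm (dd k u))\<^sup>2)"
proof -
  have z: "inner (\<sigma> j (dd j u)) (\<sigma> k (dd k u)) = 0" if "j \<noteq> k" for j k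
    using cross_terms[OF assms that] by (simp add: inner_commute)
  have "(norm (D u))\<^sup>2 = (\<Sum>j\<in>UNIV. \<Sum>k\<in>UNIV. inner (\<sigma> j (dd j u)) (\<sigma> k (dd k u)))"
    unfolding power2_norm_eq_inner D_def inner_sum_left inner_sum_right by (rule sum.swap)
  also have "\<dots> = (\<Sum>j\<in>UNIV. \<Sum>k\<in>UNIV. if j = k then (norm (dd j u))\<^sup>2 else 0)"
    by (intro sum.cong refl) (auto simp: z power2_norm_eq_inner[symmetric])
  finally show ?thesis by simp
qed

lemma norm_dd_le:
  assumes "u \<in> H" shows "norm (dd k u) \<le> norm (D u)"
proof (rule power2_le_imp_le)
  show "(norm (dd k u))\<^sup>2 \<le> (norm (D u))\<^sup>2" unfolding norm_D[OF assms]
    by (rule member_le_sum) auto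
qed simp

lemma grad_norm_le: "u \<in> H \<Longrightarrow> grad_norm u \<le> real CARD('n) * norm (D u)"
  unfolding grad_norm_def using sum_bounded_above[of UNIV "\<lambda>k. norm (dd k u)" "norm (D u)"] norm_dd_le by auto

lemma norm_resolvent_D:
  assumes "u \<in> H" shows "(norm (u - b *\<^sub>R D u))\<^sup>2 = (norm u)\<^sup>2 + b\<^sup>2 * (norm (D u))\<^sup>2"
proof -
  have "inner u (D u) = 0" using D_skew[OF assms] by (simp add: inner_commute)
  then show ?thesis using D_skew[OF assms] unfolding power2_norm_eq_inner
    by (simp only: inner_diff_left inner_diff_right inner_scaleR_left inner_scaleR_right)
      (simp add: power2_eq_square)
qed

text \<open>The range is closed because \<open>norm_resolvent_D\<close> and \<open>norm_D\<close>
  bound a preimage and each of its derivatives by the right-hand side. It is dense because a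
  mollified vector \<open>g\<close> orthogonal to it satisfies
  \<open>|g|^2 = \<langle>g, g - b D g\<rangle> = 0\<close>.\<close>

lemma resolvent_surjective:
  assumes b: "b \<noteq> 0"
  shows "\<exists>u\<in>H. u - b *\<^sub>R D u = f"
proof -
  define R where "R = (\<lambda>u. u - b *\<^sub>R D u) ` H"
  have "R = UNIV"
  proof (rule closed_subspace_dense_eq_UNIV)
    show "subspace R"
    proof (rule subspaceI)
      have "0 - b *\<^sub>R D 0 = 0" using D_scale[of 0 0] subspace_0[OF subspace_H] by simp
      then show "0 \<in> R" unfolding R_def using subspace_0[OF subspace_H]
        by (intro image_eqI[of _ _ 0]) auto
      show "x + y \<in> R" if xy: "x \<in> R" "y \<in> R" for x y
      proof -
        obtain u v where "u \<in> H" "v \<in> H" "x = u - b *\<^sub>R D u" "y = v - b *\<^sub>R D v"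
          using xy unfolding R_def by blast
        then have "x + y = (u + v) - b *\<^sub>R D (u + v)" "u + v \<in> H"
          using subspace_add[OF subspace_H] by (auto simp: D_add scaleR_add_right)
        then show ?thesis unfolding R_def by (rule image_eqI)
      qed
      show "c *\<^sub>R x \<in> R" if cx: "x \<in> R" for c x
      proof -
        obtain u where "u \<in> H" "x = u - b *\<^sub>R D u" using cx unfolding R_def by blast
        then have "c *\<^sub>R x = (c *\<^sub>R u) - b *\<^sub>R D (c *\<^sub>R u)" "c *\<^sub>R u \<in> H"
          using subspace_scale[OF subspace_H] by (auto simp: D_scale scaleR_diff_right mult.commute)
        then show ?thesis unfolding R_def by (rule image_eqI)
      qed
    qed
    show "closed R"
      unfolding closed_sequential_limits
    proof (intro allI impI, elim conjE)
      fix y l assume "\<forall>n. y n \<in> R" and l: "y \<longlonglongrightarrow> l"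
      then obtain u where u: "\<And>n. u n \<in> H" "\<And>n. y n = u n - b *\<^sub>R D (u n)" unfolding R_def image_iff by metis
      have uH: "u m - u n \<in> H" for m n using subspace_diff[OF subspace_H] u by blast
      have yd: "(norm (y m - y n))\<^sup>2 = (norm (u m - u n))\<^sup>2 + b\<^sup>2 * (norm (D (u m - u n)))\<^sup>2" for m n
        using norm_resolvent_D[OF uH, of m n b] by (simp add: u D_diff algebra_simps)
      have cy: "Cauchy y" using l LIMSEQ_imp_Cauchy by blast
      have 1: "norm (u m - u n) \<le> norm (y m - y n)" for m n
        by (rule power2_le_imp_le) (auto simp: yd)
      have 2: "norm (D (u m - u n)) \<le> norm (y m - y n) / \<bar>b\<bar>" for m n
      proof -
        have "(\<bar>b\<bar> * norm (D (u m - u n)))\<^sup>2 \<le> (norm (y m - y n))\<^sup>2"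
          unfolding yd by (simp add: power_mult_distrib)
        then have "\<bar>b\<bar> * norm (D (u m - u n)) \<le> norm (y m - y n)" by (rule power2_le_imp_le) simp
        then show ?thesis using b by (simp add: field_simps)
      qed
      have conv: "convergent v" if "\<And>m n. norm (v m - v n :: 'a) \<le> c * norm (y m - y n)" "c > 0" for v c
      proof -
        have "Cauchy v"
        proof (rule metric_CauchyI)
          fix e :: real assume "e > 0"
          then obtain N where N: "\<And>m n. m \<ge> N \<Longrightarrow> n \<ge> N \<Longrightarrow> dist (y m) (y n) < e / c"
            using metric_CauchyD[OF cy, of "e / c"] \<open>c > 0\<close> by auto
          have "dist (v m) (v n) < e" if "m \<ge> N" "n \<ge> N" for m n
          proof -
            have "c * norm (y m - y n) < e" using N[OF that] \<open>c > 0\<close> by (simp add: dist_norm field_simps)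
            then show ?thesis using \<open>norm (v m - v n) \<le> c * norm (y m - y n)\<close> by (simp add: dist_norm)
          qed
          then show "\<exists>M. \<forall>m\<ge>M. \<forall>n\<ge>M. dist (v m) (v n) < e" by blast
        qed
        then show ?thesis by (rule Cauchy_convergent)
      qed
      have "convergent u" using 1 by (intro conv[where c = 1]) auto
      then obtain u0 where u0: "u \<longlonglongrightarrow> u0" unfolding convergent_def by blast
      have "convergent (\<lambda>n. dd k (u n))" for k
      proof (rule conv[where c = "1 / \<bar>b\<bar>"])
        show "norm (dd k (u m) - dd k (u n)) \<le> 1 / \<bar>b\<bar> * norm (y m - y n)" for m n
          using norm_dd_le[OF uH, of k m n] 2[of m n] u by (simp add: dd_diff)
      qed (use b in simp)
      then obtain g where g: "\<And>k. (\<lambda>n. dd k (u n)) \<longlonglongrightarrow> g k" unfolding convergent_def by metis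
      have pd: "pd k u0 (g k)" for k by (rule pd_closed[OF pd_dd[OF u(1)] u0 g])
      then have H: "u0 \<in> H" by (rule H_I)
      have "(\<lambda>n. D (u n)) \<longlonglongrightarrow> D u0"
        unfolding D_def dd_eq[OF pd] by (intro tendsto_sum bounded_linear.tendsto[OF sigma_bounded_linear] g)
      then have "y \<longlonglongrightarrow> u0 - b *\<^sub>R D u0"
        unfolding u(2)[abs_def] by (intro tendsto_intros u0)
      then have "l = u0 - b *\<^sub>R D u0" using l LIMSEQ_unique by blast
      then show "l \<in> R" unfolding R_def using H by (rule image_eqI)
    qed
    fix f assume f: "\<And>w. w \<in> R \<Longrightarrow> inner f w = 0"
    obtain ks where ks: "set ks = (UNIV :: 'n set)" using all_directions by blast
    \<comment> \<open>As \<open>R\<close> is invariant under translations, mollifying \<open>f\<close> moves it into \<open>H\<close> and keeps it orthogonal to \<open>R\<close>.\<close>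
    have tR: "\<tau> y w \<in> R" if wR: "w \<in> R" for y w
    proof -
      obtain u where u: "u \<in> H" "w = u - b *\<^sub>R D u" using wR unfolding R_def by blast
      then have "\<tau> y w = \<tau> y u - b *\<^sub>R D (\<tau> y u)" by (simp add: D_tau tau_diff tau_scale)
      then show ?thesis unfolding R_def using dd_tau(1)[OF u(1)] by (rule image_eqI)
    qed
    have "mol ks r f = 0" if r: "r > 0" for r
    proof -
      define g where "g = mol ks r f"
      have g: "g \<in> H" unfolding g_def H_def using mol_pd[OF r] ks by auto
      then have "inner g (g - b *\<^sub>R D g) = 0"
        unfolding g_def by (intro mol_orthogonal[OF r tR f]) (auto simp: R_def)
      then have "inner g g = 0" using D_skew[OF g] by (simp add: inner_diff_right inner_commute)
      then show ?thesis unfolding g_def by simp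
    qed
    then have "\<forall>\<^sub>F r in at_right 0. mol ks r f = 0"
      unfolding eventually_at_right_field by (intro exI[of _ 1]) auto
    then have "((\<lambda>r. 0) \<longlongrightarrow> f) (at_right (0::real))"
      using mol_tendsto by (rule Lim_transform_eventually[rotated])
    then show "f = 0" by (simp add: tendsto_const_iff)
  qed
  then show ?thesis unfolding R_def by (metis (mono_tags, lifting) UNIV_I image_iff)
qed

lemma D_skew_generator: "skew_generator H D 1"
proof
  show "\<exists>u\<in>H. u - a *\<^sub>R D u = f" if "0 < a" for a f using that by (intro resolvent_surjective) simp
  show "\<exists>u\<in>H. u + a *\<^sub>R D u = f" if "0 < a" for a f using that resolvent_surjective[of "- a" f] by simp
qed (simp_all add: subspace_H D_add D_scale D_skew dense_H)

end

section \<open>The Hilbert space of square integrable functions\<close>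

text \<open>
  Elements are classes of Borel functions with respect to \<open>lborel\<close>; this keeps translations and
  Tonelli's theorem free of completions.
\<close>

definition sq_int :: "('a::euclidean_space \<Rightarrow> 'b::euclidean_space) \<Rightarrow> bool" where
  "sq_int f \<longleftrightarrow> f \<in> borel_measurable borel \<and> integrable lborel (\<lambda>x. (norm (f x))\<^sup>2)"

definition l2_rel :: "('a::euclidean_space \<Rightarrow> 'b::euclidean_space) \<Rightarrow> ('a \<Rightarrow> 'b) \<Rightarrow> bool" where
  "l2_rel f g \<longleftrightarrow> sq_int f \<and> sq_int g \<and> (AE x in lborel. f x = g x)"

lemma sq_int_zero: "sq_int (\<lambda>x. 0)" unfolding sq_int_def by simp

lemma part_equivp_l2_rel: "part_equivp l2_rel"
proof (rule part_equivpI)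
  show "\<exists>f. l2_rel f f" using sq_int_zero unfolding l2_rel_def by auto
  show "symp l2_rel" unfolding symp_def l2_rel_def by auto
  show "transp l2_rel" unfolding transp_def l2_rel_def by auto
qed

quotient_type (overloaded) ('a, 'b) l2 = "'a::euclidean_space \<Rightarrow> 'b::euclidean_space" / partial: l2_rel
  morphisms rp l2_of
  by (rule part_equivp_l2_rel)

lemma rp_sq_int [simp]: "sq_int (rp u)"
  using Quotient3_rep_reflp[OF Quotient3_l2, of u] unfolding l2_rel_def by blast

lemma rp_measurable [measurable, simp]: "rp u \<in> borel_measurable borel"
  using rp_sq_int[of u] unfolding sq_int_def by blast

lemma l2_of_rp [simp]: "l2_of (rp u) = u" by (rule Quotient3_abs_rep[OF Quotient3_l2])

lemma rp_l2_of: "sq_int f \<Longrightarrow> AE x in lborel. rp (l2_of f) x = f x"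
  using Quotient3_rep_abs[OF Quotient3_l2, of f] unfolding l2_rel_def by auto

lemma l2_of_eq_iff: "sq_int f \<Longrightarrow> sq_int g \<Longrightarrow> l2_of f = l2_of g \<longleftrightarrow> (AE x in lborel. f x = g x)"
  using Quotient3_rel[OF Quotient3_l2, of f g] unfolding l2_rel_def by auto

lemma l2_eqI: "(AE x in lborel. rp u x = rp v x) \<Longrightarrow> u = v"
  using l2_of_eq_iff[of "rp u" "rp v"] by simp

lemma sq_int_bound:
  assumes "f \<in> borel_measurable borel" "sq_int g" "\<And>x. norm (f x) \<le> c * norm (g x)"
  shows "sq_int f"
  unfolding sq_int_def
proof
  show "integrable lborel (\<lambda>x. (norm (f x))\<^sup>2)"
  proof (rule Bochner_Integration.integrable_bound)
    show "integrable lborel (\<lambda>x. c\<^sup>2 * (norm (g x))\<^sup>2)" using assms(2) unfolding sq_int_def by simp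
    show "AE x in lborel. norm ((norm (f x))\<^sup>2) \<le> norm (c\<^sup>2 * (norm (g x))\<^sup>2)"
      using assms(3) by (auto simp: power_mult_distrib[symmetric] intro!: power_mono)
  qed (use assms(1) in measurable)
qed (rule assms(1))

lemma sq_int_add:
  assumes "sq_int f" "sq_int g" shows "sq_int (\<lambda>x. f x + g x)"
  unfolding sq_int_def
proof
  have [measurable]: "f \<in> borel_measurable borel" "g \<in> borel_measurable borel"
    using assms unfolding sq_int_def by auto
  show "(\<lambda>x. f x + g x) \<in> borel_measurable borel" by measurable
  show "integrable lborel (\<lambda>x. (norm (f x + g x))\<^sup>2)"
  proof (rule Bochner_Integration.integrable_bound)
    show "integrable lborel (\<lambda>x. 2 * (norm (f x))\<^sup>2 + 2 * (norm (g x))\<^sup>2)"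
      using assms unfolding sq_int_def by simp
    have "(norm (f x + g x))\<^sup>2 \<le> 2 * (norm (f x))\<^sup>2 + 2 * (norm (g x))\<^sup>2" for x
    proof -
      have "(norm (f x + g x))\<^sup>2 \<le> (norm (f x) + norm (g x))\<^sup>2" by (intro power_mono norm_triangle_ineq) auto
      also have "\<dots> \<le> 2 * (norm (f x))\<^sup>2 + 2 * (norm (g x))\<^sup>2"
        using zero_le_power2[of "norm (f x) - norm (g x)"] by (simp add: power2_sum power2_diff)
      finally show ?thesis .
    qed
    then show "AE x in lborel. norm ((norm (f x + g x))\<^sup>2) \<le> norm (2 * (norm (f x))\<^sup>2 + 2 * (norm (g x))\<^sup>2)"
      by auto
  qed simp
qed

lemma sq_int_scale: "sq_int f \<Longrightarrow> sq_int (\<lambda>x. c *\<^sub>R f x)"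
  by (rule sq_int_bound[where c = "\<bar>c\<bar>"]) (auto simp: sq_int_def)

lemma sq_int_minus: "sq_int f \<Longrightarrow> sq_int (\<lambda>x. - f x)"
  using sq_int_scale[of f "-1"] by simp

lemma sq_int_diff: "sq_int f \<Longrightarrow> sq_int g \<Longrightarrow> sq_int (\<lambda>x. f x - g x)"
  using sq_int_add[of f "\<lambda>x. - g x"] sq_int_minus[of g] by simp

lemma sq_int_inner:
  assumes "sq_int f" "sq_int g" shows "integrable lborel (\<lambda>x. inner (f x) (g x))"
proof (rule Bochner_Integration.integrable_bound)
  have [measurable]: "f \<in> borel_measurable borel" "g \<in> borel_measurable borel"
    using assms unfolding sq_int_def by auto
  show "integrable lborel (\<lambda>x. (norm (f x))\<^sup>2 + (norm (g x))\<^sup>2)"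
    using assms unfolding sq_int_def by simp
  have "\<bar>inner (f x) (g x)\<bar> \<le> (norm (f x))\<^sup>2 + (norm (g x))\<^sup>2" for x
  proof -
    have "\<bar>inner (f x) (g x)\<bar> \<le> norm (f x) * norm (g x)" by (rule Cauchy_Schwarz_ineq2)
    also have "\<dots> \<le> (norm (f x))\<^sup>2 + (norm (g x))\<^sup>2"
      using zero_le_power2[of "norm (f x) - norm (g x)"] mult_nonneg_nonneg[OF norm_ge_zero norm_ge_zero, of "f x" "g x"]
      unfolding power2_diff by linarith
    finally show ?thesis .
  qed
  then show "AE x in lborel. norm (inner (f x) (g x)) \<le> norm ((norm (f x))\<^sup>2 + (norm (g x))\<^sup>2)" by auto
  show "(\<lambda>x. inner (f x) (g x)) \<in> borel_measurable lborel" by measurable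
qed

instantiation l2 :: (euclidean_space, euclidean_space) real_vector
begin

definition "0 = l2_of (\<lambda>x. 0)"
definition "u + v = l2_of (\<lambda>x. rp u x + rp v x)"
definition "- u = l2_of (\<lambda>x. - rp u x)"
definition "(u :: ('a, 'b) l2) - v = u + (- v)"
definition "c *\<^sub>R u = l2_of (\<lambda>x. c *\<^sub>R rp u x)"

lemma rp_zero: "AE x in lborel. rp (0 :: ('a, 'b) l2) x = 0"
  unfolding zero_l2_def by (rule rp_l2_of) (rule sq_int_zero)
lemma rp_add: "AE x in lborel. rp (u + v :: ('a, 'b) l2) x = rp u x + rp v x"
  unfolding plus_l2_def by (intro rp_l2_of sq_int_add rp_sq_int)
lemma rp_uminus: "AE x in lborel. rp (- u :: ('a, 'b) l2) x = - rp u x"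
  unfolding uminus_l2_def by (intro rp_l2_of sq_int_minus rp_sq_int)
lemma rp_scale: "AE x in lborel. rp (c *\<^sub>R u :: ('a, 'b) l2) x = c *\<^sub>R rp u x"
  unfolding scaleR_l2_def by (intro rp_l2_of sq_int_scale rp_sq_int)
lemma rp_diff: "AE x in lborel. rp (u - v :: ('a, 'b) l2) x = rp u x - rp v x"
  unfolding minus_l2_def using rp_add[of u "- v"] rp_uminus[of v] by eventually_elim simp

instance
proof
  fix u v w :: "('a, 'b) l2" and a b :: real
  show "u + v + w = u + (v + w)"
    by (rule l2_eqI) (use rp_add[of "u + v" w] rp_add[of u v] rp_add[of u "v + w"] rp_add[of v w] in \<open>eventually_elim, simp\<close>)
  show "u + v = v + u" unfolding plus_l2_def by (simp add: add.commute)
  show "0 + u = u"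
    by (rule l2_eqI) (use rp_add[of 0 u] rp_zero in \<open>eventually_elim, simp\<close>)
  show "- u + u = 0"
    by (rule l2_eqI) (use rp_add[of "- u" u] rp_zero rp_uminus[of u] in \<open>eventually_elim, simp\<close>)
  show "u - v = u + - v" by (rule minus_l2_def)
  show "a *\<^sub>R (u + v) = a *\<^sub>R u + a *\<^sub>R v"
    by (rule l2_eqI) (use rp_add[of "a *\<^sub>R u" "a *\<^sub>R v"] rp_scale[of a u] rp_scale[of a v] rp_scale[of a "u + v"] rp_add[of u v]
      in \<open>eventually_elim, simp add: scaleR_add_right\<close>)
  show "(a + b) *\<^sub>R u = a *\<^sub>R u + b *\<^sub>R u"
    by (rule l2_eqI) (use rp_add[of "a *\<^sub>R u" "b *\<^sub>R u"] rp_scale[of a u] rp_scale[of b u] rp_scale[of "a + b" u]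
      in \<open>eventually_elim, simp add: scaleR_add_left\<close>)
  show "a *\<^sub>R b *\<^sub>R u = (a * b) *\<^sub>R u"
    by (rule l2_eqI) (use rp_scale[of a "b *\<^sub>R u"] rp_scale[of b u] rp_scale[of "a * b" u] in \<open>eventually_elim, simp\<close>)
  show "1 *\<^sub>R u = u"
    by (rule l2_eqI) (use rp_scale[of 1 u] in \<open>eventually_elim, simp\<close>)
qed

end

instantiation l2 :: (euclidean_space, euclidean_space) real_inner
begin

definition "inner u v = (LINT x|lborel. inner (rp u x) (rp v x))"
definition "norm (u :: ('a, 'b) l2) = sqrt (inner u u)"
definition "dist (u :: ('a, 'b) l2) v = norm (u - v)"
definition "sgn (u :: ('a, 'b) l2) = u /\<^sub>R norm u"
definition "uniformity = (INF e\<in>{0<..}. principal {(u, v :: ('a, 'b) l2). dist u v < e})"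
definition "open (S :: ('a, 'b) l2 set) \<longleftrightarrow> (\<forall>u\<in>S. \<forall>\<^sub>F (u', v) in uniformity. u' = u \<longrightarrow> v \<in> S)"

instance
proof
  fix u v w :: "('a, 'b) l2" and r :: real
  show "dist u v = norm (u - v)" by (rule dist_l2_def)
  show "sgn u = u /\<^sub>R norm u" by (rule sgn_l2_def)
  show "(uniformity :: (('a, 'b) l2 \<times> ('a, 'b) l2) filter) = (INF e\<in>{0<..}. principal {(u, v). dist u v < e})"
    by (rule uniformity_l2_def)
  show "open U \<longleftrightarrow> (\<forall>u\<in>U. \<forall>\<^sub>F (u', v) in uniformity. u' = u \<longrightarrow> v \<in> U)" for U :: "('a, 'b) l2 set"
    by (rule open_l2_def)
  show "inner u v = inner v u" unfolding inner_l2_def by (simp add: inner_commute)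
  have "inner (u + v) w = (LINT x|lborel. inner (rp u x) (rp w x) + inner (rp v x) (rp w x))"
    unfolding inner_l2_def
    by (rule integral_cong_AE) (use rp_add[of u v] in \<open>measurable, eventually_elim, simp add: inner_add_left\<close>)
  then show "inner (u + v) w = inner u w + inner v w"
    unfolding inner_l2_def by (simp add: Bochner_Integration.integral_add sq_int_inner)
  have "inner (r *\<^sub>R u) v = (LINT x|lborel. r * inner (rp u x) (rp v x))"
    unfolding inner_l2_def
    by (rule integral_cong_AE) (use rp_scale[of r u] in \<open>measurable, eventually_elim, simp\<close>)
  then show "inner (r *\<^sub>R u) v = r * inner u v" unfolding inner_l2_def by simp
  show "0 \<le> inner u u" unfolding inner_l2_def by simp
  show "inner u u = 0 \<longleftrightarrow> u = 0"
  proof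
    assume "inner u u = 0"
    then have "AE x in lborel. inner (rp u x) (rp u x) = 0"
      unfolding inner_l2_def by (subst (asm) integral_nonneg_eq_0_iff_AE) (auto intro: sq_int_inner)
    then have "AE x in lborel. rp u x = rp 0 x" using rp_zero by eventually_elim simp
    then show "u = 0" by (rule l2_eqI)
  next
    assume "u = 0"
    then have "AE x in lborel. rp u x = 0" using rp_zero by simp
    then have "AE x in lborel. inner (rp u x) (rp u x) = 0" by eventually_elim simp
    then show "inner u u = 0" unfolding inner_l2_def by (rule integral_eq_zero_AE)
  qed
  show "norm u = sqrt (inner u u)" by (rule norm_l2_def)
qed

end

section \<open>Norms of concrete functions and completeness\<close>

lemma inner_l2_of:
  assumes "sq_int f" "sq_int g"
  shows "inner (l2_of f) (l2_of g) = (LINT x|lborel. inner (f x) (g x))"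
proof -
  have [measurable]: "f \<in> borel_measurable borel" "g \<in> borel_measurable borel"
    using assms unfolding sq_int_def by auto
  show ?thesis
    unfolding inner_l2_def
    by (rule integral_cong_AE) (use rp_l2_of[OF assms(1)] rp_l2_of[OF assms(2)] in \<open>measurable, eventually_elim, simp\<close>)
qed

lemma norm_l2_of:
  assumes "sq_int f" shows "(norm (l2_of f))\<^sup>2 = (LINT x|lborel. (norm (f x))\<^sup>2)"
  unfolding power2_norm_eq_inner by (rule inner_l2_of[OF assms assms])

lemma norm_l2: "(norm u)\<^sup>2 = (LINT x|lborel. (norm (rp u x))\<^sup>2)"
  using norm_l2_of[of "rp u"] by simp

lemma nn_norm_l2_of:
  assumes "sq_int f" shows "(\<integral>\<^sup>+x. ennreal ((norm (f x))\<^sup>2) \<partial>lborel) = ennreal ((norm (l2_of f))\<^sup>2)"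
  unfolding norm_l2_of[OF assms] using assms unfolding sq_int_def by (intro nn_integral_eq_integral) auto

lemma sq_int_nn:
  assumes "f \<in> borel_measurable borel" "(\<integral>\<^sup>+x. ennreal ((norm (f x))\<^sup>2) \<partial>lborel) \<le> ennreal c"
  shows "sq_int f"
  unfolding sq_int_def
proof
  show "integrable lborel (\<lambda>x. (norm (f x))\<^sup>2)"
    by (rule integrableI_nonneg) (use assms in \<open>auto simp: le_less_trans\<close>)
qed (rule assms(1))

lemma norm_l2_of_le_nn:
  assumes "sq_int f" "(\<integral>\<^sup>+x. ennreal ((norm (f x))\<^sup>2) \<partial>lborel) \<le> ennreal (c\<^sup>2)" "c \<ge> 0"
  shows "norm (l2_of f) \<le> c"
proof (rule power2_le_imp_le)
  show "(norm (l2_of f))\<^sup>2 \<le> c\<^sup>2" using assms unfolding nn_norm_l2_of[OF assms(1)] by simp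
qed (rule assms(3))

lemma l2_of_add: "sq_int f \<Longrightarrow> sq_int g \<Longrightarrow> l2_of (\<lambda>x. f x + g x) = l2_of f + l2_of g"
  by (rule l2_eqI) (use rp_add[of "l2_of f" "l2_of g"] rp_l2_of[of f] rp_l2_of[of g] rp_l2_of[OF sq_int_add[of f g]]
    in \<open>auto elim: eventually_elim2\<close>)

lemma l2_of_diff: "sq_int f \<Longrightarrow> sq_int g \<Longrightarrow> l2_of (\<lambda>x. f x - g x) = l2_of f - l2_of g"
  by (rule l2_eqI) (use rp_diff[of "l2_of f" "l2_of g"] rp_l2_of[of f] rp_l2_of[of g] rp_l2_of[OF sq_int_diff[of f g]]
    in \<open>auto elim: eventually_elim2\<close>)

lemma l2_of_scale: "sq_int f \<Longrightarrow> l2_of (\<lambda>x. c *\<^sub>R f x) = c *\<^sub>R l2_of f"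
  by (rule l2_eqI) (use rp_scale[of c "l2_of f"] rp_l2_of[of f] rp_l2_of[OF sq_int_scale[of f c]]
    in \<open>auto elim: eventually_elim2\<close>)

text \<open>Weighting the squared increments by \<open>2^n\<close> still leaves summable integrals,
  since \<open>2^n (1/4)^n = (1/2)^n\<close>. Wherever the weighted sum is finite, the increments
  decay like \<open>2^(-n/2)\<close>.\<close>

lemma fast_Cauchy_AE_convergent:
  fixes f :: "nat \<Rightarrow> 'a::euclidean_space \<Rightarrow> 'b::euclidean_space"
  assumes f: "\<And>n. sq_int (f n)" and fast: "\<And>n. norm (l2_of (f (Suc n)) - l2_of (f n)) \<le> (1/2) ^ n"
  shows "AE x in lborel. convergent (\<lambda>n. f n x)"
proof -
  have [measurable]: "f n \<in> borel_measurable borel" for n using f unfolding sq_int_def by auto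
  define d where "d n x = f (Suc n) x - f n x" for n x
  have [measurable]: "d n \<in> borel_measurable borel" for n unfolding d_def by measurable
  have d: "sq_int (d n)" for n unfolding d_def by (intro sq_int_diff f)
  have nd: "(\<integral>\<^sup>+x. ennreal ((norm (d n x))\<^sup>2) \<partial>lborel) \<le> ennreal ((1/4) ^ n)" for n
  proof -
    have "(norm (l2_of (d n)))\<^sup>2 \<le> ((1/2) ^ n)\<^sup>2"
      unfolding d_def l2_of_diff[OF f f] by (intro power_mono fast) auto
    also have "\<dots> = (1/4) ^ n" by (simp add: power2_eq_square flip: power_mult_distrib)
    finally show ?thesis unfolding nn_norm_l2_of[OF d] by (rule ennreal_leI)
  qed
  define S where "S x = (\<Sum>n. ennreal (2 ^ n * (norm (d n x))\<^sup>2))" for x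
  have [measurable]: "S \<in> borel_measurable borel" unfolding S_def by measurable
  have "(\<integral>\<^sup>+x. S x \<partial>lborel) = (\<Sum>n. \<integral>\<^sup>+x. ennreal (2 ^ n * (norm (d n x))\<^sup>2) \<partial>lborel)"
    unfolding S_def by (rule nn_integral_suminf) measurable
  also have "\<dots> \<le> (\<Sum>n. ennreal ((1/2) ^ n))"
  proof (rule suminf_le)
    fix n
    have "(\<integral>\<^sup>+x. ennreal (2 ^ n * (norm (d n x))\<^sup>2) \<partial>lborel) = ennreal (2 ^ n) * (\<integral>\<^sup>+x. ennreal ((norm (d n x))\<^sup>2) \<partial>lborel)"
      by (simp add: ennreal_mult nn_integral_cmult)
    also have "\<dots> \<le> ennreal (2 ^ n) * ennreal ((1/4) ^ n)" by (intro mult_left_mono nd) auto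
    also have "\<dots> = ennreal ((1/2) ^ n)" by (simp add: ennreal_mult[symmetric] flip: power_mult_distrib)
    finally show "(\<integral>\<^sup>+x. ennreal (2 ^ n * (norm (d n x))\<^sup>2) \<partial>lborel) \<le> ennreal ((1/2) ^ n)" .
  qed auto
  also have "(\<Sum>n. ennreal ((1/2) ^ n)) = ennreal (\<Sum>n. (1/2) ^ n)"
    by (rule suminf_ennreal2) auto
  finally have "(\<integral>\<^sup>+x. S x \<partial>lborel) \<noteq> \<infinity>" by (auto simp: top_unique)
  then have "AE x in lborel. S x \<noteq> \<infinity>" by (intro nn_integral_PInf_AE) auto
  then show ?thesis
  proof eventually_elim
    case (elim x)
    then obtain s where s: "S x = ennreal s" "s \<ge> 0" by (cases "S x") auto
    have dn: "norm (d n x) \<le> sqrt s * (1 / sqrt 2) ^ n" for n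
    proof -
      have "ennreal (2 ^ n * (norm (d n x))\<^sup>2) = (\<Sum>i\<in>{n}. ennreal (2 ^ i * (norm (d i x))\<^sup>2))" by simp
      also have "\<dots> \<le> S x" unfolding S_def by (rule sum_le_suminf) auto
      finally have "2 ^ n * (norm (d n x))\<^sup>2 \<le> s" using s by simp
      then have "sqrt (2 ^ n * (norm (d n x))\<^sup>2) \<le> sqrt s" by (rule real_sqrt_le_mono)
      then have "sqrt 2 ^ n * norm (d n x) \<le> sqrt s" by (simp add: real_sqrt_mult real_sqrt_power)
      then show ?thesis by (simp add: power_one_over field_simps)
    qed
    have sg: "summable (\<lambda>n. sqrt s * (1 / sqrt 2) ^ n)"
      by (intro summable_mult summable_geometric) simp
    have "summable (\<lambda>n. d n x)" by (rule summable_comparison_test'[OF sg dn])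
    then have "convergent (\<lambda>n. \<Sum>i<n. d i x)" by (simp add: summable_iff_convergent)
    then have "convergent (\<lambda>n. f n x - f 0 x)" unfolding d_def
      by (simp only: sum_lessThan_telescope[of "\<lambda>i. f i x"])
    then have "convergent (\<lambda>n. (f n x - f 0 x) + f 0 x)" by (intro convergent_add convergent_const)
    then show ?case by simp
  qed
qed

instance l2 :: (euclidean_space, euclidean_space) banach
proof
  fix X :: "nat \<Rightarrow> ('a, 'b) l2" assume X: "Cauchy X"
  have "\<forall>n. \<exists>N. \<forall>p\<ge>N. \<forall>q\<ge>N. dist (X p) (X q) < (1/2) ^ n"
    using metric_CauchyD[OF X, of "(1/2) ^ n" for n] by simp
  then obtain N where N: "\<And>n p q. p \<ge> N n \<Longrightarrow> q \<ge> N n \<Longrightarrow> dist (X p) (X q) < (1/2) ^ n" by metis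
  \<comment> \<open>Summing the thresholds makes \<open>s n\<close> dominate all earlier ones, and
    adding \<open>n\<close> makes it strictly increasing.\<close>
  define s where "s n = (\<Sum>i\<le>n. N i) + n" for n
  have sN: "s m \<ge> N n" if "n \<le> m" for m n
  proof -
    have "N n \<le> (\<Sum>i\<le>m. N i)" by (rule member_le_sum) (use that in auto)
    then show ?thesis unfolding s_def by simp
  qed
  have "strict_mono s" unfolding strict_mono_Suc_iff s_def by simp
  define f where "f n = rp (X (s n))" for n
  have [measurable]: "f n \<in> borel_measurable borel" for n unfolding f_def by simp
  have f: "sq_int (f n)" "l2_of (f n) = X (s n)" for n unfolding f_def by simp_all
  have fd: "norm (l2_of (f m) - l2_of (f n)) \<le> (1/2) ^ n" if "n \<le> m" for m n
    using N[OF sN[OF that] sN[OF order_refl, of n]] unfolding f by (simp add: dist_norm)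
  have conv: "AE x in lborel. convergent (\<lambda>n. f n x)"
    by (rule fast_Cauchy_AE_convergent[OF f(1)]) (rule fd, simp)
  define g where "g x = lim (\<lambda>n. f n x)" for x
  have [measurable]: "g \<in> borel_measurable borel"
    unfolding g_def by (rule borel_measurable_lim_metric) measurable
  \<comment> \<open>Fatou's lemma in \<open>m\<close> with \<open>n\<close> fixed: the pointwise
    limit inherits the L2 bound of the tail.\<close>
  have gd: "(\<integral>\<^sup>+x. ennreal ((norm (f n x - g x))\<^sup>2) \<partial>lborel) \<le> ennreal (((1/2) ^ n)\<^sup>2)" for n
  proof -
    have "(\<integral>\<^sup>+x. ennreal ((norm (f n x - g x))\<^sup>2) \<partial>lborel) = (\<integral>\<^sup>+x. liminf (\<lambda>m. ennreal ((norm (f n x - f m x))\<^sup>2)) \<partial>lborel)"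
    proof (rule nn_integral_cong_AE)
      show "AE x in lborel. ennreal ((norm (f n x - g x))\<^sup>2) = liminf (\<lambda>m. ennreal ((norm (f n x - f m x))\<^sup>2))"
        using conv
      proof eventually_elim
        case (elim x)
        then have "(\<lambda>m. f m x) \<longlonglongrightarrow> g x" unfolding g_def by (simp add: convergent_LIMSEQ_iff)
        then have "(\<lambda>m. ennreal ((norm (f n x - f m x))\<^sup>2)) \<longlonglongrightarrow> ennreal ((norm (f n x - g x))\<^sup>2)"
          by (intro tendsto_intros)
        then show ?case by (rule lim_imp_Liminf[OF sequentially_bot, symmetric])
      qed
    qed
    also have "\<dots> \<le> liminf (\<lambda>m. \<integral>\<^sup>+x. ennreal ((norm (f n x - f m x))\<^sup>2) \<partial>lborel)"
      by (rule nn_integral_liminf) measurable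
    also have "\<dots> \<le> ennreal (((1/2) ^ n)\<^sup>2)"
    proof (rule Liminf_le)
      show "\<forall>\<^sub>F m in sequentially. (\<integral>\<^sup>+x. ennreal ((norm (f n x - f m x))\<^sup>2) \<partial>lborel) \<le> ennreal (((1/2) ^ n)\<^sup>2)"
        using eventually_ge_at_top[of n]
      proof eventually_elim
        case (elim m)
        have "norm (l2_of (\<lambda>x. f n x - f m x)) \<le> (1/2) ^ n"
          using fd[OF elim] by (simp add: l2_of_diff f(1) norm_minus_commute)
        then show ?case unfolding nn_norm_l2_of[OF sq_int_diff[OF f(1) f(1)]] by (intro ennreal_leI power_mono) auto
      qed
    qed simp
    finally show ?thesis .
  qed
  have fg: "sq_int (\<lambda>x. f n x - g x)" for n by (rule sq_int_nn[OF _ gd]) measurable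
  have g: "sq_int g" using sq_int_diff[OF f(1) fg, of 0 0] by simp
  have "norm (X (s n) - l2_of g) \<le> (1/2) ^ n" for n
    using norm_l2_of_le_nn[OF fg gd, of n] by (simp add: l2_of_diff f g)
  then have "(\<lambda>n. X (s n) - l2_of g) \<longlonglongrightarrow> 0"
    by (intro Lim_null_comparison[OF always_eventually LIMSEQ_realpow_zero[of "1/2"]]) auto
  then have l: "(X \<circ> s) \<longlonglongrightarrow> l2_of g" by (simp add: LIM_zero_iff o_def)
  have "X \<longlonglongrightarrow> l2_of g" using X \<open>strict_mono s\<close> l by (rule Cauchy_converges_subseq)
  then show "convergent X" unfolding convergent_def by blast
qed

section \<open>Test functions\<close>

lemma cont_diff_SucI:
  assumes "\<And>x. (f has_derivative f' x) (at x)" "\<And>v. cont_diff n (\<lambda>x. f' x v)"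
  shows "cont_diff (Suc n) f"
proof -
  have "frechet_derivative f (at x) = f' x" for x using frechet_derivative_at[OF assms(1)] by simp
  then show ?thesis using assms
    by (auto simp: differentiable_on_def differentiable_def intro: has_derivative_at_withinI)
qed

lemma cont_diff_SucD:
  assumes "cont_diff (Suc n) f"
  shows "(f has_derivative frechet_derivative f (at x)) (at x)" "cont_diff n (\<lambda>x. frechet_derivative f (at x) v)"
  using assms by (auto simp: differentiable_on_def frechet_derivative_works)

lemma cont_diff_continuous: "cont_diff n f \<Longrightarrow> continuous_on UNIV f"
  by (cases n) (auto intro: differentiable_imp_continuous_on)

lemma cont_diff_mono_Suc: "cont_diff (Suc n) f \<Longrightarrow> cont_diff n f"
proof (induction n arbitrary: f)
  case 0 then show ?case by (auto intro: differentiable_imp_continuous_on)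
next
  case (Suc n)
  show ?case by (rule cont_diff_SucI[OF cont_diff_SucD(1)[OF Suc.prems]]) (rule Suc.IH[OF cont_diff_SucD(2)[OF Suc.prems]])
qed

lemma cont_diff_const: "cont_diff n (\<lambda>x. c)"
proof (induction n arbitrary: c)
  case (Suc n)
  show ?case by (rule cont_diff_SucI[where f' = "\<lambda>x v. 0"]) (auto intro: Suc)
qed simp

lemma cont_diff_add:
  "cont_diff n f \<Longrightarrow> cont_diff n g \<Longrightarrow> cont_diff n (\<lambda>x. f x + g x)"
proof (induction n arbitrary: f g)
  case (Suc n)
  show ?case
    by (rule cont_diff_SucI, rule has_derivative_add[OF cont_diff_SucD(1)[OF Suc.prems(1)] cont_diff_SucD(1)[OF Suc.prems(2)]])
      (intro Suc.IH cont_diff_SucD(2) Suc.prems)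
qed (auto intro: continuous_on_add)

lemma cont_diff_mult:
  fixes f g :: "'a::real_normed_vector \<Rightarrow> real"
  shows "cont_diff n f \<Longrightarrow> cont_diff n g \<Longrightarrow> cont_diff n (\<lambda>x. f x * g x)"
proof (induction n arbitrary: f g)
  case (Suc n)
  show ?case
    by (rule cont_diff_SucI, rule has_derivative_mult[OF cont_diff_SucD(1)[OF Suc.prems(1)] cont_diff_SucD(1)[OF Suc.prems(2)]])
      (rule cont_diff_add[OF Suc.IH[OF cont_diff_mono_Suc[OF Suc.prems(1)] cont_diff_SucD(2)[OF Suc.prems(2)]]
        Suc.IH[OF cont_diff_SucD(2)[OF Suc.prems(1)] cont_diff_mono_Suc[OF Suc.prems(2)]]])
qed (auto intro: continuous_on_mult)

lemma cont_diff_prod: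
  fixes f :: "'i \<Rightarrow> 'a::real_normed_vector \<Rightarrow> real"
  shows "finite I \<Longrightarrow> (\<And>i. i \<in> I \<Longrightarrow> cont_diff n (f i)) \<Longrightarrow> cont_diff n (\<lambda>x. \<Prod>i\<in>I. f i x)"
  by (induction I rule: finite_induct) (auto intro: cont_diff_const cont_diff_mult)

lemma cont_diff_affine:
  fixes A :: "'a::real_normed_vector \<Rightarrow> 'c::real_normed_vector"
  assumes A: "bounded_linear A"
  shows "cont_diff n \<phi> \<Longrightarrow> cont_diff n (\<lambda>x. \<phi> (A x + c))"
proof (induction n arbitrary: \<phi>)
  case 0
  have "continuous_on UNIV (\<lambda>x. A x + c)"
    by (intro continuous_on_add continuous_on_const linear_continuous_on A)
  then show ?case using 0 continuous_on_compose2[of UNIV \<phi> UNIV "\<lambda>x. A x + c"] by simp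
next
  case (Suc n)
  show ?case
  proof (rule cont_diff_SucI)
    fix x
    have "((\<lambda>x. A x + c) has_derivative A) (at x)"
      using has_derivative_add[OF bounded_linear_imp_has_derivative[OF A] has_derivative_const[of c]] by simp
    from diff_chain_at[OF this cont_diff_SucD(1)[OF Suc.prems]]
    show "((\<lambda>x. \<phi> (A x + c)) has_derivative (\<lambda>v. frechet_derivative \<phi> (at (A x + c)) (A v))) (at x)"
      by (simp add: o_def)
  qed (rule Suc.IH[OF cont_diff_SucD(2)[OF Suc.prems]])
qed

lemma cont_diff_exp:
  fixes f :: "'a::real_normed_vector \<Rightarrow> real"
  shows "cont_diff n f \<Longrightarrow> cont_diff n (\<lambda>x. exp (f x))"
proof (induction n)
  case (Suc n)
  show ?case
  proof (rule cont_diff_SucI)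
    show "((\<lambda>x. exp (f x)) has_derivative (\<lambda>v. exp (f x) * frechet_derivative f (at x) v)) (at x)" for x
      using has_derivative_exp[OF cont_diff_SucD(1)[OF Suc.prems]] by (simp add: mult.commute)
  qed (intro cont_diff_mult Suc.IH cont_diff_mono_Suc[OF Suc.prems] cont_diff_SucD(2)[OF Suc.prems])
qed (auto intro: continuous_on_exp)

text \<open>The functions \<open>p(1/t) exp(-1/t)\<close>, extended by zero, are closed under
  differentiation; smoothness of the basic cut-off thus reduces to one first derivative.\<close>

definition flat :: "real poly \<Rightarrow> real \<Rightarrow> real" where
  "flat p t = (if t > 0 then poly p (1 / t) * exp (- (1 / t)) else 0)"

lemma poly_exp_tendsto_0: "((\<lambda>s. poly p s * exp (- s)) \<longlongrightarrow> (0::real)) at_top"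
proof -
  have "((\<lambda>s. \<Sum>i\<le>degree p. coeff p i * (s ^ i / exp s)) \<longlongrightarrow> (\<Sum>i\<le>degree p. coeff p i * 0)) at_top"
    by (intro tendsto_sum tendsto_mult tendsto_const tendsto_power_div_exp_0)
  moreover have "(\<lambda>s. \<Sum>i\<le>degree p. coeff p i * (s ^ i / exp s)) = (\<lambda>s. poly p s * exp (- s))"
    by (rule ext) (simp add: poly_altdef exp_minus sum_distrib_right divide_inverse mult.assoc)
  ultimately show ?thesis by simp
qed

text \<open>The factor \<open>[:0, 0, 1:]\<close> is \<open>1/t^2\<close> in the variable
  \<open>1/t\<close>, from the chain rule; at 0 the exponential beats every polynomial in
  \<open>1/t\<close>.\<close>

lemma flat_has_derivative:
  "(flat p has_real_derivative flat ([:0, 0, 1:] * (p - pderiv p)) t) (at t)"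
proof -
  consider "t > 0" | "t < 0" | "t = 0" by linarith
  then show ?thesis
  proof cases
    case 1
    have i: "((\<lambda>t. 1 / t) has_real_derivative - (1 / t\<^sup>2)) (at t)"
      using 1 by (auto intro!: derivative_eq_intros simp: power2_eq_square)
    have p: "((\<lambda>t. poly p (1 / t)) has_real_derivative poly (pderiv p) (1 / t) * (- (1 / t\<^sup>2))) (at t)"
      by (rule DERIV_chain2[OF poly_DERIV i])
    have e: "((\<lambda>t. exp (- (1 / t))) has_real_derivative exp (- (1 / t)) * (1 / t\<^sup>2)) (at t)"
      using DERIV_chain2[OF DERIV_exp DERIV_minus[OF i]] by simp
    have "((\<lambda>t. poly p (1 / t) * exp (- (1 / t))) has_real_derivative flat ([:0, 0, 1:] * (p - pderiv p)) t) (at t)"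
      using DERIV_mult[OF p e] 1 by (simp add: flat_def power2_eq_square algebra_simps diff_divide_distrib)
    then show ?thesis
      by (rule has_field_derivative_transform_within_open[where S = "{0<..}"]) (use 1 in \<open>auto simp: flat_def\<close>)
  next
    case 2
    have "((\<lambda>t. 0) has_real_derivative 0) (at t)" by simp
    then have "(flat p has_real_derivative 0) (at t)"
      by (rule has_field_derivative_transform_within_open[where S = "{..<0}"]) (use 2 in \<open>auto simp: flat_def\<close>)
    then show ?thesis using 2 by (simp add: flat_def)
  next
    case 3
    have "((\<lambda>h. flat p h / h) \<longlongrightarrow> 0) (at_right 0)"
    proof -
      have "((\<lambda>h. poly ([:0, 1:] * p) (inverse h) * exp (- inverse h)) \<longlongrightarrow> 0) (at_right (0::real))"
        by (rule filterlim_compose[OF poly_exp_tendsto_0 filterlim_inverse_at_top_right])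
      moreover have "\<forall>\<^sub>F h in at_right 0. poly ([:0, 1:] * p) (inverse h) * exp (- inverse h) = flat p h / h"
        unfolding eventually_at_right_field by (intro exI[of _ 1]) (auto simp: flat_def divide_inverse)
      ultimately show ?thesis by (rule Lim_transform_eventually)
    qed
    moreover have "((\<lambda>h. flat p h / h) \<longlongrightarrow> 0) (at_left 0)"
    proof (rule Lim_transform_eventually[OF tendsto_const])
      show "\<forall>\<^sub>F h in at_left 0. 0 = flat p h / h"
        unfolding eventually_at_left_field by (intro exI[of _ "-1"]) (auto simp: flat_def)
    qed
    ultimately have "((\<lambda>h. flat p h / h) \<longlongrightarrow> 0) (at 0)"
      using filterlim_split_at[of "\<lambda>h. flat p h / h" "nhds 0" 0] by blast
    then show ?thesis using 3 by (simp add: has_field_derivative_iff flat_def)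
  qed
qed

text \<open>The constant \<open>c\<close> absorbs the direction \<open>v\<close> of the Frechet
  derivative, so that the induction hypothesis applies again.\<close>

lemma cont_diff_flat_scale: "cont_diff n (\<lambda>t. flat p t * c)"
proof (induction n arbitrary: p c)
  case 0
  have "continuous_on UNIV (flat p)"
    by (intro continuous_at_imp_continuous_on ballI DERIV_isCont[OF flat_has_derivative])
  then show ?case by (auto intro: continuous_on_mult continuous_on_const)
next
  case (Suc n)
  show ?case
  proof (rule cont_diff_SucI)
    show "((\<lambda>t. flat p t * c) has_derivative (\<lambda>v. flat ([:0, 0, 1:] * (p - pderiv p)) t * (v * c))) (at t)" for t
      using has_derivative_mult_left[OF flat_has_derivative[of p t, unfolded has_field_derivative_def], of c]
      by (simp add: mult.assoc)
  qed (rule Suc)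
qed

lemma cont_diff_flat: "cont_diff n (flat p)"
  using cont_diff_flat_scale[of n p 1] by simp

lemma flat_1_pos: "flat 1 t > 0 \<longleftrightarrow> t > 0" and flat_1_nonneg: "flat 1 t \<ge> 0" and flat_1_0: "flat 1 t = 0 \<longleftrightarrow> t \<le> 0"
  by (auto simp: flat_def)

definition box_weight :: "real^'n::finite \<Rightarrow> real^'n \<Rightarrow> real^'n \<Rightarrow> real" where
  "box_weight a b x = (\<Prod>k\<in>UNIV. flat 1 (x $ k - a $ k) * flat 1 (b $ k - x $ k))"

lemma box_weight_pos: "x \<in> box a b \<Longrightarrow> box_weight a b x > 0"
  unfolding box_weight_def by (auto simp: mem_box_cart flat_1_pos intro!: prod_pos)

lemma box_weight_nonneg: "box_weight a b x \<ge> 0"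
  unfolding box_weight_def by (auto simp: flat_1_nonneg intro!: prod_nonneg)

lemma box_weight_0: "x \<notin> box a b \<Longrightarrow> box_weight a b x = 0"
  unfolding box_weight_def by (auto simp: mem_box_cart flat_1_0 prod_zero_iff not_less)

lemma cont_diff_box_weight:
  fixes a b :: "real^'n::finite"
  shows "cont_diff n (box_weight a b)"
proof -
  have "cont_diff n (\<lambda>x::real^'n. flat 1 (x $ k - a $ k))" for k
    using cont_diff_affine[OF bounded_linear_vec_nth cont_diff_flat, of n 1 k "- a $ k"] by simp
  moreover have "cont_diff n (\<lambda>x::real^'n. flat 1 (b $ k - x $ k))" for k
    using cont_diff_affine[OF bounded_linear_minus[OF bounded_linear_vec_nth] cont_diff_flat, of n 1 k "b $ k"] by simp
  ultimately show ?thesis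
    unfolding box_weight_def[abs_def] by (intro cont_diff_prod cont_diff_mult) auto
qed

text \<open>As \<open>j\<close> grows these test functions increase to the indicator of the open
  box, so that integrals over boxes are limits of integrals against tests.\<close>

definition box_bump :: "nat \<Rightarrow> real^'n::finite \<Rightarrow> real^'n \<Rightarrow> real^'n \<Rightarrow> real" where
  "box_bump j a b x = 1 - exp (- (real j * box_weight a b x))"

lemma box_bump_bounds: "0 \<le> box_bump j a b x" "box_bump j a b x \<le> indicator (box a b) x"
  using box_weight_nonneg[of a b x] box_weight_0[of x a b]
  by (auto simp: box_bump_def indicator_def)

lemma box_bump_tendsto: "(\<lambda>j. box_bump j a b x) \<longlonglongrightarrow> indicator (box a b) x"
proof (cases "x \<in> box a b")
  case True
  define c where "c = exp (- box_weight a b x)"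
  have c: "0 < c" "c < 1" unfolding c_def using box_weight_pos[OF True] by auto
  have "(\<lambda>j. 1 - c ^ j) \<longlonglongrightarrow> 1 - 0" by (intro tendsto_diff tendsto_const LIMSEQ_realpow_zero) (use c in auto)
  moreover have "box_bump j a b x = 1 - c ^ j" for j unfolding box_bump_def c_def by (simp add: exp_of_nat_mult[symmetric])
  ultimately show ?thesis using True by simp
qed (simp add: box_bump_def box_weight_0)

lemma test_function_box_bump: "test_function (box_bump j a b)"
  unfolding test_function_def
proof
  have e: "box_bump j a b = (\<lambda>x. 1 + (-1) * exp ((- real j) * box_weight a b x))"
    by (rule ext) (simp add: box_bump_def)
  show "\<forall>n. cont_diff n (box_bump j a b)"
    unfolding e by (intro allI cont_diff_add cont_diff_mult cont_diff_exp cont_diff_const cont_diff_box_weight)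
  have "{x. box_bump j a b x \<noteq> 0} \<subseteq> cbox a b"
  proof
    fix x assume "x \<in> {x. box_bump j a b x \<noteq> 0}"
    then have "x \<in> box a b" using box_weight_0[of x a b] by (auto simp: box_bump_def)
    then show "x \<in> cbox a b" using box_subset_cbox by blast
  qed
  then have c: "closure {x. box_bump j a b x \<noteq> 0} \<subseteq> cbox a b" by (rule closure_minimal) (rule closed_cbox)
  have "compact (cbox a b \<inter> closure {x. box_bump j a b x \<noteq> 0})"
    by (rule compact_Int_closed[OF compact_cbox closed_closure])
  then show "compact (closure {x. box_bump j a b x \<noteq> 0})" using c by (simp add: Int_absorb1)
qed

section \<open>Borel representatives and separation by test functions\<close>

lemma lebesgue_borel_representative:
  fixes f :: "'a::euclidean_space \<Rightarrow> 'b::euclidean_space"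
  assumes "f \<in> borel_measurable lebesgue"
  shows "\<exists>g\<in>borel_measurable borel. AE x in lborel. f x = g x"
proof -
  have "\<exists>g\<in>borel_measurable lborel. AE x in lborel. inner (f x) b = g x" for b
  proof (rule completion_ex_borel_measurable_real)
    show "(\<lambda>x. inner (f x) b) \<in> borel_measurable lebesgue" using assms by measurable
  qed
  then have "\<forall>b. \<exists>g. g \<in> borel_measurable borel \<and> (AE x in lborel. inner (f x) b = g x)" by auto
  then obtain g where g: "\<And>b. g b \<in> borel_measurable borel" "\<And>b. AE x in lborel. inner (f x) b = g b x"
    by metis
  have "AE x in lborel. \<forall>b\<in>Basis. inner (f x) b = g b x"
    by (rule AE_finite_allI) (auto simp: g(2))
  then have "AE x in lborel. f x = (\<Sum>b\<in>Basis. g b x *\<^sub>R b)"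
  proof eventually_elim
    case (elim x)
    then have "(\<Sum>b\<in>Basis. g b x *\<^sub>R b) = (\<Sum>b\<in>Basis. inner (f x) b *\<^sub>R b)" by (intro sum.cong) auto
    then show ?case by (simp add: euclidean_representation)
  qed
  moreover have "(\<lambda>x. \<Sum>b\<in>Basis. g b x *\<^sub>R b) \<in> borel_measurable borel"
    by (intro borel_measurable_sum borel_measurable_scaleR g(1) borel_measurable_const)
  ultimately show ?thesis by (intro bexI)
qed

text \<open>Boxes are an intersection-stable generator of the Borel sets, so vanishing spreads to
  all of them by a Dynkin argument; the integral over the whole space handles complements.\<close>

lemma integral_zero_on_boxes_imp_AE_zero:
  fixes f :: "'a::euclidean_space \<Rightarrow> 'b::{banach, second_countable_topology}"
  assumes f: "integrable lborel f" and z: "(LINT x|lborel. f x) = 0"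
    and box: "\<And>a b. (LINT x:box a b|lborel. f x) = 0"
  shows "AE x in lborel. f x = 0"
proof (rule sigma_finite_measure.density_zero[OF sigma_finite_lborel f])
  let ?G = "range (\<lambda>(a, b). box a b :: 'a set)"
  have fi: "set_integrable lborel A f" if "A \<in> sets borel" for A
    unfolding set_integrable_def using f that by (intro integrable_mult_indicator) auto
  fix A :: "'a set" assume A0: "A \<in> sets lborel"
  have sG: "sigma_sets UNIV ?G = sets borel" by (subst borel_eq_box) (simp add: sets_measure_of_conv)
  have "Int_stable ?G"
  proof (rule Int_stableI, elim rangeE)
    fix X Y :: "'a set" and p q :: "'a \<times> 'a"
    assume XY: "X = (case p of (a, b) \<Rightarrow> box a b)" "Y = (case q of (a, b) \<Rightarrow> box a b)"
    have "\<exists>e f. box (fst p) (snd p) \<inter> box (fst q) (snd q) = box e f" by (intro exI) (rule box_Int_box)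
    then obtain e f where ef: "box (fst p) (snd p) \<inter> box (fst q) (snd q) = box e f" by (elim exE)
    show "X \<inter> Y \<in> ?G" unfolding XY case_prod_beta ef
      by (rule range_eqI[of _ _ "(e, f)"]) simp
  qed
  moreover have "?G \<subseteq> Pow UNIV" by simp
  moreover have "A \<in> sigma_sets UNIV ?G" using A0 sG by simp
  ultimately show "(LINT x:A|lborel. f x) = 0"
  proof (induction rule: sigma_sets_induct_disjoint)
    case (basic A) then show ?case using box by auto
  next
    case empty then show ?case by (simp add: set_lebesgue_integral_def)
  next
    case (compl A)
    then have A: "A \<in> sets borel" using sG by simp
    have "(LINT x:A \<union> (UNIV - A)|lborel. f x) = (LINT x:A|lborel. f x) + (LINT x:UNIV - A|lborel. f x)"
      using A by (intro set_integral_Un fi) auto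
    moreover have "(LINT x:A \<union> (UNIV - A)|lborel. f x) = 0" using z by (simp add: set_lebesgue_integral_def)
    ultimately show ?case using compl by simp
  next
    case (union A)
    then have A: "A i \<in> sets borel" for i using sG by auto
    have "(LINT x:(\<Union>i. A i)|lborel. f x) = (\<Sum>i. (LINT x:A i|lborel. f x))"
      by (rule lebesgue_integral_countable_add) (use union(1) A in \<open>auto simp: disjoint_family_on_def intro!: fi\<close>)
    then show ?case using union by simp
  qed
qed

lemma test_function_continuous: "test_function \<psi> \<Longrightarrow> continuous_on S \<psi>"
  unfolding test_function_def using cont_diff_continuous continuous_on_subset by blast

lemma test_function_borel: "test_function \<psi> \<Longrightarrow> \<psi> \<in> borel_measurable borel"
  by (rule borel_measurable_continuous_onI) (rule test_function_continuous)

text \<open>Bumps converge to indicators of boxes under the integral. As \<open>h\<close> is only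
  locally integrable, the box criterion is applied to its restrictions to a countable
  exhaustion.\<close>

lemma test_functions_separate:
  fixes h :: "real^'n::finite \<Rightarrow> 'b::euclidean_space"
  assumes h: "h \<in> borel_measurable borel" "\<And>a b. set_integrable lborel (cbox a b) h"
    and z: "\<And>\<psi>. test_function \<psi> \<Longrightarrow> (LINT x|lborel. \<psi> x *\<^sub>R h x) = 0"
  shows "AE x in lborel. h x = 0"
proof -
  note [measurable] = h(1)
  have hb: "set_integrable lborel (box a b) h" for a b
    by (rule set_integrable_subset[OF h(2)[of a b] _ box_subset_cbox]) simp
  have box: "(LINT x:box a b|lborel. h x) = 0" for a b
  proof -
    have "(\<lambda>j. LINT x|lborel. box_bump j a b x *\<^sub>R h x) \<longlonglongrightarrow> (LINT x|lborel. indicator (box a b) x *\<^sub>R h x)"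
    proof (rule integral_dominated_convergence)
      show "integrable lborel (\<lambda>x. norm (indicator (box a b) x *\<^sub>R h x))"
        using hb[of a b] unfolding set_integrable_def by (rule integrable_norm)
      show "AE x in lborel. (\<lambda>j. box_bump j a b x *\<^sub>R h x) \<longlonglongrightarrow> indicator (box a b) x *\<^sub>R h x"
        by (intro AE_I2 tendsto_scaleR box_bump_tendsto tendsto_const)
      show "AE x in lborel. norm (box_bump j a b x *\<^sub>R h x) \<le> norm (indicator (box a b) x *\<^sub>R h x)" for j
        using box_bump_bounds[of j a b] by (auto intro!: mult_right_mono)
      show "(\<lambda>x. box_bump j a b x *\<^sub>R h x) \<in> borel_measurable lborel" for j
        using test_function_borel[OF test_function_box_bump] by measurable
    qed simp
    then show ?thesis
      unfolding set_lebesgue_integral_def z[OF test_function_box_bump] by (simp add: LIMSEQ_const_iff)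
  qed
  have "AE x in lborel. indicator (box (\<chi> i. - real n) (\<chi> i. real n)) x *\<^sub>R h x = 0" for n
  proof (rule integral_zero_on_boxes_imp_AE_zero)
    let ?B = "box (\<chi> i. - real n) (\<chi> i. real n) :: (real^'n) set"
    show "integrable lborel (\<lambda>x. indicator ?B x *\<^sub>R h x)"
      using hb unfolding set_integrable_def .
    show "(LINT x|lborel. indicator ?B x *\<^sub>R h x) = 0"
      using box unfolding set_lebesgue_integral_def .
    show "(LINT x:box a b|lborel. indicator ?B x *\<^sub>R h x) = 0" for a b
    proof -
      obtain c d where cd: "box a b \<inter> ?B = box c d" using box_Int_box by blast
      have "(LINT x:box a b|lborel. indicator ?B x *\<^sub>R h x) = (LINT x:box a b \<inter> ?B|lborel. h x)"
        unfolding set_lebesgue_integral_def by (simp add: indicator_inter_arith)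
      then show ?thesis unfolding cd box .
    qed
  qed
  then have "AE x in lborel. \<forall>n. indicator (box (\<chi> i. - real n) (\<chi> i. real n)) x *\<^sub>R h x = 0"
    unfolding AE_all_countable by blast
  then show ?thesis
  proof eventually_elim
    case (elim x)
    obtain n where n: "norm x < real n" using reals_Archimedean2 by blast
    have "- real n < x $ i \<and> x $ i < real n" for i using component_le_norm_cart[of x i] n by linarith
    then have "x \<in> box (\<chi> i. - real n) (\<chi> i. real n)" by (simp add: mem_box_cart)
    then show ?case using elim[rule_format, of n] by simp
  qed
qed

section \<open>Translations of square integrable functions\<close>

lemma AE_lborel_shift:
  fixes y :: "'a::euclidean_space"
  assumes "AE x in lborel. P x" shows "AE x in lborel. P (x + y)"
proof -
  have "AE x in distr lborel borel ((+) y). P x" using assms by (simp only: lborel_distr_plus)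
  then have "AE x in lborel. P (y + x)" by (rule AE_distrD[rotated]) simp
  then show ?thesis by (simp add: add.commute)
qed

lemma integral_lborel_shift:
  fixes f :: "'a::euclidean_space \<Rightarrow> 'b::{banach, second_countable_topology}"
  assumes "f \<in> borel_measurable borel"
  shows "(LINT x|lborel. f (x + y)) = (LINT x|lborel. f x)"
proof -
  have "(LINT x|distr lborel borel ((+) y). f x) = (LINT x|lborel. f (y + x))"
    using assms by (intro integral_distr) auto
  then show ?thesis unfolding lborel_distr_plus by (simp add: add.commute)
qed

lemma integrable_lborel_shift:
  fixes f :: "'a::euclidean_space \<Rightarrow> 'b::{banach, second_countable_topology}"
  assumes "integrable lborel f" shows "integrable lborel (\<lambda>x. f (x + y))"
proof -
  have "integrable (distr lborel borel ((+) y)) f" using assms by (simp only: lborel_distr_plus)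
  then have "integrable lborel (\<lambda>x. f (y + x))"
    by (subst (asm) integrable_distr_eq) (use assms in auto)
  then show ?thesis by (simp add: add.commute)
qed

lemma sq_int_shift:
  assumes "sq_int f" shows "sq_int (\<lambda>x. f (x + y))"
proof -
  have [measurable]: "f \<in> borel_measurable borel" using assms unfolding sq_int_def by blast
  have "(\<lambda>x. f (x + y)) \<in> borel_measurable borel" by measurable
  then show ?thesis
    using assms integrable_lborel_shift[of "\<lambda>x. (norm (f x))\<^sup>2" y] unfolding sq_int_def by simp
qed

text \<open>With \<open>x + y\<close> rather than \<open>x - y\<close> the generator is the partial
  derivative with positive sign.\<close>

definition l2_shift :: "'a::euclidean_space \<Rightarrow> ('a, 'b::euclidean_space) l2 \<Rightarrow> ('a, 'b) l2" where
  "l2_shift y u = l2_of (\<lambda>x. rp u (x + y))"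

lemma rp_shift: "AE x in lborel. rp (l2_shift y u) x = rp u (x + y)"
  unfolding l2_shift_def by (intro rp_l2_of sq_int_shift rp_sq_int)

lemma l2_shift_of: "sq_int f \<Longrightarrow> l2_shift y (l2_of f) = l2_of (\<lambda>x. f (x + y))"
  unfolding l2_shift_def
  by (subst l2_of_eq_iff) (auto intro: sq_int_shift AE_lborel_shift rp_l2_of)

lemma linear_l2_shift: "linear (l2_shift y)"
proof (rule linearI)
  fix u v :: "('a, 'b) l2" and c
  have "AE x in lborel. rp (u + v) (x + y) = rp u (x + y) + rp v (x + y)"
    by (rule AE_lborel_shift[OF rp_add])
  note a = this
  show "l2_shift y (u + v) = l2_shift y u + l2_shift y v"
    by (rule l2_eqI) (use a rp_shift[of y "u + v"] rp_shift[of y u] rp_shift[of y v]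
      rp_add[of "l2_shift y u" "l2_shift y v"] in \<open>eventually_elim, simp\<close>)
  have "AE x in lborel. rp (c *\<^sub>R u) (x + y) = c *\<^sub>R rp u (x + y)"
    by (rule AE_lborel_shift[OF rp_scale])
  note b = this
  show "l2_shift y (c *\<^sub>R u) = c *\<^sub>R l2_shift y u"
    by (rule l2_eqI) (use b rp_shift[of y "c *\<^sub>R u"] rp_shift[of y u] rp_scale[of c "l2_shift y u"]
      in \<open>eventually_elim, simp\<close>)
qed

lemma norm_l2_shift: "norm (l2_shift y u) = norm u"
proof -
  have "(norm (l2_shift y u))\<^sup>2 = (norm u)\<^sup>2"
    unfolding l2_shift_def norm_l2_of[OF sq_int_shift[OF rp_sq_int]] unfolding norm_l2
    using integral_lborel_shift[of "\<lambda>x. (norm (rp u x))\<^sup>2" y] by simp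
  then show ?thesis by simp
qed

lemma l2_shift_add: "l2_shift (x + y) u = l2_shift x (l2_shift y u)"
  using l2_shift_of[OF sq_int_shift[OF rp_sq_int], of x u y] unfolding l2_shift_def[of y] l2_shift_def[of "x + y"]
  by (simp add: add.assoc)

lemma l2_shift_0: "l2_shift 0 u = u"
  unfolding l2_shift_def by simp

subsection \<open>Density of test functions\<close>

lemma test_function_support:
  fixes \<psi> :: "'a::euclidean_space \<Rightarrow> real"
  assumes "test_function \<psi>" obtains R where "R > 0" "\<And>x. x \<notin> cball 0 R \<Longrightarrow> \<psi> x = 0"
proof -
  have "bounded (closure {x. \<psi> x \<noteq> 0})" using assms compact_imp_bounded unfolding test_function_def by blast
  then obtain R where R: "R > 0" "\<forall>x\<in>closure {x. \<psi> x \<noteq> 0}. norm x \<le> R" by (auto simp: bounded_pos)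
  then have "\<psi> x = 0" if "x \<notin> cball 0 R" for x
    using that closure_subset[of "{x. \<psi> x \<noteq> 0}"] by auto
  then show thesis using that R(1) by blast
qed

lemma sq_int_bounded_support:
  fixes f :: "'a::euclidean_space \<Rightarrow> 'b::euclidean_space"
  assumes f: "f \<in> borel_measurable borel" and b: "\<And>x. norm (f x) \<le> c * indicator (cball 0 R) x" and "c \<ge> 0"
  shows "sq_int f" "norm (l2_of f) \<le> c * sqrt (measure lborel (cball (0::'a) R))"
proof -
  have le: "(norm (f x))\<^sup>2 \<le> c\<^sup>2 * indicator (cball 0 R) x" for x
    using power_mono[OF b[of x] norm_ge_zero, of 2] by (auto simp: indicator_def)
  have i: "integrable lborel (\<lambda>x. c\<^sup>2 * indicator (cball (0::'a) R) x :: real)"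
    using emeasure_lborel_cball_finite[of "0::'a" R] by (intro integrable_mult_right integrable_real_indicator) auto
  show s: "sq_int f"
    unfolding sq_int_def
  proof
    show "integrable lborel (\<lambda>x. (norm (f x))\<^sup>2)"
      by (rule Bochner_Integration.integrable_bound[OF i]) (use f le in auto)
  qed (rule f)
  have "(norm (l2_of f))\<^sup>2 \<le> (LINT x|lborel. c\<^sup>2 * indicator (cball (0::'a) R) x)"
    unfolding norm_l2_of[OF s] by (rule integral_mono[OF _ i le]) (use s in \<open>auto simp: sq_int_def\<close>)
  also have "\<dots> = (c * sqrt (measure lborel (cball (0::'a) R)))\<^sup>2"
    by (simp add: power_mult_distrib)
  finally show "norm (l2_of f) \<le> c * sqrt (measure lborel (cball (0::'a) R))"
    by (rule power2_le_imp_le) (use \<open>c \<ge> 0\<close> in simp)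
qed

lemma sq_int_test:
  fixes \<psi> :: "'a::euclidean_space \<Rightarrow> real" and b :: "'b::euclidean_space"
  assumes \<psi>: "test_function \<psi>" shows "sq_int (\<lambda>x. \<psi> x *\<^sub>R b)"
proof -
  obtain R where R: "R > 0" "\<And>x. x \<notin> cball 0 R \<Longrightarrow> \<psi> x = 0" using test_function_support[OF \<psi>] by blast
  have "bounded (\<psi> ` cball 0 R)"
    by (intro compact_imp_bounded compact_continuous_image test_function_continuous \<psi> compact_cball)
  then obtain B where B: "B > 0" "\<forall>x\<in>cball 0 R. norm (\<psi> x) \<le> B" by (auto simp: bounded_pos)
  show ?thesis
  proof (rule sq_int_bounded_support(1)[where c = "B * norm b" and R = R])
    show "(\<lambda>x. \<psi> x *\<^sub>R b) \<in> borel_measurable borel" using test_function_borel[OF \<psi>] by measurable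
    show "norm (\<psi> x *\<^sub>R b) \<le> B * norm b * indicator (cball 0 R) x" for x
      using R(2)[of x] B by (auto simp: indicator_def intro!: mult_right_mono)
  qed (use B in simp)
qed

definition l2_test :: "('a::euclidean_space \<Rightarrow> real) \<Rightarrow> 'b::euclidean_space \<Rightarrow> ('a, 'b) l2" where
  "l2_test \<psi> b = l2_of (\<lambda>x. \<psi> x *\<^sub>R b)"

lemma test_times_integrable:
  assumes "test_function \<psi>" "sq_int f" shows "integrable lborel (\<lambda>x. \<psi> x *\<^sub>R f x)"
proof (rule Bochner_Integration.integrable_bound)
  have "sq_int (\<lambda>x. \<psi> x *\<^sub>R (1::real))" by (rule sq_int_test[OF assms(1)])
  moreover have "sq_int (\<lambda>x. norm (f x))"
  proof -
    have [measurable]: "f \<in> borel_measurable borel" using assms(2) unfolding sq_int_def by blast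
    have "(\<lambda>x. norm (f x)) \<in> borel_measurable borel" by measurable
    then show ?thesis using assms(2) unfolding sq_int_def by simp
  qed
  ultimately show "integrable lborel (\<lambda>x. inner (\<psi> x *\<^sub>R (1::real)) (norm (f x)))" by (rule sq_int_inner)
  have [measurable]: "\<psi> \<in> borel_measurable borel" "f \<in> borel_measurable borel"
    using test_function_borel[OF assms(1)] assms(2) unfolding sq_int_def by auto
  show "(\<lambda>x. \<psi> x *\<^sub>R f x) \<in> borel_measurable lborel" by measurable
qed simp

lemma inner_l2_test:
  assumes "test_function \<psi>" "sq_int f"
  shows "inner (l2_test \<psi> b) (l2_of f) = inner (LINT x|lborel. \<psi> x *\<^sub>R f x) b"
proof -
  have "inner (l2_test \<psi> b) (l2_of f) = (LINT x|lborel. inner (\<psi> x *\<^sub>R f x) b)"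
    unfolding l2_test_def inner_l2_of[OF sq_int_test[OF assms(1)] assms(2)] by (simp add: inner_commute)
  also have "\<dots> = inner (LINT x|lborel. \<psi> x *\<^sub>R f x) b"
    by (rule integral_inner_left) (rule test_times_integrable[OF assms])
  finally show ?thesis .
qed

lemma sq_int_set_integrable:
  assumes "sq_int f" "compact K" shows "set_integrable lborel K f"
  unfolding set_integrable_def
proof (rule Bochner_Integration.integrable_bound)
  have K: "K \<in> sets borel" "emeasure lborel K < \<infinity>"
    using assms(2) by (auto simp: borel_compact compact_imp_bounded intro!: emeasure_bounded_finite[unfolded infinity_ennreal_def])
  show "integrable lborel (\<lambda>x. indicator K x + (norm (f x))\<^sup>2 :: real)"
    using assms(1) K unfolding sq_int_def by (intro Bochner_Integration.integrable_add integrable_real_indicator) auto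
  have [measurable]: "f \<in> borel_measurable borel" "K \<in> sets borel" using assms(1) K unfolding sq_int_def by auto
  show "(\<lambda>x. indicat_real K x *\<^sub>R f x) \<in> borel_measurable lborel" by measurable
  have "norm (f x) \<le> 1 + (norm (f x))\<^sup>2" for x
  proof -
    have "2 * norm (f x) \<le> (norm (f x))\<^sup>2 + 1"
      using zero_le_power2[of "norm (f x) - 1"] by (simp add: power2_diff)
    then show ?thesis using norm_ge_zero[of "f x"] by linarith
  qed
  then show "AE x in lborel. norm (indicat_real K x *\<^sub>R f x) \<le> norm (indicat_real K x + (norm (f x))\<^sup>2)"
    by (auto simp: indicator_def)
qed

text \<open>A vector orthogonal to every test function times every fixed matrix or vector
  \<open>b\<close> has zero integral against all tests, component by component, and so
  vanishes.\<close>

lemma l2_tests_total: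
  fixes S :: "(real^'n::finite, 'b::euclidean_space) l2 set"
  assumes "subspace S" "closed S" "\<And>\<psi> b. test_function \<psi> \<Longrightarrow> l2_test \<psi> b \<in> S"
  shows "S = UNIV"
proof (rule closed_subspace_dense_eq_UNIV[OF assms(1,2)])
  fix f assume f: "\<And>w. w \<in> S \<Longrightarrow> inner f w = 0"
  have "AE x in lborel. rp f x = 0"
  proof (rule test_functions_separate)
    show "set_integrable lborel (cbox a b) (rp f)" for a b by (rule sq_int_set_integrable) auto
    fix \<psi> :: "real^'n \<Rightarrow> real" assume \<psi>: "test_function \<psi>"
    have "inner (LINT x|lborel. \<psi> x *\<^sub>R rp f x) b = 0" for b
      using inner_l2_test[OF \<psi> rp_sq_int[of f], of b] f[OF assms(3)[OF \<psi>, of b]] by (simp add: inner_commute)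
    then show "(LINT x|lborel. \<psi> x *\<^sub>R rp f x) = 0" using inner_eq_zero_iff by blast
  qed simp
  then have "AE x in lborel. rp f x = rp 0 x" using rp_zero by eventually_elim simp
  then show "f = 0" by (rule l2_eqI)
qed

lemma test_function_affine_shift:
  assumes "test_function \<psi>" shows "test_function (\<lambda>x. \<psi> (x + y))"
  unfolding test_function_def
proof
  show "\<forall>n. cont_diff n (\<lambda>x. \<psi> (x + y))"
    using cont_diff_affine[OF bounded_linear_ident] assms unfolding test_function_def by blast
  have "{x. \<psi> (x + y) \<noteq> 0} = (\<lambda>x. - y + x) ` {x. \<psi> x \<noteq> 0}"
  proof (intro equalityI subsetI)
    fix x assume "x \<in> {x. \<psi> (x + y) \<noteq> 0}"
    then show "x \<in> (\<lambda>x. - y + x) ` {x. \<psi> x \<noteq> 0}" by (intro image_eqI[of _ _ "x + y"]) auto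
  qed auto
  then have "closure {x. \<psi> (x + y) \<noteq> 0} = (\<lambda>x. - y + x) ` closure {x. \<psi> x \<noteq> 0}"
    by (simp only: closure_translation)
  then show "compact (closure {x. \<psi> (x + y) \<noteq> 0})"
    using assms compact_translation unfolding test_function_def by metis
qed

lemma shift_l2_test: "test_function \<psi> \<Longrightarrow> l2_shift y (l2_test \<psi> b) = l2_test (\<lambda>x. \<psi> (x + y)) b"
  unfolding l2_test_def by (rule l2_shift_of) (rule sq_int_test)

text \<open>The radius \<open>R\<close> does not depend on \<open>e\<close>, so pointwise smallness
  becomes smallness in L2 with the volume of one fixed ball as constant.\<close>

lemma test_function_uniform:
  fixes \<psi> :: "'a::euclidean_space \<Rightarrow> real"
  assumes \<psi>: "test_function \<psi>"
  obtains R where "\<And>e. e > 0 \<Longrightarrow> \<exists>d>0. \<forall>x y. norm y < d \<longrightarrow> \<bar>\<psi> (x + y) - \<psi> x\<bar> \<le> e * indicator (cball 0 R) x"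
proof -
  obtain R where R: "R > 0" "\<And>x. x \<notin> cball 0 R \<Longrightarrow> \<psi> x = 0" using test_function_support[OF \<psi>] by blast
  show thesis
  proof (rule that[of "R + 1"])
    fix e :: real assume "e > 0"
    have "uniformly_continuous_on (cball 0 (R + 2)) \<psi>"
      by (intro compact_uniformly_continuous test_function_continuous \<psi> compact_cball)
    then obtain d where d: "d > 0" "\<And>x x'. x \<in> cball 0 (R + 2) \<Longrightarrow> x' \<in> cball 0 (R + 2) \<Longrightarrow> dist x' x < d \<Longrightarrow> dist (\<psi> x') (\<psi> x) < e"
      using \<open>e > 0\<close> unfolding uniformly_continuous_on_def by metis
    show "\<exists>d>0. \<forall>x y. norm y < d \<longrightarrow> \<bar>\<psi> (x + y) - \<psi> x\<bar> \<le> e * indicator (cball 0 (R + 1)) x"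
    proof (intro exI[of _ "min d 1"] conjI allI impI)
      fix x y :: 'a assume y: "norm y < min d 1"
      show "\<bar>\<psi> (x + y) - \<psi> x\<bar> \<le> e * indicator (cball 0 (R + 1)) x"
      proof (cases "x \<in> cball 0 (R + 1)")
        case True
        have "norm (x + y) \<le> norm x + norm y" by (rule norm_triangle_ineq)
        then have "x + y \<in> cball 0 (R + 2)" "x \<in> cball 0 (R + 2)" using True y by auto
        then have "dist (\<psi> (x + y)) (\<psi> x) < e" by (intro d(2)) (use y in \<open>auto simp: dist_norm\<close>)
        then show ?thesis using True by (simp add: dist_real_def)
      next
        case False
        have "norm x \<le> norm (x + y) + norm y" using norm_triangle_ineq4[of "x + y" y] by simp
        then have "x + y \<notin> cball 0 R" "x \<notin> cball 0 R" using False y by auto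
        then have "\<psi> (x + y) = 0" "\<psi> x = 0" by (auto intro!: R(2))
        then show ?thesis using \<open>e > 0\<close> by (simp add: indicator_def)
      qed
    qed (use d(1) in auto)
  qed
qed

text \<open>By isometry of the shifts the vectors with this property form a closed subspace; it
  contains the test functions by their uniform continuity on a fixed ball.\<close>

lemma l2_shift_tendsto: "((\<lambda>y. l2_shift y u) \<longlongrightarrow> u) (at 0)"
  for u :: "(real^'n::finite, 'b::euclidean_space) l2"
proof -
  let ?S = "{u :: (real^'n, 'b) l2. ((\<lambda>y. l2_shift y u) \<longlongrightarrow> u) (at 0)}"
  have "?S = UNIV"
  proof (rule l2_tests_total)
    show "subspace ?S"
    proof (rule subspaceI)
      show "0 \<in> ?S" by (simp add: linear_0[OF linear_l2_shift])
    qed (auto simp: linear_add[OF linear_l2_shift] linear_scale[OF linear_l2_shift] intro!: tendsto_add tendsto_scaleR)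
    show "closed ?S"
      unfolding closed_sequential_limits
    proof (intro allI impI, elim conjE)
      fix v :: "nat \<Rightarrow> (real^'n, 'b) l2" and l
      assume v: "\<forall>n. v n \<in> ?S" and l: "v \<longlonglongrightarrow> l"
      have "((\<lambda>y. l2_shift y l) \<longlongrightarrow> l) (at 0)"
      proof (rule tendstoI)
        fix e :: real assume "e > 0"
        then obtain n where n: "dist (v n) l < e / 3"
          using tendstoD[OF l, of "e / 3"] by (auto simp: eventually_sequentially)
        have "((\<lambda>y. l2_shift y (v n)) \<longlongrightarrow> v n) (at 0)" using v by blast
        then have "\<forall>\<^sub>F y in at 0. dist (l2_shift y (v n)) (v n) < e / 3" using \<open>e > 0\<close> by (intro tendstoD) auto
        then show "\<forall>\<^sub>F y in at 0. dist (l2_shift y l) l < e"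
        proof eventually_elim
          case (elim y)
          have "norm (l2_shift y (l - v n)) = norm (l - v n)" by (rule norm_l2_shift)
          then have "dist (l2_shift y l) (l2_shift y (v n)) = dist l (v n)"
            by (simp add: dist_norm linear_diff[OF linear_l2_shift])
          then show ?case
            using elim n dist_triangle[of "l2_shift y l" l "l2_shift y (v n)"] dist_triangle[of "l2_shift y (v n)" l "v n"]
            by (simp add: dist_commute)
        qed
      qed
      then show "l \<in> ?S" by blast
    qed
    fix \<psi> :: "real^'n \<Rightarrow> real" and b :: 'b assume \<psi>: "test_function \<psi>"
    have "((\<lambda>y. l2_shift y (l2_test \<psi> b)) \<longlongrightarrow> l2_test \<psi> b) (at 0)"
    proof (rule tendstoI)
      fix e :: real assume e: "e > 0"
      obtain R where R: "\<And>e. e > 0 \<Longrightarrow> \<exists>d>0. \<forall>x y. norm y < d \<longrightarrow> \<bar>\<psi> (x + y) - \<psi> x\<bar> \<le> e * indicator (cball 0 R) x"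
        by (rule test_function_uniform[OF \<psi>]) (rule that, blast)
      \<comment> \<open>Bounds \<open>|b|\<close> times the root of the volume; the added ones make
        it positive.\<close>
      define c where "c = (norm b + 1) * (sqrt (measure lborel (cball (0::real^'n) R)) + 1)"
      have c: "c > 0" unfolding c_def by (intro mult_pos_pos add_nonneg_pos) auto
      then have "e / (2 * c) > 0" using e by simp
      then obtain d where d: "0 < d" "\<And>x y. norm y < d \<Longrightarrow> \<bar>\<psi> (x + y) - \<psi> x\<bar> \<le> e / (2 * c) * indicator (cball 0 R) x"
        using R by blast
      have "dist (l2_shift y (l2_test \<psi> b)) (l2_test \<psi> b) < e" if y: "norm y < d" for y
      proof -
        have eq: "l2_shift y (l2_test \<psi> b) - l2_test \<psi> b = l2_of (\<lambda>x. (\<psi> (x + y) - \<psi> x) *\<^sub>R b)"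
          unfolding shift_l2_test[OF \<psi>] unfolding l2_test_def scaleR_diff_left
          by (rule l2_of_diff[symmetric]) (intro sq_int_test test_function_affine_shift \<psi>)+
        have "norm (l2_of (\<lambda>x. (\<psi> (x + y) - \<psi> x) *\<^sub>R b)) \<le> (e / (2 * c) * norm b) * sqrt (measure lborel (cball (0::real^'n) R))"
        proof (rule sq_int_bounded_support(2))
          show "(\<lambda>x. (\<psi> (x + y) - \<psi> x) *\<^sub>R b) \<in> borel_measurable borel"
            using test_function_borel[OF \<psi>] test_function_borel[OF test_function_affine_shift[OF \<psi>, of y]] by measurable
          fix x
          have "\<bar>\<psi> (x + y) - \<psi> x\<bar> \<le> e / (2 * c) * indicator (cball 0 R) x" by (rule d(2)[OF y])
          then show "norm ((\<psi> (x + y) - \<psi> x) *\<^sub>R b) \<le> e / (2 * c) * norm b * indicator (cball 0 R) x"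
            using mult_right_mono[of "\<bar>\<psi> (x + y) - \<psi> x\<bar>" "e / (2 * c) * indicator (cball 0 R) x" "norm b"] by (simp add: mult_ac)
        qed (use e c in simp)
        also have "\<dots> = e / (2 * c) * (norm b * sqrt (measure lborel (cball (0::real^'n) R)))" by simp
        also have "\<dots> \<le> e / (2 * c) * c"
          unfolding c_def[symmetric] using e c by (intro mult_left_mono) (auto simp: c_def intro!: mult_mono)
        also have "\<dots> < e" using c e by simp
        finally show ?thesis using eq by (simp add: dist_norm)
      qed
      then show "\<forall>\<^sub>F y in at 0. dist (l2_shift y (l2_test \<psi> b)) (l2_test \<psi> b) < e"
        unfolding eventually_at using d(1) by (intro exI[of _ d]) auto
    qed
    then show "l2_test \<psi> b \<in> ?S" by blast
  qed
  then show ?thesis by blast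
qed

lemma l2_shift_continuous: "continuous_on UNIV (\<lambda>y. l2_shift y u)"
  for u :: "(real^'n::finite, 'b::euclidean_space) l2"
  unfolding continuous_on_def
proof
  fix y :: "real^'n"
  have "((\<lambda>h. l2_shift y (l2_shift h u)) \<longlongrightarrow> l2_shift y u) (at 0)"
  proof (rule LIM_zero_cancel, rule Lim_null_comparison)
    show "\<forall>\<^sub>F h in at 0. norm (l2_shift y (l2_shift h u) - l2_shift y u) \<le> norm (l2_shift h u - u)"
      by (simp add: linear_diff[OF linear_l2_shift, symmetric] norm_l2_shift)
    show "((\<lambda>h. norm (l2_shift h u - u)) \<longlongrightarrow> 0) (at 0)"
      by (intro tendsto_norm_zero LIM_zero l2_shift_tendsto)
  qed
  then have "((\<lambda>h. l2_shift (y + h) u) \<longlongrightarrow> l2_shift y u) (at 0)" by (simp add: l2_shift_add)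
  then show "((\<lambda>y. l2_shift y u) \<longlongrightarrow> l2_shift y u) (at y within UNIV)"
    using LIM_offset_zero_iff[of y "\<lambda>y. l2_shift y u" "l2_shift y u"] by simp
qed

interpretation l2: translation_group "l2_shift :: real^'n::finite \<Rightarrow> (real^'n, 'b::euclidean_space) l2 \<Rightarrow> _"
  by (rule translation_group.intro) (rule linear_l2_shift norm_l2_shift l2_shift_add l2_shift_0 l2_shift_continuous)+

section \<open>Lebesgue functions and their classes\<close>

text \<open>Lebesgue measurable functions enter the Hilbert space through a Borel representative;
  the value is meaningful on \<open>Lp 2\<close> only.\<close>

definition cls :: "('a::euclidean_space \<Rightarrow> 'b::euclidean_space) \<Rightarrow> ('a, 'b) l2" where
  "cls f = l2_of (SOME g. sq_int g \<and> (AE x in lborel. f x = g x))"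

lemma Lp2_iff: "f \<in> Lp 2 \<longleftrightarrow> f \<in> borel_measurable lebesgue \<and> integrable lebesgue (\<lambda>x. (norm (f x))\<^sup>2)"
  unfolding Lp_def by simp

lemma Lp2_representative:
  assumes "f \<in> Lp 2" shows "\<exists>g. sq_int g \<and> (AE x in lborel. f x = g x)"
proof -
  have f: "f \<in> borel_measurable lebesgue" "integrable lebesgue (\<lambda>x. (norm (f x))\<^sup>2)"
    using assms unfolding Lp2_iff by auto
  obtain g where g: "g \<in> borel_measurable borel" "AE x in lborel. f x = g x"
    using lebesgue_borel_representative[OF f(1)] by blast
  have [measurable]: "g \<in> borel_measurable borel" by (rule g(1))
  have m: "(\<lambda>x. (norm (g x))\<^sup>2) \<in> borel_measurable lborel" by measurable
  have "AE x in lebesgue. (norm (f x))\<^sup>2 = (norm (g x))\<^sup>2"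
    using AE_completion[OF g(2)] by eventually_elim simp
  then have "integrable lebesgue (\<lambda>x. (norm (g x))\<^sup>2)"
    by (rule Bochner_Integration.integrable_cong_AE_imp[OF f(2) measurable_completion[OF m], rotated]) 
  then have "integrable lborel (\<lambda>x. (norm (g x))\<^sup>2)" using integrable_completion[OF m] by blast
  then show ?thesis using g unfolding sq_int_def by blast
qed

lemma rp_cls:
  assumes "f \<in> Lp 2" shows "AE x in lborel. rp (cls f) x = f x"
proof -
  define g where "g = (SOME g. sq_int g \<and> (AE x in lborel. f x = g x))"
  have g: "sq_int g \<and> (AE x in lborel. f x = g x)"
    unfolding g_def by (rule someI_ex[OF Lp2_representative[OF assms]])
  then have "AE x in lborel. rp (cls f) x = g x" unfolding cls_def g_def[symmetric] by (intro rp_l2_of) blast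
  with conjunct2[OF g] show ?thesis by eventually_elim simp
qed

lemma sq_int_Lp2: "sq_int f \<Longrightarrow> f \<in> Lp 2"
  unfolding sq_int_def Lp2_iff by (auto simp: integrable_completion intro: measurable_completion)

lemma Lp2_AE_I:
  assumes f: "f \<in> borel_measurable lebesgue" and e: "AE x in lborel. f x = rp u x"
  shows "f \<in> Lp 2" "cls f = u"
proof -
  have "rp u \<in> Lp 2" by (rule sq_int_Lp2) simp
  then have i: "integrable lebesgue (\<lambda>x. (norm (rp u x))\<^sup>2)" unfolding Lp2_iff by blast
  have "integrable lebesgue (\<lambda>x. (norm (f x))\<^sup>2)"
  proof (rule Bochner_Integration.integrable_cong_AE_imp[OF i])
    show "(\<lambda>x. (norm (f x))\<^sup>2) \<in> borel_measurable lebesgue" using f by measurable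
    show "AE x in lebesgue. (norm (rp u x))\<^sup>2 = (norm (f x))\<^sup>2"
      using AE_completion[OF e] by eventually_elim simp
  qed
  then show L: "f \<in> Lp 2" using f unfolding Lp2_iff by blast
  show "cls f = u" by (rule l2_eqI) (use rp_cls[OF L] e in \<open>eventually_elim, simp\<close>)
qed

lemma cls_rp [simp]: "cls (rp u) = u" "rp u \<in> Lp 2"
proof -
  have "rp u \<in> borel_measurable lebesgue"
    using measurable_completion[of "rp u" lborel borel] by simp
  from Lp2_AE_I[OF this, of u] show "cls (rp u) = u" "rp u \<in> Lp 2" by simp_all
qed

lemma Lp2_measurable: "f \<in> Lp 2 \<Longrightarrow> f \<in> borel_measurable lebesgue"
  unfolding Lp2_iff by blast

lemma Lp2_diff:
  assumes "f \<in> Lp 2" "g \<in> Lp 2"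
  shows "(\<lambda>x. f x - g x) \<in> Lp 2" "cls (\<lambda>x. f x - g x) = cls f - cls g"
proof -
  have m: "(\<lambda>x. f x - g x) \<in> borel_measurable lebesgue"
    by (intro borel_measurable_diff Lp2_measurable assms)
  have "AE x in lborel. f x - g x = rp (cls f - cls g) x"
    using rp_cls[OF assms(1)] rp_cls[OF assms(2)] rp_diff[of "cls f" "cls g"] by eventually_elim simp
  from Lp2_AE_I[OF m this] show "(\<lambda>x. f x - g x) \<in> Lp 2" "cls (\<lambda>x. f x - g x) = cls f - cls g" .
qed

lemma Lp2_scale:
  assumes "f \<in> Lp 2"
  shows "(\<lambda>x. c *\<^sub>R f x) \<in> Lp 2" "cls (\<lambda>x. c *\<^sub>R f x) = c *\<^sub>R cls f"
proof -
  have m: "(\<lambda>x. c *\<^sub>R f x) \<in> borel_measurable lebesgue"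
    by (intro borel_measurable_scaleR borel_measurable_const Lp2_measurable assms)
  have "AE x in lborel. c *\<^sub>R f x = rp (c *\<^sub>R cls f) x"
    using rp_cls[OF assms] rp_scale[of c "cls f"] by eventually_elim simp
  from Lp2_AE_I[OF m this] show "(\<lambda>x. c *\<^sub>R f x) \<in> Lp 2" "cls (\<lambda>x. c *\<^sub>R f x) = c *\<^sub>R cls f" .
qed

lemma Lp_norm_cls:
  assumes "f \<in> Lp 2" shows "Lp_norm 2 f = norm (cls f)"
proof -
  have m: "(\<lambda>x. (norm (rp (cls f) x))\<^sup>2) \<in> borel_measurable lborel" by measurable
  have "(LINT x|lebesgue. norm (f x) powr 2) = (LINT x|lebesgue. (norm (rp (cls f) x))\<^sup>2)"
  proof (rule integral_cong_AE)
    show "(\<lambda>x. norm (f x) powr 2) \<in> borel_measurable lebesgue"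
      using Lp2_measurable[OF assms] by measurable
    show "(\<lambda>x. (norm (rp (cls f) x))\<^sup>2) \<in> borel_measurable lebesgue" by (rule measurable_completion[OF m])
    show "AE x in lebesgue. norm (f x) powr 2 = (norm (rp (cls f) x))\<^sup>2"
      using AE_completion[OF rp_cls[OF assms]] by eventually_elim simp
  qed
  also have "\<dots> = (norm (cls f))\<^sup>2" unfolding integral_completion[OF m] by (rule norm_l2[symmetric])
  finally show ?thesis unfolding Lp_norm_def by (simp add: powr_half_sqrt)
qed

section \<open>Weak derivatives as generators of translations\<close>

lemma Lp2_locally_integrable:
  assumes "f \<in> Lp 2" shows "locally_integrable f"
  unfolding locally_integrable_def
proof (intro allI impI)
  fix K :: "'a set" assume K: "compact K"
  then have Kb: "K \<in> sets borel" by (simp add: borel_compact)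
  have m: "(\<lambda>x. indicat_real K x *\<^sub>R rp (cls f) x) \<in> borel_measurable lborel" using Kb by measurable
  have "integrable lborel (\<lambda>x. indicat_real K x *\<^sub>R rp (cls f) x)"
    using sq_int_set_integrable[OF rp_sq_int K] unfolding set_integrable_def .
  then have i: "integrable lebesgue (\<lambda>x. indicat_real K x *\<^sub>R rp (cls f) x)" using integrable_completion[OF m] by blast
  have f: "f \<in> borel_measurable lebesgue" by (rule Lp2_measurable[OF assms])
  show "set_integrable lebesgue K f"
    unfolding set_integrable_def
  proof (rule Bochner_Integration.integrable_cong_AE_imp[OF i])
    have "indicat_real K \<in> borel_measurable lebesgue"
      by (rule borel_measurable_indicator) (use Kb in \<open>simp add: sets_completionI_sets\<close>)
    then show "(\<lambda>x. indicat_real K x *\<^sub>R f x) \<in> borel_measurable lebesgue" using f by measurable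
    show "AE x in lebesgue. indicat_real K x *\<^sub>R rp (cls f) x = indicat_real K x *\<^sub>R f x"
      using AE_completion[OF rp_cls[OF assms]] by eventually_elim simp
  qed
qed

lemma test_function_lebesgue: "test_function \<psi> \<Longrightarrow> \<psi> \<in> borel_measurable lebesgue"
  using measurable_completion[of \<psi> lborel borel] test_function_borel[of \<psi>] by simp

lemma integral_test_representative:
  fixes f :: "'a::euclidean_space \<Rightarrow> 'b::euclidean_space"
  assumes "test_function \<psi>" "f \<in> borel_measurable lebesgue" "g \<in> borel_measurable borel" "AE x in lborel. f x = g x"
  shows "(LINT x|lebesgue. \<psi> x *\<^sub>R f x) = (LINT x|lborel. \<psi> x *\<^sub>R g x)"
proof -
  have [measurable]: "\<psi> \<in> borel_measurable borel" "g \<in> borel_measurable borel"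
    using test_function_borel[OF assms(1)] assms(3) by auto
  have m: "(\<lambda>x. \<psi> x *\<^sub>R g x) \<in> borel_measurable lborel" by measurable
  have "(LINT x|lebesgue. \<psi> x *\<^sub>R f x) = (LINT x|lebesgue. \<psi> x *\<^sub>R g x)"
  proof (rule integral_cong_AE)
    show "(\<lambda>x. \<psi> x *\<^sub>R f x) \<in> borel_measurable lebesgue"
      by (intro borel_measurable_scaleR test_function_lebesgue assms)
    show "(\<lambda>x. \<psi> x *\<^sub>R g x) \<in> borel_measurable lebesgue" by (rule measurable_completion[OF m])
    show "AE x in lebesgue. \<psi> x *\<^sub>R f x = \<psi> x *\<^sub>R g x"
      using AE_completion[OF assms(4)] by eventually_elim simp
  qed
  then show ?thesis unfolding integral_completion[OF m] .
qed

lemma inner_test_cls: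
  assumes "test_function \<psi>" "f \<in> Lp 2"
  shows "inner (l2_test \<psi> b) (cls f) = inner (LINT x|lebesgue. \<psi> x *\<^sub>R f x) b"
proof -
  have "AE x in lborel. f x = rp (cls f) x" using rp_cls[OF assms(2)] by eventually_elim simp
  from integral_test_representative[OF assms(1) Lp2_measurable[OF assms(2)] rp_measurable this]
  show ?thesis using inner_l2_test[OF assms(1) rp_sq_int[of "cls f"], of b] by simp
qed

lemma test_function_derivative:
  fixes \<psi> :: "'a::euclidean_space \<Rightarrow> real"
  assumes "test_function \<psi>" shows "test_function (\<lambda>x. frechet_derivative \<psi> (at x) v)"
  unfolding test_function_def
proof
  show "\<forall>n. cont_diff n (\<lambda>x. frechet_derivative \<psi> (at x) v)"
    using assms cont_diff_SucD(2) unfolding test_function_def by blast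
  let ?C = "closure {x. \<psi> x \<noteq> 0}"
  have "frechet_derivative \<psi> (at x) v = 0" if "x \<notin> ?C" for x
  proof -
    have "((\<lambda>x. 0) has_derivative (\<lambda>v. 0)) (at x)" by simp
    then have "(\<psi> has_derivative (\<lambda>v. 0)) (at x)"
      by (rule has_derivative_transform_within_open[where s = "- ?C"])
        (use that closure_subset[of "{x. \<psi> x \<noteq> 0}"] in auto)
    from frechet_derivative_at[OF this, symmetric] show ?thesis by simp
  qed
  then have "{x. frechet_derivative \<psi> (at x) v \<noteq> 0} \<subseteq> ?C" by blast
  then have c: "closure {x. frechet_derivative \<psi> (at x) v \<noteq> 0} \<subseteq> ?C" by (rule closure_minimal) (rule closed_closure)
  have "compact ?C" using assms unfolding test_function_def by blast
  then have "compact (?C \<inter> closure {x. frechet_derivative \<psi> (at x) v \<noteq> 0})"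
    by (rule compact_Int_closed[OF _ closed_closure])
  then show "compact (closure {x. frechet_derivative \<psi> (at x) v \<noteq> 0})" using c by (simp add: Int_absorb1)
qed

lemma test_function_has_derivative:
  "test_function \<psi> \<Longrightarrow> (\<psi> has_derivative frechet_derivative \<psi> (at x)) (at x)"
  unfolding test_function_def using cont_diff_SucD(1)[of 0 \<psi> x] by blast

lemma frechet_derivative_shift:
  assumes "test_function \<psi>"
  shows "frechet_derivative (\<lambda>x. \<psi> (x + y)) (at x) v = frechet_derivative \<psi> (at (x + y)) v"
proof -
  have "((\<lambda>x. x + y) has_derivative (\<lambda>v. v)) (at x)" by (auto intro!: derivative_eq_intros)
  from diff_chain_at[OF this test_function_has_derivative[OF assms]]
  have "((\<lambda>x. \<psi> (x + y)) has_derivative frechet_derivative \<psi> (at (x + y))) (at x)" by (simp add: o_def)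
  from frechet_derivative_at[OF this] show ?thesis by simp
qed

text \<open>Pointwise the remainder is at most \<open>|h|\<close> times the oscillation of the
  derivative over a short segment, and it is supported in one fixed ball; hence it is o(h) in
  L2.\<close>

lemma pd_test:
  fixes \<psi> :: "real^'n::finite \<Rightarrow> real" and b :: "'b::euclidean_space"
  assumes \<psi>: "test_function \<psi>"
  shows "l2.pd k (l2_test \<psi> b) (l2_test (\<lambda>x. frechet_derivative \<psi> (at x) (axis k 1)) b)"
  unfolding l2.pd_def has_vector_derivative_def has_derivative_within_alt
proof (intro conjI allI impI bounded_linear_scaleR_left)
  let ?d = "\<lambda>x. frechet_derivative \<psi> (at x) (axis k 1)"
  have d: "test_function ?d" by (rule test_function_derivative[OF \<psi>])
  fix e :: real assume e: "e > 0"
  obtain R where R: "\<And>e. e > 0 \<Longrightarrow> \<exists>\<delta>>0. \<forall>x y. norm y < \<delta> \<longrightarrow> \<bar>?d (x + y) - ?d x\<bar> \<le> e * indicator (cball 0 R) x"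
    by (rule test_function_uniform[OF d]) (rule that, blast)
  define c where "c = (norm b + 1) * (sqrt (measure lborel (cball (0::real^'n) R)) + 1)"
  have c: "c > 0" unfolding c_def by (intro mult_pos_pos add_nonneg_pos) auto
  then have "e / c > 0" using e by simp
  then obtain \<delta> where \<delta>: "0 < \<delta>" "\<And>x y. norm y < \<delta> \<Longrightarrow> \<bar>?d (x + y) - ?d x\<bar> \<le> e / c * indicator (cball 0 R) x"
    using R by blast
  show "\<exists>\<delta>>0. \<forall>h\<in>UNIV. norm (h - 0) < \<delta> \<longrightarrow>
      norm (l2_shift (axis k h) (l2_test \<psi> b) - l2_shift (axis k 0) (l2_test \<psi> b) - (h - 0) *\<^sub>R l2_test ?d b) \<le> e * norm (h - 0)"
  proof (intro exI[of _ \<delta>] conjI ballI impI \<delta>(1))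
    fix h :: real assume h: "norm (h - 0) < \<delta>"
    define \<phi> where "\<phi> x = \<psi> (x + axis k h) - \<psi> x - h * ?d x" for x
    have \<phi>: "\<bar>\<phi> x\<bar> \<le> (e / c * \<bar>h\<bar>) * indicator (cball 0 R) x" for x
    proof -
      have "norm (\<psi> (x + axis k h) - \<psi> (x + axis k 0) - (h - 0) *\<^sub>R ?d x) \<le> (e / c * indicator (cball 0 R) x) * \<bar>h - 0\<bar>"
      proof (rule vector_derivative_linear_bound[where a = "min 0 h" and b = "max 0 h" and f = "\<lambda>s. \<psi> (x + axis k s)" and f' = "\<lambda>s. ?d (x + axis k s)"])
        fix s assume s: "s \<in> {min 0 h..max 0 h}"
        have e: "axis k r = r *\<^sub>R axis k 1" for r :: real by (simp add: axis_def vec_eq_iff)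
        have eq: "(\<lambda>s. \<psi> (x + axis k s)) = (\<lambda>s. \<psi> (x + s *\<^sub>R axis k 1))"
          by (rule ext) (subst e, rule refl)
        have "((\<lambda>s. x + s *\<^sub>R axis k 1) has_derivative (\<lambda>r. r *\<^sub>R axis k 1)) (at s)"
          by (auto intro!: derivative_eq_intros)
        from diff_chain_at[OF this test_function_has_derivative[OF \<psi>]]
        have "((\<lambda>s. \<psi> (x + s *\<^sub>R axis k 1)) has_derivative (\<lambda>r. frechet_derivative \<psi> (at (x + s *\<^sub>R axis k 1)) (r *\<^sub>R axis k 1))) (at s)"
          by (simp add: o_def)
        moreover have "frechet_derivative \<psi> (at (x + s *\<^sub>R axis k 1)) (r *\<^sub>R axis k 1) = r *\<^sub>R ?d (x + s *\<^sub>R axis k 1)" for r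
          by (rule linear_scale[OF has_derivative_linear[OF test_function_has_derivative[OF \<psi>]]])
        ultimately have "((\<lambda>s. \<psi> (x + axis k s)) has_vector_derivative ?d (x + axis k s)) (at s)"
          unfolding has_vector_derivative_def eq e[of s] by (simp only:)
        then show "((\<lambda>s. \<psi> (x + axis k s)) has_vector_derivative ?d (x + axis k s)) (at s within {min 0 h..max 0 h})"
          by (rule has_vector_derivative_at_within)
        have "norm (axis k s) < \<delta>" using s h unfolding e[of s] by (auto simp: norm_axis_1)
        then show "norm (?d (x + axis k s) - ?d x) \<le> e / c * indicator (cball 0 R) x"
          using \<delta>(2) unfolding real_norm_def by blast
      qed auto
      then show ?thesis unfolding \<phi>_def by (simp add: l2.axis_zero_real mult_ac)
    qed
    have [measurable]: "\<psi> \<in> borel_measurable borel" "?d \<in> borel_measurable borel"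
      using test_function_borel[OF \<psi>] test_function_borel[OF d] by auto
    have "norm (l2_of (\<lambda>x. \<phi> x *\<^sub>R b)) \<le> (e / c * \<bar>h\<bar> * norm b) * sqrt (measure lborel (cball (0::real^'n) R))"
    proof (rule sq_int_bounded_support(2))
      show "(\<lambda>x. \<phi> x *\<^sub>R b) \<in> borel_measurable borel" unfolding \<phi>_def by measurable
      show "norm (\<phi> x *\<^sub>R b) \<le> e / c * \<bar>h\<bar> * norm b * indicator (cball 0 R) x" for x
        using mult_right_mono[OF \<phi>[of x] norm_ge_zero[of b]] by (simp add: mult_ac)
    qed (use e c in simp)
    also have "\<dots> = e / c * \<bar>h\<bar> * (norm b * sqrt (measure lborel (cball (0::real^'n) R)))" by simp
    also have "\<dots> \<le> e / c * \<bar>h\<bar> * c"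
    proof (rule mult_left_mono)
      show "norm b * sqrt (measure lborel (cball (0::real^'n) R)) \<le> c"
        unfolding c_def by (intro mult_mono) auto
    qed (use e c in simp)
    also have "\<dots> = e * norm (h - 0)" using c by simp
    finally have n: "norm (l2_of (\<lambda>x. \<phi> x *\<^sub>R b)) \<le> e * norm (h - 0)" .
    have s: "sq_int (\<lambda>x. \<psi> (x + axis k h) *\<^sub>R b)" "sq_int (\<lambda>x. \<psi> x *\<^sub>R b)" "sq_int (\<lambda>x. ?d x *\<^sub>R b)"
      by (intro sq_int_test test_function_affine_shift \<psi> d)+
    have "l2_of (\<lambda>x. \<phi> x *\<^sub>R b) = l2_of (\<lambda>x. \<psi> (x + axis k h) *\<^sub>R b - \<psi> x *\<^sub>R b - h *\<^sub>R (?d x *\<^sub>R b))"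
      unfolding \<phi>_def by (simp add: scaleR_diff_left)
    also have "\<dots> = l2_shift (axis k h) (l2_test \<psi> b) - l2_test \<psi> b - h *\<^sub>R l2_test ?d b"
      unfolding shift_l2_test[OF \<psi>] unfolding l2_test_def
      by (simp only: l2_of_diff l2_of_scale s sq_int_diff sq_int_scale)
    finally have "l2_of (\<lambda>x. \<phi> x *\<^sub>R b) = l2_shift (axis k h) (l2_test \<psi> b) - l2_test \<psi> b - h *\<^sub>R l2_test ?d b" .
    then show "norm (l2_shift (axis k h) (l2_test \<psi> b) - l2_shift (axis k 0) (l2_test \<psi> b) - (h - 0) *\<^sub>R l2_test ?d b) \<le> e * norm (h - 0)"
      using n by simp
  qed
qed

lemma closure_subspace:
  assumes "subspace (S :: 'a::real_normed_vector set)" shows "subspace (closure S)"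
proof (rule subspaceI)
  show "0 \<in> closure S" using subspace_0[OF assms] closure_subset by blast
  show "x + y \<in> closure S" if xy: "x \<in> closure S" "y \<in> closure S" for x y
  proof -
    obtain u v where "\<forall>n. u n \<in> S" "u \<longlonglongrightarrow> x" "\<forall>n. v n \<in> S" "v \<longlonglongrightarrow> y"
      using xy unfolding closure_sequential by blast
    then have "\<forall>n. u n + v n \<in> S" "(\<lambda>n. u n + v n) \<longlonglongrightarrow> x + y"
      using subspace_add[OF assms] by (auto intro: tendsto_add)
    then show ?thesis unfolding closure_sequential by (intro exI conjI)
  qed
  show "c *\<^sub>R x \<in> closure S" if x: "x \<in> closure S" for c x
  proof -
    obtain u where "\<forall>n. u n \<in> S" "u \<longlonglongrightarrow> x" using x unfolding closure_sequential by blast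
    then have "\<forall>n. c *\<^sub>R u n \<in> S" "(\<lambda>n. c *\<^sub>R u n) \<longlonglongrightarrow> c *\<^sub>R x"
      using subspace_scale[OF assms] by (auto intro: tendsto_scaleR)
    then show ?thesis unfolding closure_sequential by (intro exI conjI)
  qed
qed

text \<open>
  The weak identity is differentiated along \<open>s \<mapsto> \<langle>u, \<tau>\<^sub>-\<^sub>s w\<rangle>\<close> for \<open>w\<close> in a dense set; the mean value theorem
  gives exactly the bound that characterizes the generator.
\<close>

lemma weak_derivative_imp_pd:
  fixes u v :: "(real^'n::finite, 'b::euclidean_space) l2"
  assumes weak: "\<And>\<psi> b. test_function \<psi> \<Longrightarrow>
      inner (l2_test (\<lambda>x. frechet_derivative \<psi> (at x) (axis k 1)) b) u = - inner (l2_test \<psi> b) v"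
  shows "l2.pd k u v"
proof -
  \<comment> \<open>The identity is demanded for all translates of \<open>w\<close>, because it is
    used along the whole segment of shifts from 0 to \<open>h\<close>. Test functions qualify since
    their translates are test functions.\<close>
  define W where "W = {w :: (real^'n, 'b) l2. \<exists>w'. l2.pd k w w' \<and> (\<forall>y. inner (l2_shift y w') u = - inner (l2_shift y w) v)}"
  have sub: "subspace W"
  proof (rule subspaceI)
    have "l2.pd k (0 :: (real^'n, 'b) l2) 0" by (simp add: l2.pd_def linear_0[OF linear_l2_shift])
    then show "0 \<in> W" unfolding W_def by (auto simp: linear_0[OF linear_l2_shift])
    show "x + y \<in> W" if xy: "x \<in> W" "y \<in> W" for x y
    proof -
      obtain x' y' where "l2.pd k x x'" "\<forall>z. inner (l2_shift z x') u = - inner (l2_shift z x) v"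
        "l2.pd k y y'" "\<forall>z. inner (l2_shift z y') u = - inner (l2_shift z y) v" using xy unfolding W_def by blast
      then have "l2.pd k (x + y) (x' + y') \<and> (\<forall>z. inner (l2_shift z (x' + y')) u = - inner (l2_shift z (x + y)) v)"
        by (simp add: l2.pd_add l2.tau_plus inner_add_left)
      then show ?thesis unfolding W_def by blast
    qed
    show "c *\<^sub>R x \<in> W" if x: "x \<in> W" for c x
    proof -
      obtain x' where "l2.pd k x x'" "\<forall>z. inner (l2_shift z x') u = - inner (l2_shift z x) v" using x unfolding W_def by blast
      then have "l2.pd k (c *\<^sub>R x) (c *\<^sub>R x') \<and> (\<forall>z. inner (l2_shift z (c *\<^sub>R x')) u = - inner (l2_shift z (c *\<^sub>R x)) v)"
        by (simp add: l2.pd_scale l2.tau_scale)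
      then show ?thesis unfolding W_def by blast
    qed
  qed
  have "l2_test \<psi> b \<in> W" if \<psi>: "test_function \<psi>" for \<psi> b
  proof -
    have "inner (l2_shift y (l2_test (\<lambda>x. frechet_derivative \<psi> (at x) (axis k 1)) b)) u = - inner (l2_shift y (l2_test \<psi> b)) v" for y
      using weak[OF test_function_affine_shift[OF \<psi>, of y], of b]
      unfolding frechet_derivative_shift[OF \<psi>] shift_l2_test[OF \<psi>] shift_l2_test[OF test_function_derivative[OF \<psi>]] .
    then show ?thesis unfolding W_def using pd_test[OF \<psi>] by blast
  qed
  then have dense: "closure W = UNIV"
    using closure_subset[of W] by (intro l2_tests_total closure_subspace[OF sub] closed_closure) auto
  show ?thesis
    unfolding l2.pd_iff_bound
  proof (intro allI impI)
    fix h C assume C: "\<forall>s. \<bar>s\<bar> \<le> \<bar>h\<bar> \<longrightarrow> norm (l2_shift (axis k s) v - v) \<le> C"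
    have C0: "C \<ge> 0" using C[rule_format, of 0] by simp
    show "norm (l2_shift (axis k h) u - u - h *\<^sub>R v) \<le> C * \<bar>h\<bar>"
    proof (rule norm_le_inner_dense[OF dense])
      fix w assume "w \<in> W"
      then obtain w' where pd: "l2.pd k w w'" and w': "\<And>y. inner (l2_shift y w') u = - inner (l2_shift y w) v"
        unfolding W_def by blast
      have "norm (inner (l2_shift (axis k h) u) w - inner (l2_shift (axis k 0) u) w - (h - 0) *\<^sub>R inner v w) \<le> (C * norm w) * \<bar>h - 0\<bar>"
      proof (rule vector_derivative_linear_bound[where a = "min 0 h" and b = "max 0 h" and f = "\<lambda>s. inner (l2_shift (axis k s) u) w" and f' = "\<lambda>s. inner (l2_shift (axis k s) v) w"])
        fix s assume s: "s \<in> {min 0 h..max 0 h}"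
        have "((\<lambda>r. l2_shift (axis k r) w) \<circ> uminus has_vector_derivative ((-1) *\<^sub>R l2_shift (axis k (- s)) w')) (at s)"
          by (rule vector_diff_chain_at) (auto intro!: derivative_eq_intros l2.pd_curve[OF pd])
        then have "((\<lambda>r. inner u (l2_shift (axis k (- r)) w)) has_vector_derivative inner u ((-1) *\<^sub>R l2_shift (axis k (- s)) w')) (at s)"
          by (intro bounded_linear.has_vector_derivative[OF bounded_linear_inner_right]) (simp add: o_def)
        moreover have "inner u ((-1) *\<^sub>R l2_shift (axis k (- s)) w') = inner (l2_shift (axis k s) v) w"
        proof -
          have "inner u ((-1) *\<^sub>R l2_shift (axis k (- s)) w') = - inner (l2_shift (axis k (- s)) w') u"
            by (simp add: inner_commute)
          also have "\<dots> = inner v (l2_shift (- axis k s) w)"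
            unfolding w' by (simp add: inner_commute l2.axis_minus_real)
          also have "\<dots> = inner (l2_shift (axis k s) v) w" by (rule l2.inner_tau_swap[symmetric])
          finally show ?thesis .
        qed
        ultimately have "((\<lambda>s. inner (l2_shift (axis k s) u) w) has_vector_derivative inner (l2_shift (axis k s) v) w) (at s)"
          by (simp add: l2.inner_tau_swap l2.axis_minus_real)
        then show "((\<lambda>s. inner (l2_shift (axis k s) u) w) has_vector_derivative inner (l2_shift (axis k s) v) w) (at s within {min 0 h..max 0 h})"
          by (rule has_vector_derivative_at_within)
        have "\<bar>s\<bar> \<le> \<bar>h\<bar>" using s by auto
        then have "norm (l2_shift (axis k s) v - v) * norm w \<le> C * norm w" using C by (intro mult_right_mono) auto
        then show "norm (inner (l2_shift (axis k s) v) w - inner v w) \<le> C * norm w"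
          using Cauchy_Schwarz_ineq2[of "l2_shift (axis k s) v - v" w] by (simp add: inner_diff_left)
      qed auto
      then have "\<bar>inner (l2_shift (axis k h) u - u - h *\<^sub>R v) w\<bar> \<le> C * norm w * \<bar>h\<bar>"
        by (simp add: inner_diff_left)
      then show "inner (l2_shift (axis k h) u - u - h *\<^sub>R v) w \<le> C * \<bar>h\<bar> * norm w" by (simp add: mult_ac)
    qed (use C0 in simp)
  qed
qed

text \<open>The bridge between the distributional derivative and the generator. In one direction
  \<open>weak_derivative_imp_pd\<close> applies; in the other, \<open>pd_skew\<close> is evaluated
  against test functions.\<close>

lemma has_weak_partial_iff_pd:
  fixes f g :: "real^'n::finite \<Rightarrow> 'b::euclidean_space"
  assumes "f \<in> Lp 2" "g \<in> Lp 2"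
  shows "has_weak_partial k f g \<longleftrightarrow> l2.pd k (cls f) (cls g)"
proof
  assume w: "has_weak_partial k f g"
  show "l2.pd k (cls f) (cls g)"
  proof (rule weak_derivative_imp_pd)
    fix \<psi> :: "real^'n \<Rightarrow> real" and b :: 'b assume \<psi>: "test_function \<psi>"
    then show "inner (l2_test (\<lambda>x. frechet_derivative \<psi> (at x) (axis k 1)) b) (cls f) = - inner (l2_test \<psi> b) (cls g)"
      using w unfolding has_weak_partial_def inner_test_cls[OF \<psi> assms(2)] inner_test_cls[OF test_function_derivative[OF \<psi>] assms(1)]
      by simp
  qed
next
  assume pd: "l2.pd k (cls f) (cls g)"
  show "has_weak_partial k f g"
    unfolding has_weak_partial_def
  proof (intro conjI allI impI Lp2_locally_integrable assms)
    fix \<psi> :: "real^'n \<Rightarrow> real" assume \<psi>: "test_function \<psi>"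
    have "inner (l2_test (\<lambda>x. frechet_derivative \<psi> (at x) (axis k 1)) b) (cls f) = - inner (l2_test \<psi> b) (cls g)" for b
      by (rule l2.pd_skew[OF pd_test[OF \<psi>] pd])
    then have "inner (LINT x|lebesgue. frechet_derivative \<psi> (at x) (axis k 1) *\<^sub>R f x) b = inner (- (LINT x|lebesgue. \<psi> x *\<^sub>R g x)) b" for b
      unfolding inner_test_cls[OF \<psi> assms(2)] inner_test_cls[OF test_function_derivative[OF \<psi>] assms(1)] by simp
    then show "(LINT x|lebesgue. frechet_derivative \<psi> (at x) (axis k 1) *\<^sub>R f x) = - (LINT x|lebesgue. \<psi> x *\<^sub>R g x)"
      using euclidean_eqI by blast
  qed
qed

lemma locally_integrable_measurable:
  fixes f :: "'a::euclidean_space \<Rightarrow> 'b::euclidean_space"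
  assumes "locally_integrable f" shows "f \<in> borel_measurable lebesgue"
proof (rule borel_measurable_LIMSEQ_metric)
  show "(\<lambda>x. indicat_real (cball 0 (real n)) x *\<^sub>R f x) \<in> borel_measurable lebesgue" for n
    using assms unfolding locally_integrable_def set_integrable_def by (intro borel_measurable_integrable) auto
  fix x :: 'a
  obtain n where n: "norm x < real n" using reals_Archimedean2 by blast
  have "\<forall>\<^sub>F m in sequentially. indicat_real (cball 0 (real m)) x *\<^sub>R f x = f x"
    using eventually_ge_at_top[of n] by eventually_elim (use n in auto)
  then show "(\<lambda>m. indicat_real (cball 0 (real m)) x *\<^sub>R f x) \<longlonglongrightarrow> f x" by (rule tendsto_eventually)
qed

text \<open>Stated for locally integrable functions, because \<open>weak_partial\<close> chooses
  among all of these; uniqueness then forces the chosen one into the L2 class of the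
  generator.\<close>

lemma weak_partial_unique:
  fixes f g h :: "real^'n::finite \<Rightarrow> 'b::euclidean_space"
  assumes g: "has_weak_partial k f g" and h: "has_weak_partial k f h"
  shows "AE x in lborel. g x = h x"
proof -
  have lg: "locally_integrable g" and lh: "locally_integrable h" using g h unfolding has_weak_partial_def by auto
  have m: "g \<in> borel_measurable lebesgue" "h \<in> borel_measurable lebesgue"
    using lg lh by (auto intro: locally_integrable_measurable)
  obtain d where d: "d \<in> borel_measurable borel" "AE x in lborel. g x - h x = d x"
    using lebesgue_borel_representative[of "\<lambda>x. g x - h x"] m by (auto intro: borel_measurable_diff)
  have [measurable]: "d \<in> borel_measurable borel" by (rule d(1))
  have "AE x in lborel. d x = 0"
  proof (rule test_functions_separate[OF d(1)])
    fix a b :: "real^'n"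
    let ?K = "cbox a b"
    have dm: "(\<lambda>x. indicat_real ?K x *\<^sub>R d x) \<in> borel_measurable lborel" by measurable
    have "set_integrable lebesgue ?K (\<lambda>x. g x - h x)"
      using lg lh unfolding locally_integrable_def by (intro set_integral_diff) auto
    then have i: "integrable lebesgue (\<lambda>x. indicat_real ?K x *\<^sub>R (g x - h x))" unfolding set_integrable_def .
    have "integrable lebesgue (\<lambda>x. indicat_real ?K x *\<^sub>R d x)"
    proof (rule Bochner_Integration.integrable_cong_AE_imp[OF i measurable_completion[OF dm]])
      show "AE x in lebesgue. indicat_real ?K x *\<^sub>R (g x - h x) = indicat_real ?K x *\<^sub>R d x"
        using AE_completion[OF d(2)] by eventually_elim simp
    qed
    then show "set_integrable lborel ?K d" unfolding set_integrable_def integrable_completion[OF dm] .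
  next
    fix \<psi> :: "real^'n \<Rightarrow> real" assume \<psi>: "test_function \<psi>"
    obtain R where R: "\<And>x. x \<notin> cball 0 R \<Longrightarrow> \<psi> x = 0" using test_function_support[OF \<psi>] by blast
    have ti: "integrable lebesgue (\<lambda>x. \<psi> x *\<^sub>R p x)" if lp: "locally_integrable p" for p :: "real^'n \<Rightarrow> 'b"
    proof -
      have "bounded (\<psi> ` cball 0 R)"
        by (intro compact_imp_bounded compact_continuous_image test_function_continuous \<psi> compact_cball)
      then obtain B where B: "B > 0" "\<forall>x\<in>cball 0 R. norm (\<psi> x) \<le> B" by (auto simp: bounded_pos)
      have "integrable lebesgue (\<lambda>x. indicat_real (cball 0 R) x *\<^sub>R p x)"
        using lp unfolding locally_integrable_def set_integrable_def by (metis compact_cball)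
      then have ii: "integrable lebesgue (\<lambda>x. B *\<^sub>R (indicat_real (cball 0 R) x *\<^sub>R p x))"
        by (intro integrable_scaleR_right)
      show ?thesis
      proof (rule Bochner_Integration.integrable_bound[OF ii])
        show "(\<lambda>x. \<psi> x *\<^sub>R p x) \<in> borel_measurable lebesgue"
          by (intro borel_measurable_scaleR test_function_lebesgue[OF \<psi>] locally_integrable_measurable[OF lp])
        have "norm (\<psi> x *\<^sub>R p x) \<le> norm (B *\<^sub>R (indicat_real (cball 0 R) x *\<^sub>R p x))" for x
          using B R[of x] by (cases "x \<in> cball 0 R") (auto intro!: mult_right_mono)
        then show "AE x in lebesgue. norm (\<psi> x *\<^sub>R p x) \<le> norm (B *\<^sub>R (indicat_real (cball 0 R) x *\<^sub>R p x))" by simp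
      qed
    qed
    have "(LINT x|lborel. \<psi> x *\<^sub>R d x) = (LINT x|lebesgue. \<psi> x *\<^sub>R (g x - h x))"
      by (rule integral_test_representative[OF \<psi> borel_measurable_diff[OF m] d, symmetric])
    also have "\<dots> = (LINT x|lebesgue. \<psi> x *\<^sub>R g x) - (LINT x|lebesgue. \<psi> x *\<^sub>R h x)"
      unfolding scaleR_diff_right by (rule Bochner_Integration.integral_diff[OF ti[OF lg] ti[OF lh]])
    also have "\<dots> = 0"
    proof -
      have "(LINT x|lebesgue. frechet_derivative \<psi> (at x) (axis k 1) *\<^sub>R f x) = - (LINT x|lebesgue. \<psi> x *\<^sub>R g x)"
        and "(LINT x|lebesgue. frechet_derivative \<psi> (at x) (axis k 1) *\<^sub>R f x) = - (LINT x|lebesgue. \<psi> x *\<^sub>R h x)"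
        using g h \<psi> unfolding has_weak_partial_def by blast+
      then show ?thesis by simp
    qed
    finally show "(LINT x|lborel. \<psi> x *\<^sub>R d x) = 0" .
  qed
  with d(2) show ?thesis by eventually_elim simp
qed

lemma H1_iff: "f \<in> H1 \<longleftrightarrow> f \<in> Lp 2 \<and> cls f \<in> l2.H"
  for f :: "real^'n::finite \<Rightarrow> 'b::euclidean_space"
proof
  assume f: "f \<in> H1"
  then have L: "f \<in> Lp 2" unfolding H1_def by blast
  have "\<exists>v. l2.pd k (cls f) v" for k
    using f has_weak_partial_iff_pd[OF L] unfolding H1_def by blast
  then show "f \<in> Lp 2 \<and> cls f \<in> l2.H" using L unfolding l2.H_def by blast
next
  assume f: "f \<in> Lp 2 \<and> cls f \<in> l2.H"
  have "has_weak_partial k f (rp (l2.dd k (cls f)))" for k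
    using f l2.pd_dd[of "cls f" k] has_weak_partial_iff_pd[of f "rp (l2.dd k (cls f))" k] by simp
  then show "f \<in> H1" using f cls_rp(2) unfolding H1_def by blast
qed

lemma weak_partial_cls:
  fixes f :: "real^'n::finite \<Rightarrow> 'b::euclidean_space"
  assumes "f \<in> H1"
  shows "weak_partial k f \<in> Lp 2" "cls (weak_partial k f) = l2.dd k (cls f)"
proof -
  have L: "f \<in> Lp 2" "cls f \<in> l2.H" using assms unfolding H1_iff by auto
  have w: "has_weak_partial k f (rp (l2.dd k (cls f)))"
    using l2.pd_dd[OF L(2), of k] has_weak_partial_iff_pd[OF L(1), of "rp (l2.dd k (cls f))" k] by simp
  then have s: "has_weak_partial k f (weak_partial k f)" unfolding weak_partial_def
    by (rule someI[of "has_weak_partial k f"])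
  then have "weak_partial k f \<in> borel_measurable lebesgue"
    unfolding has_weak_partial_def by (auto intro: locally_integrable_measurable)
  from Lp2_AE_I[OF this weak_partial_unique[OF s w]]
  show "weak_partial k f \<in> Lp 2" "cls (weak_partial k f) = l2.dd k (cls f)" .
qed

lemma H1_norm_cls:
  fixes f :: "real^'n::finite \<Rightarrow> 'b::euclidean_space"
  assumes "f \<in> H1"
  shows "H1_norm f = sqrt ((norm (cls f))\<^sup>2 + (\<Sum>k\<in>UNIV. (norm (l2.dd k (cls f)))\<^sup>2))"
  unfolding H1_norm_def using assms weak_partial_cls[OF assms] by (simp add: Lp_norm_cls H1_iff)

section \<open>Multiplication by singular potentials\<close>

definition mulop :: "('a::euclidean_space \<Rightarrow> real) \<Rightarrow> ('a, 'b::euclidean_space) l2 \<Rightarrow> ('a, 'b) l2" where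
  "mulop \<beta> u = l2_of (\<lambda>x. \<beta> x *\<^sub>R rp u x)"

context
  fixes \<beta> :: "'a::euclidean_space \<Rightarrow> real" and N :: real
  assumes \<beta>: "\<beta> \<in> borel_measurable borel" "\<And>x. \<bar>\<beta> x\<bar> \<le> N"
begin

lemma sq_int_mulop: "sq_int (f :: 'a \<Rightarrow> 'b::euclidean_space) \<Longrightarrow> sq_int (\<lambda>x. \<beta> x *\<^sub>R f x)"
  by (rule sq_int_bound[where c = N]) (use \<beta> in \<open>auto simp: sq_int_def intro!: mult_right_mono\<close>)

lemma rp_mulop: "AE x in lborel. rp (mulop \<beta> u) x = \<beta> x *\<^sub>R rp u x"
  unfolding mulop_def by (intro rp_l2_of sq_int_mulop rp_sq_int)

lemma nn_norm_mulop: "ennreal ((norm (mulop \<beta> u))\<^sup>2) = (\<integral>\<^sup>+x. ennreal ((\<beta> x)\<^sup>2 * (norm (rp u x))\<^sup>2) \<partial>lborel)"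
  unfolding mulop_def nn_norm_l2_of[OF sq_int_mulop[OF rp_sq_int], symmetric] by (simp add: power_mult_distrib)

lemma norm_mulop_le: "norm (mulop \<beta> u) \<le> N * norm u"
proof -
  have N: "N \<ge> 0" using \<beta>(2)[of undefined] by linarith
  have "(\<integral>\<^sup>+x. ennreal ((\<beta> x)\<^sup>2 * (norm (rp u x))\<^sup>2) \<partial>lborel) \<le> (\<integral>\<^sup>+x. ennreal (N\<^sup>2) * ennreal ((norm (rp u x))\<^sup>2) \<partial>lborel)"
    using \<beta>(2) by (intro nn_integral_mono) (auto simp: ennreal_mult[symmetric] abs_le_square_iff[symmetric] intro!: ennreal_leI mult_right_mono order_trans[OF _ abs_ge_self])
  also have "\<dots> = ennreal (N\<^sup>2) * ennreal ((norm u)\<^sup>2)"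
    using nn_norm_l2_of[OF rp_sq_int, of u] by (subst nn_integral_cmult) auto
  also have "\<dots> = ennreal ((N * norm u)\<^sup>2)" by (simp add: ennreal_mult[symmetric] power_mult_distrib)
  finally have "(norm (mulop \<beta> u))\<^sup>2 \<le> (N * norm u)\<^sup>2" unfolding nn_norm_mulop[symmetric] by simp
  then show ?thesis by (rule power2_le_imp_le) (use N in simp)
qed

lemma bounded_linear_mulop: "bounded_linear (mulop \<beta> :: ('a, 'b::euclidean_space) l2 \<Rightarrow> _)"
proof (rule bounded_linear_intro[where K = N])
  fix u v :: "('a, 'b) l2" and c
  show "mulop \<beta> (u + v) = mulop \<beta> u + mulop \<beta> v"
    by (rule l2_eqI) (use rp_mulop[of "u + v"] rp_mulop[of u] rp_mulop[of v] rp_add[of u v] rp_add[of "mulop \<beta> u" "mulop \<beta> v"]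
      in \<open>eventually_elim, simp add: scaleR_add_right\<close>)
  show "mulop \<beta> (c *\<^sub>R u) = c *\<^sub>R mulop \<beta> u"
    by (rule l2_eqI) (use rp_mulop[of "c *\<^sub>R u"] rp_mulop[of u] rp_scale[of c u] rp_scale[of c "mulop \<beta> u"]
      in \<open>eventually_elim, simp\<close>)
  show "norm (mulop \<beta> u) \<le> norm u * N" using norm_mulop_le[of u] by (simp add: mult.commute)
qed

text \<open>Tonelli: averaging the translates of \<open>g\<close> decouples the weight from \<open>g\<close>.\<close>

lemma mulop_translates:
  fixes g :: "('a, 'b::euclidean_space) l2"
  assumes s: "sq_int \<beta>"
  shows "(\<integral>\<^sup>+y. ennreal ((norm (mulop \<beta> (l2_shift y g)))\<^sup>2) \<partial>lborel) = ennreal ((norm (l2_of \<beta>) * norm g)\<^sup>2)"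
proof -
  note [measurable] = \<beta>(1)
  have "(\<integral>\<^sup>+y. ennreal ((norm (mulop \<beta> (l2_shift y g)))\<^sup>2) \<partial>lborel)
      = (\<integral>\<^sup>+y. \<integral>\<^sup>+x. ennreal ((\<beta> x)\<^sup>2 * (norm (rp g (x + y)))\<^sup>2) \<partial>lborel \<partial>lborel)"
  proof (rule nn_integral_cong)
    fix y :: 'a
    show "ennreal ((norm (mulop \<beta> (l2_shift y g)))\<^sup>2) = (\<integral>\<^sup>+x. ennreal ((\<beta> x)\<^sup>2 * (norm (rp g (x + y)))\<^sup>2) \<partial>lborel)"
      unfolding nn_norm_mulop by (rule nn_integral_cong_AE) (use rp_shift[of y g] in \<open>eventually_elim, simp\<close>)
  qed
  also have "\<dots> = (\<integral>\<^sup>+x. \<integral>\<^sup>+y. ennreal ((\<beta> x)\<^sup>2 * (norm (rp g (x + y)))\<^sup>2) \<partial>lborel \<partial>lborel)"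
    by (rule lborel_pair.Fubini') measurable
  also have "\<dots> = (\<integral>\<^sup>+x. ennreal ((\<beta> x)\<^sup>2) * ennreal ((norm g)\<^sup>2) \<partial>lborel)"
  proof (rule nn_integral_cong)
    fix x :: 'a
    have "(\<integral>\<^sup>+y. ennreal ((norm (rp g (x + y)))\<^sup>2) \<partial>lborel) = (\<integral>\<^sup>+y. ennreal ((norm (rp g y))\<^sup>2) \<partial>distr lborel borel ((+) x))"
      by (subst nn_integral_distr) auto
    also have "\<dots> = ennreal ((norm g)\<^sup>2)" unfolding lborel_distr_plus using nn_norm_l2_of[OF rp_sq_int, of g] by simp
    finally show "(\<integral>\<^sup>+y. ennreal ((\<beta> x)\<^sup>2 * (norm (rp g (x + y)))\<^sup>2) \<partial>lborel) = ennreal ((\<beta> x)\<^sup>2) * ennreal ((norm g)\<^sup>2)"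
      by (simp add: ennreal_mult nn_integral_cmult)
  qed
  also have "\<dots> = ennreal ((norm (l2_of \<beta>))\<^sup>2) * ennreal ((norm g)\<^sup>2)"
    using nn_norm_l2_of[OF s] by (subst nn_integral_multc) auto
  finally show ?thesis by (simp add: ennreal_mult[symmetric] power_mult_distrib)
qed

end

text \<open>Pull the norm into the average, apply Cauchy-Schwarz over the cube, and enlarge the
  domain of the squared norms to all translates. The root of the volume divided by the volume
  remains.\<close>

lemma mulop_average_bound:
  fixes \<beta> :: "real^'n::finite \<Rightarrow> real" and g :: "(real^'n, 'b::euclidean_space) l2"
  assumes \<beta>: "\<beta> \<in> borel_measurable borel" "\<And>x. \<bar>\<beta> x\<bar> \<le> N" and s: "sq_int \<beta>" and r: "r > 0"
  shows "norm (mulop \<beta> (l2.M r g)) \<le> norm (l2_of \<beta>) * (sqrt (r ^ CARD('n)) / r ^ CARD('n)) * norm g"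
proof -
  let ?a = "\<lambda>y. norm (mulop \<beta> (l2_shift y g))"
  let ?C = "cbox 0 (\<chi> i. r) :: (real^'n) set"
  define v where "v = r ^ CARD('n)"
  have v: "v > 0" "measure lborel ?C = v" using r unfolding v_def by (auto simp: l2.content_cube)
  define S where "S = norm (l2_of \<beta>) * norm g"
  have S: "S \<ge> 0" unfolding S_def by simp
  have bl: "bounded_linear (mulop \<beta> :: (real^'n, 'b) l2 \<Rightarrow> _)" by (rule bounded_linear_mulop[OF \<beta>])
  have ac: "continuous_on T ?a" for T
    by (intro continuous_on_norm bounded_linear.continuous_on[OF bl] continuous_on_subset[OF l2.tau_cont]) simp
  have sq: "integral ?C (\<lambda>y. (?a y)\<^sup>2) \<le> S\<^sup>2"
  proof -
    have i: "set_integrable lborel ?C (\<lambda>y. (?a y)\<^sup>2)"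
      unfolding set_integrable_def
      by (rule borel_integrable_compact[OF compact_cbox]) (intro continuous_on_power ac)
    have "ennreal (integral ?C (\<lambda>y. (?a y)\<^sup>2)) = ennreal (LINT y|lborel. indicator ?C y *\<^sub>R (?a y)\<^sup>2)"
      using set_borel_integral_eq_integral(2)[OF i] by (simp add: set_lebesgue_integral_def)
    also have "\<dots> = (\<integral>\<^sup>+y. ennreal (indicator ?C y *\<^sub>R (?a y)\<^sup>2) \<partial>lborel)"
      using i unfolding set_integrable_def by (intro nn_integral_eq_integral[symmetric]) auto
    also have "\<dots> \<le> (\<integral>\<^sup>+y. ennreal ((?a y)\<^sup>2) \<partial>lborel)"
      by (intro nn_integral_mono) (auto simp: indicator_def)
    also have "\<dots> = ennreal (S\<^sup>2)" unfolding S_def by (rule mulop_translates[OF \<beta> s])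
    finally show ?thesis by simp
  qed
  \<comment> \<open>Cauchy-Schwarz through \<open>2 c a \<le> a^2 + c^2\<close> with the optimal
    \<open>c\<close>; taking \<open>S'\<close> strictly above \<open>S\<close> keeps
    \<open>c\<close> positive when \<open>S = 0\<close>.\<close>
  have "integral ?C ?a \<le> S' * sqrt v" if S': "S' > S" for S'
  proof -
    have S'0: "S' > 0" using S S' by linarith
    define c where "c = S' / sqrt v"
    have c: "c > 0" unfolding c_def using S'0 v by simp
    have "integral ?C ?a \<le> integral ?C (\<lambda>y. (1 / (2 * c)) * (?a y)\<^sup>2 + c / 2)"
    proof (rule integral_le)
      fix y
      have "0 \<le> (?a y - c)\<^sup>2" by simp
      then have "2 * c * ?a y \<le> (?a y)\<^sup>2 + c\<^sup>2" by (simp add: power2_diff algebra_simps)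
      then have "?a y \<le> ((?a y)\<^sup>2 + c\<^sup>2) / (2 * c)" using c by (simp add: field_simps)
      also have "\<dots> = (1 / (2 * c)) * (?a y)\<^sup>2 + c / 2" using c by (simp add: add_divide_distrib power2_eq_square)
      finally show "?a y \<le> (1 / (2 * c)) * (?a y)\<^sup>2 + c / 2" .
    qed (intro integrable_continuous continuous_intros ac)+
    also have "\<dots> = (1 / (2 * c)) * integral ?C (\<lambda>y. (?a y)\<^sup>2) + c / 2 * v"
      using v(2) c by (subst integral_add) (auto intro!: integrable_continuous continuous_intros ac)
    also have "\<dots> \<le> (1 / (2 * c)) * S'\<^sup>2 + c / 2 * v"
    proof (intro add_right_mono mult_left_mono)
      have "S\<^sup>2 \<le> S'\<^sup>2" using S S' by (intro power_mono) auto
      then show "integral ?C (\<lambda>y. (?a y)\<^sup>2) \<le> S'\<^sup>2" using sq by linarith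
    qed (use c in simp)
    also have "\<dots> = S' * sqrt v"
    proof -
      have "v = sqrt v * sqrt v" using v by simp
      then have "c / 2 * v = S' * sqrt v / 2" unfolding c_def using v by (simp add: field_simps)
      moreover have "(1 / (2 * c)) * S'\<^sup>2 = S' * sqrt v / 2" unfolding c_def using S'0 v by (simp add: power2_eq_square)
      ultimately show ?thesis by simp
    qed
    finally show ?thesis .
  qed
  then have "integral ?C ?a / sqrt v \<le> S' " if "S' > S" for S' using that v by (simp add: divide_le_eq)
  then have "integral ?C ?a / sqrt v \<le> S" by (rule dense_ge)
  then have b: "integral ?C ?a \<le> S * sqrt v" using v by (simp add: divide_le_eq)
  have "mulop \<beta> (l2.M r g) = inverse v *\<^sub>R mulop \<beta> (integral ?C (\<lambda>y. l2_shift y g))"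
    unfolding l2.M_def v_def by (rule linear_scale[OF bounded_linear.linear[OF bl]])
  also have "mulop \<beta> (integral ?C (\<lambda>y. l2_shift y g)) = integral ?C (\<lambda>y. mulop \<beta> (l2_shift y g))"
    using integral_linear[OF l2.tau_integrable[where u = g and a = 0 and b = "\<chi> i. r"] bl] by (simp add: o_def)
  finally have "norm (mulop \<beta> (l2.M r g)) = inverse v * norm (integral ?C (\<lambda>y. mulop \<beta> (l2_shift y g)))"
    using v by simp
  also have "\<dots> \<le> inverse v * integral ?C ?a"
  proof (rule mult_left_mono)
    show "norm (integral ?C (\<lambda>y. mulop \<beta> (l2_shift y g))) \<le> integral ?C ?a"
      by (rule integral_norm_bound_integral)
        (auto intro!: integrable_continuous ac bounded_linear.continuous_on[OF bl] continuous_on_subset[OF l2.tau_cont])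
  qed (use v in simp)
  also have "\<dots> \<le> inverse v * (S * sqrt v)" using v b by (intro mult_left_mono) auto
  finally show ?thesis unfolding S_def v_def by (simp add: divide_inverse mult_ac)
qed

text \<open>Truncated weights are bounded multipliers, to which the dyadic estimate applies with
  constants independent of the truncation; Fatou's lemma then gives both integrability and the bound
  for \<open>w\<close> itself.\<close>

lemma singular_weight_bound:
  fixes w :: "real^3 \<Rightarrow> real"
  assumes p: "p > 3" and w: "w \<in> borel_measurable borel" "\<And>x. w x \<ge> 0" "integrable lborel (\<lambda>x. w x powr p)"
    and \<epsilon>: "\<epsilon> > 0"
  shows "\<exists>C\<ge>0. \<forall>u\<in>(l2.H :: (real^3, 'b::euclidean_space) l2 set).
    sq_int (\<lambda>x. w x *\<^sub>R rp u x) \<and> norm (l2_of (\<lambda>x. w x *\<^sub>R rp u x)) \<le> \<epsilon> * l2.grad_norm u + C * norm u"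
proof -
  note [measurable] = w(1)
  \<comment> \<open>Above height \<open>R\<close> one has
    \<open>w^2 \<le> R powr (2 - p) * w powr p\<close>; the root of the integral has exponent
    \<open>1 - p/2\<close>, and \<open>\<gamma> > 1/2\<close> means \<open>p > 3\<close>.\<close>
  define \<gamma> where "\<gamma> = p / 2 - 1"
  define I where "I = (LINT x|lborel. w x powr p)"
  have I: "I \<ge> 0" unfolding I_def by simp
  have "\<gamma> > 1/2" unfolding \<gamma>_def using p by simp
  then obtain C where C: "C \<ge> 0" and dy: "\<And>T :: (real^3, 'b) l2 \<Rightarrow> (real^3, 'b) l2. bounded_linear T \<Longrightarrow>
      (\<forall>R\<ge>1. \<exists>T' :: (real^3, 'b) l2 \<Rightarrow> (real^3, 'b) l2. bounded_linear T' \<and> (\<forall>v. norm (T v) \<le> R * norm v + norm (T' v)) \<and>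
         (\<forall>r>0. \<forall>v. norm (T' (l2.M r v)) \<le> sqrt I * R powr - \<gamma> * r powr - (3/2) * norm v)) \<Longrightarrow>
      (\<forall>u\<in>l2.H. norm (T u) \<le> \<epsilon> * l2.grad_norm u + C * norm u)"
    using l2.dyadic_multiplier_bound[of \<gamma> "sqrt I" \<epsilon>] \<epsilon> I by auto
  have trunc: "norm (mulop (\<lambda>x. min (w x) (real N)) u) \<le> \<epsilon> * l2.grad_norm u + C * norm u"
    if u: "u \<in> l2.H" for N and u :: "(real^3, 'b) l2"
  proof -
    define m where "m x = min (w x) (real N)" for x
    have m: "m \<in> borel_measurable borel" "\<And>x. \<bar>m x\<bar> \<le> real N" "\<And>x. 0 \<le> m x" "\<And>x. m x \<le> w x"
      unfolding m_def using w(2) by (auto simp: abs_le_iff)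
    note [measurable] = m(1)
    show ?thesis
      unfolding m_def[symmetric]
    proof (rule dy[rule_format, OF _ _ u])
      show "bounded_linear (mulop m :: (real^3, 'b) l2 \<Rightarrow> _)" by (rule bounded_linear_mulop[OF m(1,2)])
      fix R :: real assume R: "R \<ge> 1"
      \<comment> \<open>The part of the weight above the level \<open>R\<close> is square integrable, with norm at most \<open>sqrt I * R powr - \<gamma>\<close>.\<close>
      define \<beta> where "\<beta> x = (if w x > R then m x else 0)" for x
      have \<beta>: "\<beta> \<in> borel_measurable borel" "\<And>x. \<bar>\<beta> x\<bar> \<le> real N"
        unfolding \<beta>_def using m(2) by (measurable, auto)
      have \<beta>I: "(\<beta> x)\<^sup>2 \<le> R powr (2 - p) * w x powr p" for x
      proof (cases "w x > R")
        case True
        then have wx: "w x > 0" using R by linarith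
        have "(\<beta> x)\<^sup>2 \<le> (w x)\<^sup>2" unfolding \<beta>_def using True m(3,4)[of x] by (simp add: power_mono)
        also have "(w x)\<^sup>2 = w x powr (2 - p) * w x powr p" using wx by (simp add: powr_add[symmetric] powr_numeral)
        also have "\<dots> \<le> R powr (2 - p) * w x powr p"
          using True R p by (intro mult_right_mono powr_mono2') auto
        finally show ?thesis .
      qed (simp add: \<beta>_def)
      have s: "sq_int \<beta>"
        unfolding sq_int_def
      proof
        show "integrable lborel (\<lambda>x. (norm (\<beta> x))\<^sup>2)"
          by (rule Bochner_Integration.integrable_bound[OF integrable_mult_right[OF w(3), of "R powr (2 - p)"]])
            (use \<beta>(1) \<beta>I in \<open>auto simp: abs_mult\<close>)
      qed (rule \<beta>(1))
      have "(norm (l2_of \<beta>))\<^sup>2 \<le> (LINT x|lborel. R powr (2 - p) * w x powr p)"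
        unfolding norm_l2_of[OF s]
        by (rule integral_mono[OF _ integrable_mult_right[OF w(3)]]) (use s \<beta>I in \<open>auto simp: sq_int_def\<close>)
      also have "\<dots> = (sqrt I * R powr - \<gamma>)\<^sup>2"
      proof -
        have "R powr (2 - p) = R powr (- \<gamma> + - \<gamma>)" by (rule arg_cong[where f = "(powr) R"]) (simp add: \<gamma>_def)
        also have "\<dots> = (R powr - \<gamma>)\<^sup>2" unfolding power2_eq_square by (rule powr_add)
        finally show ?thesis unfolding power_mult_distrib integral_mult_right_zero I_def[symmetric] using I by simp
      qed
      finally have nb: "norm (l2_of \<beta>) \<le> sqrt I * R powr - \<gamma>" by (rule power2_le_imp_le) (use I in simp)
      show "\<exists>T' :: (real^3, 'b) l2 \<Rightarrow> (real^3, 'b) l2. bounded_linear T' \<and> (\<forall>v. norm (mulop m v) \<le> R * norm v + norm (T' v)) \<and>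
         (\<forall>r>0. \<forall>v. norm (T' (l2.M r v)) \<le> sqrt I * R powr - \<gamma> * r powr - (3/2) * norm v)"
      proof (intro exI[of _ "mulop \<beta>"] conjI allI impI)
        show "bounded_linear (mulop \<beta> :: (real^3, 'b) l2 \<Rightarrow> _)" by (rule bounded_linear_mulop[OF \<beta>])
        fix v :: "(real^3, 'b) l2"
        define l where "l x = (if w x > R then 0 else m x)" for x
        have l: "l \<in> borel_measurable borel" "\<And>x. \<bar>l x\<bar> \<le> R"
          unfolding l_def using m(3,4) R by (measurable, auto) (meson dual_order.trans not_le)
        have ml: "m x = l x + \<beta> x" for x unfolding l_def \<beta>_def by simp
        have "mulop m v = mulop l v + mulop \<beta> v"
        proof (rule l2_eqI)
          show "AE x in lborel. rp (mulop m v) x = rp (mulop l v + mulop \<beta> v) x"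
            using rp_mulop[OF m(1,2), of v] rp_mulop[OF l, of v] rp_mulop[OF \<beta>, of v] rp_add[of "mulop l v" "mulop \<beta> v"]
          proof eventually_elim
            case (elim x)
            show ?case by (simp only: elim ml[of x] scaleR_add_left)
          qed
        qed
        then have "norm (mulop m v) \<le> norm (mulop l v) + norm (mulop \<beta> v)" by (simp add: norm_triangle_ineq)
        also have "norm (mulop l v) \<le> R * norm v" by (rule norm_mulop_le[OF l])
        finally show "norm (mulop m v) \<le> R * norm v + norm (mulop \<beta> v)" by simp
        fix r :: real assume r: "r > 0"
        have "norm (mulop \<beta> (l2.M r v)) \<le> norm (l2_of \<beta>) * (sqrt (r ^ CARD(3)) / r ^ CARD(3)) * norm v"
          by (rule mulop_average_bound[OF \<beta> s r])
        also have "sqrt (r ^ CARD(3)) / r ^ CARD(3) = r powr - (3/2)"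
        proof -
          have "sqrt (r ^ 3) = r powr (3/2)" using r by (simp add: powr_half_sqrt[symmetric] powr_powr flip: powr_numeral)
          moreover have "r ^ 3 = r powr 3" using r by simp
          ultimately show ?thesis by (simp add: powr_diff[symmetric])
        qed
        also have "norm (l2_of \<beta>) * r powr - (3/2) * norm v \<le> (sqrt I * R powr - \<gamma>) * r powr - (3/2) * norm v"
          by (intro mult_right_mono nb) auto
        finally show "norm (mulop \<beta> (l2.M r v)) \<le> sqrt I * R powr - \<gamma> * r powr - (3/2) * norm v" .
      qed
    qed
  qed
  show ?thesis
  proof (intro exI[of _ C] conjI C ballI)
    fix u :: "(real^3, 'b) l2" assume u: "u \<in> l2.H"
    define c where "c = \<epsilon> * l2.grad_norm u + C * norm u"
    have c: "c \<ge> 0" unfolding c_def l2.grad_norm_def using \<epsilon> C by (simp add: sum_nonneg)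
    have m: "(\<lambda>x. w x *\<^sub>R rp u x) \<in> borel_measurable borel" by measurable
    have "(\<integral>\<^sup>+x. ennreal ((norm (w x *\<^sub>R rp u x))\<^sup>2) \<partial>lborel)
        = (\<integral>\<^sup>+x. liminf (\<lambda>N. ennreal ((min (w x) (real N))\<^sup>2 * (norm (rp u x))\<^sup>2)) \<partial>lborel)"
    proof (rule nn_integral_cong)
      fix x :: "real^3"
      obtain n where n: "w x < real n" using reals_Archimedean2 by blast
      have "\<forall>\<^sub>F N in sequentially. ennreal ((min (w x) (real N))\<^sup>2 * (norm (rp u x))\<^sup>2) = ennreal ((norm (w x *\<^sub>R rp u x))\<^sup>2)"
        using eventually_ge_at_top[of n]
      proof eventually_elim
        case (elim N)
        then have "min (w x) (real N) = w x" using n by simp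
        then show ?case by (simp add: power_mult_distrib)
      qed
      then have "(\<lambda>N. ennreal ((min (w x) (real N))\<^sup>2 * (norm (rp u x))\<^sup>2)) \<longlonglongrightarrow> ennreal ((norm (w x *\<^sub>R rp u x))\<^sup>2)"
        by (rule tendsto_eventually)
      then show "ennreal ((norm (w x *\<^sub>R rp u x))\<^sup>2) = liminf (\<lambda>N. ennreal ((min (w x) (real N))\<^sup>2 * (norm (rp u x))\<^sup>2))"
        by (rule lim_imp_Liminf[OF sequentially_bot, symmetric])
    qed
    also have "\<dots> \<le> liminf (\<lambda>N. \<integral>\<^sup>+x. ennreal ((min (w x) (real N))\<^sup>2 * (norm (rp u x))\<^sup>2) \<partial>lborel)"
      by (rule nn_integral_liminf) measurable
    also have "\<dots> \<le> ennreal (c\<^sup>2)"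
    proof (rule Liminf_le)
      have "(\<integral>\<^sup>+x. ennreal ((min (w x) (real N))\<^sup>2 * (norm (rp u x))\<^sup>2) \<partial>lborel) \<le> ennreal (c\<^sup>2)" for N
      proof -
        have b: "\<bar>min (w x) (real N)\<bar> \<le> real N" for x using w(2)[of x] by simp
        have "(\<lambda>x. min (w x) (real N)) \<in> borel_measurable borel" by measurable
        from nn_norm_mulop[OF this b, of u, symmetric]
        show ?thesis using trunc[OF u, of N] unfolding c_def by (simp add: ennreal_leI power_mono)
      qed
      then show "\<forall>\<^sub>F N in sequentially. (\<integral>\<^sup>+x. ennreal ((min (w x) (real N))\<^sup>2 * (norm (rp u x))\<^sup>2) \<partial>lborel) \<le> ennreal (c\<^sup>2)"
        by simp
    qed simp
    finally have le: "(\<integral>\<^sup>+x. ennreal ((norm (w x *\<^sub>R rp u x))\<^sup>2) \<partial>lborel) \<le> ennreal (c\<^sup>2)" .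
    show s: "sq_int (\<lambda>x. w x *\<^sub>R rp u x)" by (rule sq_int_nn[OF m le])
    show "norm (l2_of (\<lambda>x. w x *\<^sub>R rp u x)) \<le> \<epsilon> * l2.grad_norm u + C * norm u"
      unfolding c_def[symmetric] by (rule norm_l2_of_le_nn[OF s le c])
  qed
qed

section \<open>Pointwise algebra\<close>

lemma matrix22_nth [simp]:
  "matrix22 a b c d $ 1 $ 1 = a" "matrix22 a b c d $ 1 $ 2 = b"
  "matrix22 a b c d $ 2 $ 1 = c" "matrix22 a b c d $ 2 $ 2 = d"
  unfolding matrix22_def by simp_all

lemma matrix22_eq_iff: "M = N \<longleftrightarrow> M $ 1 $ 1 = N $ 1 $ 1 \<and> M $ 1 $ 2 = N $ 1 $ 2 \<and> M $ 2 $ 1 = N $ 2 $ 1 \<and> M $ 2 $ 2 = N $ 2 $ 2"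
  for M N :: "complex^2^2"
  by (auto simp: vec_eq_iff forall_2)

lemma matrix_mult22_nth: "(M ** N) $ i $ j = M $ i $ 1 * N $ 1 $ j + M $ i $ 2 * N $ 2 $ j"
  for M N :: "complex^2^2"
  by (simp add: matrix_matrix_mult_def sum_2)

lemma cscale_nth [simp]: "(c *\<^sub>C M) $ i $ j = c * M $ i $ j"
  by (simp add: cscale_def)

lemma e_low_nth [simp]:
  "e_low 0 $ 1 $ 1 = 1" "e_low 0 $ 1 $ 2 = 0" "e_low 0 $ 2 $ 1 = 0" "e_low 0 $ 2 $ 2 = 1"
  "e_low 1 $ 1 $ 1 = 0" "e_low 1 $ 1 $ 2 = 1" "e_low 1 $ 2 $ 1 = 1" "e_low 1 $ 2 $ 2 = 0"
  "e_low (Suc 0) $ 1 $ 1 = 0" "e_low (Suc 0) $ 1 $ 2 = 1" "e_low (Suc 0) $ 2 $ 1 = 1" "e_low (Suc 0) $ 2 $ 2 = 0"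
  "e_low 2 $ 1 $ 1 = 0" "e_low 2 $ 1 $ 2 = - \<i>" "e_low 2 $ 2 $ 1 = \<i>" "e_low 2 $ 2 $ 2 = 0"
  "e_low 3 $ 1 $ 1 = 1" "e_low 3 $ 1 $ 2 = 0" "e_low 3 $ 2 $ 1 = 0" "e_low 3 $ 2 $ 2 = - 1"
  by (simp_all add: e_low_def mat_def)

lemma inner22: "inner M N = inner (M $ 1 $ 1) (N $ 1 $ 1) + inner (M $ 1 $ 2) (N $ 1 $ 2) + inner (M $ 2 $ 1) (N $ 2 $ 1) + inner (M $ 2 $ 2) (N $ 2 $ 2)"
  for M N :: "complex^2^2"
  by (simp add: inner_vec_def sum_2)

lemma norm22: "(norm M)\<^sup>2 = (cmod (M $ 1 $ 1))\<^sup>2 + (cmod (M $ 1 $ 2))\<^sup>2 + (cmod (M $ 2 $ 1))\<^sup>2 + (cmod (M $ 2 $ 2))\<^sup>2"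
  for M :: "complex^2^2"
  unfolding power2_norm_eq_inner inner22 by simp

lemma norm22_eqI: "(cmod (M $ 1 $ 1))\<^sup>2 + (cmod (M $ 1 $ 2))\<^sup>2 + (cmod (M $ 2 $ 1))\<^sup>2 + (cmod (M $ 2 $ 2))\<^sup>2
   = (cmod (N $ 1 $ 1))\<^sup>2 + (cmod (N $ 1 $ 2))\<^sup>2 + (cmod (N $ 2 $ 1))\<^sup>2 + (cmod (N $ 2 $ 2))\<^sup>2 \<Longrightarrow> norm M = norm N"
  for M N :: "complex^2^2"
  unfolding norm22[symmetric] by simp

definition pauli :: "3 \<Rightarrow> complex^2^2" where
  "pauli k = (if k = 1 then e_low 1 else if k = 2 then e_low 2 else e_low 3)"

lemma pauli_cases: "pauli 1 = e_low 1" "pauli 2 = e_low 2" "pauli 3 = e_low 3"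
  by (simp_all add: pauli_def)

lemma pauli_sym: "inner (pauli k ** M) N = inner M (pauli k ** N)" for M N :: "complex^2^2"
  using exhaust_3[of k] unfolding inner22
  by (auto simp: pauli_cases matrix_mult22_nth inner_complex_def algebra_simps)

lemma pauli_sq: "pauli k ** (pauli k ** M) = M" for M :: "complex^2^2"
  using exhaust_3[of k] unfolding matrix22_eq_iff by (auto simp: pauli_cases matrix_mult22_nth)

lemma pauli_anti: "j \<noteq> k \<Longrightarrow> pauli j ** (pauli k ** M) = - (pauli k ** (pauli j ** M))" for M :: "complex^2^2"
  using exhaust_3[of k] exhaust_3[of j] unfolding matrix22_eq_iff
  by (auto simp: pauli_cases matrix_mult22_nth)

lemma linear_pauli: "linear (\<lambda>M :: complex^2^2. pauli k ** M)"
  by (rule linearI) (simp_all add: matrix22_eq_iff matrix_mult22_nth algebra_simps)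

lemma norm_e_low_mult: "\<mu> \<le> 3 \<Longrightarrow> norm (e_low \<mu> ** M) = norm M" for M :: "complex^2^2"
proof (rule norm22_eqI)
  assume "\<mu> \<le> 3"
  then have "\<mu> = 0 \<or> \<mu> = 1 \<or> \<mu> = 2 \<or> \<mu> = 3" by auto
  then show "(cmod ((e_low \<mu> ** M) $ 1 $ 1))\<^sup>2 + (cmod ((e_low \<mu> ** M) $ 1 $ 2))\<^sup>2 + (cmod ((e_low \<mu> ** M) $ 2 $ 1))\<^sup>2 + (cmod ((e_low \<mu> ** M) $ 2 $ 2))\<^sup>2 =
      (cmod (M $ 1 $ 1))\<^sup>2 + (cmod (M $ 1 $ 2))\<^sup>2 + (cmod (M $ 2 $ 1))\<^sup>2 + (cmod (M $ 2 $ 2))\<^sup>2"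
    by (elim disjE) (simp_all add: matrix_mult22_nth norm_mult)
qed

lemma norm_mult_e_low_3: "norm (M ** e_low 3) = norm M" for M :: "complex^2^2"
  by (rule norm22_eqI) (simp add: matrix_mult22_nth)

lemma norm_cscale: "norm (c *\<^sub>C M) = cmod c * norm M" for M :: "complex^2^2"
proof -
  have "(norm (c *\<^sub>C M))\<^sup>2 = (cmod c * norm M)\<^sup>2"
    unfolding power_mult_distrib norm22 by (simp add: norm_mult power_mult_distrib algebra_simps)
  then show ?thesis by (simp add: power2_eq_iff_nonneg)
qed

lemma hat_nth [simp]: "hat M $ 1 $ 1 = cnj (M $ 2 $ 2)" "hat M $ 1 $ 2 = - cnj (M $ 2 $ 1)"
  "hat M $ 2 $ 1 = - cnj (M $ 1 $ 2)" "hat M $ 2 $ 2 = cnj (M $ 1 $ 1)"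
  by (simp_all add: hat_def)

lemma hat_hat [simp]: "hat (hat M) = M" by (simp add: matrix22_eq_iff)

lemma linear_hat: "linear hat"
  by (rule linearI) (simp_all add: matrix22_eq_iff)

lemma norm_hat [simp]: "norm (hat M) = norm M"
  by (rule norm22_eqI) simp

text \<open>The potential part of the equation for \<open>hat \<phi>\<close>, brought to the
  right-hand side, with coefficients frozen at one point.\<close>

definition pot_term :: "real \<Rightarrow> (nat \<Rightarrow> real) \<Rightarrow> complex^2^2 \<Rightarrow> complex^2^2" where
  "pot_term q a M = - ((\<i> *\<^sub>C (q *\<^sub>R ((\<Sum>\<mu>=0..3. a \<mu> *\<^sub>R e_up \<mu>) ** M))) ** e_low 3)"

lemma sum_0_3: "(\<Sum>\<mu>=0..3. f \<mu>) = f 0 + f 1 + f 2 + f (3::nat)"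
  by (simp add: numeral_3_eq_3 numeral_2_eq_2)

lemma pot_term_nth:
  "pot_term q a M $ i $ 1 = - (\<i> * of_real q * ((\<Sum>\<mu>=0..3. a \<mu> *\<^sub>R e_up \<mu>) $ i $ 1 * M $ 1 $ 1 + (\<Sum>\<mu>=0..3. a \<mu> *\<^sub>R e_up \<mu>) $ i $ 2 * M $ 2 $ 1))"
  "pot_term q a M $ i $ 2 = \<i> * of_real q * ((\<Sum>\<mu>=0..3. a \<mu> *\<^sub>R e_up \<mu>) $ i $ 1 * M $ 1 $ 2 + (\<Sum>\<mu>=0..3. a \<mu> *\<^sub>R e_up \<mu>) $ i $ 2 * M $ 2 $ 2)"
  unfolding pot_term_def by (simp_all add: matrix_mult22_nth scaleR_conv_of_real[where 'a = complex] algebra_simps)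

lemma potential_nth:
  "(\<Sum>\<mu>=0..3. a \<mu> *\<^sub>R e_up \<mu>) $ 1 $ 1 = of_real (a 0 - a 3)" "(\<Sum>\<mu>=0..3. a \<mu> *\<^sub>R e_up \<mu>) $ 1 $ 2 = - of_real (a 1) + \<i> * of_real (a 2)"
  "(\<Sum>\<mu>=0..3. a \<mu> *\<^sub>R e_up \<mu>) $ 2 $ 1 = - of_real (a 1) - \<i> * of_real (a 2)" "(\<Sum>\<mu>=0..3. a \<mu> *\<^sub>R e_up \<mu>) $ 2 $ 2 = of_real (a 0 + a 3)"
  unfolding sum_0_3 e_up_def by (simp_all add: scaleR_conv_of_real[where 'a = complex] algebra_simps)

text \<open>The potential matrix P and \<open>e_low 3\<close> are Hermitian, so the trace of M^H P M
  \<open>e_low 3\<close> is real; multiplied by \<i> it contributes nothing to the real scalar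
  product.\<close>

lemma pot_term_skew: "inner (pot_term q a M) M = 0"
  unfolding inner22 pot_term_nth potential_nth by (simp add: inner_complex_def algebra_simps)

lemma linear_pot_term: "linear (pot_term q a)"
  by (rule linearI) (simp_all add: matrix22_eq_iff pot_term_nth algebra_simps scaleR_conv_of_real[where 'a = complex])

lemma norm_pot_term: "norm (pot_term q a M) \<le> \<bar>q\<bar> * (\<Sum>\<mu>=0..3. \<bar>a \<mu>\<bar>) * norm M"
proof -
  have "norm (pot_term q a M) = \<bar>q\<bar> * norm ((\<Sum>\<mu>=0..3. a \<mu> *\<^sub>R e_up \<mu>) ** M)"
    unfolding pot_term_def by (simp add: norm_mult_e_low_3 norm_cscale)
  also have "(\<Sum>\<mu>=0..3. a \<mu> *\<^sub>R e_up \<mu>) ** M = (\<Sum>\<mu>=0..3. a \<mu> *\<^sub>R (e_up \<mu> ** M))"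
    unfolding sum_0_3 by (simp add: matrix22_eq_iff matrix_mult22_nth algebra_simps scaleR_conv_of_real[where 'a = complex])
  also have "norm \<dots> \<le> (\<Sum>\<mu>=0..3. \<bar>a \<mu>\<bar> * norm M)"
  proof (rule sum_norm_le)
    fix \<mu> :: nat assume "\<mu> \<in> {0..3}"
    then have "norm (e_low \<mu> ** M) = norm M" by (intro norm_e_low_mult) simp
    moreover have "- e_low \<mu> ** M = - (e_low \<mu> ** M)" by (simp add: matrix22_eq_iff matrix_mult22_nth)
    ultimately show "norm (a \<mu> *\<^sub>R (e_up \<mu> ** M)) \<le> \<bar>a \<mu>\<bar> * norm M"
      unfolding e_up_def by (cases "\<mu> = 0") auto
  qed
  finally show ?thesis by (simp add: sum_distrib_right mult.assoc mult_left_mono)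
qed

subsection \<open>The regularized nonlinearity is Lipschitz\<close>

lemma cmod_nth_le: "cmod (M $ i $ j) \<le> norm M" for M :: "complex^2^2"
  by (rule order_trans[OF Finite_Cartesian_Product.norm_nth_le Finite_Cartesian_Product.norm_nth_le])

lemma det_diff_le: "cmod (det M - det N) \<le> 2 * (norm M + norm N) * norm (M - N)" for M N :: "complex^2^2"
proof -
  have d: "cmod (M $ i $ j - N $ i $ j) \<le> norm (M - N)" for i j using cmod_nth_le[of "M - N" i j] by simp
  have p: "cmod (M $ i $ j * M $ k $ l - N $ i $ j * N $ k $ l) \<le> (norm M + norm N) * norm (M - N)" for i j k l
  proof -
    have "M $ i $ j * M $ k $ l - N $ i $ j * N $ k $ l = M $ k $ l * (M $ i $ j - N $ i $ j) + N $ i $ j * (M $ k $ l - N $ k $ l)"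
      by (simp add: algebra_simps)
    then have "cmod (M $ i $ j * M $ k $ l - N $ i $ j * N $ k $ l) \<le> cmod (M $ k $ l) * cmod (M $ i $ j - N $ i $ j) + cmod (N $ i $ j) * cmod (M $ k $ l - N $ k $ l)"
      unfolding norm_mult[symmetric] by (simp only: norm_triangle_ineq)
    also have "\<dots> \<le> norm M * norm (M - N) + norm N * norm (M - N)"
      by (intro add_mono mult_mono d cmod_nth_le) auto
    finally show ?thesis by (simp add: algebra_simps)
  qed
  have "det M - det N = (M $ 1 $ 1 * M $ 2 $ 2 - N $ 1 $ 1 * N $ 2 $ 2) - (M $ 1 $ 2 * M $ 2 $ 1 - N $ 1 $ 2 * N $ 2 $ 1)"
    by (simp add: det_2)
  then have "cmod (det M - det N) \<le> cmod (M $ 1 $ 1 * M $ 2 $ 2 - N $ 1 $ 1 * N $ 2 $ 2) + cmod (M $ 1 $ 2 * M $ 2 $ 1 - N $ 1 $ 2 * N $ 2 $ 1)"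
    by (simp only: norm_triangle_ineq4)
  also have "\<dots> \<le> (norm M + norm N) * norm (M - N) + (norm M + norm N) * norm (M - N)" by (intro add_mono p)
  finally show ?thesis by (simp add: algebra_simps)
qed

text \<open>The regularizing term is nonnegative, so the numerator never exceeds the denominator; a
  zero denominator gives the value 0.\<close>

lemma cmod_V_le_1:
  assumes "l > 0" shows "cmod (V l M) \<le> 1"
proof -
  define s where "s = cmod (det M) + l * (norm M)\<^sup>2"
  have s: "cmod (det M) \<le> s" "0 \<le> s" unfolding s_def using assms by auto
  have "cmod (V l M) = cmod (det M) / s" unfolding V_def s_def[symmetric] using s by (simp add: norm_divide)
  also have "\<dots> \<le> 1" using s by (cases "s = 0") auto
  finally show ?thesis .
qed

lemma cscale_diff_left: "(a - b) *\<^sub>C M = a *\<^sub>C M - b *\<^sub>C M" for M :: "complex^2^2"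
  by (simp add: matrix22_eq_iff algebra_simps)
lemma cscale_diff_right: "a *\<^sub>C (M - N) = a *\<^sub>C M - a *\<^sub>C N" for M :: "complex^2^2"
  by (simp add: matrix22_eq_iff algebra_simps)

text \<open>Writing the difference of the quotients over the larger denominator is what makes the bound uniform.\<close>

lemma V_lipschitz_ordered:
  fixes M N :: "complex^2^2"
  assumes l: "l > 0" and le: "norm N \<le> norm M"
  shows "norm (V l M *\<^sub>C M - V l N *\<^sub>C N) \<le> (1 + (8 + 2 * l) / l) * norm (M - N)"
proof (cases "N = 0")
  case True
  have "norm (V l M *\<^sub>C M - V l N *\<^sub>C N) = cmod (V l M) * norm M"
  proof -
    have "V l N *\<^sub>C N = 0" using True by (simp add: matrix22_eq_iff)
    then show ?thesis by (simp add: norm_cscale)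
  qed
  also have "\<dots> \<le> 1 * norm M" by (intro mult_right_mono cmod_V_le_1 l) auto
  also have "\<dots> \<le> (1 + (8 + 2 * l) / l) * norm M" using l by (intro mult_right_mono) auto
  finally show ?thesis using True by simp
next
  case False
  then have n: "norm N > 0" "norm M > 0" using le by (auto intro: less_le_trans)
  define s where "s X = cmod (det X) + l * (norm X)\<^sup>2" for X :: "complex^2^2"
  have s: "s N > 0" "s M > 0" "l * (norm M)\<^sup>2 \<le> s M" "cmod (det N) \<le> s N" "cmod (det M) \<le> s M"
    unfolding s_def using l n by (auto intro: add_nonneg_pos)
  define e where "e = norm (M - N)"
  have e: "e \<ge> 0" unfolding e_def by simp
  have dd: "cmod (det M - det N) \<le> 4 * norm M * e"
  proof -
    have "cmod (det M - det N) \<le> 2 * (norm M + norm N) * e" unfolding e_def by (rule det_diff_le)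
    also have "\<dots> \<le> 4 * norm M * e" using le e by (intro mult_right_mono) auto
    finally show ?thesis .
  qed
  have sd: "\<bar>s N - s M\<bar> \<le> (4 + 2 * l) * norm M * e"
  proof -
    have "\<bar>norm N - norm M\<bar> \<le> e" unfolding e_def by (metis norm_minus_commute norm_triangle_ineq3)
    then have "\<bar>norm N - norm M\<bar> * (norm N + norm M) \<le> e * (2 * norm M)" using le e by (intro mult_mono) auto
    moreover have "(norm N)\<^sup>2 - (norm M)\<^sup>2 = (norm N - norm M) * (norm N + norm M)" by (simp add: power2_eq_square algebra_simps)
    ultimately have q: "\<bar>(norm N)\<^sup>2 - (norm M)\<^sup>2\<bar> \<le> 2 * norm M * e" by (simp add: abs_mult mult_ac)
    have "\<bar>cmod (det N) - cmod (det M)\<bar> \<le> 4 * norm M * e"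
      using norm_triangle_ineq3[of "det M" "det N"] dd by (simp add: abs_minus_commute)
    moreover have "\<bar>l * (norm N)\<^sup>2 - l * (norm M)\<^sup>2\<bar> \<le> l * (2 * norm M * e)"
      using q l by (simp add: right_diff_distrib[symmetric] abs_mult mult_left_mono)
    ultimately have "\<bar>s N - s M\<bar> \<le> 4 * norm M * e + l * (2 * norm M * e)" unfolding s_def by linarith
    then show ?thesis by (simp add: algebra_simps)
  qed
  \<comment> \<open>Arranged so that the smaller matrix's denominator \<open>s N\<close> divides
    only a term with the factor \<open>det N\<close>, which it dominates; what is left is divided by
    \<open>s M \<ge> l |M|^2\<close>.\<close>
  have VV: "V l M - V l N = (cnj (det M) - cnj (det N)) / of_real (s M) + cnj (det N) * of_real (s N - s M) / (of_real (s M) * of_real (s N))"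
    unfolding V_def s_def[symmetric] using s(1,2) by (simp add: field_simps)
  have "cmod (V l M - V l N) \<le> cmod (cnj (det M) - cnj (det N)) / s M + cmod (det N) * \<bar>s N - s M\<bar> / (s M * s N)"
    unfolding VV using s(1,2)
    by (intro order_trans[OF norm_triangle_ineq]) (simp add: norm_divide norm_mult del: of_real_diff)
  also have "cmod (cnj (det M) - cnj (det N)) = cmod (det M - det N)" by (metis complex_cnj_diff complex_mod_cnj)
  also have "cmod (det M - det N) / s M + cmod (det N) * \<bar>s N - s M\<bar> / (s M * s N) \<le> (4 * norm M * e) / s M + ((4 + 2 * l) * norm M * e) / s M"
  proof (rule add_mono)
    show "cmod (det M - det N) / s M \<le> 4 * norm M * e / s M" using dd s(2) by (intro divide_right_mono) auto
    have "cmod (det N) * \<bar>s N - s M\<bar> / (s M * s N) \<le> s N * ((4 + 2 * l) * norm M * e) / (s M * s N)"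
      using s sd by (intro divide_right_mono mult_mono) auto
    also have "\<dots> = ((4 + 2 * l) * norm M * e) / s M" using s(1) by simp
    finally show "cmod (det N) * \<bar>s N - s M\<bar> / (s M * s N) \<le> (4 + 2 * l) * norm M * e / s M" .
  qed
  \<comment> \<open>Of the 8, one 4 stems from the numerators; the other 4 and the
    \<open>2 * l\<close> from the denominators.\<close>
  also have "\<dots> = (8 + 2 * l) * norm M * e / s M" by (simp add: add_divide_distrib[symmetric] algebra_simps)
  also have "\<dots> \<le> (8 + 2 * l) * norm M * e / (l * (norm M)\<^sup>2)"
    using s l n e by (intro divide_left_mono) auto
  also have "\<dots> = (8 + 2 * l) / l * e / norm M" using n l by (simp add: power2_eq_square field_simps)
  finally have v: "cmod (V l M - V l N) \<le> (8 + 2 * l) / l * e / norm M" .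
  \<comment> \<open>The difference of the coefficients multiplies \<open>N\<close>, so
    \<open>|N| \<le> |M|\<close> cancels the factor \<open>1 / |M|\<close>; the summand 1 in the
    constant comes from \<open>|V| \<le> 1\<close>.\<close>
  have "V l M *\<^sub>C M - V l N *\<^sub>C N = (V l M - V l N) *\<^sub>C N + V l M *\<^sub>C (M - N)"
    by (simp add: cscale_diff_left cscale_diff_right)
  then have "norm (V l M *\<^sub>C M - V l N *\<^sub>C N) \<le> cmod (V l M - V l N) * norm N + cmod (V l M) * e"
    unfolding e_def by (metis norm_cscale norm_triangle_ineq)
  also have "\<dots> \<le> ((8 + 2 * l) / l * e / norm M) * norm M + 1 * e"
    using e le l by (intro add_mono mult_mono v mult_right_mono cmod_V_le_1) auto
  also have "\<dots> = (1 + (8 + 2 * l) / l) * e"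
  proof -
    have "(8 + 2 * l) / l * e / norm M * norm M = (8 + 2 * l) / l * e" using n by simp
    then show ?thesis by (simp only: distrib_right)
  qed
  finally show ?thesis unfolding e_def .
qed

lemma V_lipschitz:
  fixes M N :: "complex^2^2"
  assumes l: "l > 0"
  shows "norm (V l M *\<^sub>C M - V l N *\<^sub>C N) \<le> (1 + (8 + 2 * l) / l) * norm (M - N)"
  using V_lipschitz_ordered[OF l, of N M] V_lipschitz_ordered[OF l, of M N]
  by (cases "norm N \<le> norm M") (auto simp: norm_minus_commute)

section \<open>Pointwise maps on square integrable functions\<close>

definition l2_map :: "('b::euclidean_space \<Rightarrow> 'b) \<Rightarrow> ('a::euclidean_space, 'b) l2 \<Rightarrow> ('a, 'b) l2" where
  "l2_map A u = l2_of (\<lambda>x. A (rp u x))"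

lemma norm_l2_of_mono:
  assumes "sq_int f" "sq_int g" "\<And>x. norm (f x) \<le> c * norm (g x)" "c \<ge> 0"
  shows "norm (l2_of f) \<le> c * norm (l2_of g)"
proof -
  have "(norm (l2_of f))\<^sup>2 \<le> (LINT x|lborel. c\<^sup>2 * (norm (g x))\<^sup>2)"
    unfolding norm_l2_of[OF assms(1)]
  proof (rule integral_mono)
    show "(norm (f x))\<^sup>2 \<le> c\<^sup>2 * (norm (g x))\<^sup>2" for x
      unfolding power_mult_distrib[symmetric] by (rule power_mono[OF assms(3)]) simp
  qed (use assms in \<open>auto simp: sq_int_def\<close>)
  also have "\<dots> = (c * norm (l2_of g))\<^sup>2" by (simp add: power_mult_distrib norm_l2_of[OF assms(2)])
  finally show ?thesis by (rule power2_le_imp_le) (use assms in simp)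
qed

text \<open>\<open>A 0 = 0\<close> turns the Lipschitz bound into linear growth, so that
  \<open>A\<close> preserves square integrability on a space of infinite measure.\<close>

context
  fixes A :: "'b::euclidean_space \<Rightarrow> 'b" and c :: real
  assumes A0: "A 0 = 0" and A_lip: "\<And>v w. norm (A v - A w) \<le> c * norm (v - w)" and c: "c \<ge> 0"
begin

lemma lipschitz_map_borel: "A \<in> borel_measurable borel"
  by (rule borel_measurable_continuous_onI, rule lipschitz_on_continuous_on[of c])
    (use A_lip c in \<open>auto simp: lipschitz_on_def dist_norm\<close>)

lemma sq_int_map:
  assumes "sq_int (f :: 'a::euclidean_space \<Rightarrow> 'b)" shows "sq_int (\<lambda>x. A (f x))"
proof (rule sq_int_bound[OF _ assms])
  have "f \<in> borel_measurable borel" using assms unfolding sq_int_def by blast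
  then show "(\<lambda>x. A (f x)) \<in> borel_measurable borel" by (rule measurable_compose[OF _ lipschitz_map_borel])
  show "norm (A (f x)) \<le> c * norm (f x)" for x using A_lip[of "f x" 0] A0 by simp
qed

lemma rp_map: "AE x in lborel. rp (l2_map A u) x = A (rp u x)"
  unfolding l2_map_def by (intro rp_l2_of sq_int_map rp_sq_int)

lemma l2_map_lipschitz: "norm (l2_map A u - l2_map A v) \<le> c * norm (u - v)"
proof -
  have "norm (l2_of (\<lambda>x. A (rp u x) - A (rp v x))) \<le> c * norm (l2_of (\<lambda>x. rp u x - rp v x))"
    by (rule norm_l2_of_mono[OF _ _ A_lip c]) (intro sq_int_diff sq_int_map rp_sq_int)+
  then show ?thesis unfolding l2_map_def by (simp add: l2_of_diff sq_int_map)
qed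

lemma l2_map_shift: "l2_map A (l2_shift y u) = l2_shift y (l2_map A u)"
proof (rule l2_eqI)
  have "AE x in lborel. rp (l2_map A u) (x + y) = A (rp u (x + y))" by (rule AE_lborel_shift[OF rp_map])
  then show "AE x in lborel. rp (l2_map A (l2_shift y u)) x = rp (l2_shift y (l2_map A u)) x"
    using rp_map[of "l2_shift y u"] rp_shift[of y u] rp_shift[of y "l2_map A u"] by eventually_elim simp
qed

lemma l2_map_cls:
  assumes "f \<in> Lp 2" shows "(\<lambda>x. A (f x)) \<in> Lp 2" "cls (\<lambda>x. A (f x)) = l2_map A (cls f)"
proof -
  have m: "(\<lambda>x. A (f x)) \<in> borel_measurable lebesgue"
    by (rule measurable_compose[OF Lp2_measurable[OF assms] lipschitz_map_borel])
  have "AE x in lborel. A (f x) = rp (l2_map A (cls f)) x"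
    using rp_cls[OF assms] rp_map[of "cls f"] by eventually_elim simp
  from Lp2_AE_I[OF m this] show "(\<lambda>x. A (f x)) \<in> Lp 2" "cls (\<lambda>x. A (f x)) = l2_map A (cls f)" .
qed

lemma l2_map_linear:
  assumes "linear A" shows "bounded_linear (l2_map A :: ('a::euclidean_space, 'b) l2 \<Rightarrow> _)"
proof (rule bounded_linear_intro[where K = c])
  fix u v :: "('a, 'b) l2" and r
  show "l2_map A (u + v) = l2_map A u + l2_map A v"
    by (rule l2_eqI) (use rp_map[of "u + v"] rp_map[of u] rp_map[of v] rp_add[of u v] rp_add[of "l2_map A u" "l2_map A v"]
      in \<open>eventually_elim, simp add: linear_add[OF assms]\<close>)
  show "l2_map A (r *\<^sub>R u) = r *\<^sub>R l2_map A u"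
    by (rule l2_eqI) (use rp_map[of "r *\<^sub>R u"] rp_map[of u] rp_scale[of r u] rp_scale[of r "l2_map A u"]
      in \<open>eventually_elim, simp add: linear_scale[OF assms]\<close>)
  have "l2_map A 0 = (0 :: ('a, 'b) l2)"
    by (rule l2_eqI) (use rp_map[of "0 :: ('a, 'b) l2"] rp_zero[where 'a = 'a and 'b = 'b] in \<open>eventually_elim, simp add: A0\<close>)
  then show "norm (l2_map A u) \<le> norm u * c" using l2_map_lipschitz[of u 0] by (simp add: mult.commute)
qed

end

lemma isometry_lipschitz:
  assumes "linear A" "\<And>v. norm (A v) = norm v"
  shows "A 0 = 0" "\<And>v w. norm (A v - A w) \<le> 1 * norm (v - w)" "(1::real) \<ge> 0"
  using assms(2) by (simp_all add: linear_0[OF assms(1)] linear_diff[OF assms(1), symmetric])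

lemma norm_pauli: "norm (pauli k ** M) = norm M" for M :: "complex^2^2"
  by (simp add: norm_eq_sqrt_inner pauli_sym pauli_sq)

lemmas pauli_iso = isometry_lipschitz[OF linear_pauli norm_pauli]
lemmas hat_iso = isometry_lipschitz[OF linear_hat norm_hat]

definition sig :: "3 \<Rightarrow> (real^3, complex^2^2) l2 \<Rightarrow> (real^3, complex^2^2) l2" where
  "sig k = l2_map (\<lambda>M. pauli k ** M)"

lemma rp_sig: "AE x in lborel. rp (sig k u) x = pauli k ** rp u x"
  unfolding sig_def by (rule rp_map[OF pauli_iso])

interpretation weyl: weyl_operator "l2_shift :: real^3 \<Rightarrow> (real^3, complex^2^2) l2 \<Rightarrow> _" sig
proof (rule weyl_operator.intro[OF l2.translation_group_axioms], rule weyl_operator_axioms.intro)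
  fix j k :: 3 and u v :: "(real^3, complex^2^2) l2" and y
  show "bounded_linear (sig k)" unfolding sig_def by (rule l2_map_linear[OF pauli_iso linear_pauli])
  show "inner (sig k u) v = inner u (sig k v)"
    unfolding inner_l2_def
  proof (rule integral_cong_AE)
    show "AE x in lborel. inner (rp (sig k u) x) (rp v x) = inner (rp u x) (rp (sig k v) x)"
      using rp_sig[of k u] rp_sig[of k v] by eventually_elim (simp add: pauli_sym)
  qed measurable
  show "sig k (sig k u) = u"
    by (rule l2_eqI) (use rp_sig[of k "sig k u"] rp_sig[of k u] in \<open>eventually_elim, simp add: pauli_sq\<close>)
  show "sig j (sig k u) = - sig k (sig j u)" if "j \<noteq> k"
    by (rule l2_eqI) (use rp_sig[of j "sig k u"] rp_sig[of k u] rp_sig[of k "sig j u"] rp_sig[of j u] rp_uminus[of "sig k (sig j u)"]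
      in \<open>eventually_elim, simp add: pauli_anti[OF that]\<close>)
  show "sig k (l2_shift y u) = l2_shift y (sig k u)" unfolding sig_def by (rule l2_map_shift[OF pauli_iso])
qed

section \<open>The potential term\<close>

definition kron :: "nat \<Rightarrow> nat \<Rightarrow> real" where "kron \<mu> \<nu> = (if \<nu> = \<mu> then 1 else 0)"

text \<open>Four fixed linear maps with scalar coefficients: measurability in \<open>x\<close> and
  dependence on the products \<open>q * a \<mu>\<close> alone can be read off.\<close>

lemma pot_term_expand:
  "pot_term q a M = (q * a 0) *\<^sub>R pot_term 1 (kron 0) M + (q * a 1) *\<^sub>R pot_term 1 (kron 1) M
     + (q * a 2) *\<^sub>R pot_term 1 (kron 2) M + (q * a 3) *\<^sub>R pot_term 1 (kron 3) M"
  unfolding matrix22_eq_iff vector_add_component vector_scaleR_component pot_term_nth potential_nth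
  by (simp add: kron_def scaleR_conv_of_real[where 'a = complex] algebra_simps)

lemma pot_term_cong: "(\<And>\<mu>. \<mu> \<le> 3 \<Longrightarrow> q * a \<mu> = q * b \<mu>) \<Longrightarrow> pot_term q a M = pot_term q b M"
  unfolding pot_term_expand[of q a] pot_term_expand[of q b] by (simp only: zero_le one_le_numeral order_refl numeral_le_iff semiring_norm)

lemma borel_measurable_pot_term:
  assumes a: "\<And>\<mu>. a \<mu> \<in> borel_measurable borel" and f: "f \<in> borel_measurable borel"
  shows "(\<lambda>x. pot_term q (\<lambda>\<mu>. a \<mu> x) (f x)) \<in> borel_measurable borel"
proof -
  have "continuous_on UNIV (pot_term 1 b)" for b
    by (rule linear_continuous_on) (simp add: linear_pot_term linear_conv_bounded_linear[symmetric])
  then have "pot_term 1 b \<in> borel_measurable borel" for b by (rule borel_measurable_continuous_onI)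
  then have m: "(\<lambda>x. pot_term 1 b (f x)) \<in> borel_measurable borel" for b by (rule measurable_compose[OF f])
  show ?thesis unfolding pot_term_expand[of q]
    by (intro borel_measurable_add borel_measurable_scaleR borel_measurable_times borel_measurable_const a m)
qed

text \<open>Borel versions with bounds valid everywhere: the scalar potential is cut where
  \<open>|q A0'| > m\<close> and the bounded part where it exceeds its essential bound, both on null
  sets. The weight \<open>w\<close> is the norm of the L^p part, and the 3 counts the spatial
  components.\<close>

lemma potential_representatives:
  fixes A :: "nat \<Rightarrow> real^3 \<Rightarrow> real"
  assumes A: "\<And>\<mu>. \<mu> \<le> 3 \<Longrightarrow> A \<mu> \<in> borel_measurable lebesgue" and m: "m > 0"
    and BC: "B \<in> Lp p" "C \<in> Linf" "AE x in lebesgue. (vector [A 1 x, A 2 x, A 3 x] :: real^3) = B x + C x"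
    and A0: "AE x in lebesgue. \<bar>q * A 0 x\<bar> \<le> m"
  shows "\<exists>a w c. (\<forall>\<mu>. a \<mu> \<in> borel_measurable borel) \<and> w \<in> borel_measurable borel \<and> (\<forall>x. w x \<ge> 0) \<and>
    integrable lborel (\<lambda>x. w x powr p) \<and> c \<ge> 0 \<and> (\<forall>x. \<bar>q\<bar> * (\<Sum>\<mu>=0..3. \<bar>a \<mu> x\<bar>) \<le> 3 * \<bar>q\<bar> * w x + c) \<and>
    (AE x in lborel. \<forall>\<mu>\<le>3. q * a \<mu> x = q * A \<mu> x)"
proof -
  have "B \<in> borel_measurable lebesgue" "integrable lebesgue (\<lambda>x. norm (B x) powr p)" using BC(1) unfolding Lp_def by auto
  then obtain B' where B': "B' \<in> borel_measurable borel" "AE x in lborel. B x = B' x"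
    using lebesgue_borel_representative by blast
  have "C \<in> borel_measurable lebesgue" using BC(2) unfolding Linf_def by auto
  then obtain C' where C': "C' \<in> borel_measurable borel" "AE x in lborel. C x = C' x"
    using lebesgue_borel_representative by blast
  obtain A0' where A0': "A0' \<in> borel_measurable borel" "AE x in lborel. A 0 x = A0' x"
    using lebesgue_borel_representative[OF A[of 0]] by auto
  obtain c0 where c0: "AE x in lebesgue. norm (C x) \<le> c0" using BC(2) unfolding Linf_def by auto
  note [measurable] = B'(1) C'(1) A0'(1)
  define w where "w x = norm (B' x)" for x
  define v where "v x = B' x + (if norm (C' x) \<le> \<bar>c0\<bar> then C' x else 0)" for x
  define a where "a \<mu> x = (if \<mu> = 0 then (if \<bar>q * A0' x\<bar> \<le> m then A0' x else 0)
      else if \<mu> = 1 then v x $ 1 else if \<mu> = 2 then v x $ 2 else v x $ 3)" for \<mu> :: nat and x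
  have vm: "v \<in> borel_measurable borel" unfolding v_def by measurable
  have vk: "(\<lambda>x. v x $ k) \<in> borel_measurable borel" for k :: 3
    by (rule measurable_compose[OF vm]) (intro borel_measurable_continuous_onI continuous_intros)
  have am: "a \<mu> \<in> borel_measurable borel" for \<mu>
    unfolding a_def by (intro measurable_If_set vk measurable_If borel_measurable_const) measurable
  have wp: "integrable lborel (\<lambda>x. w x powr p)"
  proof -
    have wm: "(\<lambda>x. w x powr p) \<in> borel_measurable lborel" unfolding w_def by measurable
    have "integrable lebesgue (\<lambda>x. w x powr p)"
    proof (rule Bochner_Integration.integrable_cong_AE_imp[OF \<open>integrable lebesgue (\<lambda>x. norm (B x) powr p)\<close> measurable_completion[OF wm]])
      show "AE x in lebesgue. norm (B x) powr p = w x powr p"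
        using AE_completion[OF B'(2)] by eventually_elim (simp add: w_def)
    qed
    then show ?thesis using integrable_completion[OF wm] by blast
  qed
  have vb: "\<bar>v x $ k\<bar> \<le> w x + \<bar>c0\<bar>" for x k
  proof -
    have "\<bar>v x $ k\<bar> \<le> norm (v x)" by (rule component_le_norm_cart)
    also have "\<dots> \<le> w x + \<bar>c0\<bar>" unfolding v_def w_def by (rule norm_triangle_le) auto
    finally show ?thesis .
  qed
  have bound: "\<bar>q\<bar> * (\<Sum>\<mu>=0..3. \<bar>a \<mu> x\<bar>) \<le> 3 * \<bar>q\<bar> * w x + (m + 3 * \<bar>q\<bar> * \<bar>c0\<bar>)" for x
  proof -
    have "\<bar>q\<bar> * (\<Sum>\<mu>=0..3. \<bar>a \<mu> x\<bar>) = \<bar>q\<bar> * \<bar>a 0 x\<bar> + \<bar>q\<bar> * (\<bar>v x $ 1\<bar> + \<bar>v x $ 2\<bar> + \<bar>v x $ 3\<bar>)"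
      unfolding sum_0_3 by (simp add: a_def algebra_simps)
    also have "\<dots> \<le> m + \<bar>q\<bar> * ((w x + \<bar>c0\<bar>) + (w x + \<bar>c0\<bar>) + (w x + \<bar>c0\<bar>))"
      using m by (intro add_mono mult_left_mono vb) (auto simp: a_def abs_mult)
    finally show ?thesis by (simp add: algebra_simps)
  qed
  have l: "AE x in lborel. (vector [A 1 x, A 2 x, A 3 x] :: real^3) = B x + C x" "AE x in lborel. \<bar>q * A 0 x\<bar> \<le> m" "AE x in lborel. norm (C x) \<le> c0"
    using BC(3) A0 c0 by (simp_all add: AE_completion_iff)
  have "AE x in lborel. \<forall>\<mu>\<le>3. q * a \<mu> x = q * A \<mu> x"
    using l B'(2) C'(2) A0'(2)
  proof eventually_elim
    case (elim x)
    have "v x = vector [A 1 x, A 2 x, A 3 x]" unfolding v_def using elim by simp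
    then have "v x $ 1 = A 1 x" "v x $ 2 = A 2 x" "v x $ 3 = A 3 x" by simp_all
    moreover have "\<mu> = 0 \<or> \<mu> = 1 \<or> \<mu> = 2 \<or> \<mu> = 3" if "\<mu> \<le> 3" for \<mu> :: nat using that by auto
    ultimately show ?case using elim unfolding a_def by auto
  qed
  moreover have "w \<in> borel_measurable borel" unfolding w_def[abs_def] by measurable
  ultimately show ?thesis using am wp bound m
    by (intro exI[of _ a] exI[of _ w] exI[of _ "m + 3 * \<bar>q\<bar> * \<bar>c0\<bar>"]) (auto simp: w_def)
qed

definition Kop :: "real \<Rightarrow> (nat \<Rightarrow> real^3 \<Rightarrow> real) \<Rightarrow> (real^3, complex^2^2) l2 \<Rightarrow> (real^3, complex^2^2) l2" where
  "Kop q a u = l2_of (\<lambda>x. pot_term q (\<lambda>\<mu>. a \<mu> x) (rp u x))"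

text \<open>The weight estimate with small \<epsilon> bounds the potential by a quarter of
  \<open>|D u|\<close> plus a multiple of \<open>|u|\<close>, as the perturbation lemma requires;
  skewness is inherited pointwise from \<open>pot_term\<close>.\<close>

lemma Dirac_generator:
  fixes a :: "nat \<Rightarrow> real^3 \<Rightarrow> real"
  assumes a: "\<And>\<mu>. a \<mu> \<in> borel_measurable borel" and p: "p > 3"
    and w: "w \<in> borel_measurable borel" "\<And>x. w x \<ge> 0" "integrable lborel (\<lambda>x. w x powr p)"
    and c: "c \<ge> 0" and le: "\<And>x. \<bar>q\<bar> * (\<Sum>\<mu>=0..3. \<bar>a \<mu> x\<bar>) \<le> 3 * \<bar>q\<bar> * w x + c"
  shows "\<exists>a0 C. C \<ge> 0 \<and> skew_generator l2.H (\<lambda>u. weyl.D u + Kop q a u) a0 \<and>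
    (\<forall>u\<in>l2.H. (AE x in lborel. rp (Kop q a u) x = pot_term q (\<lambda>\<mu>. a \<mu> x) (rp u x)) \<and>
      norm (Kop q a u) \<le> 1/4 * norm (weyl.D u) + C * norm u)"
proof -
  \<comment> \<open>Three components and \<open>grad_norm u \<le> 3 |D u|\<close> multiply
    \<epsilon> by \<open>9 |q|\<close>, which must stay below 1/4.\<close>
  define \<epsilon> where "\<epsilon> = 1 / (36 * (\<bar>q\<bar> + 1))"
  have \<epsilon>: "\<epsilon> > 0" unfolding \<epsilon>_def by simp
  obtain C1 where C1: "C1 \<ge> 0" and wb: "\<And>u :: (real^3, complex^2^2) l2. u \<in> l2.H \<Longrightarrow> sq_int (\<lambda>x. w x *\<^sub>R rp u x)"
    "\<And>u :: (real^3, complex^2^2) l2. u \<in> l2.H \<Longrightarrow> norm (l2_of (\<lambda>x. w x *\<^sub>R rp u x)) \<le> \<epsilon> * l2.grad_norm u + C1 * norm u"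
    using singular_weight_bound[OF p w \<epsilon>] by blast
  define C where "C = 3 * \<bar>q\<bar> * C1 + c"
  have C: "C \<ge> 0" unfolding C_def using C1 c by simp
  let ?k = "\<lambda>u x. pot_term q (\<lambda>\<mu>. a \<mu> x) (rp u x)"
  have kb: "norm (?k u x) \<le> 1 * norm ((3 * \<bar>q\<bar> * w x + c) *\<^sub>R rp u x)" for u x
  proof -
    have "norm (?k u x) \<le> \<bar>q\<bar> * (\<Sum>\<mu>=0..3. \<bar>a \<mu> x\<bar>) * norm (rp u x)" by (rule norm_pot_term)
    also have "\<dots> \<le> (3 * \<bar>q\<bar> * w x + c) * norm (rp u x)" by (intro mult_right_mono le) simp
    finally show ?thesis using w(2)[of x] c by simp
  qed
  have ws: "sq_int (\<lambda>x. (3 * \<bar>q\<bar> * w x + c) *\<^sub>R rp u x)" if "u \<in> l2.H" for u :: "(real^3, complex^2^2) l2"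
  proof -
    have "sq_int (\<lambda>x. (3 * \<bar>q\<bar>) *\<^sub>R (w x *\<^sub>R rp u x) + c *\<^sub>R rp u x)"
      by (intro sq_int_add sq_int_scale wb(1) that rp_sq_int)
    then show ?thesis by (simp add: scaleR_add_left)
  qed
  have ks: "sq_int (?k u)" if "u \<in> l2.H" for u
    by (rule sq_int_bound[OF borel_measurable_pot_term[OF a rp_measurable] ws[OF that] kb])
  have rpK: "AE x in lborel. rp (Kop q a u) x = ?k u x" if "u \<in> l2.H" for u
    unfolding Kop_def by (rule rp_l2_of[OF ks[OF that]])
  have nK: "norm (Kop q a u) \<le> 1/4 * norm (weyl.D u) + C * norm u" if u: "u \<in> l2.H" for u
  proof -
    have "norm (Kop q a u) \<le> 1 * norm (l2_of (\<lambda>x. (3 * \<bar>q\<bar> * w x + c) *\<^sub>R rp u x))"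
      unfolding Kop_def by (rule norm_l2_of_mono[OF ks[OF u] ws[OF u] kb]) simp
    also have "l2_of (\<lambda>x. (3 * \<bar>q\<bar> * w x + c) *\<^sub>R rp u x) = l2_of (\<lambda>x. (3 * \<bar>q\<bar>) *\<^sub>R (w x *\<^sub>R rp u x) + c *\<^sub>R rp u x)"
      by (simp add: scaleR_add_left)
    also have "\<dots> = (3 * \<bar>q\<bar>) *\<^sub>R l2_of (\<lambda>x. w x *\<^sub>R rp u x) + c *\<^sub>R u"
      unfolding l2_of_add[OF sq_int_scale[OF wb(1)[OF u]] sq_int_scale[OF rp_sq_int]]
        l2_of_scale[OF wb(1)[OF u]] l2_of_scale[OF rp_sq_int] l2_of_rp ..
    also have "norm \<dots> \<le> 3 * \<bar>q\<bar> * norm (l2_of (\<lambda>x. w x *\<^sub>R rp u x)) + c * norm u"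
      by (rule order_trans[OF norm_triangle_ineq]) (use c in simp)
    also have "\<dots> \<le> 3 * \<bar>q\<bar> * (\<epsilon> * (3 * norm (weyl.D u)) + C1 * norm u) + c * norm u"
    proof (intro add_right_mono mult_left_mono)
      have "l2.grad_norm u \<le> 3 * norm (weyl.D u)" using weyl.grad_norm_le[OF u] by simp
      then have "\<epsilon> * l2.grad_norm u \<le> \<epsilon> * (3 * norm (weyl.D u))" using \<epsilon> by (intro mult_left_mono) auto
      then show "norm (l2_of (\<lambda>x. w x *\<^sub>R rp u x)) \<le> \<epsilon> * (3 * norm (weyl.D u)) + C1 * norm u"
        using wb(2)[OF u] by linarith
    qed simp
    also have "\<dots> = (9 * \<bar>q\<bar> * \<epsilon>) * norm (weyl.D u) + C * norm u" unfolding C_def by (simp add: algebra_simps)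
    also have "\<dots> \<le> 1/4 * norm (weyl.D u) + C * norm u"
    proof (intro add_right_mono mult_right_mono)
      show "9 * \<bar>q\<bar> * \<epsilon> \<le> 1/4" unfolding \<epsilon>_def by (simp add: field_simps)
    qed simp
    finally show ?thesis by simp
  qed
  interpret D: skew_generator "l2.H :: (real^3, complex^2^2) l2 set" weyl.D 1 by (rule weyl.D_skew_generator)
  have H_add: "u + v \<in> l2.H" if "u \<in> l2.H" "v \<in> l2.H" for u v :: "(real^3, complex^2^2) l2"
    by (rule subspace_add[OF l2.subspace_H that])
  have H_scale: "r *\<^sub>R u \<in> l2.H" if "u \<in> l2.H" for u :: "(real^3, complex^2^2) l2" and r
    by (rule subspace_scale[OF l2.subspace_H that])
  have "skew_generator l2.H (\<lambda>u. weyl.D u + Kop q a u) (min 1 (1 / (4 * (C + 1))))"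
  proof (rule D.relatively_bounded_perturbation[OF _ _ _ nK C])
    fix u v :: "(real^3, complex^2^2) l2" and r
    show "Kop q a (u + v) = Kop q a u + Kop q a v" if uv: "u \<in> l2.H" "v \<in> l2.H"
      by (rule l2_eqI) (use rpK[OF H_add[OF uv]] rpK[OF uv(1)] rpK[OF uv(2)] rp_add[of u v] rp_add[of "Kop q a u" "Kop q a v"]
        in \<open>eventually_elim, simp add: linear_add[OF linear_pot_term]\<close>)
    show "Kop q a (r *\<^sub>R u) = r *\<^sub>R Kop q a u" if u: "u \<in> l2.H"
      by (rule l2_eqI) (use rpK[OF H_scale[OF u], of r] rpK[OF u] rp_scale[of r u] rp_scale[of r "Kop q a u"]
        in \<open>eventually_elim, simp add: linear_scale[OF linear_pot_term]\<close>)
    show "inner (Kop q a u) u = 0" if u: "u \<in> l2.H"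
      unfolding inner_l2_def
    proof (rule integral_eq_zero_AE)
      show "AE x in lborel. inner (rp (Kop q a u) x) (rp u x) = 0"
        using rpK[OF u] by eventually_elim (simp add: pot_term_skew)
    qed
  qed
  then show ?thesis using C rpK nK by blast
qed

section \<open>The nonlinear term\<close>

text \<open>Written in the unknown \<open>hat \<phi>\<close>; as \<open>hat\<close> is an
  involution, \<phi> reappears as \<open>hat M\<close>.\<close>

definition nl_term :: "real \<Rightarrow> real \<Rightarrow> complex^2^2 \<Rightarrow> complex^2^2" where
  "nl_term l m M = - ((\<i> *\<^sub>C (m *\<^sub>R (V l (hat M) *\<^sub>C hat M))) ** e_low 3)"

lemma nl_term_0: "nl_term l m 0 = 0"
  unfolding nl_term_def by (simp add: matrix22_eq_iff matrix_mult22_nth)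

lemma nl_term_lipschitz:
  assumes "l > 0" "m > 0"
  shows "norm (nl_term l m M - nl_term l m N) \<le> (m * (1 + (8 + 2 * l) / l)) * norm (M - N)"
proof -
  have "nl_term l m M - nl_term l m N = - ((\<i> *\<^sub>C (m *\<^sub>R (V l (hat M) *\<^sub>C hat M - V l (hat N) *\<^sub>C hat N))) ** e_low 3)"
    unfolding nl_term_def by (simp add: matrix22_eq_iff matrix_mult22_nth algebra_simps)
  then have "norm (nl_term l m M - nl_term l m N) = m * norm (V l (hat M) *\<^sub>C hat M - V l (hat N) *\<^sub>C hat N)"
    using assms(2) by (simp add: norm_mult_e_low_3 norm_cscale)
  also have "\<dots> \<le> m * ((1 + (8 + 2 * l) / l) * norm (hat M - hat N))"
    using assms by (intro mult_left_mono V_lipschitz) auto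
  also have "norm (hat M - hat N) = norm (M - N)" by (simp add: linear_diff[OF linear_hat, symmetric])
  finally show ?thesis by simp
qed

lemma rp_D: "AE x in lborel. rp (weyl.D u) x = (\<Sum>k\<in>UNIV. pauli k ** rp (l2.dd k u) x)"
  for u :: "(real^3, complex^2^2) l2"
proof -
  have e: "weyl.D u = sig 1 (l2.dd 1 u) + sig 2 (l2.dd 2 u) + sig 3 (l2.dd 3 u)"
    unfolding weyl.D_def sum_3 ..
  show ?thesis
    unfolding e sum_3
    using rp_add[of "sig 1 (l2.dd 1 u) + sig 2 (l2.dd 2 u)" "sig 3 (l2.dd 3 u)"] rp_add[of "sig 1 (l2.dd 1 u)" "sig 2 (l2.dd 2 u)"]
      rp_sig[of 1 "l2.dd 1 u"] rp_sig[of 2 "l2.dd 2 u"] rp_sig[of 3 "l2.dd 3 u"]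
    by eventually_elim simp
qed

text \<open>For spatial indices \<open>e_up\<close> is minus the Pauli matrix, so the derivatives
  move to the right-hand side as the Weyl operator with positive sign.\<close>

lemma dirac_pointwise:
  fixes M Dt P1 P2 P3 :: "complex^2^2"
  assumes "Dt = (pauli 1 ** P1 + pauli 2 ** P2 + pauli 3 ** P3) + pot_term q (\<lambda>\<mu>. A \<mu> x) M + nl_term l m M"
  shows "Dt + (e_up 1 ** P1 + e_up 2 ** P2 + e_up 3 ** P3)
     + (\<i> *\<^sub>C (q *\<^sub>R (potential A x ** M) + m *\<^sub>R (V l (hat M) *\<^sub>C hat M))) ** e_low 3 = 0"
proof -
  have "e_up 1 ** P1 = - (pauli 1 ** P1)" "e_up 2 ** P2 = - (pauli 2 ** P2)" "e_up 3 ** P3 = - (pauli 3 ** P3)"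
    unfolding e_up_def pauli_cases by (simp_all add: matrix22_eq_iff matrix_mult22_nth)
  moreover have "(\<i> *\<^sub>C (X + Y)) ** e_low 3 = (\<i> *\<^sub>C X) ** e_low 3 + (\<i> *\<^sub>C Y) ** e_low 3" for X Y :: "complex^2^2"
    by (simp add: matrix22_eq_iff matrix_mult22_nth algebra_simps)
  ultimately show ?thesis
    unfolding assms pot_term_def nl_term_def potential_def by simp
qed

section \<open>From the Hilbert space to functions\<close>

lemma hat_rp_Lp: "(\<lambda>x. hat (rp v x)) \<in> Lp 2" "cls (\<lambda>x. hat (rp v x)) = l2_map hat v"
  for v :: "(real^3, complex^2^2) l2"
  using l2_map_cls[OF hat_iso cls_rp(2)[of v]] by simp_all

lemma bounded_linear_l2_hat: "bounded_linear (l2_map hat :: (real^3, complex^2^2) l2 \<Rightarrow> _)"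
  by (rule l2_map_linear[OF hat_iso linear_hat])

lemma norm_l2_hat: "norm (l2_map hat v) = norm v" for v :: "(real^3, complex^2^2) l2"
proof (rule antisym)
  note z = linear_0[OF bounded_linear.linear[OF bounded_linear_l2_hat]]
  have hh: "l2_map hat (l2_map hat v) = v"
    by (rule l2_eqI) (use rp_map[OF hat_iso, of "l2_map hat v"] rp_map[OF hat_iso, of v] in \<open>eventually_elim, simp\<close>)
  have le: "norm (l2_map hat v) \<le> norm v" for v :: "(real^3, complex^2^2) l2"
    using l2_map_lipschitz[OF hat_iso, of v 0] z by simp
  show "norm (l2_map hat v) \<le> norm v" by (rule le)
  show "norm v \<le> norm (l2_map hat v)" using le[of "l2_map hat v"] by (simp add: hh)
qed

lemma pd_l2_hat: "l2.pd k v g \<Longrightarrow> l2.pd k (l2_map hat v) (l2_map hat g)" for v g :: "(real^3, complex^2^2) l2"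
  by (rule l2.pd_commuting[OF _ bounded_linear_l2_hat l2_map_shift[OF hat_iso]])

lemma H_l2_hat:
  fixes v :: "(real^3, complex^2^2) l2"
  assumes "v \<in> l2.H" shows "l2_map hat v \<in> l2.H" "l2.dd k (l2_map hat v) = l2_map hat (l2.dd k v)"
proof -
  have p: "l2.pd k (l2_map hat v) (l2_map hat (l2.dd k v))" for k by (rule pd_l2_hat[OF l2.pd_dd[OF assms]])
  show "l2_map hat v \<in> l2.H" by (rule l2.H_I[OF p])
  show "l2.dd k (l2_map hat v) = l2_map hat (l2.dd k v)" by (rule l2.dd_eq[OF p])
qed

section \<open>Regularity of the matrix-valued curve\<close>

context
  fixes u w :: "real \<Rightarrow> (real^3, complex^2^2) l2" and T :: real and \<phi> :: "real \<Rightarrow> real^3 \<Rightarrow> complex^2^2"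
  assumes T: "T > 0"
    and uH: "\<And>t. t \<in> {0..T} \<Longrightarrow> u t \<in> l2.H"
    and der: "\<And>t. t \<in> {0..T} \<Longrightarrow> (u has_vector_derivative w t) (at t within {0..T})"
    and wc: "continuous_on {0..T} w"
    and Dc: "continuous_on {0..T} (\<lambda>t. weyl.D (u t))"
    and \<phi>: "\<And>t. \<phi> t = (\<lambda>x. hat (rp (u t) x))"
begin

lemma u_continuous: "continuous_on {0..T} u" using der by (rule continuous_on_vector_derivative)

lemma \<phi>_diff: "(\<lambda>x. \<phi> s x - \<phi> t x) \<in> Lp 2" "cls (\<lambda>x. \<phi> s x - \<phi> t x) = l2_map hat (u s - u t)"
proof -
  show "(\<lambda>x. \<phi> s x - \<phi> t x) \<in> Lp 2" unfolding \<phi> by (rule Lp2_diff(1)[OF hat_rp_Lp(1) hat_rp_Lp(1)])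
  show "cls (\<lambda>x. \<phi> s x - \<phi> t x) = l2_map hat (u s - u t)"
    unfolding \<phi> Lp2_diff(2)[OF hat_rp_Lp(1) hat_rp_Lp(1)] hat_rp_Lp(2)
    by (rule linear_diff[OF bounded_linear.linear[OF bounded_linear_l2_hat], symmetric])
qed

text \<open>Since \<open>hat\<close> is isometric and \<open>|D v|\<close> is the norm of the
  gradient, the H1 distance is the graph distance of \<open>D\<close>, for which continuity in time
  is given.\<close>

lemma \<phi>_C_H1: "\<phi> \<in> C_H1 {0..T}"
  unfolding C_H1_def continuous_curve_def mem_Collect_eq
proof (intro conjI ballI)
  fix t assume t: "t \<in> {0..T}"
  show "\<phi> t \<in> H1" unfolding H1_iff \<phi> using hat_rp_Lp H_l2_hat(1)[OF uH[OF t]] by simp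
  have n: "H1_norm (\<lambda>x. \<phi> s x - \<phi> t x) = sqrt ((norm (u s - u t))\<^sup>2 + (norm (weyl.D (u s) - weyl.D (u t)))\<^sup>2)"
    if s: "s \<in> {0..T}" for s
  proof -
    have d: "u s - u t \<in> l2.H" by (rule subspace_diff[OF l2.subspace_H uH[OF s] uH[OF t]])
    then have "(\<lambda>x. \<phi> s x - \<phi> t x) \<in> H1" unfolding H1_iff \<phi>_diff(2) using \<phi>_diff(1) H_l2_hat(1) by blast
    from H1_norm_cls[OF this] show ?thesis
      unfolding \<phi>_diff(2) H_l2_hat(2)[OF d] norm_l2_hat weyl.norm_D[OF d, symmetric] weyl.D_diff[OF uH[OF s] uH[OF t]] .
  qed
  have "((\<lambda>s. sqrt ((norm (u s - u t))\<^sup>2 + (norm (weyl.D (u s) - weyl.D (u t)))\<^sup>2))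
      \<longlongrightarrow> sqrt ((norm (u t - u t))\<^sup>2 + (norm (weyl.D (u t) - weyl.D (u t)))\<^sup>2)) (at t within {0..T})"
    using u_continuous Dc t unfolding continuous_on_def by (intro tendsto_intros) auto
  then have "((\<lambda>s. sqrt ((norm (u s - u t))\<^sup>2 + (norm (weyl.D (u s) - weyl.D (u t)))\<^sup>2)) \<longlongrightarrow> 0) (at t within {0..T})"
    by simp
  then show "((\<lambda>s. H1_norm (\<lambda>x. \<phi> s x - \<phi> t x)) \<longlongrightarrow> 0) (at t within {0..T})"
    by (rule Lim_transform_eventually) (auto simp: eventually_at_filter n)
qed

lemma continuous_curve_hat:
  assumes "continuous_on {0..T} v"
  shows "continuous_curve (Lp 2) (Lp_norm 2) {0..T} (\<lambda>t x. hat (rp (v t :: (real^3, complex^2^2) l2) x))"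
  unfolding continuous_curve_def
proof (intro conjI ballI hat_rp_Lp)
  fix t assume t: "t \<in> {0..T}"
  have e: "Lp_norm 2 (\<lambda>x. hat (rp (v s) x) - hat (rp (v t) x)) = norm (v s - v t)" for s
    unfolding Lp_norm_cls[OF Lp2_diff(1)[OF hat_rp_Lp(1) hat_rp_Lp(1)]] Lp2_diff(2)[OF hat_rp_Lp(1) hat_rp_Lp(1)] hat_rp_Lp(2)
    unfolding linear_diff[OF bounded_linear.linear[OF bounded_linear_l2_hat], symmetric] by (rule norm_l2_hat)
  have "(v \<longlongrightarrow> v t) (at t within {0..T})" using assms t unfolding continuous_on_def by blast
  then show "((\<lambda>s. Lp_norm 2 (\<lambda>x. hat (rp (v s) x) - hat (rp (v t) x))) \<longlongrightarrow> 0) (at t within {0..T})"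
    unfolding e by (intro tendsto_norm_zero LIM_zero)
qed

lemma \<phi>_C1_L2: "\<phi> \<in> C1_L2 {0..T}"
  unfolding C1_L2_def mem_Collect_eq
proof (intro conjI exI[of _ "\<lambda>t x. hat (rp (w t) x)"] ballI)
  show "continuous_curve (Lp 2) (Lp_norm 2) {0..T} \<phi>"
    using continuous_curve_hat[OF u_continuous] unfolding \<phi>[symmetric, abs_def] .
  show "continuous_curve (Lp 2) (Lp_norm 2) {0..T} (\<lambda>t x. hat (rp (w t) x))" by (rule continuous_curve_hat[OF wc])
  fix t assume t: "t \<in> {0..T}"
  show "has_L2_derivative {0..T} \<phi> (\<lambda>x. hat (rp (w t) x)) t"
    unfolding has_L2_derivative_def
  proof (intro conjI ballI hat_rp_Lp)
    show "\<phi> s \<in> Lp 2" for s unfolding \<phi> by (rule hat_rp_Lp)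
    have e: "Lp_norm 2 (\<lambda>x. (\<phi> s x - \<phi> t x) /\<^sub>R (s - t) - hat (rp (w t) x)) = norm ((u s - u t) /\<^sub>R (s - t) - w t)" for s
    proof -
      note q = Lp2_scale[OF \<phi>_diff(1), of "inverse (s - t)" s t]
      have "cls (\<lambda>x. (\<phi> s x - \<phi> t x) /\<^sub>R (s - t) - hat (rp (w t) x)) = l2_map hat ((u s - u t) /\<^sub>R (s - t) - w t)"
        unfolding Lp2_diff(2)[OF q(1) hat_rp_Lp(1)] q(2) \<phi>_diff(2) hat_rp_Lp(2)
        by (simp only: linear_diff[OF bounded_linear.linear[OF bounded_linear_l2_hat]] linear_scale[OF bounded_linear.linear[OF bounded_linear_l2_hat]])
      then show ?thesis unfolding Lp_norm_cls[OF Lp2_diff(1)[OF q(1) hat_rp_Lp(1)]] by (simp add: norm_l2_hat)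
    qed
    show "((\<lambda>s. Lp_norm 2 (\<lambda>x. (\<phi> s x - \<phi> t x) /\<^sub>R (s - t) - hat (rp (w t) x))) \<longlongrightarrow> 0) (at t within {0..T})"
      unfolding e using der[OF t] unfolding has_vector_derivative_iff_quotient by (intro tendsto_norm_zero LIM_zero)
  qed
qed

text \<open>\<open>L2_derivative\<close> is a choice and has to be identified: \<open>T > 0\<close>
  leaves no isolated time in the interval, so derivatives within it are unique as classes.\<close>

lemma L2_derivative_hat_\<phi>:
  assumes t: "t \<in> {0..T}"
  shows "AE x in lborel. L2_derivative {0..T} (\<lambda>s y. hat (\<phi> s y)) t x = rp (w t) x"
proof -
  have r: "(\<lambda>s y. hat (\<phi> s y)) = (\<lambda>s. rp (u s))" unfolding \<phi> by simp
  have e: "Lp_norm 2 (\<lambda>x. (rp (u s) x - rp (u t) x) /\<^sub>R (s - t) - v x) = norm ((u s - u t) /\<^sub>R (s - t) - cls v)"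
    if v: "v \<in> Lp 2" for s v
  proof -
    note d = Lp2_diff[OF cls_rp(2)[of "u s"] cls_rp(2)[of "u t"]]
    note q = Lp2_scale[OF d(1), of "inverse (s - t)"]
    show ?thesis unfolding Lp_norm_cls[OF Lp2_diff(1)[OF q(1) v]] Lp2_diff(2)[OF q(1) v] q(2) d(2) cls_rp(1) ..
  qed
  have iff: "has_L2_derivative {0..T} (\<lambda>s. rp (u s)) v t \<longleftrightarrow> v \<in> Lp 2 \<and> (u has_vector_derivative cls v) (at t within {0..T})" for v
    unfolding has_L2_derivative_def has_vector_derivative_iff_quotient
    by (auto simp: e tendsto_norm_zero_iff LIM_zero_iff)
  have "has_L2_derivative {0..T} (\<lambda>s. rp (u s)) (rp (w t)) t" unfolding iff using der[OF t] by simp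
  then have "has_L2_derivative {0..T} (\<lambda>s. rp (u s)) (L2_derivative {0..T} (\<lambda>s. rp (u s)) t) t"
    unfolding L2_derivative_def by (rule someI[of "\<lambda>v. has_L2_derivative {0..T} (\<lambda>s. rp (u s)) v t"])
  then have L: "L2_derivative {0..T} (\<lambda>s. rp (u s)) t \<in> Lp 2"
    and d: "(u has_vector_derivative cls (L2_derivative {0..T} (\<lambda>s. rp (u s)) t)) (at t within {0..T})"
    unfolding iff by auto
  have "at t within {0..T} \<noteq> bot"
    using t T by (simp add: trivial_limit_within islimpt_Icc)
  then have "cls (L2_derivative {0..T} (\<lambda>s. rp (u s)) t) = w t"
    using vector_derivative_unique_within[OF _ d der[OF t]] by blast
  then have "AE x in lborel. rp (w t) x = L2_derivative {0..T} (\<lambda>s. rp (u s)) t x"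
    using rp_cls[OF L] by simp
  then show ?thesis unfolding r by eventually_elim simp
qed

end

theorem mainTheorem2:
  fixes l m q T :: real
    and A :: "nat \<Rightarrow> real^3 \<Rightarrow> real"
    and \<phi>0 :: "real^3 \<Rightarrow> complex^2^2"
  assumes "l > 0" and "m > 0"
    and "\<And>\<mu>. \<mu> \<le> 3 \<Longrightarrow> A \<mu> \<in> borel_measurable lebesgue"
    and "\<exists>p>3. \<exists>B\<in>Lp p. \<exists>C\<in>Linf.
           AE x in lebesgue. (vector [A 1 x, A 2 x, A 3 x] :: real^3) = B x + C x"
    and "AE x in lebesgue. \<bar>q * A 0 x\<bar> \<le> m"
    and "T > 0" and "\<phi>0 \<in> H1"
  shows "\<exists>\<phi>. \<phi> \<in> C_H1 {0..T} \<inter> C1_L2 {0..T} \<and>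
           (AE x in lebesgue. \<phi> 0 x = \<phi>0 x) \<and>
           solves_dirac l m q A {0..T} \<phi>"
proof -
  obtain p B C where p: "p > 3" and BC: "B \<in> Lp p" "C \<in> Linf"
    "AE x in lebesgue. (vector [A 1 x, A 2 x, A 3 x] :: real^3) = B x + C x" using assms(4) by blast
  obtain a w c where a: "\<And>\<mu>. a \<mu> \<in> borel_measurable borel" and w: "w \<in> borel_measurable borel" "\<And>x. w x \<ge> 0"
      "integrable lborel (\<lambda>x. w x powr p)" and c: "c \<ge> 0"
      and le: "\<And>x. \<bar>q\<bar> * (\<Sum>\<mu>=0..3. \<bar>a \<mu> x\<bar>) \<le> 3 * \<bar>q\<bar> * w x + c"
      and aA: "AE x in lborel. \<forall>\<mu>\<le>3. q * a \<mu> x = q * A \<mu> x"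
    using potential_representatives[OF assms(3) assms(2) BC assms(5)] by blast
  define L where "L u = weyl.D u + Kop q a u" for u
  obtain a0 K where K: "K \<ge> 0" and gen: "skew_generator l2.H L a0"
    and Ku: "\<And>u. u \<in> l2.H \<Longrightarrow> AE x in lborel. rp (Kop q a u) x = pot_term q (\<lambda>\<mu>. a \<mu> x) (rp u x)"
      "\<And>u. u \<in> l2.H \<Longrightarrow> norm (Kop q a u) \<le> 1/4 * norm (weyl.D u) + K * norm u"
    using Dirac_generator[OF a p w c le] unfolding L_def[abs_def] by blast
  interpret L: skew_generator l2.H L a0 by (rule gen)
  define \<omega> where "\<omega> = m * (1 + (8 + 2 * l) / l)"
  have \<omega>: "\<omega> \<ge> 0" unfolding \<omega>_def using assms by simp
  define F where "F = (l2_map (nl_term l m) :: (real^3, complex^2^2) l2 \<Rightarrow> _)"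
  note nl = nl_term_0[of l m] nl_term_lipschitz[OF assms(1,2), folded \<omega>_def] \<omega>
  have F: "norm (F u - F v) \<le> \<omega> * norm (u - v)" for u v unfolding F_def by (rule l2_map_lipschitz[OF nl])
  have rpF: "AE x in lborel. rp (F u) x = nl_term l m (rp u x)" for u unfolding F_def by (rule rp_map[OF nl])
  have \<phi>0: "\<phi>0 \<in> Lp 2" "cls \<phi>0 \<in> l2.H" using assms(7) unfolding H1_iff by auto
  \<comment> \<open>The evolution is solved for \<open>hat \<phi>\<close>, so the initial value is
    transformed as well.\<close>
  define u0 where "u0 = l2_map hat (cls \<phi>0)"
  have u0: "u0 \<in> l2.H" unfolding u0_def by (rule H_l2_hat(1)[OF \<phi>0(2)])
  obtain u where uu0: "u 0 = u0" and Lc: "continuous_on {0..T} (\<lambda>t. L (u t))"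
    and uH: "\<And>t. t \<in> {0..T} \<Longrightarrow> u t \<in> l2.H"
    and der: "\<And>t. t \<in> {0..T} \<Longrightarrow> (u has_vector_derivative L (u t) + F (u t)) (at t within {0..T})"
    using L.semilinear_evolution[OF F \<omega> u0, of T] assms(6) by auto
  have uc: "continuous_on {0..T} u" using der by (rule continuous_on_vector_derivative)
  have "continuous_on UNIV F"
    by (rule lipschitz_on_continuous_on[of \<omega>]) (use F \<omega> in \<open>auto simp: lipschitz_on_def dist_norm\<close>)
  then have "continuous_on {0..T} (\<lambda>t. F (u t))" by (rule continuous_on_compose2[OF _ uc]) auto
  then have wc: "continuous_on {0..T} (\<lambda>t. L (u t) + F (u t))" by (intro continuous_intros Lc)
  \<comment> \<open>The evolution gives continuity of \<open>L u\<close>, whereas the H1 norm needs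
    that of \<open>D u\<close>. Absorbing the quarter of \<open>|D v|\<close> leaves the factor 4/3,
    rounded up to 2.\<close>
  have Dd: "norm (weyl.D v) \<le> 2 * norm (L v) + 2 * K * norm v" if v: "v \<in> l2.H" for v
  proof -
    have "norm (weyl.D v) \<le> norm (L v) + norm (Kop q a v)"
      using norm_triangle_ineq4[of "L v" "Kop q a v"] unfolding L_def by simp
    then have "norm (weyl.D v) * (3/4) \<le> norm (L v) + K * norm v" using Ku(2)[OF v] by linarith
    moreover have "0 \<le> norm (L v) + K * norm v" using K by simp
    ultimately show ?thesis by linarith
  qed
  have Dc: "continuous_on {0..T} (\<lambda>t. weyl.D (u t))"
    unfolding continuous_on_def
  proof
    fix t assume t: "t \<in> {0..T}"
    have "((\<lambda>s. 2 * norm (L (u s) - L (u t)) + 2 * K * norm (u s - u t))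
        \<longlongrightarrow> 2 * norm (L (u t) - L (u t)) + 2 * K * norm (u t - u t)) (at t within {0..T})"
      using Lc uc t unfolding continuous_on_def by (intro tendsto_intros) auto
    then have z: "((\<lambda>s. 2 * norm (L (u s) - L (u t)) + 2 * K * norm (u s - u t)) \<longlongrightarrow> 0) (at t within {0..T})" by simp
    have "((\<lambda>s. weyl.D (u s) - weyl.D (u t)) \<longlongrightarrow> 0) (at t within {0..T})"
    proof (rule Lim_null_comparison[OF _ z])
      have "norm (weyl.D (u s) - weyl.D (u t)) \<le> 2 * norm (L (u s) - L (u t)) + 2 * K * norm (u s - u t)"
        if s: "s \<in> {0..T}" for s
        using Dd[OF L.mem_diff[OF uH[OF s] uH[OF t]]]
        unfolding weyl.D_diff[OF uH[OF s] uH[OF t]] L.L_diff[OF uH[OF s] uH[OF t]] .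
      then show "\<forall>\<^sub>F s in at t within {0..T}. norm (weyl.D (u s) - weyl.D (u t)) \<le> 2 * norm (L (u s) - L (u t)) + 2 * K * norm (u s - u t)"
        by (auto simp: eventually_at_filter)
    qed
    then show "((\<lambda>t. weyl.D (u t)) \<longlongrightarrow> weyl.D (u t)) (at t within {0..T})" by (rule LIM_zero_cancel)
  qed
  define \<phi> where "\<phi> t = (\<lambda>x. hat (rp (u t) x))" for t
  note ctx = assms(6) uH der wc Dc \<phi>_def
  have "AE x in lborel. \<phi> 0 x = \<phi>0 x"
    unfolding \<phi>_def uu0 u0_def
    using rp_map[OF hat_iso, of "cls \<phi>0"] rp_cls[OF \<phi>0(1)] by eventually_elim simp
  then have init: "AE x in lebesgue. \<phi> 0 x = \<phi>0 x" by (rule AE_completion)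
  have "solves_dirac l m q A {0..T} \<phi>"
    unfolding solves_dirac_def
  proof
    fix t assume t: "t \<in> {0..T}"
    have h: "(\<lambda>y. hat (\<phi> t y)) = rp (u t)" unfolding \<phi>_def by simp
    have H1: "rp (u t) \<in> H1" unfolding H1_iff using uH[OF t] by simp
    have Dt: "AE x in lborel. L2_derivative {0..T} (\<lambda>s y. hat (\<phi> s y)) t x = rp (L (u t) + F (u t)) x"
      by (rule L2_derivative_hat_\<phi>[OF ctx t])
    have wp: "AE x in lborel. weak_partial k (rp (u t)) x = rp (l2.dd k (u t)) x" for k
    proof -
      have "AE x in lborel. rp (cls (weak_partial k (rp (u t)))) x = weak_partial k (rp (u t)) x"
        by (rule rp_cls[OF weak_partial_cls(1)[OF H1]])
      then show ?thesis unfolding weak_partial_cls(2)[OF H1] cls_rp(1) by eventually_elim simp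
    qed
    have "AE x in lborel. L2_derivative {0..T} (\<lambda>s y. hat (\<phi> s y)) t x
        + (\<Sum>k=1..3. e_up k ** weak_partial (of_nat k) (\<lambda>y. hat (\<phi> t y)) x)
        + (\<i> *\<^sub>C (q *\<^sub>R (potential A x ** hat (\<phi> t x)) + (m *\<^sub>R (V l (\<phi> t x) *\<^sub>C \<phi> t x)))) ** e_low 3 = 0"
      using Dt rp_D[of "u t"] Ku(1)[OF uH[OF t]] rpF[of "u t"] aA
        rp_add[of "L (u t)" "F (u t)"] rp_add[of "weyl.D (u t)" "Kop q a (u t)"] wp[of 1] wp[of 2] wp[of 3]
    proof eventually_elim
      case (elim x)
      define M where "M = rp (u t) x"
      \<comment> \<open>The Borel versions \<open>a\<close> give way to the original
        \<open>A\<close>: they agree almost everywhere after multiplication by \<open>q\<close>, the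
        only form in which they enter.\<close>
      have pc: "pot_term q (\<lambda>\<mu>. a \<mu> x) M = pot_term q (\<lambda>\<mu>. A \<mu> x) M"
        by (rule pot_term_cong) (use elim(5) in blast)
      have "rp (L (u t) + F (u t)) x = rp (weyl.D (u t)) x + rp (Kop q a (u t)) x + rp (F (u t)) x"
        using elim(6,7) unfolding L_def by simp
      also have "\<dots> = (pauli 1 ** rp (l2.dd 1 (u t)) x + pauli 2 ** rp (l2.dd 2 (u t)) x + pauli 3 ** rp (l2.dd 3 (u t)) x)
          + pot_term q (\<lambda>\<mu>. A \<mu> x) M + nl_term l m M"
        unfolding elim(2-4) sum_3 M_def[symmetric] pc ..
      finally have e: "L2_derivative {0..T} (\<lambda>s y. hat (\<phi> s y)) t x = \<dots>" unfolding elim(1) .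
      have s: "(\<Sum>k=1..3. e_up k ** weak_partial (of_nat k) (rp (u t)) x) =
          e_up 1 ** rp (l2.dd 1 (u t)) x + e_up 2 ** rp (l2.dd 2 (u t)) x + e_up 3 ** rp (l2.dd 3 (u t)) x"
        using elim(8-10) by (simp add: numeral_3_eq_3 numeral_2_eq_2)
      have \<phi>x: "\<phi> t x = hat M" unfolding \<phi>_def M_def ..
      show ?case unfolding h s \<phi>x hat_hat by (rule dirac_pointwise[where A = A and x = x, OF e])
    qed
    then show "AE x in lebesgue. L2_derivative {0..T} (\<lambda>s y. hat (\<phi> s y)) t x
        + (\<Sum>k=1..3. e_up k ** weak_partial (of_nat k) (\<lambda>y. hat (\<phi> t y)) x)
        + (\<i> *\<^sub>C (q *\<^sub>R (potential A x ** hat (\<phi> t x)) + (m *\<^sub>R (V l (\<phi> t x) *\<^sub>C \<phi> t x)))) ** e_low 3 = 0"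
      by (rule AE_completion)
  qed
  moreover have "\<phi> \<in> C_H1 {0..T}" by (rule \<phi>_C_H1[OF ctx])
  moreover have "\<phi> \<in> C1_L2 {0..T}" by (rule \<phi>_C1_L2[OF ctx])
  ultimately show ?thesis using init by blast
qed

end
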